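(* (a) If $A$ is a decidable pca, then every realizability topos which is a subtopos of $\mathsf{RT}(A)$ is a retract of $\mathsf{RT}(A[f])$ for some partial function $f:A\to A$. (b) Every realizability topos which is a subtopos of the effective topos $\mathsf{RT}(\mathcal{K}_1)$ is equivalent to one of the form $\mathsf{RT}(\mathcal{K}_1[f])$ for some partial function $f$ on the natural numbers.
   Context: Partial combinatory algebras. A pca is a set $A$ with a partial binary application $(a,b)\mapsto ab$ (associating to the left) for which there exist $\mathsf{k},\mathsf{s}\in A$ such that for all $a,b,c\in A$: $\mathsf{k}ab=a$; $\mathsf{s}ab$ is defined; and whenever $ac(bc)$ is defined, $\mathsf{s}abc$ is defined and equal to it. $t{\downarrow}$ means "$t$ is defined". Booleans: $\mathsf{T}=\mathsf{k}$, $\mathsf{F}=\mathsf{k}(\mathsf{skk})$. Every pca has pairing and unpairing elements $\pi,\pi_0,\pi_1$ with $\pi_0(\pi ab)=a$, $\pi_1(\pi ab)=b$. A pca $A$ is decidable if there is $d\in A$ with $dab=\mathsf{T}$ if $a=b$ and $dab=\mathsf{F}$ if $a\neq b$, for all $a,b\in A$. $\mathcal{K}_1$ is the pca on $\mathbb{N}$ in which $ab$ is the outcome of the $a$-th Turing machine on input $b$. Applicative morphisms. An applicative morphism $\gamma:A\to B$ assigns to each $a\in A$ a nonempty subset $\gamma(a)\subseteq B$ such that there is $r\in B$ with: whenever $aa'{\downarrow}$, $b\in\gamma(a)$, $b'\in\gamma(a')$, then $rbb'{\downarrow}$ and $rbb'\in\gamma(aa')$. Composition is composition of relations. $\gamma$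 is decidable if there is $d\in B$ with $db=\mathsf{T}_B$ for all $b\in\gamma(\mathsf{T}_A)$ and $db=\mathsf{F}_B$ for all $b\in\gamma(\mathsf{F}_A)$. Toposes. $\mathrm{Ass}(A)$ has as objects pairs $(X,E)$ with $X$ a set and $E(x)\subseteq A$ nonempty for each $x\in X$; a morphism $(X,E)\to(Y,F)$ is a function $f:X\to Y$ for which some $a\in A$ satisfies $ab{\downarrow}$ and $ab\in F(f(x))$ for all $x\in X$, $b\in E(x)$. The realizability topos $\mathsf{RT}(A)$ on a pca $A$ is the ex/reg completion of $\mathrm{Ass}(A)$; a realizability topos is a topos of the form $\mathsf{RT}(B)$ for a pca $B$; the effective topos is $\mathsf{RT}(\mathcal{K}_1)$. A topos $\mathcal{E}$ is a subtopos of $\mathcal{F}$ if there is a geometric inclusion $\mathcal{E}\to\mathcal{F}$. $\mathcal{E}$ is a retract of $\mathcal{F}$ if there are geometric morphisms $\mathcal{E}\to\mathcal{F}\to\mathcal{E}$ with composite isomorphic to the identity. The pca $A[f]$. A partial function $f:A\to A$ is representable w.r.t. an applicative morphism $\gamma:A\to B$ if there is $b\in B$ such that for each $a\in\mathrm{dom}(f)$ and $c\in\gamma(a)$, $bc{\downarrow}$ and $bc\in\gamma(f(a))$. It is known that there is a pca $A[f]$ and a decidable applicative morphism $\iota_f:A\to A[f]$ w.r.t. which $f$ is representable, universal with this property: every decidable applicative morphism $\gamma:A\to B$ w.r.t. which $f$ is representable factors uniquely through $\iota_f$. This determines $A[f]$ up to isomorphism. Concretely, $A[f]$ has underlying set $A$,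 $\iota_f$ is the identity function ($a\mapsto\{a\}$), and application is: $a\cdot^f b=c$ iff either $a[b]=\pi\mathsf{T}c$, or there is a sequence $a_1,\ldots,a_n$ such that $a[b]=\pi\mathsf{F}d$ for some $d$ with $f(d)=a_1$, for all $1<k\leq n$, $a[b,a_1,\ldots,a_{k-1}]=\pi\mathsf{F}d$ for some $d$ with $f(d)=a_k$, and $a[b,a_1,\ldots,a_n]=\pi\mathsf{T}c$; here $[\ldots]$ is a standard coding of tuples in $A$.
   Formalization: The pca B presenting the subtopos is required to have two distinct elements: for the one-element pca, RT(B) is Set, a subtopos of the effective topos not equivalent to any RT(K1[f]), so the claim fails. Sets and pcas are those of an arbitrary Grothendieck universe. *)

theory Defs
  imports "HOL-Library.Equipollence" "HOL-Library.FuncSet" "HOL-Library.Nat_Bijection"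
begin

section \<open>Partial combinatory algebras\<close>

text \<open>The underlying set of a partial applicative structure is the whole type \<open>'a\<close>;
  \<open>A a b = None\<close> means that \<open>ab\<close> is undefined.\<close>

type_synonym 'a pas = "'a \<Rightarrow> 'a \<Rightarrow> 'a option"

definition app :: "'a option \<Rightarrow> 'a pas \<Rightarrow> 'a option \<Rightarrow> 'a option"
    ("_ \<cdot>\<^bsub>_\<^esub> _" [100, 0, 101] 100) where
  "x \<cdot>\<^bsub>A\<^esub> y = Option.bind x (\<lambda>a. Option.bind y (\<lambda>b. A a b))"

definition is_ks :: "'a pas \<Rightarrow> 'a \<Rightarrow> 'a \<Rightarrow> bool" where
  "is_ks A k s \<longleftrightarrow> (\<forall>a b c.
      Some k \<cdot>\<^bsub>A\<^esub> Some a \<cdot>\<^bsub>A\<^esub> Some b = Some a \<and>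
      Some s \<cdot>\<^bsub>A\<^esub> Some a \<cdot>\<^bsub>A\<^esub> Some b \<noteq> None \<and>
      (\<forall>v. (Some a \<cdot>\<^bsub>A\<^esub> Some c) \<cdot>\<^bsub>A\<^esub> (Some b \<cdot>\<^bsub>A\<^esub> Some c) = Some v \<longrightarrow>
           Some s \<cdot>\<^bsub>A\<^esub> Some a \<cdot>\<^bsub>A\<^esub> Some b \<cdot>\<^bsub>A\<^esub> Some c = Some v))"

definition pca :: "'a pas \<Rightarrow> bool" where
  "pca A \<longleftrightarrow> (\<exists>k s. is_ks A k s)"

definition ks :: "'a pas \<Rightarrow> 'a \<times> 'a" where
  "ks A = (SOME (k, s). is_ks A k s)"

definition pca_true :: "'a pas \<Rightarrow> 'a" where
  "pca_true A = fst (ks A)"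

definition pca_false :: "'a pas \<Rightarrow> 'a" where
  "pca_false A = (let k = Some (fst (ks A)); s = Some (snd (ks A))
                  in the (k \<cdot>\<^bsub>A\<^esub> (s \<cdot>\<^bsub>A\<^esub> k \<cdot>\<^bsub>A\<^esub> k)))"

definition decidable_pca :: "'a pas \<Rightarrow> bool" where
  "decidable_pca A \<longleftrightarrow> (\<exists>d. \<forall>a b. Some d \<cdot>\<^bsub>A\<^esub> Some a \<cdot>\<^bsub>A\<^esub> Some b =
      Some (if a = b then pca_true A else pca_false A))"

definition is_pairing :: "'a pas \<Rightarrow> 'a \<Rightarrow> 'a \<Rightarrow> 'a \<Rightarrow> bool" where
  "is_pairing A p p0 p1 \<longleftrightarrow> (\<forall>a b.
      Some p0 \<cdot>\<^bsub>A\<^esub> (Some p \<cdot>\<^bsub>A\<^esub> Some a \<cdot>\<^bsub>A\<^esub> Some b) = Some a \<and>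
      Some p1 \<cdot>\<^bsub>A\<^esub> (Some p \<cdot>\<^bsub>A\<^esub> Some a \<cdot>\<^bsub>A\<^esub> Some b) = Some b)"

definition pca_pair :: "'a pas \<Rightarrow> 'a \<Rightarrow> 'a \<Rightarrow> 'a" where
  "pca_pair A a b =
     the (Some (SOME p. \<exists>p0 p1. is_pairing A p p0 p1) \<cdot>\<^bsub>A\<^esub> Some a \<cdot>\<^bsub>A\<^esub> Some b)"

text \<open>Standard coding of tuples as lists: the first component of a code is a Boolean telling
  whether the tuple is empty, so that the coding is uniquely and effectively decodable
  for every choice of the pairing combinator.\<close>

fun pca_tuple :: "'a pas \<Rightarrow> 'a list \<Rightarrow> 'a" where
  "pca_tuple A [] = pca_pair A (pca_true A) (pca_true A)"
| "pca_tuple A (a # as) = pca_pair A (pca_false A) (pca_pair A a (pca_tuple A as))"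


section \<open>Adjoining a partial function\<close>

text \<open>\<open>us\<close> is the list \<open>a\<^sub>1, \<dots>, a\<^sub>n\<close> of answers of the oracle \<open>f\<close>
  (zero-based here, and \<open>n = 0\<close> is the case without queries).\<close>

definition adjoin_result :: "'a pas \<Rightarrow> ('a \<Rightarrow> 'a option) \<Rightarrow> 'a \<Rightarrow> 'a \<Rightarrow> 'a \<Rightarrow> bool" where
  "adjoin_result A f a b c \<longleftrightarrow> (\<exists>us.
      (\<forall>k < length us. \<exists>d. A a (pca_tuple A (b # take k us)) = Some (pca_pair A (pca_false A) d)
                          \<and> f d = Some (us ! k)) \<and>
      A a (pca_tuple A (b # us)) = Some (pca_pair A (pca_true A) c))"

definition adjoin :: "'a pas \<Rightarrow> ('a \<Rightarrow> 'a option) \<Rightarrow> 'a pas" where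
  "adjoin A f a b = (if \<exists>c. adjoin_result A f a b c
                     then Some (THE c. adjoin_result A f a b c) else None)"


section \<open>Kleene's first model\<close>

text \<open>Two-symbol Turing machines on a two-way infinite tape. A machine is a table of instructions,
  numbered by \<^const>\<open>list_encode\<close>; entry \<open>2q\<close> (resp. \<open>2q + 1\<close>) is executed in state \<open>q\<close>
  when a blank (resp. a stroke) is scanned. An instruction is coded as
  \<open>prod_encode (w, prod_encode (m, q'))\<close>: write a stroke iff \<open>w\<close> is odd, move left iff
  \<open>m\<close> is even and right otherwise, and go to state \<open>q'\<close>. A machine halts when the table has no
  applicable entry. A configuration consists of state, head position and tape.\<close>

type_synonym tm_config = "nat \<times> int \<times> (int \<Rightarrow> bool)"

definition tm_step :: "nat \<Rightarrow> tm_config \<Rightarrow> tm_config option" where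
  "tm_step M = (\<lambda>(q, h, t).
     let prog = list_decode M; i = 2 * q + of_bool (t h) in
     if i < length prog then
       (let (w, r) = prod_decode (prog ! i); (m, q') = prod_decode r
        in Some (q', (if even m then h - 1 else h + 1), t(h := odd w)))
     else None)"

text \<open>The input \<open>b\<close> is given by \<open>b + 1\<close> consecutive strokes, with the head on the leftmost one;
  the output is the number of strokes on the tape of the halting configuration.\<close>

definition tm_init :: "nat \<Rightarrow> tm_config" where
  "tm_init b = (0, 0, \<lambda>i. 0 \<le> i \<and> i \<le> int b)"

definition tm_outcome :: "nat \<Rightarrow> nat \<Rightarrow> nat \<Rightarrow> bool" where
  "tm_outcome M b v \<longleftrightarrow> (\<exists>q h t. (\<lambda>c c'. tm_step M c = Some c')\<^sup>*\<^sup>* (tm_init b) (q, h, t) \<and>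
      tm_step M (q, h, t) = None \<and> v = card {i. t i})"

definition K1 :: "nat pas" where
  "K1 a b = (if \<exists>v. tm_outcome a b v then Some (THE v. tm_outcome a b v) else None)"


section \<open>Categories, functors, adjunctions\<close>

record ('o, 'm) category =
  Obj :: "'o set"
  Arr :: "'m set"
  Dom :: "'m \<Rightarrow> 'o"
  Cod :: "'m \<Rightarrow> 'o"
  Idn :: "'o \<Rightarrow> 'm"
  Cmp :: "'m \<Rightarrow> 'm \<Rightarrow> 'm"  \<comment> \<open>\<open>Cmp C g f\<close> is \<open>g\<close> after \<open>f\<close>\<close>

definition hom :: "('o, 'm) category \<Rightarrow> 'o \<Rightarrow> 'o \<Rightarrow> 'm set" where
  "hom C X Y = {f \<in> Arr C. Dom C f = X \<and> Cod C f = Y}"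

definition is_iso :: "('o, 'm) category \<Rightarrow> 'm \<Rightarrow> bool" where
  "is_iso C f \<longleftrightarrow> f \<in> Arr C \<and> (\<exists>g \<in> hom C (Cod C f) (Dom C f).
      Cmp C g f = Idn C (Dom C f) \<and> Cmp C f g = Idn C (Cod C f))"

record ('o1, 'm1, 'o2, 'm2) func =
  FObj :: "'o1 \<Rightarrow> 'o2"
  FArr :: "'m1 \<Rightarrow> 'm2"

definition is_functor ::
    "('o1, 'm1) category \<Rightarrow> ('o2, 'm2) category \<Rightarrow> ('o1, 'm1, 'o2, 'm2) func \<Rightarrow> bool" where
  "is_functor C D F \<longleftrightarrow>
     (\<forall>X \<in> Obj C. FObj F X \<in> Obj D \<and> FArr F (Idn C X) = Idn D (FObj F X)) \<and>
     (\<forall>f \<in> Arr C. FArr F f \<in> hom D (FObj F (Dom C f)) (FObj F (Cod C f))) \<and>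
     (\<forall>f \<in> Arr C. \<forall>g \<in> Arr C. Cod C f = Dom C g \<longrightarrow>
        FArr F (Cmp C g f) = Cmp D (FArr F g) (FArr F f))"

definition id_func :: "('o, 'm, 'o, 'm) func" where
  "id_func = \<lparr>FObj = (\<lambda>X. X), FArr = (\<lambda>f. f)\<rparr>"

definition comp_func ::
    "('o2, 'm2, 'o3, 'm3) func \<Rightarrow> ('o1, 'm1, 'o2, 'm2) func \<Rightarrow> ('o1, 'm1, 'o3, 'm3) func" where
  "comp_func G F = \<lparr>FObj = FObj G \<circ> FObj F, FArr = FArr G \<circ> FArr F\<rparr>"

definition nat_trans ::
    "('o1, 'm1) category \<Rightarrow> ('o2, 'm2) category \<Rightarrow> ('o1, 'm1, 'o2, 'm2) func \<Rightarrow>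
     ('o1, 'm1, 'o2, 'm2) func \<Rightarrow> ('o1 \<Rightarrow> 'm2) \<Rightarrow> bool" where
  "nat_trans C D F G t \<longleftrightarrow>
     (\<forall>X \<in> Obj C. t X \<in> hom D (FObj F X) (FObj G X)) \<and>
     (\<forall>f \<in> Arr C. Cmp D (t (Cod C f)) (FArr F f) = Cmp D (FArr G f) (t (Dom C f)))"

definition isomorphic_functors ::
    "('o1, 'm1) category \<Rightarrow> ('o2, 'm2) category \<Rightarrow> ('o1, 'm1, 'o2, 'm2) func \<Rightarrow>
     ('o1, 'm1, 'o2, 'm2) func \<Rightarrow> bool" where
  "isomorphic_functors C D F G \<longleftrightarrow>
     (\<exists>t. nat_trans C D F G t \<and> (\<forall>X \<in> Obj C. is_iso D (t X)))"

definition equivalent_categories :: "('o1, 'm1) category \<Rightarrow> ('o2, 'm2) category \<Rightarrow> bool" where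
  "equivalent_categories C D \<longleftrightarrow> (\<exists>F G. is_functor C D F \<and> is_functor D C G \<and>
      isomorphic_functors C C (comp_func G F) id_func \<and>
      isomorphic_functors D D (comp_func F G) id_func)"

definition left_adjoint ::
    "('o1, 'm1) category \<Rightarrow> ('o2, 'm2) category \<Rightarrow> ('o1, 'm1, 'o2, 'm2) func \<Rightarrow>
     ('o2, 'm2, 'o1, 'm1) func \<Rightarrow> bool" where
  "left_adjoint C D L R \<longleftrightarrow> (\<exists>\<eta> \<epsilon>.
      nat_trans C C id_func (comp_func R L) \<eta> \<and>
      nat_trans D D (comp_func L R) id_func \<epsilon> \<and>
      (\<forall>X \<in> Obj C. Cmp D (\<epsilon> (FObj L X)) (FArr L (\<eta> X)) = Idn D (FObj L X)) \<and>
      (\<forall>Y \<in> Obj D. Cmp C (FArr R (\<epsilon> Y)) (\<eta> (FObj R Y)) = Idn C (FObj R Y)))"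

definition fully_faithful ::
    "('o1, 'm1) category \<Rightarrow> ('o2, 'm2) category \<Rightarrow> ('o1, 'm1, 'o2, 'm2) func \<Rightarrow> bool" where
  "fully_faithful C D F \<longleftrightarrow> (\<forall>X \<in> Obj C. \<forall>Y \<in> Obj C.
      bij_betw (FArr F) (hom C X Y) (hom D (FObj F X) (FObj F Y)))"

definition is_terminal :: "('o, 'm) category \<Rightarrow> 'o \<Rightarrow> bool" where
  "is_terminal C T \<longleftrightarrow> T \<in> Obj C \<and> (\<forall>X \<in> Obj C. \<exists>!f. f \<in> hom C X T)"

definition is_pullback :: "('o, 'm) category \<Rightarrow> 'm \<Rightarrow> 'm \<Rightarrow> 'm \<Rightarrow> 'm \<Rightarrow> bool" where
  "is_pullback C f g p q \<longleftrightarrow>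
     f \<in> Arr C \<and> g \<in> Arr C \<and> p \<in> Arr C \<and> q \<in> Arr C \<and>
     Cod C f = Cod C g \<and> Cod C p = Dom C f \<and> Cod C q = Dom C g \<and> Dom C p = Dom C q \<and>
     Cmp C f p = Cmp C g q \<and>
     (\<forall>u \<in> Arr C. \<forall>v \<in> Arr C.
        Cod C u = Dom C f \<and> Cod C v = Dom C g \<and> Dom C u = Dom C v \<and> Cmp C f u = Cmp C g v \<longrightarrow>
        (\<exists>!h. h \<in> hom C (Dom C u) (Dom C p) \<and> Cmp C p h = u \<and> Cmp C q h = v))"

text \<open>All finite limits are obtained from a terminal object and pullbacks.\<close>

definition preserves_finite_limits ::
    "('o1, 'm1) category \<Rightarrow> ('o2, 'm2) category \<Rightarrow> ('o1, 'm1, 'o2, 'm2) func \<Rightarrow> bool" where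
  "preserves_finite_limits C D F \<longleftrightarrow>
     (\<forall>T. is_terminal C T \<longrightarrow> is_terminal D (FObj F T)) \<and>
     (\<forall>f g p q. is_pullback C f g p q \<longrightarrow>
        is_pullback D (FArr F f) (FArr F g) (FArr F p) (FArr F q))"

definition regular_epi :: "('o, 'm) category \<Rightarrow> 'm \<Rightarrow> bool" where
  "regular_epi C e \<longleftrightarrow> e \<in> Arr C \<and> (\<exists>u \<in> Arr C. \<exists>v \<in> Arr C.
      Dom C u = Dom C v \<and> Cod C u = Dom C e \<and> Cod C v = Dom C e \<and> Cmp C e u = Cmp C e v \<and>
      (\<forall>h \<in> Arr C. Dom C h = Dom C e \<and> Cmp C h u = Cmp C h v \<longrightarrow>
         (\<exists>!m. m \<in> hom C (Cod C e) (Cod C h) \<and> Cmp C m e = h)))"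


section \<open>Geometric morphisms\<close>

text \<open>In \<open>('o1, 'm1, 'o2, 'm2) geom\<close>, the source topos has type \<open>('o1, 'm1) category\<close> and the
  target topos has type \<open>('o2, 'm2) category\<close>.\<close>

record ('o1, 'm1, 'o2, 'm2) geom =
  direct :: "('o1, 'm1, 'o2, 'm2) func"
  inverse_im :: "('o2, 'm2, 'o1, 'm1) func"

definition geometric_morphism ::
    "('o1, 'm1) category \<Rightarrow> ('o2, 'm2) category \<Rightarrow> ('o1, 'm1, 'o2, 'm2) geom \<Rightarrow> bool" where
  "geometric_morphism E F p \<longleftrightarrow>
     is_functor E F (direct p) \<and> is_functor F E (inverse_im p) \<and>
     left_adjoint F E (inverse_im p) (direct p) \<and>
     preserves_finite_limits F E (inverse_im p)"

definition geometric_inclusion ::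
    "('o1, 'm1) category \<Rightarrow> ('o2, 'm2) category \<Rightarrow> ('o1, 'm1, 'o2, 'm2) geom \<Rightarrow> bool" where
  "geometric_inclusion E F p \<longleftrightarrow> geometric_morphism E F p \<and> fully_faithful E F (direct p)"

definition id_geom :: "('o, 'm, 'o, 'm) geom" where
  "id_geom = \<lparr>direct = id_func, inverse_im = id_func\<rparr>"

definition comp_geom ::
    "('o2, 'm2, 'o3, 'm3) geom \<Rightarrow> ('o1, 'm1, 'o2, 'm2) geom \<Rightarrow> ('o1, 'm1, 'o3, 'm3) geom" where
  "comp_geom q p = \<lparr>direct = comp_func (direct q) (direct p),
                    inverse_im = comp_func (inverse_im p) (inverse_im q)\<rparr>"

definition isomorphic_geom ::
    "('o1, 'm1) category \<Rightarrow> ('o2, 'm2) category \<Rightarrow> ('o1, 'm1, 'o2, 'm2) geom \<Rightarrow>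
     ('o1, 'm1, 'o2, 'm2) geom \<Rightarrow> bool" where
  "isomorphic_geom E F p q \<longleftrightarrow> isomorphic_functors F E (inverse_im p) (inverse_im q)"

definition subtopos :: "('o1, 'm1) category \<Rightarrow> ('o2, 'm2) category \<Rightarrow> bool" where
  "subtopos E F \<longleftrightarrow> (\<exists>i. geometric_inclusion E F i)"

definition retract_of_topos :: "('o1, 'm1) category \<Rightarrow> ('o2, 'm2) category \<Rightarrow> bool" where
  "retract_of_topos E F \<longleftrightarrow> (\<exists>i r. geometric_morphism E F i \<and> geometric_morphism F E r \<and>
      isomorphic_geom E E (comp_geom r i) id_geom)"


section \<open>The ex/reg completion of a regular category\<close>

text \<open>A relation from \<open>X\<close> to \<open>Y\<close> is represented by a jointly monic span \<open>(r\<^sub>0, r\<^sub>1)\<close>.\<close>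

definition relation :: "('o, 'm) category \<Rightarrow> 'o \<Rightarrow> 'o \<Rightarrow> 'm \<times> 'm \<Rightarrow> bool" where
  "relation C X Y = (\<lambda>(r0, r1).
     r0 \<in> Arr C \<and> r1 \<in> Arr C \<and> Dom C r0 = Dom C r1 \<and> Cod C r0 = X \<and> Cod C r1 = Y \<and>
     (\<forall>u \<in> Arr C. \<forall>v \<in> Arr C.
        Cod C u = Dom C r0 \<and> Cod C v = Dom C r0 \<and> Dom C u = Dom C v \<and>
        Cmp C r0 u = Cmp C r0 v \<and> Cmp C r1 u = Cmp C r1 v \<longrightarrow> u = v))"

definition rel_le :: "('o, 'm) category \<Rightarrow> 'm \<times> 'm \<Rightarrow> 'm \<times> 'm \<Rightarrow> bool" where
  "rel_le C r s \<longleftrightarrow> (\<exists>h \<in> hom C (Dom C (fst r)) (Dom C (fst s)).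
      Cmp C (fst s) h = fst r \<and> Cmp C (snd s) h = snd r)"

text \<open>\<open>rel_comp C r s t\<close>: the relation \<open>t\<close> is the composite of \<open>r\<close> followed by \<open>s\<close>, i.e.\ the
  image of the span given by the pullback of \<open>snd r\<close> along \<open>fst s\<close>.\<close>

definition rel_comp :: "('o, 'm) category \<Rightarrow> 'm \<times> 'm \<Rightarrow> 'm \<times> 'm \<Rightarrow> 'm \<times> 'm \<Rightarrow> bool" where
  "rel_comp C r s t \<longleftrightarrow>
     relation C (Cod C (fst r)) (Cod C (snd s)) t \<and>
     (\<exists>p q e. is_pullback C (snd r) (fst s) p q \<and>
        regular_epi C e \<and> e \<in> hom C (Dom C p) (Dom C (fst t)) \<and>
        Cmp C (fst t) e = Cmp C (fst r) p \<and> Cmp C (snd t) e = Cmp C (snd s) q)"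

definition equivalence_relation :: "('o, 'm) category \<Rightarrow> 'o \<Rightarrow> 'm \<times> 'm \<Rightarrow> bool" where
  "equivalence_relation C X r \<longleftrightarrow>
     relation C X X r \<and> rel_le C (Idn C X, Idn C X) r \<and> rel_le C (prod.swap r) r \<and>
     (\<forall>t. rel_comp C r r t \<longrightarrow> rel_le C t r)"

definition functional_relation ::
    "('o, 'm) category \<Rightarrow> 'm \<times> 'm \<Rightarrow> 'm \<times> 'm \<Rightarrow> 'm \<times> 'm \<Rightarrow> bool" where
  "functional_relation C r s \<phi> \<longleftrightarrow>
     relation C (Cod C (fst r)) (Cod C (fst s)) \<phi> \<and>
     (\<forall>t. rel_comp C r \<phi> t \<longrightarrow> rel_le C t \<phi>) \<and>
     (\<forall>t. rel_comp C \<phi> s t \<longrightarrow> rel_le C t \<phi>) \<and>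
     (\<forall>t. rel_comp C (prod.swap \<phi>) \<phi> t \<longrightarrow> rel_le C t s) \<and>
     (\<forall>t. rel_comp C \<phi> (prod.swap \<phi>) t \<longrightarrow> rel_le C r t)"

text \<open>Relations which represent the same subobject are identified.\<close>

definition rel_class :: "('o, 'm) category \<Rightarrow> 'm \<times> 'm \<Rightarrow> ('m \<times> 'm) set" where
  "rel_class C \<phi> = {\<psi>. relation C (Cod C (fst \<phi>)) (Cod C (snd \<phi>)) \<psi> \<and> rel_le C \<phi> \<psi> \<and> rel_le C \<psi> \<phi>}"

type_synonym 'm exreg_arr = "('m \<times> 'm) \<times> ('m \<times> 'm) set \<times> ('m \<times> 'm)"

definition ex_reg :: "('o, 'm) category \<Rightarrow> ('m \<times> 'm, 'm exreg_arr) category" where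
  "ex_reg C = (let Ob = {r. \<exists>X \<in> Obj C. equivalence_relation C X r} in
     \<lparr>Obj = Ob,
      Arr = {(r, K, s). r \<in> Ob \<and> s \<in> Ob \<and> (\<exists>\<phi>. functional_relation C r s \<phi> \<and> K = rel_class C \<phi>)},
      Dom = (\<lambda>(r, K, s). r),
      Cod = (\<lambda>(r, K, s). s),
      Idn = (\<lambda>r. (r, rel_class C r, r)),
      Cmp = (\<lambda>(_, L, t) (r, K, _). (r, {\<chi>. \<exists>\<phi> \<in> K. \<exists>\<psi> \<in> L. rel_comp C \<phi> \<psi> \<chi>}, t))\<rparr>)"


section \<open>Assemblies and realizability toposes\<close>

text \<open>Assemblies and toposes are built over a category of sets which must be closed under
  power sets; HOL does not provide such a type. The sets are therefore taken to be the subsets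
  of a type \<open>'u\<close> of smaller cardinality than \<open>'u\<close> itself, where the cardinality of \<open>'u\<close> is an
  inaccessible cardinal (uncountable, strong limit, regular). Up to equivalence, this is the
  category of sets of a Grothendieck universe.\<close>

definition set_universe :: "'u itself \<Rightarrow> bool" where
  "set_universe _ \<longleftrightarrow>
     (UNIV :: nat set) \<prec> (UNIV :: 'u set) \<and>
     (\<forall>X :: 'u set. X \<prec> (UNIV :: 'u set) \<longrightarrow> Pow X \<prec> (UNIV :: 'u set)) \<and>
     (\<forall>\<X> :: 'u set set. \<X> \<prec> (UNIV :: 'u set) \<and> (\<forall>X \<in> \<X>. X \<prec> (UNIV :: 'u set))
        \<longrightarrow> \<Union>\<X> \<prec> (UNIV :: 'u set))"

definition small :: "'u itself \<Rightarrow> 'x set \<Rightarrow> bool" where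
  "small _ X \<longleftrightarrow> X \<prec> (UNIV :: 'u set)"

type_synonym ('u, 'a) assembly = "'u set \<times> ('u \<Rightarrow> 'a set)"

text \<open>Functions on \<open>X\<close> are represented canonically, with a fixed value outside of \<open>X\<close>.\<close>

definition assemblies :: "('u, 'a) assembly set" where
  "assemblies = {(X, E). small TYPE('u) X \<and> (\<forall>x. E x \<noteq> {} \<longleftrightarrow> x \<in> X)}"

definition tracks :: "'a pas \<Rightarrow> 'a \<Rightarrow> ('u, 'a) assembly \<Rightarrow> ('u \<Rightarrow> 'u) \<Rightarrow> ('u, 'a) assembly \<Rightarrow> bool" where
  "tracks A a P f Q \<longleftrightarrow>
     (\<forall>x \<in> fst P. \<forall>b \<in> snd P x. \<exists>c. A a b = Some c \<and> c \<in> snd Q (f x))"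

type_synonym ('u, 'a) assembly_arr = "('u, 'a) assembly \<times> ('u \<Rightarrow> 'u) \<times> ('u, 'a) assembly"

definition Ass :: "'u itself \<Rightarrow> 'a pas \<Rightarrow> (('u, 'a) assembly, ('u, 'a) assembly_arr) category" where
  "Ass _ A =
     \<lparr>Obj = assemblies,
      Arr = {(P, f, Q). P \<in> assemblies \<and> Q \<in> assemblies \<and> f \<in> fst P \<rightarrow>\<^sub>E fst Q \<and>
                        (\<exists>a. tracks A a P f Q)},
      Dom = (\<lambda>(P, f, Q). P),
      Cod = (\<lambda>(P, f, Q). Q),
      Idn = (\<lambda>P. (P, restrict (\<lambda>x. x) (fst P), P)),
      Cmp = (\<lambda>(_, g, R) (P, f, _). (P, compose (fst P) g f, R))\<rparr>"

definition RT ::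
    "'u itself \<Rightarrow> 'a pas \<Rightarrow>
     (('u, 'a) assembly_arr \<times> ('u, 'a) assembly_arr, ('u, 'a) assembly_arr exreg_arr) category" where
  "RT U A = ex_reg (Ass U A)"

end

theory Submission imports Defs begin

text \<open>A geometric inclusion of \<open>RT(B)\<close> into \<open>RT(A)\<close> restricts to points: its inverse image commutes
 with the constant objects, so it is given by a computationally dense applicative morphism \<open>A \<rightarrow> B\<close>, whose right adjoint
 provides codes \<open>h b\<close> in \<open>A\<close> for the elements of \<open>B\<close>. If \<open>A\<close> is decidable, the application of \<open>B\<close> on codes, together
 with the decoding, is a partial function \<open>f\<close> on \<open>A\<close>; the morphism then factors through \<open>A[f]\<close>, where the codes become
 a one-sided inverse. Over the natural numbers the decoding can be inverted by recursion on numerals, which makes the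
 retraction an equivalence.\<close>

section \<open>Programming in an arbitrary pca\<close>

section \<open>Combinatory completeness\<close>

text \<open>The inclusion is not assumed to lie over sets, so this must be proved of its inverse
  image \<open>L\<close>. An empty object has an image without points, since otherwise the two
  points of a two-element object would coincide; left exactness and the invertible counit then make
  \<open>L\<close> bijective on points. Every partitioned assembly is a pullback of \<open>A\<close>
  itself along constant objects, so \<open>L\<close> is controlled by the single object
  \<open>L(A)\<close>. Decidability of \<open>A\<close> makes the oracle single-valued: a common
  realizer of two different elements would lead to a common realizer of both truth values. Exact
  completions are awkward to compute in. Each topos is therefore replaced by the category of partial
  equivalence relations over its realizability tripos, where limits and epimorphisms are described
  by entailments. Direct images preserve conjunction and existential quantification, hence these
  descriptions of limits. For the second claim the given Turing machines must first be shown to form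
  a decidable pca. Register programs are compiled to them, and the s-m-n property and a universal
  program provide the combinators.\<close>

abbreviation (input) eqv (infixr "<->" 25) where "P <-> Q == (P :: bool) = Q"
abbreviation (input) "tru == pca_true"
abbreviation (input) "fls == pca_false"
abbreviation (input) "pp == pca_pair"
abbreviation (input) "tup == pca_tuple"
abbreviation K_of :: "'a pas => 'a" where "K_of A \<equiv> fst (ks A)"
abbreviation S_of :: "'a pas => 'a" where "S_of A \<equiv> snd (ks A)"

lemma app_Some [simp]: "Some a \<cdot>\<^bsub>A\<^esub> Some b = A a b"
 by(simp add: app_def)

lemma app_None [simp]: "None \<cdot>\<^bsub>A\<^esub> y = None" "x \<cdot>\<^bsub>A\<^esub> None = None"
 by(auto simp: app_def bind_eq_None_conv)

lemma app_eq_Some: "x \<cdot>\<^bsub>A\<^esub> y = Some c <-> (EX a b. x = Some a & y = Some b & A a b = Some c)"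
 by(cases x; cases y) auto

lemma pca_ks: "pca A ==> is_ks A (K_of A) (S_of A)"
proof -
 assume "pca A"
 hence "EX p. (case p of (k, s) => is_ks A k s)" by(auto simp: pca_def)
 hence "case ks A of (k, s) => is_ks A k s" unfolding ks_def by(rule someI_ex)
 thus ?thesis by(simp add: case_prod_unfold)
qed

lemma pca_K: assumes "pca A" obtains x where "A (K_of A) a = Some x" "!!b. A x b = Some a"
proof -
 have *: "Some (K_of A) \<cdot>\<^bsub>A\<^esub> Some a \<cdot>\<^bsub>A\<^esub> Some b = Some a" for b
  using pca_ks[OF assms] unfolding is_ks_def by blast
 from *[of a] obtain x where x: "A (K_of A) a = Some x" by(auto simp: app_eq_Some)
 have "A x b = Some a" for b using *[of b] x by simp
 thus ?thesis using that x by blast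
qed

lemma pca_S:
 assumes "pca A"
 obtains x y where "A (S_of A) a = Some x" "A x b = Some y"
  "!!c u v w. A a c = Some u ==> A b c = Some v ==> A u v = Some w ==> A y c = Some w"
proof -
 have 1: "Some (S_of A) \<cdot>\<^bsub>A\<^esub> Some a \<cdot>\<^bsub>A\<^esub> Some b ~= None"
  using pca_ks[OF assms] unfolding is_ks_def by blast
 have 2: "!!c v. (Some a \<cdot>\<^bsub>A\<^esub> Some c) \<cdot>\<^bsub>A\<^esub> (Some b \<cdot>\<^bsub>A\<^esub> Some c) = Some v ==>
     Some (S_of A) \<cdot>\<^bsub>A\<^esub> Some a \<cdot>\<^bsub>A\<^esub> Some b \<cdot>\<^bsub>A\<^esub> Some c = Some v"
  using pca_ks[OF assms] unfolding is_ks_def by blast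
 from 1 obtain y where y: "Some (S_of A) \<cdot>\<^bsub>A\<^esub> Some a \<cdot>\<^bsub>A\<^esub> Some b = Some y" by blast
 then obtain x where x: "A (S_of A) a = Some x" "A x b = Some y" by(auto simp: app_eq_Some)
 show ?thesis
 proof(rule that[OF x])
  fix c u v w assume "A a c = Some u" "A b c = Some v" "A u v = Some w"
  thus "A y c = Some w" using 2[of c w] y by simp
 qed
qed

text \<open>Polynomials over a pca. De Bruijn indices make every abstraction concern variable 0, so
  that nested abstractions need no renaming.\<close>

datatype 'a ct = Vr nat | Cn 'a | Ap "'a ct" "'a ct" (infixl "$" 75)

fun ev :: "'a pas => (nat => 'a) => 'a ct => 'a option" where
 "ev A e (Vr n) = Some (e n)"
| "ev A e (Cn c) = Some c"
| "ev A e (t $ u) = ev A e t \<cdot>\<^bsub>A\<^esub> ev A e u"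

abbreviation ext :: "'a => (nat => 'a) => nat => 'a" (infixr "##" 65) where "x ## e \<equiv> case_nat x e"

text \<open>Bracket abstraction of variable 0, and of a fresh variable (a delayed term).\<close>

fun ab :: "'a pas => 'a ct => 'a ct" where
 "ab A (Vr 0) = Cn (S_of A) $ Cn (K_of A) $ Cn (K_of A)"
| "ab A (Vr (Suc n)) = Cn (K_of A) $ Vr n"
| "ab A (Cn c) = Cn (K_of A) $ Cn c"
| "ab A (t $ u) = Cn (S_of A) $ ab A t $ ab A u"

fun dl :: "'a pas => 'a ct => 'a ct" where
 "dl A (Vr n) = Cn (K_of A) $ Vr n"
| "dl A (Cn c) = Cn (K_of A) $ Cn c"
| "dl A (t $ u) = Cn (S_of A) $ dl A t $ dl A u"

lemma pca_I: assumes "pca A"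
 obtains x y where "A (S_of A) (K_of A) = Some x" "A x (K_of A) = Some y" "!!c. A y c = Some c"
proof -
 obtain x y where *: "A (S_of A) (K_of A) = Some x" "A x (K_of A) = Some y"
  "!!c u v w. A (K_of A) c = Some u ==> A (K_of A) c = Some v ==> A u v = Some w ==> A y c = Some w"
  by(rule pca_S[OF assms, of "K_of A" "K_of A"]) blast
 have "A y c = Some c" for c by(rule pca_K[OF assms, of c]) (use *(3) in blast)
 with * show ?thesis using that by blast
qed

lemma ev_S_aux:
 assumes "pca A" "ev A e t' = Some x" "ev A e u' = Some y"
 obtains w where "ev A e (Cn (S_of A) $ t' $ u') = Some w"
  "!!c p q r. A x c = Some p ==> A y c = Some q ==> A p q = Some r ==> A w c = Some r"
 by(rule pca_S[OF assms(1), of x y]) (use assms that in "auto simp: app_eq_Some")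

lemma ev_ab:
 assumes "pca A"
 obtains w where "ev A e (ab A t) = Some w" "!!x v. ev A (x ## e) t = Some v ==> A w x = Some v"
proof -
 have "EX w. ev A e (ab A t) = Some w & (ALL x v. ev A (x ## e) t = Some v --> A w x = Some v)"
 proof(induction t)
  case (Vr n)
  show ?case
   by(cases n; rule pca_I[OF assms]; rule pca_K[OF assms, of "e (n - 1)"]) (auto simp: app_eq_Some)
 next
  case (Cn c)
  show ?case by(rule pca_K[OF assms, of c]) (auto simp: app_eq_Some)
 next
  case (Ap t u)
  then obtain x y where *: "ev A e (ab A t) = Some x" "ev A e (ab A u) = Some y"
   "ALL z v. ev A (z ## e) t = Some v --> A x z = Some v"
   "ALL z v. ev A (z ## e) u = Some v --> A y z = Some v" by blast
  show ?case by(rule ev_S_aux[OF assms *(1,2)]) (use * in "fastforce simp: app_eq_Some")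
 qed
 thus ?thesis using that by blast
qed

text \<open>A delayed term has a value even where \<open>t\<close> has none; applying that value to
  anything runs \<open>t\<close>. Conditionals rely on this, as the branch not taken may be
  undefined.\<close>

lemma ev_dl:
 assumes "pca A"
 obtains w where "ev A e (dl A t) = Some w" "!!x v. ev A e t = Some v ==> A w x = Some v"
proof -
 have "EX w. ev A e (dl A t) = Some w & (ALL x v. ev A e t = Some v --> A w x = Some v)"
 proof(induction t)
  case (Vr n)
  show ?case by(rule pca_K[OF assms, of "e n"]) (auto simp: app_eq_Some)
 next
  case (Cn c)
  show ?case by(rule pca_K[OF assms, of c]) (auto simp: app_eq_Some)
 next
  case (Ap t u)
  then obtain x y where *: "ev A e (dl A t) = Some x" "ev A e (dl A u) = Some y"
   "ALL z v. ev A e t = Some v --> A x z = Some v"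
   "ALL z v. ev A e u = Some v --> A y z = Some v" by blast
  show ?case by(rule ev_S_aux[OF assms *(1,2)]) (use * in "fastforce simp: app_eq_Some")
 qed
 thus ?thesis using that by blast
qed

text \<open>Only definedness of the body is propagated, because the axiom for \<open>s\<close> is
  one-sided: \<open>sabc\<close> may be defined where \<open>ac(bc)\<close> is not.\<close>

lemma lam1:
 assumes "pca A"
 obtains a where "!!x v. ev A (x ## e) t = Some v ==> A a x = Some v"
 by(rule ev_ab[OF assms, of e t]) (use that in blast)

lemma lam2:
 assumes "pca A"
 obtains a f where "!!x. A a x = Some (f x)"
  "!!x y v. ev A (y ## x ## e) t = Some v ==> A (f x) y = Some v"
proof -
 obtain a where a: "!!x v. ev A (x ## e) (ab A t) = Some v ==> A a x = Some v"
  using lam1[OF assms] by blast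
 have "ALL x. EX w. A a x = Some w & (ALL y v. ev A (y ## x ## e) t = Some v --> A w y = Some v)"
  using a ev_ab[OF assms] by metis
 thus ?thesis using that by metis
qed

lemma lam3:
 assumes "pca A"
 obtains a f g where "!!x. A a x = Some (f x)" "!!x y. A (f x) y = Some (g x y)"
  "!!x y z v. ev A (z ## y ## x ## e) t = Some v ==> A (g x y) z = Some v"
proof -
 obtain a f where a: "!!x. A a x = Some (f x)"
  "!!x y v. ev A (y ## x ## e) (ab A t) = Some v ==> A (f x) y = Some v"
  using lam2[OF assms, where e = e and t = "ab A t"] by metis
 have "ALL x y. EX w. A (f x) y = Some w & (ALL z v. ev A (z ## y ## x ## e) t = Some v --> A w z = Some v)"
  using a(2) ev_ab[OF assms] by metis
 with a(1) show ?thesis using that by metis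
qed

section \<open>Booleans, pairing, recursion\<close>

lemma pca_true_eq: "tru A = K_of A" by(simp add: pca_true_def)

lemma pca_false_app:
 assumes "pca A"
 obtains i where "!!y. A (fls A) y = Some i" "!!x. A i x = Some x"
proof -
 obtain x i where i: "A (S_of A) (K_of A) = Some x" "A x (K_of A) = Some i" "!!c. A i c = Some c"
  by(rule pca_I[OF assms]) blast
 obtain f where f: "A (K_of A) i = Some f" "!!b. A f b = Some i" by(rule pca_K[OF assms]) blast
 have "fls A = f" unfolding pca_false_def using i f by(simp add: Let_def)
 thus ?thesis using that f i by blast
qed

lemma pca_true_app:
 assumes "pca A"
 obtains f where "!!y. A (tru A) y = Some (f y)" "!!x y. A (f x) y = Some x"
proof -
 have "EX x. A (K_of A) y = Some x & (ALL b. A x b = Some y)" for y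
  by(rule pca_K[OF assms, of y]) blast
 then obtain f where "!!y. A (K_of A) y = Some (f y) & (ALL b. A (f y) b = Some y)" by metis
 thus ?thesis using that unfolding pca_true_eq by blast
qed

lemma bool_app:
 assumes "pca A"
 shows "Some (tru A) \<cdot>\<^bsub>A\<^esub> Some x \<cdot>\<^bsub>A\<^esub> Some y = Some x"
  "Some (fls A) \<cdot>\<^bsub>A\<^esub> Some x \<cdot>\<^bsub>A\<^esub> Some y = Some y"
 using pca_true_app[OF assms] pca_false_app[OF assms] by(metis app_Some)+

lemma true_neq_false:
 assumes "pca (A :: 'x pas)" "x ~= (y :: 'x)"
 shows "tru A ~= fls A"
 using bool_app[OF assms(1), of x y] assms(2) by auto

text \<open>The Boolean selects one of two delayed terms; the last argument is a dummy that starts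
  it.\<close>

definition If :: "'a pas => 'a ct => 'a ct => 'a ct => 'a ct" where
 "If A b t u = b $ dl A t $ dl A u $ Cn (K_of A)"

lemma ev_If:
 assumes "pca A"
 shows "ev A e b = Some (tru A) ==> ev A e t = Some v ==> ev A e (If A b t u) = Some v"
  "ev A e b = Some (fls A) ==> ev A e u = Some v ==> ev A e (If A b t u) = Some v"
proof -
 obtain w1 where w1: "ev A e (dl A t) = Some w1" "!!x v. ev A e t = Some v ==> A w1 x = Some v"
  by(rule ev_dl[OF assms]) blast
 obtain w2 where w2: "ev A e (dl A u) = Some w2" "!!x v. ev A e u = Some v ==> A w2 x = Some v"
  by(rule ev_dl[OF assms]) blast
 show "ev A e b = Some (tru A) ==> ev A e t = Some v ==> ev A e (If A b t u) = Some v"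
  using w1(2) by(simp add: If_def w1(1) w2(1) bool_app[OF assms, unfolded app_Some])
 show "ev A e b = Some (fls A) ==> ev A e u = Some v ==> ev A e (If A b t u) = Some v"
  using w2(2) by(simp add: If_def w1(1) w2(1) bool_app[OF assms, unfolded app_Some])
qed

lemma ex_pairing: assumes "pca A" shows "EX p p0 p1. is_pairing A p p0 p1"
proof -
 obtain a f g where a: "!!x. A a x = Some (f x)" "!!x y. A (f x) y = Some (g x y)"
  "!!x y z v. ev A (z ## y ## x ## (%_. undefined)) (Vr 0 $ Vr 2 $ Vr 1) = Some v ==> A (g x y) z = Some v"
  by(rule lam3[OF assms]) blast
 obtain p0 where p0: "!!x v. ev A (x ## (%_. undefined)) (Vr 0 $ Cn (tru A)) = Some v ==> A p0 x = Some v"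
  by(rule lam1[OF assms]) blast
 obtain p1 where p1: "!!x v. ev A (x ## (%_. undefined)) (Vr 0 $ Cn (fls A)) = Some v ==> A p1 x = Some v"
  by(rule lam1[OF assms]) blast
 have "A (g x y) (tru A) = Some x" "A (g x y) (fls A) = Some y" for x y
  using bool_app[OF assms] by(auto intro!: a(3) simp: numeral_2_eq_2)
 hence "is_pairing A a p0 p1" unfolding is_pairing_def by(auto simp: a(1,2) intro!: p0 p1)
 thus ?thesis by blast
qed

lemma pca_pair_ex:
 assumes "pca A"
 shows "EX p p0 p1 f. (ALL a. A p a = Some (f a)) & (ALL a b. A (f a) b = Some (pp A a b)) &
  (ALL a b. A p0 (pp A a b) = Some a) & (ALL a b. A p1 (pp A a b) = Some b)"
proof -
 define p where "p = (SOME p. EX p0 p1. is_pairing A p p0 p1)"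
 have "EX p0 p1. is_pairing A p p0 p1" unfolding p_def by(rule someI_ex) (rule ex_pairing[OF assms])
 then obtain p0 p1 where pr: "is_pairing A p p0 p1" by blast
 have ex: "EX x y. A p a = Some x & A x b = Some y" for a b
 proof -
  have "Some p0 \<cdot>\<^bsub>A\<^esub> (Some p \<cdot>\<^bsub>A\<^esub> Some a \<cdot>\<^bsub>A\<^esub> Some b) = Some a"
   using pr unfolding is_pairing_def by blast
  thus ?thesis by(auto simp: app_eq_Some)
 qed
 have "ALL a. EX x. A p a = Some x" using ex by blast
 from choice[OF this] obtain f where f: "!!a. A p a = Some (f a)" by blast
 have g: "A (f a) b = Some (pp A a b)" for a b
  using ex[of a b] unfolding pca_pair_def p_def[symmetric] by(auto simp: f)
 have "A p0 (pp A a b) = Some a" "A p1 (pp A a b) = Some b" for a b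
  using pr unfolding is_pairing_def by(simp_all add: f g)
 thus ?thesis using f g by blast
qed

text \<open>\<open>pca_pair\<close> already fixes a pairing function by choice. A combinator and
  projections are selected here for that same function, so that programs agree with the coding of
  tuples.\<close>

definition ppr :: "'a pas => 'a * 'a * 'a" where
 "ppr A = (SOME (p, p0, p1). (ALL a. EX f. A p a = Some f & (ALL b. A f b = Some (pp A a b))) &
  (ALL a b. A p0 (pp A a b) = Some a) & (ALL a b. A p1 (pp A a b) = Some b))"

abbreviation P_of :: "'a pas => 'a" where "P_of A \<equiv> fst (ppr A)"
abbreviation P0_of :: "'a pas => 'a" where "P0_of A \<equiv> fst (snd (ppr A))"
abbreviation P1_of :: "'a pas => 'a" where "P1_of A \<equiv> snd (snd (ppr A))"

lemma pca_pair:
 assumes "pca A"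
 shows "Some (P_of A) \<cdot>\<^bsub>A\<^esub> Some a \<cdot>\<^bsub>A\<^esub> Some b = Some (pp A a b)"
  "A (P0_of A) (pp A a b) = Some a" "A (P1_of A) (pp A a b) = Some b"
proof -
 let ?P = "%(p, p0, p1). (ALL a. EX f. A p a = Some f & (ALL b. A f b = Some (pp A a b))) &
  (ALL a b. A p0 (pp A a b) = Some a) & (ALL a b. A p1 (pp A a b) = Some b)"
 have "EX x. ?P x" using pca_pair_ex[OF assms] unfolding case_prod_unfold by(metis fst_conv snd_conv)
 hence *: "?P (ppr A)" unfolding ppr_def by(rule someI_ex)
 then obtain f where "A (P_of A) a = Some f" "A f b = Some (pp A a b)"
  unfolding case_prod_unfold by blast
 thus "Some (P_of A) \<cdot>\<^bsub>A\<^esub> Some a \<cdot>\<^bsub>A\<^esub> Some b = Some (pp A a b)" by simp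
 show "A (P0_of A) (pp A a b) = Some a" "A (P1_of A) (pp A a b) = Some b"
  using * unfolding case_prod_unfold by blast+
qed

lemma pca_pair_inject:
 assumes "pca A"
 shows "pp A a b = pp A a' b' <-> a = a' & b = b'"
 by(metis option.inject pca_pair(2,3)[OF assms])

abbreviation Pair_t :: "'a pas => 'a ct => 'a ct => 'a ct" where
 "Pair_t A t u \<equiv> Cn (P_of A) $ t $ u"

lemma ev_Pair:
 assumes "pca A" "ev A e t = Some a" "ev A e u = Some b"
 shows "ev A e (Pair_t A t u) = Some (pp A a b)"
 using pca_pair(1)[OF assms(1), of a b] assms(2,3) by simp

lemma ev_Fst: "pca A ==> ev A e t = Some (pp A a b) ==> ev A e (Cn (P0_of A) $ t) = Some a"
 and ev_Snd: "pca A ==> ev A e t = Some (pp A a b) ==> ev A e (Cn (P1_of A) $ t) = Some b"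
 by(simp_all add: pca_pair)

lemma pca_fix:
 assumes "pca A"
 obtains r where "!!x v. ev A (x ## r ## e) t = Some v ==> A r x = Some v"
proof -
 text \<open>The usual fixed point \<open>zz\<close> with \<open>zux = t(uu,x)\<close>; \<open>uu\<close> is evaluated after \<open>x\<close> is given.\<close>
 obtain z f where z: "!!x. A z x = Some (f x)"
  "!!x y v. ev A (y ## x ## e) (Cn (the (ev A e (ab A (ab A t)))) $ (Vr 1 $ Vr 1) $ Vr 0) = Some v
   ==> A (f x) y = Some v"
  by(rule lam2[OF assms, of e "Cn (the (ev A e (ab A (ab A t)))) $ (Vr 1 $ Vr 1) $ Vr 0"]) blast
 obtain w where w: "ev A e (ab A (ab A t)) = Some w"
  "!!x v. ev A (x ## e) (ab A t) = Some v ==> A w x = Some v" by(rule ev_ab[OF assms]) blast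
 have "A (f z) x = Some v" if "ev A (x ## f z ## e) t = Some v" for x v
 proof(rule z(2))
  obtain w' where w': "ev A (f z ## e) (ab A t) = Some w'"
   "!!x v. ev A (x ## f z ## e) t = Some v ==> A w' x = Some v" by(rule ev_ab[OF assms]) blast
  show "ev A (x ## z ## e) (Cn (the (ev A e (ab A (ab A t)))) $ (Vr 1 $ Vr 1) $ Vr 0) = Some v"
   using w'(2)[OF that] w(2)[OF w'(1)] by(simp add: w(1) z(1))
 qed
 thus ?thesis using that by blast
qed

section \<open>First-order reasoning in the realizability tripos\<close>

section \<open>Uniform realizability\<close>

definition cj :: "'a pas => 'a set => 'a set => 'a set" where
 "cj A ph ps = {pp A a b | a b. a : ph & b : ps}"

text \<open>\<open>fc A W e ph\<close> is Kripke--Joyal forcing of \<open>ph\<close> at the partitioned assembly \<open>(W, e)\<close>;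
 it turns entailments in the realizability tripos into plain first-order reasoning.\<close>

definition fc :: "'a pas => 'w set => ('w => 'a) => ('w => 'a set) => bool" where
 "fc A W e ph <-> (EX a. ALL w:W. EX c. A a (e w) = Some c & c : ph w)"

abbreviation fc1 :: "'a pas => 'w set => ('w => 'a) => ('x => 'a set) => ('w => 'x) => bool" where
 "fc1 A W e F x \<equiv> fc A W e (%w. F (x w))"

abbreviation fc2 :: "'a pas => 'w set => ('w => 'a) => ('x => 'y => 'a set) => ('w => 'x) => ('w => 'y) => bool" where
 "fc2 A W e F x y \<equiv> fc A W e (%w. F (x w) (y w))"

type_synonym ('u, 'a) st1 = "('u * 'a) set"
type_synonym ('u, 'a) st2 = "('u * 'u * 'a) set"
type_synonym ('u, 'a) st3 = "('u * 'u * 'u * 'a) set"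
type_synonym ('u, 'a) tcat = "(('u set * ('u => 'u => 'a set)), ('u set * ('u => 'u => 'a set)) * ('u => 'u => 'a set) * ('u set * ('u => 'u => 'a set))) category"

definition cp :: "'a pas => 'w set => ('w => 'a) => ('w => 'a) => bool" where
 "cp A W e q <-> (EX a. ALL w:W. A a (e w) = Some (q w))"

definition ent :: "'a pas => ('i => 'a set) => ('i => 'a set) => bool" where
 "ent A ph ps <-> (EX a. ALL i. ALL b:ph i. EX c. A a b = Some c & c : ps i)"

definition ent2 :: "'a pas => ('i => 'j => 'a set) => ('i => 'j => 'a set) => bool" where
 "ent2 A ph ps <-> (EX a. ALL i j. ALL b:ph i j. EX c. A a b = Some c & c : ps i j)"

definition ent3 :: "'a pas => ('i => 'j => 'k => 'a set) => ('i => 'j => 'k => 'a set) => bool" where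
 "ent3 A ph ps <-> (EX a. ALL i j k. ALL b:ph i j k. EX c. A a b = Some c & c : ps i j k)"

text \<open>Passes from a realizer to the function of realizers it produces. Such functions can be
  handled pointwise and combined by \<open>cp_app\<close>, \<open>cp_pair\<close> and
  \<open>cp_trans\<close>.\<close>

lemma fc_cp: "fc A W e ph <-> (EX q. cp A W e q & (ALL w:W. q w : ph w))"
proof
 assume "fc A W e ph"
 then obtain a where a: "ALL w:W. EX c. A a (e w) = Some c & c : ph w" unfolding fc_def by blast
 from bchoice[OF a] obtain q where "ALL w:W. A a (e w) = Some (q w) & q w : ph w" by blast
 thus "EX q. cp A W e q & (ALL w:W. q w : ph w)" unfolding cp_def by blast
qed (force simp: fc_def cp_def)

lemma cp_const: assumes "pca A" shows "cp A W e (%_. c)"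
 by(rule pca_K[OF assms, of c]) (auto simp: cp_def)

lemma cp_id: assumes "pca A" shows "cp A W e e"
 by(rule pca_I[OF assms]) (auto simp: cp_def)

lemma cp_app:
 assumes "pca A" "cp A W e q" "cp A W e q'" "!!w. w : W ==> A (q w) (q' w) = Some (s w)"
 shows "cp A W e s"
proof -
 obtain a a' where a: "ALL w:W. A a (e w) = Some (q w)" "ALL w:W. A a' (e w) = Some (q' w)"
  using assms(2,3) unfolding cp_def by blast
 obtain b where b: "!!x v. ev A (x ## (%_. a)) ((Cn a $ Vr 0) $ (Cn a' $ Vr 0)) = Some v ==> A b x = Some v"
  by(rule lam1[OF assms(1)]) blast
 have "ALL w:W. A b (e w) = Some (s w)" using a assms(4) by(auto intro!: b)
 thus ?thesis unfolding cp_def by blast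
qed

lemma cp_app1: "pca A ==> cp A W e q' ==> (!!w. w : W ==> A r (q' w) = Some (s w)) ==> cp A W e s"
 by(rule cp_app[OF _ cp_const, of A W e q' r s]) auto

lemma cp_pair:
 assumes "pca A" "cp A W e q" "cp A W e q'"
 shows "cp A W e (%w. pp A (q w) (q' w))"
proof -
 have "EX f. A (P_of A) a = Some f & A f b = Some (pp A a b)" for a b
  using pca_pair(1)[OF assms(1), of a b] by(auto simp: app_eq_Some)
 hence *: "A (P_of A) a = Some (the (A (P_of A) a))"
  "A (the (A (P_of A) a)) b = Some (pp A a b)" for a b by(metis option.sel)+
 have "cp A W e (%w. the (A (P_of A) (q w)))"
  by(rule cp_app1[OF assms(1,2)]) (rule *)
 thus ?thesis by(rule cp_app[OF assms(1) _ assms(3)]) (rule *)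
qed

lemma cp_fst: "pca A ==> cp A W e (%w. pp A (q w) (q' w)) ==> cp A W e q"
 and cp_snd: "pca A ==> cp A W e (%w. pp A (q w) (q' w)) ==> cp A W e q'"
 by(blast intro: cp_app1 pca_pair(2,3))+

lemma cp_trans:
 assumes "pca A" "cp A W e q" "cp A W q s" shows "cp A W e s"
proof -
 obtain a where a: "ALL w:W. A a (q w) = Some (s w)" using assms(3) unfolding cp_def by blast
 show ?thesis by(rule cp_app1[OF assms(1,2), where r = a]) (simp add: a)
qed

lemma cp_cong: "cp A W e q ==> (!!w. w : W ==> q w = q' w) ==> cp A W e q'"
 by(simp add: cp_def)

lemma fc_trans: "pca A ==> cp A W e q ==> fc A W q ph ==> fc A W e ph"
 using cp_trans unfolding fc_cp by blast

lemma fc_mem: "pca A ==> (!!w. w : W ==> e w : ph w) ==> fc A W e ph"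
 unfolding fc_cp using cp_id by blast

lemma fc_const: "pca A ==> (!!w. w : W ==> c : ph w) ==> fc A W e ph"
 unfolding fc_cp by(rule exI[of _ "%_. c"]) (simp add: cp_const)

lemma fc_mono: "fc A W e ph ==> (!!w. w : W ==> ph w \<subseteq> ps w) ==> fc A W e ps"
 unfolding fc_def by blast

lemma fc_ne: "fc A W e ph ==> w : W ==> ph w ~= {}"
 unfolding fc_def by blast

lemma cj_ne [simp]: "cj A ph ps = {} <-> ph = {} | ps = {}"
 by(auto simp: cj_def)

lemma fc_cj:
 assumes "pca A"
 shows "fc2 A W e (cj A) ph ps <-> fc A W e ph & fc A W e ps" (is "?L <-> ?R")
proof
 assume ?L
 then obtain q where q: "cp A W e q" "ALL w:W. EX p. q w = pp A (fst p) (snd p) & fst p : ph w & snd p : ps w"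
  unfolding fc_cp by(force simp: cj_def)
 from bchoice[OF q(2)] obtain p where
  p: "ALL w:W. q w = pp A (fst (p w)) (snd (p w)) & fst (p w) : ph w & snd (p w) : ps w" by blast
 have "cp A W e (%w. pp A (fst (p w)) (snd (p w)))" using q(1) by(rule cp_cong) (use p in blast)
 from cp_fst[OF assms this] cp_snd[OF assms this] show ?R unfolding fc_cp using p by blast
next
 assume ?R
 then obtain q q' where q: "cp A W e q" "ALL w:W. q w : ph w" "cp A W e q'" "ALL w:W. q' w : ps w"
  unfolding fc_cp by blast
 from cp_pair[OF assms q(1,3)] show ?L unfolding fc_cp using q by(force simp: cj_def)
qed

text \<open>Existential quantification is a union of sets of realizers. The witnesses
  \<open>j w\<close> come from the axiom of choice and need not be computable; only the realizers
  must be uniform.\<close>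

lemma fc_Un: "fc A W e (%w. \<Union>j\<in>J w. ph w j) <-> (EX j. (ALL w:W. j w : J w) & fc A W e (%w. ph w (j w)))"
proof
 assume "fc A W e (%w. \<Union>j\<in>J w. ph w j)"
 then obtain a where "ALL w:W. EX j. EX c. A a (e w) = Some c & j : J w & c : ph w j" unfolding fc_def by blast
 from bchoice[OF this] show "EX j. (ALL w:W. j w : J w) & fc A W e (%w. ph w (j w))" unfolding fc_def by blast
qed (force simp: fc_def)

lemma fc_UN: "fc A W e (%w. \<Union>j. ph w j) <-> (EX j. fc A W e (%w. ph w (j w)))"
 using fc_Un[where J = "%_. UNIV"] by simp

lemma entD: "pca A ==> ent A ph ps ==> fc1 A W e ph i ==> fc1 A W e ps i"
proof -
 assume *: "pca A" "ent A ph ps" "fc1 A W e ph i"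
 from *(3) obtain q where q: "cp A W e q" "ALL w:W. q w : ph (i w)" unfolding fc_cp by blast
 from *(2) q(2) have "fc1 A W q ps i" unfolding ent_def fc_def by blast
 with fc_trans[OF *(1) q(1)] show ?thesis by blast
qed

lemma ent2D: "pca A ==> ent2 A ph ps ==> fc2 A W e ph x y ==> fc2 A W e ps x y"
 using entD[of A "%(x,y). ph x y" "%(x,y). ps x y" W e "%w. (x w, y w)"] by(simp add: ent_def ent2_def)

lemma ent3D: "pca A ==> ent3 A ph ps ==> fc A W e (%w. ph (x w) (y w) (z w)) ==> fc A W e (%w. ps (x w) (y w) (z w))"
 using entD[of A "%(x,y,z). ph x y z" "%(x,y,z). ps x y z" W e "%w. (x w, y w, z w)"] by(simp add: ent_def ent3_def)

text \<open>One generic stage decides the entailment: all pairs of an index and a realizer of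
  \<open>ph\<close>, with that realizer as datum. Hence stages \<open>W\<close> of this one type are
  enough.\<close>

lemma entI:
 assumes "pca A" and *: "!!(W :: ('i * 'a) set) e i. fc1 A W e ph i ==> fc1 A W e ps i"
 shows "ent A (ph :: 'i => 'a set) ps"
proof -
 have "fc A {(i,b). b : ph i} snd (%w. ps (fst w))" by(rule *) (rule fc_mem, use assms(1) in auto)
 thus ?thesis unfolding ent_def fc_def by auto
qed

lemma ent2I:
 assumes "pca A" and *: "!!(W :: ('i * 'j * 'a) set) e x y. fc2 A W e ph x y ==> fc2 A W e ps x y"
 shows "ent2 A (ph :: 'i => 'j => 'a set) ps"
proof -
 have "fc A {(i,j,b). b : ph i j} (%(i,j,b). b) (%w. ps (fst w) (fst (snd w)))"
  by(rule *) (rule fc_mem, use assms(1) in auto)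
 thus ?thesis unfolding ent2_def fc_def by(simp add: Ball_def)
qed

lemma ent3I:
 assumes "pca A" and *: "!!(W :: ('i * 'j * 'k * 'a) set) e x y z.
  fc A W e (%w. ph (x w) (y w) (z w)) ==> fc A W e (%w. ps (x w) (y w) (z w))"
 shows "ent3 A (ph :: 'i => 'j => 'k => 'a set) ps"
proof -
 have "fc A {(i,j,k,b). b : ph i j k} (%(i,j,k,b). b) (%w. ps (fst w) (fst (snd w)) (fst (snd (snd w))))"
  by(rule *) (rule fc_mem, use assms(1) in auto)
 thus ?thesis unfolding ent3_def fc_def by(simp add: Ball_def)
qed

section \<open>Cardinal arithmetic in the universe\<close>

section \<open>The universe\<close>

lemma small_mono: "small U Y ==> X \<lesssim> Y ==> small U X"
 unfolding small_def using lesspoll_trans1 by blast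

lemma small_image: "small U X ==> small U (f ` X)"
 using small_mono image_lepoll by blast

lemma small_subset: "small U Y ==> X \<subseteq> Y ==> small U X"
 using small_mono subset_imp_lepoll by blast

text \<open>A product with an infinite factor has at most the size of the larger factor. The
  disjunction is in the form in which smallness is inherited in each case.\<close>

lemma lepoll_times_cases:
 fixes X :: "'x set" and Y :: "'y set"
 shows "finite (X \<times> Y) | X \<times> Y \<lesssim> X | X \<times> Y \<lesssim> Y"
proof -
 include cardinal_syntax
 have *: "M \<times> N \<lesssim> M & N \<times> M \<lesssim> M" if "infinite M" "N \<lesssim> M" for M :: "'m set" and N :: "'n set"
 proof(cases "N = {}")
  case False
  have "|N| \<le>o |M|" using that(2) card_of_ordLeq unfolding lepoll_def by blast
  hence "|M \<times> N| =o |M|" "|N \<times> M| =o |M|" using card_of_Times_infinite[OF that(1) False] by auto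
  thus ?thesis unfolding lepoll_def card_of_ordLeq by(simp add: ordIso_imp_ordLeq)
 qed auto
 have "X \<lesssim> Y | Y \<lesssim> X"
  unfolding lepoll_def card_of_ordLeq by(meson card_of_Well_order ordLeq_total)
 thus ?thesis using *[of X Y] *[of Y X] by(metis finite_SigmaI finite_lepoll_infinite)
qed

context
 assumes U: "set_universe TYPE('u)"
begin

lemma infinite_universe: "infinite (UNIV :: 'u set)"
proof -
 have "(UNIV :: nat set) \<lesssim> (UNIV :: 'u set)"
  using U unfolding set_universe_def by(blast intro: lesspoll_imp_lepoll)
 thus ?thesis using infinite_le_lepoll by blast
qed

lemma small_finite: "finite X ==> small TYPE('u) X"
 unfolding small_def using infinite_universe by(rule finite_lesspoll_infinite)

lemma small_inj: assumes "small TYPE('u) X" obtains f where "inj_on (f :: 'x => 'u) X"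
 using assms unfolding small_def lesspoll_def lepoll_def by blast

lemma small_Times: assumes "small TYPE('u) X" "small TYPE('u) Y" shows "small TYPE('u) (X \<times> Y)"
 using lepoll_times_cases[of X Y] small_finite[of "X \<times> Y"] small_mono[OF assms(1), of "X \<times> Y"]
  small_mono[OF assms(2), of "X \<times> Y"] by argo

lemma small_Pow: assumes "small TYPE('u) (X :: 'x set)" shows "small TYPE('u) (Pow X)"
proof -
 obtain f where f: "inj_on (f :: 'x => 'u) X" using small_inj[OF assms] .
 have "small TYPE('u) (f ` X)" by(rule small_image[OF assms])
 hence "small TYPE('u) (Pow (f ` X))" using U unfolding set_universe_def small_def by blast
 moreover have "Pow X \<lesssim> Pow (f ` X)"
  unfolding lepoll_def using inj_on_image_Pow[OF f] by(intro exI[of _ "image f"]) auto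
 ultimately show ?thesis by(rule small_mono)
qed

lemma ex_pair_encoding: "EX f :: 'u * 'u => 'u. inj f"
proof -
 have "infinite ((UNIV :: 'u set) \<times> (UNIV :: 'u set))"
  using finite_cartesian_productD1[of "UNIV :: 'u set" "UNIV :: 'u set"] infinite_universe by blast
 hence "(UNIV :: 'u set) \<times> (UNIV :: 'u set) \<lesssim> (UNIV :: 'u set)"
  using lepoll_times_cases[of "UNIV :: 'u set" "UNIV :: 'u set"] by blast
 thus ?thesis unfolding lepoll_def by auto
qed

end

section \<open>Adjunctions, geometric morphisms and equivalences of abstract categories\<close>

section \<open>Functors with universal arrows\<close>

definition cat :: "('o, 'm) category => bool" where
 "cat C <-> (ALL f:Arr C. Dom C f : Obj C & Cod C f : Obj C) &
  (ALL X:Obj C. Idn C X : hom C X X) &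
  (ALL X Y Z f g. f : hom C X Y --> g : hom C Y Z --> Cmp C g f : hom C X Z) &
  (ALL X Y f. f : hom C X Y --> Cmp C f (Idn C X) = f & Cmp C (Idn C Y) f = f) &
  (ALL X Y Z W f g h. f : hom C X Y --> g : hom C Y Z --> h : hom C Z W -->
   Cmp C h (Cmp C g f) = Cmp C (Cmp C h g) f)"

lemma homD: "f : hom C X Y ==> f : Arr C" "f : hom C X Y ==> Dom C f = X" "f : hom C X Y ==> Cod C f = Y"
 by(simp_all add: hom_def)

lemma hom_self: "f : Arr C ==> f : hom C (Dom C f) (Cod C f)"
 by(simp add: hom_def)

lemma cat_id: "cat C ==> X : Obj C ==> Idn C X : hom C X X"
 unfolding cat_def by blast

lemma cat_comp: "cat C ==> f : hom C X Y ==> g : hom C Y Z ==> Cmp C g f : hom C X Z"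
 unfolding cat_def by blast

lemma cat_idr: "cat C ==> f : hom C X Y ==> Cmp C f (Idn C X) = f"
 unfolding cat_def by blast

lemma cat_idl: "cat C ==> f : hom C X Y ==> Cmp C (Idn C Y) f = f"
 unfolding cat_def by blast

lemma cat_assoc: "cat C ==> f : hom C X Y ==> g : hom C Y Z ==> h : hom C Z W ==>
  Cmp C h (Cmp C g f) = Cmp C (Cmp C h g) f"
 unfolding cat_def by blast

lemma cat_obj: "cat C ==> f : hom C X Y ==> X : Obj C" "cat C ==> f : hom C X Y ==> Y : Obj C"
 unfolding cat_def hom_def by blast+

definition iso_in :: "('o, 'm) category => 'm => 'm => 'o => 'o => bool" where
 "iso_in C f g X Y <-> f : hom C X Y & g : hom C Y X & Cmp C g f = Idn C X & Cmp C f g = Idn C Y"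

lemma is_iso_in: "f : hom C X Y ==> is_iso C f <-> (EX g. iso_in C f g X Y)"
 unfolding is_iso_def iso_in_def hom_def by auto

lemma iso_in_sym: "iso_in C f g X Y ==> iso_in C g f Y X"
 by(auto simp: iso_in_def)

lemma iso_in_comp:
 assumes C: "cat C" and 1: "iso_in C f f' X Y" and 2: "iso_in C g g' Y Z"
 shows "iso_in C (Cmp C g f) (Cmp C f' g') X Z"
proof -
 note h = 1[unfolded iso_in_def] 2[unfolded iso_in_def]
 have *: "Cmp C (Cmp C f' g') (Cmp C g f) = Idn C X"
  if "iso_in C f f' X Y" "iso_in C g g' Y Z" for f f' g g' X Y Z
 proof -
  note k = that[unfolded iso_in_def]
  have "Cmp C (Cmp C f' g') (Cmp C g f) = Cmp C f' (Cmp C g' (Cmp C g f))"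
   using k by(intro cat_assoc[OF C, symmetric]) (auto intro: cat_comp[OF C])
  also have "Cmp C g' (Cmp C g f) = Cmp C (Cmp C g' g) f" using k by(intro cat_assoc[OF C]) auto
  also have "\<dots> = f" using k cat_idl[OF C, of f X Y] by auto
  finally show ?thesis using k by auto
 qed
 show ?thesis unfolding iso_in_def
  using *[OF 1 2] *[OF iso_in_sym[OF 2] iso_in_sym[OF 1]] h by(auto intro: cat_comp[OF C])
qed

lemma iso_in_id: "cat C ==> X : Obj C ==> iso_in C (Idn C X) (Idn C X) X X"
 unfolding iso_in_def using cat_id cat_idl by fastforce

lemma fun_obj: "is_functor C D F ==> X : Obj C ==> FObj F X : Obj D"
 unfolding is_functor_def by blast

lemma fun_id: "is_functor C D F ==> X : Obj C ==> FArr F (Idn C X) = Idn D (FObj F X)"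
 unfolding is_functor_def by blast

lemma fun_hom: "is_functor C D F ==> f : hom C X Y ==> FArr F f : hom D (FObj F X) (FObj F Y)"
 unfolding is_functor_def by(auto simp: hom_def)

lemma fun_cmp: "is_functor C D F ==> f : hom C X Y ==> g : hom C Y Z ==>
  FArr F (Cmp C g f) = Cmp D (FArr F g) (FArr F f)"
 unfolding is_functor_def by(auto simp: hom_def)

lemma is_functorI:
 assumes "cat C" "!!X. X : Obj C ==> FObj F X : Obj D"
  "!!X. X : Obj C ==> FArr F (Idn C X) = Idn D (FObj F X)"
  "!!f X Y. f : hom C X Y ==> FArr F f : hom D (FObj F X) (FObj F Y)"
  "!!f g X Y Z. f : hom C X Y ==> g : hom C Y Z ==> FArr F (Cmp C g f) = Cmp D (FArr F g) (FArr F f)"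
 shows "is_functor C D F"
 unfolding is_functor_def
proof(intro conjI ballI impI)
 fix f g assume "f : Arr C" "g : Arr C" "Cod C f = Dom C g"
 thus "FArr F (Cmp C g f) = Cmp D (FArr F g) (FArr F f)"
  using assms(5)[of f "Dom C f" "Cod C f" g "Cod C g"] by(simp add: hom_def)
qed (use assms(2,3) assms(4)[OF hom_self] in auto)

lemma fun_iso: "is_functor C D F ==> cat C ==> iso_in C f g X Y ==> iso_in D (FArr F f) (FArr F g) (FObj F X) (FObj F Y)"
proof -
 assume *: "is_functor C D F" "cat C" "iso_in C f g X Y"
 hence k: "f : hom C X Y" "g : hom C Y X" "Cmp C g f = Idn C X" "Cmp C f g = Idn C Y"
  unfolding iso_in_def by auto
 show ?thesis unfolding iso_in_def
  using fun_hom[OF *(1) k(1)] fun_hom[OF *(1) k(2)] fun_cmp[OF *(1) k(1,2)] fun_cmp[OF *(1) k(2,1)]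
   fun_id[OF *(1)] cat_obj[OF *(2) k(1)] k(3,4) by simp
qed

abbreviation (input) "lx == preserves_finite_limits"
abbreviation (input) "isof == isomorphic_functors"
abbreviation (input) "eqrel == equivalence_relation"
notation comp_func (infixr "oo" 65)

lemma comp_func_simps [simp]: "FObj (G oo F) X = FObj G (FObj F X)" "FArr (G oo F) f = FArr G (FArr F f)"
 by(simp_all add: comp_func_def)

lemma id_func_simps [simp]: "FObj id_func X = X" "FArr id_func f = f"
 by(simp_all add: id_func_def)

lemma comp_functor: "cat C ==> is_functor C D F ==> is_functor D E G ==> is_functor C E (G oo F)"
proof(rule is_functorI)
 fix f g X Y Z assume F: "is_functor C D F" and G: "is_functor D E G" and f: "f : hom C X Y" and g: "g : hom C Y Z"
 show "FArr (G oo F) (Cmp C g f) = Cmp E (FArr (G oo F) g) (FArr (G oo F) f)"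
  using fun_cmp[OF F f g] fun_cmp[OF G fun_hom[OF F f] fun_hom[OF F g]] by simp
qed (auto simp: fun_obj fun_id intro: fun_hom)

text \<open>A terminal arrow from \<open>L\<close> to \<open>Z\<close>, that is, one component of a
  counit. Inverse images are handled through such arrows; a right adjoint functor is assembled from
  them only in \<open>lexadj_geometric\<close>.\<close>

definition ua :: "('o1, 'm1) category => ('o2, 'm2) category => ('o1, 'm1, 'o2, 'm2) func =>
  'o2 => 'o1 => 'm2 => bool" where
 "ua C D L Z V eps <-> V : Obj C & eps : hom D (FObj L V) Z &
  (ALL Y:Obj C. ALL g:hom D (FObj L Y) Z. EX! k. k : hom C Y V & Cmp D eps (FArr L k) = g)"

definition lexadj :: "('o1, 'm1) category => ('o2, 'm2) category => ('o1, 'm1, 'o2, 'm2) func => bool" where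
 "lexadj C D L <-> is_functor C D L & lx C D L &
  (ALL Z:Obj D. EX V eps. ua C D L Z V eps)"

text \<open>The inverse image of a geometric inclusion: the counit is invertible.\<close>

definition lexincl :: "('o1, 'm1) category => ('o2, 'm2) category => ('o1, 'm1, 'o2, 'm2) func => bool" where
 "lexincl C D L <-> is_functor C D L & lx C D L &
  (ALL Z:Obj D. EX V eps. ua C D L Z V eps & is_iso D eps)"

lemma lexincl_lexadj: "lexincl C D L ==> lexadj C D L"
 unfolding lexincl_def lexadj_def by blast

lemma lexadjD:
 assumes "lexadj C D L"
 shows "is_functor C D L" "lx C D L"
  "Z : Obj D ==> EX V eps. ua C D L Z V eps"
 using assms unfolding lexadj_def by simp_all

lemma lexinclD:
 assumes "lexincl C D L"
 shows "is_functor C D L" "lx C D L"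
  "Z : Obj D ==> EX V eps. ua C D L Z V eps & is_iso D eps"
 using assms unfolding lexincl_def by simp_all

lemma uaD:
 assumes "ua C D L Z V eps"
 shows "V : Obj C" "eps : hom D (FObj L V) Z"
 using assms unfolding ua_def by simp_all

lemma ua_ex: "ua C D L Z V eps ==> Y : Obj C ==> g : hom D (FObj L Y) Z ==>
  EX k. k : hom C Y V & Cmp D eps (FArr L k) = g"
 unfolding ua_def by blast

lemma ua_unique:
 assumes "ua C D L Z V eps" "cat C" "is_functor C D L" "cat D"
  "k : hom C Y V" "k' : hom C Y V" "Cmp D eps (FArr L k) = Cmp D eps (FArr L k')"
 shows "k = k'"
proof -
 have "Y : Obj C" by(rule cat_obj(1)[OF assms(2,5)])
 moreover have "Cmp D eps (FArr L k') : hom D (FObj L Y) Z"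
  using cat_comp[OF assms(4) fun_hom[OF assms(3,6)]] assms(1) unfolding ua_def by blast
 ultimately show ?thesis using assms unfolding ua_def by blast
qed

lemma ua_comp:
 assumes cats: "cat C" "cat D" "cat E" and F: "is_functor C D L" and G: "is_functor D E M"
  and 1: "ua D E M Z V eps" and 2: "ua C D L V W de"
 shows "ua C E (M oo L) Z W (Cmp E eps (FArr M de))"
proof -
 have W: "W : Obj C" and d: "de : hom D (FObj L W) V" and e: "eps : hom E (FObj M V) Z"
  using 1 2 unfolding ua_def by auto
 note Md = fun_hom[OF G d]
 have c: "Cmp E (Cmp E eps (FArr M de)) (FArr M (FArr L k)) = Cmp E eps (FArr M (Cmp D de (FArr L k)))"
  if "k : hom C Y W" for Y k
  using fun_cmp[OF G fun_hom[OF F that] d] cat_assoc[OF cats(3) fun_hom[OF G fun_hom[OF F that]] Md e]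
  by simp
 have "EX! k. k : hom C Y W & Cmp E (Cmp E eps (FArr M de)) (FArr M (FArr L k)) = g"
  if Y: "Y : Obj C" and g: "g : hom E (FObj M (FObj L Y)) Z" for Y g
 proof -
  obtain h where h: "h : hom D (FObj L Y) V" "Cmp E eps (FArr M h) = g"
   using ua_ex[OF 1 fun_obj[OF F Y] g] by blast
  obtain k where k: "k : hom C Y W" "Cmp D de (FArr L k) = h" using ua_ex[OF 2 Y h(1)] by blast
  show ?thesis
  proof(rule ex1I[of _ k])
   show "k : hom C Y W & Cmp E (Cmp E eps (FArr M de)) (FArr M (FArr L k)) = g"
    using c[OF k(1)] k h by simp
  next
   fix k' assume k': "k' : hom C Y W & Cmp E (Cmp E eps (FArr M de)) (FArr M (FArr L k')) = g"
   hence h': "Cmp D de (FArr L k') : hom D (FObj L Y) V" using cat_comp[OF cats(2) fun_hom[OF F] d] by blast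
   have "Cmp D de (FArr L k') = h"
    by(rule ua_unique[OF 1 cats(2) G cats(3) h' h(1)]) (use c[OF conjunct1[OF k']] k' h in simp)
   thus "k' = k"
    by(intro ua_unique[OF 2 cats(1) F cats(2) _ k(1)]) (use k k' in auto)
  qed
 qed
 thus ?thesis unfolding ua_def using W cat_comp[OF cats(3) Md e] by simp
qed

lemma lexD:
 assumes "lx C D L"
 shows "is_terminal C T ==> is_terminal D (FObj L T)"
  "is_pullback C f g p q ==> is_pullback D (FArr L f) (FArr L g) (FArr L p) (FArr L q)"
 using assms unfolding preserves_finite_limits_def by fast+

lemma comp_lex:
 assumes "lx C D L" "lx D E M"
 shows "lx C E (M oo L)"
 unfolding preserves_finite_limits_def comp_func_simps
 by(intro conjI allI impI; rule lexD[OF assms(2)], erule lexD[OF assms(1)])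

lemma lexadj_comp:
 assumes "cat C" "cat D" "cat E" "lexadj C D L" "lexadj D E M"
 shows "lexadj C E (M oo L)"
 unfolding lexadj_def
proof(intro conjI ballI)
 note F = lexadjD(1)[OF assms(4)] lexadjD(1)[OF assms(5)]
 show "is_functor C E (M oo L)" by(rule comp_functor[OF assms(1) F])
 show "lx C E (M oo L)"
  by(rule comp_lex[OF lexadjD(2)[OF assms(4)] lexadjD(2)[OF assms(5)]])
 fix Z assume "Z : Obj E"
 from lexadjD(3)[OF assms(5) this] obtain V eps where 1: "ua D E M Z V eps" by blast
 from lexadjD(3)[OF assms(4) uaD(1)[OF 1]] obtain W de where 2: "ua C D L V W de" by blast
 show "EX V eps. ua C E (M oo L) Z V eps" using ua_comp[OF assms(1-3) F 1 2] by blast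
qed

lemma lexincl_comp:
 assumes "cat C" "cat D" "cat E" "lexincl C D L" "lexincl D E M"
 shows "lexincl C E (M oo L)"
 unfolding lexincl_def
proof(intro conjI ballI)
 note F = lexinclD(1)[OF assms(4)] lexinclD(1)[OF assms(5)]
 show "is_functor C E (M oo L)" by(rule comp_functor[OF assms(1) F])
 show "lx C E (M oo L)"
  by(rule comp_lex[OF lexinclD(2)[OF assms(4)] lexinclD(2)[OF assms(5)]])
 fix Z assume "Z : Obj E"
 from lexinclD(3)[OF assms(5) this] obtain V eps where 1: "ua D E M Z V eps" "is_iso E eps" by blast
 from lexinclD(3)[OF assms(4) uaD(1)[OF 1(1)]] obtain W de
  where 2: "ua C D L V W de" "is_iso D de" by blast
 note e = uaD(2)[OF 1(1)] and d = uaD(2)[OF 2(1)]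
 obtain e' d' where i: "iso_in E eps e' (FObj M V) Z" "iso_in D de d' (FObj L W) V"
  using is_iso_in[OF e] is_iso_in[OF d] 1(2) 2(2) by blast
 have "iso_in E (Cmp E eps (FArr M de)) (Cmp E (FArr M d') e') (FObj M (FObj L W)) Z"
  by(rule iso_in_comp[OF assms(3) fun_iso[OF F(2) assms(2) i(2)] i(1)])
 hence "is_iso E (Cmp E eps (FArr M de))" using is_iso_in[OF cat_comp[OF assms(3) fun_hom[OF F(2) d] e]] by blast
 thus "EX V eps. ua C E (M oo L) Z V eps & is_iso E eps"
  using ua_comp[OF assms(1-3) F 1(1) 2(1)] by blast
qed

subsection \<open>Adjunctions\<close>

text \<open>A choice of terminal arrows defines the right adjoint by transposition. Functoriality,
  naturality of the unit and the second triangle identity all come from \<open>uniq\<close>: arrows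
  into \<open>V Z\<close> are determined by their transposes.\<close>

lemma lexadj_geometric:
 assumes C: "cat C" and D: "cat D" and L: "lexadj C D L"
 shows "EX p. geometric_morphism D C p & inverse_im p = L"
proof -
 have F: "is_functor C D L" and lex: "lx C D L" using lexadjD[OF L] by simp_all
 have "ALL Z:Obj D. EX p. ua C D L Z (fst p) (snd p)" using lexadjD(3)[OF L] by auto
 from bchoice[OF this] obtain p where p: "!!Z. Z : Obj D ==> ua C D L Z (fst (p Z)) (snd (p Z))" by blast
 define V where "V Z = fst (p Z)" for Z
 define eps where "eps Z = snd (p Z)" for Z
 have u: "ua C D L Z (V Z) (eps Z)" if "Z : Obj D" for Z using p[OF that] unfolding V_def eps_def .
 have V: "V Z : Obj C" and e: "eps Z : hom D (FObj L (V Z)) Z" if "Z : Obj D" for Z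
  using u[OF that] unfolding ua_def by auto
 define tr where "tr Z Y g = (THE k. k : hom C Y (V Z) & Cmp D (eps Z) (FArr L k) = g)" for Z Y g
 have tr: "tr Z Y g : hom C Y (V Z) & Cmp D (eps Z) (FArr L (tr Z Y g)) = g"
  if "Z : Obj D" "Y : Obj C" "g : hom D (FObj L Y) Z" for Z Y g
 proof -
  have "EX! k. k : hom C Y (V Z) & Cmp D (eps Z) (FArr L k) = g"
   using u[OF that(1)] that(2,3) unfolding ua_def by blast
  from theI'[OF this] show ?thesis unfolding tr_def .
 qed
 have uniq: "k = k'" if "k : hom C Y (V Z)" "k' : hom C Y (V Z)"
   "Cmp D (eps Z) (FArr L k) = Cmp D (eps Z) (FArr L k')" "Z : Obj D" for k k' Y Z
  using ua_unique[OF u[OF that(4)] C F D that(1-3)] .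
 define R where "R = \<lparr>FObj = V, FArr = (%g. tr (Cod D g) (V (Dom D g)) (Cmp D g (eps (Dom D g))))\<rparr>"
 have RO [simp]: "FObj R = V" by(simp add: R_def)
 have Rh: "FArr R g : hom C (V X) (V Y)" and Re: "Cmp D (eps Y) (FArr L (FArr R g)) = Cmp D g (eps X)"
  if "g : hom D X Y" for g X Y
  using tr[of Y "V X" "Cmp D g (eps X)"] cat_comp[OF D e that] cat_obj[OF D that] V homD[OF that]
  by(auto simp: R_def)
 have R: "is_functor D C R"
 proof(rule is_functorI[OF D])
  fix X assume X: "X : Obj D"
  show "FArr R (Idn D X) = Idn C (FObj R X)"
   by(rule uniq[of _ "V X" X])
    (use Rh[OF cat_id[OF D X]] Re[OF cat_id[OF D X]] cat_id[OF C V[OF X]] X fun_id[OF F V[OF X]]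
     cat_idl[OF D e[OF X]] cat_idr[OF D e[OF X]] in auto)
 next
  fix f g X Y Z assume f: "f : hom D X Y" and g: "g : hom D Y Z"
  note o = cat_obj[OF D f] cat_obj[OF D g]
  have "Cmp D (eps Z) (FArr L (Cmp C (FArr R g) (FArr R f))) = Cmp D (eps Z) (Cmp D (FArr L (FArr R g)) (FArr L (FArr R f)))"
   using fun_cmp[OF F Rh[OF f] Rh[OF g]] by simp
  also have "\<dots> = Cmp D (Cmp D g (eps Y)) (FArr L (FArr R f))"
   using cat_assoc[OF D fun_hom[OF F Rh[OF f]] fun_hom[OF F Rh[OF g]] e[OF o(4)]] Re[OF g] by simp
  also have "\<dots> = Cmp D g (Cmp D f (eps X))"
   using cat_assoc[OF D fun_hom[OF F Rh[OF f]] e[OF o(2)] g] Re[OF f] by simp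
  also have "\<dots> = Cmp D (Cmp D g f) (eps X)" using cat_assoc[OF D e[OF o(1)] f g] .
  also have "\<dots> = Cmp D (eps Z) (FArr L (FArr R (Cmp D g f)))" using Re[OF cat_comp[OF D f g]] by simp
  finally show "FArr R (Cmp D g f) = Cmp C (FArr R g) (FArr R f)"
   by(intro uniq[of _ "V X" Z]) (use Rh cat_comp[OF D f g] cat_comp[OF C Rh[OF f] Rh[OF g]] o in auto)
 qed (use V Rh in auto)
 define eta where "eta Y = tr (FObj L Y) Y (Idn D (FObj L Y))" for Y
 have eta: "eta Y : hom C Y (V (FObj L Y))" and tri1: "Cmp D (eps (FObj L Y)) (FArr L (eta Y)) = Idn D (FObj L Y)"
  if "Y : Obj C" for Y
  using tr[OF fun_obj[OF F that] that cat_id[OF D fun_obj[OF F that]]] unfolding eta_def by auto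
 have n1: "nat_trans C C id_func (R oo L) eta"
  unfolding nat_trans_def
 proof(intro conjI ballI)
  fix f assume f0: "f : Arr C"
  define X Y where "X = Dom C f" and "Y = Cod C f"
  have f: "f : hom C X Y" using f0 unfolding X_def Y_def by(rule hom_self)
  note o = cat_obj[OF C f] and Lf = fun_hom[OF F f]
  note lo = fun_obj[OF F o(1)] fun_obj[OF F o(2)]
  have "Cmp D (eps (FObj L Y)) (FArr L (Cmp C (eta Y) f)) = FArr L f"
   using fun_cmp[OF F f eta[OF o(2)]] cat_assoc[OF D Lf fun_hom[OF F eta[OF o(2)]] e[OF lo(2)]]
    tri1[OF o(2)] cat_idl[OF D Lf] by simp
  moreover have "Cmp D (eps (FObj L Y)) (FArr L (Cmp C (FArr R (FArr L f)) (eta X))) = FArr L f"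
   using fun_cmp[OF F eta[OF o(1)] Rh[OF Lf]] Re[OF Lf]
    cat_assoc[OF D fun_hom[OF F eta[OF o(1)]] fun_hom[OF F Rh[OF Lf]] e[OF lo(2)]]
    cat_assoc[OF D fun_hom[OF F eta[OF o(1)]] e[OF lo(1)] Lf] tri1[OF o(1)] cat_idr[OF D Lf] by simp
  ultimately have "Cmp C (eta Y) f = Cmp C (FArr R (FArr L f)) (eta X)"
   by(intro uniq[of _ X "FObj L Y"])
    (use cat_comp[OF C f eta[OF o(2)]] cat_comp[OF C eta[OF o(1)] Rh[OF Lf]] lo in auto)
  thus "Cmp C (eta (Cod C f)) (FArr id_func f) = Cmp C (FArr (R oo L) f) (eta (Dom C f))"
   by(simp add: X_def Y_def)
 qed (simp add: eta)
 have n2: "nat_trans D D (L oo R) id_func eps"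
  unfolding nat_trans_def using e Re[OF hom_self] by simp
 have tri2: "Cmp C (FArr R (eps Z)) (eta (V Z)) = Idn C (V Z)" if Z: "Z : Obj D" for Z
 proof(rule uniq[of _ "V Z" Z])
  note VZ = V[OF Z] and eZ = e[OF Z]
  note h = eta[OF VZ] Rh[OF eZ]
  show "Cmp C (FArr R (eps Z)) (eta (V Z)) : hom C (V Z) (V Z)" by(rule cat_comp[OF C h])
  show "Cmp D (eps Z) (FArr L (Cmp C (FArr R (eps Z)) (eta (V Z)))) = Cmp D (eps Z) (FArr L (Idn C (V Z)))"
   using fun_cmp[OF F h] cat_assoc[OF D fun_hom[OF F h(1)] fun_hom[OF F h(2)] eZ] Re[OF eZ]
    cat_assoc[OF D fun_hom[OF F h(1)] e[OF fun_obj[OF F VZ]] eZ] tri1[OF VZ] fun_id[OF F VZ] by simp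
 qed (use cat_id[OF C V[OF Z]] Z in auto)
 have "left_adjoint C D L R"
  unfolding left_adjoint_def using n1 n2 tri1 tri2 by(intro exI[of _ eta] exI[of _ eps]) auto
 hence "geometric_morphism D C \<lparr>direct = R, inverse_im = L\<rparr>"
  unfolding geometric_morphism_def using R F lex by simp
 thus ?thesis by(intro exI[of _ "\<lparr>direct = R, inverse_im = L\<rparr>"]) simp
qed

lemma inclusion_lexincl:
 assumes C: "cat C" and D: "cat D" and p: "geometric_inclusion D C p"
 shows "lexincl C D (inverse_im p)"
proof -
 define L R where "L = inverse_im p" and "R = direct p"
 have R: "is_functor D C R" and L: "is_functor C D L" and lex: "lx C D L"
  and adj: "left_adjoint C D L R" and ff: "fully_faithful D C R"
  using p unfolding geometric_inclusion_def geometric_morphism_def L_def R_def by auto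
 obtain eta eps where n1: "nat_trans C C id_func (R oo L) eta" and n2: "nat_trans D D (L oo R) id_func eps"
  and t1: "!!X. X : Obj C ==> Cmp D (eps (FObj L X)) (FArr L (eta X)) = Idn D (FObj L X)"
  and t2: "!!Y. Y : Obj D ==> Cmp C (FArr R (eps Y)) (eta (FObj R Y)) = Idn C (FObj R Y)"
  using adj unfolding left_adjoint_def by blast
 have eta: "eta X : hom C X (FObj R (FObj L X))" if "X : Obj C" for X
  using n1 that unfolding nat_trans_def by simp
 have eps: "eps X : hom D (FObj L (FObj R X)) X" if "X : Obj D" for X
  using n2 that unfolding nat_trans_def by simp
 have ne: "Cmp C (eta Y) f = Cmp C (FArr R (FArr L f)) (eta X)" if "f : hom C X Y" for f X Y
  using n1 homD[OF that] unfolding nat_trans_def by auto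
 have np: "Cmp D (eps Y) (FArr L (FArr R f)) = Cmp D f (eps X)" if "f : hom D X Y" for f X Y
  using n2 homD[OF that] unfolding nat_trans_def by auto
 have "ua C D L Z (FObj R Z) (eps Z) & is_iso D (eps Z)" if Z: "Z : Obj D" for Z
 proof
  note RZ = fun_obj[OF R Z] and eZ = eps[OF Z]
  have ex: "EX k. k : hom C Y (FObj R Z) & Cmp D (eps Z) (FArr L k) = g"
   if Y: "Y : Obj C" and g: "g : hom D (FObj L Y) Z" for Y g
  proof(intro exI conjI)
   note h = eta[OF Y] fun_hom[OF R g]
   show "Cmp C (FArr R g) (eta Y) : hom C Y (FObj R Z)" by(rule cat_comp[OF C h])
   show "Cmp D (eps Z) (FArr L (Cmp C (FArr R g) (eta Y))) = g"
    using fun_cmp[OF L h] cat_assoc[OF D fun_hom[OF L h(1)] fun_hom[OF L h(2)] eZ] np[OF g]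
     cat_assoc[OF D fun_hom[OF L h(1)] eps[OF fun_obj[OF L Y]] g] t1[OF Y] cat_idr[OF D g] by simp
  qed
  have bk: "k = Cmp C (FArr R (Cmp D (eps Z) (FArr L k))) (eta Y)" if k: "k : hom C Y (FObj R Z)" for k Y
  proof -
   note Y = cat_obj(1)[OF C k] and Lk = fun_hom[OF L k]
   have "Cmp C (FArr R (Cmp D (eps Z) (FArr L k))) (eta Y) = Cmp C (FArr R (eps Z)) (Cmp C (FArr R (FArr L k)) (eta Y))"
    using fun_cmp[OF R Lk eZ] cat_assoc[OF C eta[OF Y] fun_hom[OF R Lk] fun_hom[OF R eZ]] by simp
   also have "\<dots> = Cmp C (Cmp C (FArr R (eps Z)) (eta (FObj R Z))) k"
    using ne[OF k] cat_assoc[OF C k eta[OF RZ] fun_hom[OF R eZ]] by simp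
   also have "\<dots> = k" using t2[OF Z] cat_idl[OF C k] by simp
   finally show ?thesis by simp
  qed
  show "ua C D L Z (FObj R Z) (eps Z)"
   unfolding ua_def
  proof(intro conjI ballI RZ eZ)
   fix Y g assume "Y : Obj C" "g : hom D (FObj L Y) Z"
   from ex[OF this] obtain k where k: "k : hom C Y (FObj R Z)" "Cmp D (eps Z) (FArr L k) = g" by blast
   show "EX! k. k : hom C Y (FObj R Z) & Cmp D (eps Z) (FArr L k) = g"
    by(rule ex1I[of _ k]) (use k bk in metis)+
  qed
  have inj: "x = y" if "x : hom D X Y" "y : hom D X Y" "FArr R x = FArr R y" for x y X Y
   using ff that cat_obj[OF D that(1)] unfolding fully_faithful_def bij_betw_def inj_on_def by blast
  \<comment> \<open>Fullness of the direct image gives a preimage \<open>s\<close> of the unit at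
    \<open>R Z\<close>. Faithfulness and the triangle identities make it inverse to the
    counit.\<close>
  have "FArr R ` hom D Z (FObj L (FObj R Z)) = hom C (FObj R Z) (FObj R (FObj L (FObj R Z)))"
   using ff Z fun_obj[OF L RZ] unfolding fully_faithful_def bij_betw_def by blast
  then obtain s where s: "s : hom D Z (FObj L (FObj R Z))" "FArr R s = eta (FObj R Z)"
   using eta[OF RZ] by(metis imageE)
  have 1: "Cmp D (eps Z) s = Idn D Z"
   by(rule inj[of _ Z Z])
    (use cat_comp[OF D s(1) eZ] cat_id[OF D Z] fun_cmp[OF R s(1) eZ] s(2) t2[OF Z] fun_id[OF R Z] in auto)
  have 2: "Cmp D s (eps Z) = Idn D (FObj L (FObj R Z))" using np[OF s(1)] t1[OF RZ] s(2) by simp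
  show "is_iso D (eps Z)" using 1 2 s eZ is_iso_in[OF eZ] unfolding iso_in_def by blast
 qed
 thus ?thesis using L lex unfolding lexincl_def L_def by(intro conjI ballI) (assumption | rule exI)+
qed

subsection \<open>Equivalences\<close>

definition eqf :: "('o1, 'm1) category => ('o2, 'm2) category => ('o1, 'm1, 'o2, 'm2) func => bool" where
 "eqf C D F <-> is_functor C D F & fully_faithful C D F &
  (ALL Y:Obj D. EX X:Obj C. EX i i'. iso_in D i i' (FObj F X) Y)"

text \<open>Surjectivity on objects holds on the nose, as is the case for \<open>RTF\<close>; a
  section then satisfies equations instead of isomorphisms.\<close>

definition sqf :: "('o1, 'm1) category => ('o2, 'm2) category => ('o1, 'm1, 'o2, 'm2) func => bool" where
 "sqf C D F <-> is_functor C D F & fully_faithful C D F & (ALL Y:Obj D. EX X:Obj C. FObj F X = Y)"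

lemma eqfD:
 assumes "eqf C D F"
 shows "is_functor C D F" "fully_faithful C D F"
  "Y : Obj D ==> EX X:Obj C. EX i i'. iso_in D i i' (FObj F X) Y"
 using assms unfolding eqf_def by simp_all

lemma sqfD:
 assumes "sqf C D F"
 shows "is_functor C D F" "fully_faithful C D F" "Y : Obj D ==> EX X:Obj C. FObj F X = Y"
 using assms unfolding sqf_def by simp_all

lemma sqf_eqf: "cat D ==> sqf C D F ==> eqf C D F"
 unfolding eqf_def sqf_def using iso_in_id by metis

lemma ff_full:
 assumes "fully_faithful C D F" "X : Obj C" "Y : Obj C" "g : hom D (FObj F X) (FObj F Y)"
 obtains f where "f : hom C X Y" "FArr F f = g"
proof -
 have "FArr F ` hom C X Y = hom D (FObj F X) (FObj F Y)"
  using assms(1-3) unfolding fully_faithful_def bij_betw_def by simp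
 thus ?thesis using assms(4) that by(metis imageE)
qed

lemma ff_faithful:
 assumes "fully_faithful C D F" "cat C" "f : hom C X Y" "f' : hom C X Y" "FArr F f = FArr F f'"
 shows "f = f'"
proof -
 have "inj_on (FArr F) (hom C X Y)"
  using assms(1) cat_obj[OF assms(2,3)] unfolding fully_faithful_def bij_betw_def by simp
 from inj_onD[OF this assms(5,3,4)] show ?thesis .
qed

lemma eqf_terminal:
 assumes C: "cat C" and D: "cat D" and F: "eqf C D F" and T: "is_terminal C T"
 shows "is_terminal D (FObj F T)"
 unfolding is_terminal_def
proof(intro conjI ballI)
 note fu = eqfD(1)[OF F] and ff = eqfD(2)[OF F]
 have TO: "T : Obj C" using T unfolding is_terminal_def by simp
 thus "FObj F T : Obj D" by(rule fun_obj[OF fu])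
 fix Y assume "Y : Obj D"
 from eqfD(3)[OF F this] obtain X i i' where X: "X : Obj C" and i: "iso_in D i i' (FObj F X) Y" by blast
 note ii = i[unfolded iso_in_def]
 from T X obtain k where k: "k : hom C X T" and ku: "!!k'. k' : hom C X T ==> k' = k"
  unfolding is_terminal_def by blast
 have "Cmp D (FArr F k) i' : hom D Y (FObj F T)" using ii cat_comp[OF D _ fun_hom[OF fu k]] by blast
 moreover have "g = Cmp D (FArr F k) i'" if g: "g : hom D Y (FObj F T)" for g
 proof -
  have "Cmp D g i : hom D (FObj F X) (FObj F T)" using ii cat_comp[OF D _ g] by blast
  then obtain k' where "k' : hom C X T" "FArr F k' = Cmp D g i" using ff_full[OF ff X TO] by metis
  hence "FArr F k = Cmp D g i" using ku by simp
  moreover have "Cmp D (Cmp D g i) i' = Cmp D g (Cmp D i i')" using ii cat_assoc[OF D _ _ g] by metis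
  ultimately show ?thesis using ii cat_idr[OF D g] by simp
 qed
 ultimately show "EX! f. f : hom D Y (FObj F T)" by blast
qed

lemma pbD:
 assumes "is_pullback C f g p q"
 shows "p : hom C (Dom C p) (Dom C f)" "q : hom C (Dom C p) (Dom C g)"
  "f : hom C (Dom C f) (Cod C f)" "g : hom C (Dom C g) (Cod C f)" "Cmp C f p = Cmp C g q"
  "u : hom C Y (Dom C f) ==> v : hom C Y (Dom C g) ==> Cmp C f u = Cmp C g v ==>
   EX! h. h : hom C Y (Dom C p) & Cmp C p h = u & Cmp C q h = v"
proof -
 show "u : hom C Y (Dom C f) ==> v : hom C Y (Dom C g) ==> Cmp C f u = Cmp C g v ==>
   EX! h. h : hom C Y (Dom C p) & Cmp C p h = u & Cmp C q h = v"
 proof -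
  assume u: "u : hom C Y (Dom C f)" and v: "v : hom C Y (Dom C g)" and eq: "Cmp C f u = Cmp C g v"
  have "ALL u:Arr C. ALL v:Arr C.
    Cod C u = Dom C f & Cod C v = Dom C g & Dom C u = Dom C v & Cmp C f u = Cmp C g v -->
    (EX! h. h : hom C (Dom C u) (Dom C p) & Cmp C p h = u & Cmp C q h = v)"
   using assms unfolding is_pullback_def by(elim conjE)
  from bspec[OF bspec[OF this homD(1)[OF u]] homD(1)[OF v]] show ?thesis
   using homD(2,3)[OF u] homD(2,3)[OF v] eq by simp
 qed
qed (use assms in "simp_all add: is_pullback_def hom_def")

lemma pbI:
 assumes "p : hom C P A" "q : hom C P B" "f : hom C A Z" "g : hom C B Z" "Cmp C f p = Cmp C g q"
  "!!u v Y. u : hom C Y A ==> v : hom C Y B ==> Cmp C f u = Cmp C g v ==>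
   EX! h. h : hom C Y P & Cmp C p h = u & Cmp C q h = v"
 shows "is_pullback C f g p q"
proof -
 have "EX! h. h : hom C (Dom C u) (Dom C p) & Cmp C p h = u & Cmp C q h = v"
  if "u : Arr C" "v : Arr C" "Cod C u = Dom C f & Cod C v = Dom C g & Dom C u = Dom C v & Cmp C f u = Cmp C g v" for u v
  using assms(6)[of u "Dom C u" v] that assms(1-4) by(simp add: hom_def)
 thus ?thesis using assms(1-5) unfolding is_pullback_def by(simp add: hom_def)
qed

lemma eqf_pullback:
 assumes C: "cat C" and D: "cat D" and F: "eqf C D F" and P: "is_pullback C f g p q"
 shows "is_pullback D (FArr F f) (FArr F g) (FArr F p) (FArr F q)"
proof -
 note fu = eqfD(1)[OF F] and ff = eqfD(2)[OF F]
 note pb = pbD[OF P]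
 note h = fun_hom[OF fu pb(1)] fun_hom[OF fu pb(2)] fun_hom[OF fu pb(3)] fun_hom[OF fu pb(4)]
 show ?thesis
 proof(rule pbI[OF h])
  show "Cmp D (FArr F f) (FArr F p) = Cmp D (FArr F g) (FArr F q)"
   using fun_cmp[OF fu pb(1,3)] fun_cmp[OF fu pb(2,4)] pb(5) by simp
 next
  fix u v Y assume u: "u : hom D Y (FObj F (Dom C f))" and v: "v : hom D Y (FObj F (Dom C g))"
   and eq: "Cmp D (FArr F f) u = Cmp D (FArr F g) v"
  from eqfD(3)[OF F cat_obj(1)[OF D u]] obtain X i i' where X: "X : Obj C" and i: "iso_in D i i' (FObj F X) Y" by blast
  have ii: "i : hom D (FObj F X) Y" "i' : hom D Y (FObj F X)" "Cmp D i i' = Idn D Y" "Cmp D i' i = Idn D (FObj F X)"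
   using i unfolding iso_in_def by simp_all
  note o = cat_obj(1)[OF C pb(3)] cat_obj(1)[OF C pb(4)] cat_obj(1)[OF C pb(1)]
  obtain u0 where u0: "u0 : hom C X (Dom C f)" "FArr F u0 = Cmp D u i"
   by(rule ff_full[OF ff X o(1) cat_comp[OF D ii(1) u]]) 
  obtain v0 where v0: "v0 : hom C X (Dom C g)" "FArr F v0 = Cmp D v i"
   by(rule ff_full[OF ff X o(2) cat_comp[OF D ii(1) v]]) 
  have "Cmp C f u0 = Cmp C g v0"
   by(rule ff_faithful[OF ff C cat_comp[OF C u0(1) pb(3)] cat_comp[OF C v0(1) pb(4)]])
    (use fun_cmp[OF fu u0(1) pb(3)] fun_cmp[OF fu v0(1) pb(4)] u0(2) v0(2) eq
     cat_assoc[OF D ii(1) u h(3)] cat_assoc[OF D ii(1) v h(4)] in simp)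
  from pb(6)[OF u0(1) v0(1) this] obtain k where k: "k : hom C X (Dom C p)" "Cmp C p k = u0" "Cmp C q k = v0"
   and ku: "!!k'. k' : hom C X (Dom C p) ==> Cmp C p k' = u0 ==> Cmp C q k' = v0 ==> k' = k" by blast
  note Fk = fun_hom[OF fu k(1)]
  have cancel: "Cmp D (Cmp D x i) i' = x" if "x : hom D Y Z" for x Z
   using cat_assoc[OF D ii(2,1) that] ii(3) cat_idr[OF D that] by simp
  show "EX! h. h : hom D Y (FObj F (Dom C p)) & Cmp D (FArr F p) h = u & Cmp D (FArr F q) h = v"
  proof(rule ex1I[of _ "Cmp D (FArr F k) i'"])
   show "Cmp D (FArr F k) i' : hom D Y (FObj F (Dom C p)) &
     Cmp D (FArr F p) (Cmp D (FArr F k) i') = u & Cmp D (FArr F q) (Cmp D (FArr F k) i') = v"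
    using cat_comp[OF D ii(2) Fk] cat_assoc[OF D ii(2) Fk h(1)] cat_assoc[OF D ii(2) Fk h(2)]
     fun_cmp[OF fu k(1) pb(1)] fun_cmp[OF fu k(1) pb(2)] k(2,3) u0(2) v0(2) cancel[OF u] cancel[OF v] by simp
  next
   fix m assume m: "m : hom D Y (FObj F (Dom C p)) & Cmp D (FArr F p) m = u & Cmp D (FArr F q) m = v"
   hence mh: "m : hom D Y (FObj F (Dom C p))" by simp
   obtain k' where k': "k' : hom C X (Dom C p)" "FArr F k' = Cmp D m i"
    by(rule ff_full[OF ff X o(3) cat_comp[OF D ii(1) mh]])
   have "Cmp C p k' = u0"
    by(rule ff_faithful[OF ff C cat_comp[OF C k'(1) pb(1)] u0(1)])
     (use fun_cmp[OF fu k'(1) pb(1)] k'(2) m cat_assoc[OF D ii(1) mh h(1)] u0(2) in simp)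
   moreover have "Cmp C q k' = v0"
    by(rule ff_faithful[OF ff C cat_comp[OF C k'(1) pb(2)] v0(1)])
     (use fun_cmp[OF fu k'(1) pb(2)] k'(2) m cat_assoc[OF D ii(1) mh h(2)] v0(2) in simp)
   ultimately have "k' = k" using ku k'(1) by simp
   thus "m = Cmp D (FArr F k) i'" using k'(2) cancel[OF mh] by simp
  qed
 qed
qed

lemma eqf_lexincl:
 assumes C: "cat C" and D: "cat D" and F: "eqf C D F"
 shows "lexincl C D F"
 unfolding lexincl_def
proof(intro conjI ballI)
 note fu = eqfD(1)[OF F] and ff = eqfD(2)[OF F]
 show "is_functor C D F" by(rule fu)
 show "lx C D F"
  unfolding preserves_finite_limits_def using eqf_terminal[OF C D F] eqf_pullback[OF C D F] by simp
 fix Z assume "Z : Obj D"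
 from eqfD(3)[OF F this] obtain V i i' where V: "V : Obj C" and i: "iso_in D i i' (FObj F V) Z" by blast
 have ii: "i : hom D (FObj F V) Z" "i' : hom D Z (FObj F V)" "Cmp D i i' = Idn D Z" "Cmp D i' i = Idn D (FObj F V)"
  using i unfolding iso_in_def by simp_all
 have "EX! k. k : hom C Y V & Cmp D i (FArr F k) = g" if Y: "Y : Obj C" and g: "g : hom D (FObj F Y) Z" for Y g
 proof -
  obtain k where k: "k : hom C Y V" "FArr F k = Cmp D i' g" by(rule ff_full[OF ff Y V cat_comp[OF D g ii(2)]])
  show ?thesis
  proof(rule ex1I[of _ k])
   show "k : hom C Y V & Cmp D i (FArr F k) = g"
    using k cat_assoc[OF D g ii(2,1)] ii(3) cat_idl[OF D g] by simp
   fix k' assume k': "k' : hom C Y V & Cmp D i (FArr F k') = g"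
   hence "FArr F k' = Cmp D i' g"
    using cat_assoc[OF D fun_hom[OF fu conjunct1[OF k']] ii(1,2)] ii(4) cat_idl[OF D fun_hom[OF fu conjunct1[OF k']]] by simp
   thus "k' = k" by(intro ff_faithful[OF ff C conjunct1[OF k'] k(1)]) (simp add: k(2))
  qed
 qed
 hence "ua C D F Z V i" unfolding ua_def using V ii(1) by simp
 moreover have "is_iso D i" using is_iso_in[OF ii(1)] i by blast
 ultimately show "EX V eps. ua C D F Z V eps & is_iso D eps" by blast
qed

lemma sqf_section:
 assumes C: "cat C" and D: "cat D" and F: "sqf C D F"
 obtains G where "eqf D C G" "!!Y. Y : Obj D ==> FObj F (FObj G Y) = Y"
  "!!g X Y. g : hom D X Y ==> FArr F (FArr G g) = g"
proof -
 note fu = sqfD(1)[OF F] and ff = sqfD(2)[OF F]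
 have "ALL Y:Obj D. EX X. X : Obj C & FObj F X = Y" using sqfD(3)[OF F] by blast
 from bchoice[OF this] obtain s where s: "!!Y. Y : Obj D ==> s Y : Obj C" "!!Y. Y : Obj D ==> FObj F (s Y) = Y" by blast
 define a where "a g = (SOME f. f : hom C (s (Dom D g)) (s (Cod D g)) & FArr F f = g)" for g
 have a: "a g : hom C (s X) (s Y) & FArr F (a g) = g" if g: "g : hom D X Y" for g X Y
 proof -
  note o = cat_obj[OF D g]
  have "EX f. f : hom C (s X) (s Y) & FArr F f = g"
   by(rule ff_full[OF ff s(1)[OF o(1)] s(1)[OF o(2)], of g]) (use g s(2) o in auto)
  from someI_ex[OF this] show ?thesis unfolding a_def homD(2,3)[OF g] .
 qed
 define G where "G = \<lparr>FObj = s, FArr = a\<rparr>"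
 have [simp]: "FObj G = s" "FArr G = a" by(simp_all add: G_def)
 have G: "is_functor D C G"
 proof(rule is_functorI[OF D])
  fix X assume X: "X : Obj D"
  show "FArr G (Idn D X) = Idn C (FObj G X)"
   using ff_faithful[OF ff C conjunct1[OF a[OF cat_id[OF D X]]] cat_id[OF C s(1)[OF X]]]
    a[OF cat_id[OF D X]] fun_id[OF fu s(1)[OF X]] s(2)[OF X] by simp
 next
  fix f g X Y Z assume f: "f : hom D X Y" and g: "g : hom D Y Z"
  note af = conjunct1[OF a[OF f]] and ag = conjunct1[OF a[OF g]]
  show "FArr G (Cmp D g f) = Cmp C (FArr G g) (FArr G f)"
   using ff_faithful[OF ff C conjunct1[OF a[OF cat_comp[OF D f g]]] cat_comp[OF C af ag]]
    a[OF cat_comp[OF D f g]] fun_cmp[OF fu af ag] a[OF f] a[OF g] by simp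
 qed (use s(1) a in auto)
 have "fully_faithful D C G"
  unfolding fully_faithful_def
 proof(intro ballI bij_betw_imageI)
  fix X Y assume X: "X : Obj D" and Y: "Y : Obj D"
  show "inj_on (FArr G) (hom D X Y)" by(rule inj_on_inverseI[of _ "FArr F"]) (use a in auto)
  show "FArr G ` hom D X Y = hom C (FObj G X) (FObj G Y)"
  proof
   show "FArr G ` hom D X Y \<subseteq> hom C (FObj G X) (FObj G Y)" using a by auto
   show "hom C (FObj G X) (FObj G Y) \<subseteq> FArr G ` hom D X Y"
   proof
    fix f assume "f : hom C (FObj G X) (FObj G Y)"
    hence f: "f : hom C (s X) (s Y)" by simp
    have Ff: "FArr F f : hom D X Y" using fun_hom[OF fu f] s(2) X Y by simp
    have "f = a (FArr F f)" by(rule ff_faithful[OF ff C f]) (use a[OF Ff] in auto)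
    thus "f : FArr G ` hom D X Y" using Ff by auto
   qed
  qed
 qed
 moreover have "EX Y:Obj D. EX i i'. iso_in C i i' (FObj G Y) X" if X: "X : Obj C" for X
 proof -
  note FX = fun_obj[OF fu X] note sF = s(1)[OF FX] and sFF = s(2)[OF FX]
  have id: "Idn D (FObj F X) : hom D (FObj F (s (FObj F X))) (FObj F X)"
   "Idn D (FObj F X) : hom D (FObj F X) (FObj F (s (FObj F X)))" using sFF cat_id[OF D FX] by simp_all
  obtain i where i: "i : hom C (s (FObj F X)) X" "FArr F i = Idn D (FObj F X)" by(rule ff_full[OF ff sF X id(1)])
  obtain j where j: "j : hom C X (s (FObj F X))" "FArr F j = Idn D (FObj F X)" by(rule ff_full[OF ff X sF id(2)])
  have "Cmp C i j = Idn C X"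
   by(rule ff_faithful[OF ff C cat_comp[OF C j(1) i(1)] cat_id[OF C X]])
    (use fun_cmp[OF fu j(1) i(1)] i j cat_idl[OF D cat_id[OF D FX]] fun_id[OF fu X] in simp)
  moreover have "Cmp C j i = Idn C (s (FObj F X))"
   by(rule ff_faithful[OF ff C cat_comp[OF C i(1) j(1)] cat_id[OF C sF]])
    (use fun_cmp[OF fu i(1) j(1)] i j cat_idl[OF D cat_id[OF D FX]] fun_id[OF fu sF] sFF in simp)
  ultimately show ?thesis using FX i j unfolding iso_in_def by auto
 qed
 ultimately have "eqf D C G" unfolding eqf_def using G by simp
 thus ?thesis by(rule that) (use s a in auto)
qed

lemma isomorphic_reflect:
 assumes E: "cat E" and C: "cat C" and D: "cat D" and F: "is_functor E C F" and G: "is_functor E C G"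
  and H: "is_functor C D H" "fully_faithful C D H"
  and iso: "isof E D (H oo F) (H oo G)"
 shows "isof E C F G"
proof -
 obtain t where t: "nat_trans E D (H oo F) (H oo G) t" and ti: "!!X. X : Obj E ==> is_iso D (t X)"
  using iso unfolding isomorphic_functors_def by auto
 have th: "t X : hom D (FObj H (FObj F X)) (FObj H (FObj G X))" if "X : Obj E" for X
  using t that unfolding nat_trans_def by simp
 have tn: "Cmp D (t Y) (FArr H (FArr F f)) = Cmp D (FArr H (FArr G f)) (t X)" if "f : hom E X Y" for f X Y
  using t homD[OF that] unfolding nat_trans_def by auto
 have "ALL X:Obj E. EX s. s : hom C (FObj F X) (FObj G X) & FArr H s = t X"
 proof
  fix X assume X: "X : Obj E"
  show "EX s. s : hom C (FObj F X) (FObj G X) & FArr H s = t X"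
   by(rule ff_full[OF H(2) fun_obj[OF F X] fun_obj[OF G X] th[OF X]]) blast
 qed
 from bchoice[OF this] obtain s where s: "!!X. X : Obj E ==> s X : hom C (FObj F X) (FObj G X)"
  "!!X. X : Obj E ==> FArr H (s X) = t X" by blast
 have "nat_trans E C F G s"
  unfolding nat_trans_def
 proof(intro conjI ballI s(1))
  fix f assume f0: "f : Arr E"
  define X Y where "X = Dom E f" and "Y = Cod E f"
  have f: "f : hom E X Y" using f0 unfolding X_def Y_def by(rule hom_self)
  note o = cat_obj[OF E f]
  show "Cmp C (s (Cod E f)) (FArr F f) = Cmp C (FArr G f) (s (Dom E f))"
   unfolding X_def[symmetric] Y_def[symmetric]
   by(rule ff_faithful[OF H(2) C cat_comp[OF C fun_hom[OF F f] s(1)[OF o(2)]] cat_comp[OF C s(1)[OF o(1)] fun_hom[OF G f]]])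
    (use fun_cmp[OF H(1) fun_hom[OF F f] s(1)[OF o(2)]] fun_cmp[OF H(1) s(1)[OF o(1)] fun_hom[OF G f]] s(2) o tn[OF f] in simp)
 qed
 moreover have "is_iso C (s X)" if X: "X : Obj E" for X
 proof -
  note FX = fun_obj[OF F X] and GX = fun_obj[OF G X] and sX = s(1)[OF X]
  obtain t' where t': "iso_in D (t X) t' (FObj H (FObj F X)) (FObj H (FObj G X))" using ti[OF X] is_iso_in[OF th[OF X]] by blast
  hence "t' : hom D (FObj H (FObj G X)) (FObj H (FObj F X))" unfolding iso_in_def by simp
  then obtain s' where s': "s' : hom C (FObj G X) (FObj F X)" "FArr H s' = t'" by(rule ff_full[OF H(2) GX FX])
  have "Cmp C s' (s X) = Idn C (FObj F X)"
   by(rule ff_faithful[OF H(2) C cat_comp[OF C sX s'(1)] cat_id[OF C FX]])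
    (use fun_cmp[OF H(1) sX s'(1)] s'(2) s(2)[OF X] fun_id[OF H(1) FX] t' in "simp add: iso_in_def")
  moreover have "Cmp C (s X) s' = Idn C (FObj G X)"
   by(rule ff_faithful[OF H(2) C cat_comp[OF C s'(1) sX] cat_id[OF C GX]])
    (use fun_cmp[OF H(1) s'(1) sX] s'(2) s(2)[OF X] fun_id[OF H(1) GX] t' in "simp add: iso_in_def")
  ultimately have "iso_in C (s X) s' (FObj F X) (FObj G X)" using sX s'(1) unfolding iso_in_def by simp
  thus ?thesis using is_iso_in[OF sX] by blast
 qed
 ultimately show ?thesis unfolding isomorphic_functors_def by auto
qed

text \<open>It suffices to compare after the fully faithful \<open>Ph\<close>. There both sections
  cancel strictly, and what remains is the given isomorphism between \<open>G oo H\<close> and the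
  identity, precomposed with \<open>Ph\<close>.\<close>

lemma isomorphic_via:
 assumes cats: "cat C" "cat C'" "cat T" "cat T'"
  and Ph: "sqf C T Ph" and Ph': "sqf C' T' Ph'"
  and Ps: "eqf T C Ps" "!!Y. Y : Obj T ==> FObj Ph (FObj Ps Y) = Y" "!!g X Y. g : hom T X Y ==> FArr Ph (FArr Ps g) = g"
  and Ps': "eqf T' C' Ps'" "!!Y. Y : Obj T' ==> FObj Ph' (FObj Ps' Y) = Y" "!!g X Y. g : hom T' X Y ==> FArr Ph' (FArr Ps' g) = g"
  and G: "is_functor T' T G" and H: "is_functor T T' H"
  and iso: "isof T T (G oo H) id_func"
 shows "isof C C ((Ps oo (G oo Ph')) oo (Ps' oo (H oo Ph))) id_func"
proof(rule isomorphic_reflect[OF cats(1,1,3) _ _ sqfD(1,2)[OF Ph]])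
 note p = sqfD(1)[OF Ph] and p' = sqfD(1)[OF Ph'] and s = eqfD(1)[OF Ps(1)] and s' = eqfD(1)[OF Ps'(1)]
 show "is_functor C C ((Ps oo (G oo Ph')) oo (Ps' oo (H oo Ph)))"
  by(rule comp_functor[OF cats(1) comp_functor[OF cats(1) comp_functor[OF cats(1) p H] s']
    comp_functor[OF cats(2) comp_functor[OF cats(2) p' G] s]])
 show "is_functor C C id_func" by(simp add: is_functor_def hom_def)
 obtain t where t: "nat_trans T T (G oo H) id_func t" and ti: "!!X. X : Obj T ==> is_iso T (t X)"
  using iso unfolding isomorphic_functors_def by auto
 have e1: "FObj Ph (FObj Ps (FObj G (FObj Ph' (FObj Ps' (FObj H (FObj Ph X)))))) = FObj G (FObj H (FObj Ph X))"
  if X: "X : Obj C" for X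
  using Ps(2) Ps'(2) fun_obj[OF H fun_obj[OF p X]] fun_obj[OF G fun_obj[OF H fun_obj[OF p X]]] by simp
 have e2: "FArr Ph (FArr Ps (FArr G (FArr Ph' (FArr Ps' (FArr H (FArr Ph f)))))) = FArr G (FArr H (FArr Ph f))"
  if f: "f : hom C X Y" for f X Y
  using Ps(3)[OF fun_hom[OF G fun_hom[OF H fun_hom[OF p f]]]] Ps'(3)[OF fun_hom[OF H fun_hom[OF p f]]] by simp
 have "nat_trans C T (Ph oo ((Ps oo (G oo Ph')) oo (Ps' oo (H oo Ph))))
   (Ph oo id_func) (%X. t (FObj Ph X))"
  unfolding nat_trans_def
 proof(intro conjI ballI)
  fix X assume X: "X : Obj C"
  have "t (FObj Ph X) : hom T (FObj G (FObj H (FObj Ph X))) (FObj Ph X)"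
   using t fun_obj[OF p X] unfolding nat_trans_def by simp
  thus "t (FObj Ph X) : hom T (FObj (Ph oo ((Ps oo (G oo Ph')) oo (Ps' oo (H oo Ph)))) X)
    (FObj (Ph oo id_func) X)" using e1[OF X] by simp
 next
  fix f assume "f : Arr C"
  note f = hom_self[OF this] note Pf = fun_hom[OF p f]
  have "Cmp T (t (FObj Ph (Cod C f))) (FArr G (FArr H (FArr Ph f))) = Cmp T (FArr Ph f) (t (FObj Ph (Dom C f)))"
   using t homD[OF Pf] unfolding nat_trans_def by auto
  thus "Cmp T (t (FObj Ph (Cod C f))) (FArr (Ph oo ((Ps oo (G oo Ph')) oo (Ps' oo (H oo Ph)))) f) =
    Cmp T (FArr (Ph oo id_func) f) (t (FObj Ph (Dom C f)))" using e2[OF f] by simp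
 qed
 thus "isof C T (Ph oo ((Ps oo (G oo Ph')) oo (Ps' oo (H oo Ph))))
   (Ph oo id_func)"
  unfolding isomorphic_functors_def using ti fun_obj[OF p] by(intro exI[of _ "%X. t (FObj Ph X)"]) simp
qed

text \<open>The inverse image runs from \<open>T\<close> to \<open>C\<close> along a section, then
  to \<open>C'\<close>, then to \<open>T'\<close>; equivalences count as inverse images of
  inclusions.\<close>

lemma subtopos_transport:
 assumes cats: "cat C" "cat C'" "cat T" "cat T'" and Ph: "sqf C T Ph" and Ph': "sqf C' T' Ph'"
  and sub: "subtopos C' C"
 shows "EX L. lexincl T T' L"
proof -
 obtain p where "geometric_inclusion C' C p" using sub unfolding subtopos_def by blast
 note 1 = inclusion_lexincl[OF cats(1,2) this]
 obtain Ps where "eqf T C Ps" by(rule sqf_section[OF cats(1,3) Ph])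
 note 2 = eqf_lexincl[OF cats(3,1) this]
 note 3 = eqf_lexincl[OF cats(2,4) sqf_eqf[OF cats(4) Ph']]
 show ?thesis by(rule exI, rule lexincl_comp[OF cats(3,2,4) lexincl_comp[OF cats(3,1,2) 2 1] 3])
qed

lemma retract_transport:
 assumes cats: "cat C" "cat C'" "cat T" "cat T'" and Ph: "sqf C T Ph" and Ph': "sqf C' T' Ph'"
  and G: "lexadj T' T G" and H: "lexadj T T' H" and iso: "isof T T (G oo H) id_func"
 shows "retract_of_topos C C'"
proof -
 obtain Ps where Ps: "eqf T C Ps" "!!Y. Y : Obj T ==> FObj Ph (FObj Ps Y) = Y" "!!g X Y. g : hom T X Y ==> FArr Ph (FArr Ps g) = g"
  by(rule sqf_section[OF cats(1,3) Ph]) (rule that, simp_all)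
 obtain Ps' where Ps': "eqf T' C' Ps'" "!!Y. Y : Obj T' ==> FObj Ph' (FObj Ps' Y) = Y" "!!g X Y. g : hom T' X Y ==> FArr Ph' (FArr Ps' g) = g"
  by(rule sqf_section[OF cats(2,4) Ph']) (rule that, simp_all)
 note la = lexincl_lexadj[OF eqf_lexincl]
 have "lexadj C' C (Ps oo (G oo Ph'))"
  by(rule lexadj_comp[OF cats(2,3,1) lexadj_comp[OF cats(2,4,3) la[OF cats(2,4) sqf_eqf[OF cats(4) Ph']] G] la[OF cats(3,1) Ps(1)]])
 from lexadj_geometric[OF cats(2,1) this] obtain i where
  i: "geometric_morphism C C' i" "inverse_im i = comp_func Ps (G oo Ph')" by blast
 have "lexadj C C' (Ps' oo (H oo Ph))"
  by(rule lexadj_comp[OF cats(1,4,2) lexadj_comp[OF cats(1,3,4) la[OF cats(1,3) sqf_eqf[OF cats(3) Ph]] H] la[OF cats(4,2) Ps'(1)]])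
 from lexadj_geometric[OF cats(1,2) this] obtain r where
  r: "geometric_morphism C' C r" "inverse_im r = comp_func Ps' (H oo Ph)" by blast
 have "isomorphic_geom C C (comp_geom r i) id_geom"
  unfolding isomorphic_geom_def comp_geom_def id_geom_def using i(2) r(2)
   isomorphic_via[OF cats Ph Ph' Ps Ps' lexadjD(1)[OF G] lexadjD(1)[OF H] iso] by simp
 thus ?thesis unfolding retract_of_topos_def using i(1) r(1) by(intro exI[of _ i] exI[of _ r]) simp
qed

lemma equivalence_transport:
 assumes cats: "cat C" "cat C'" "cat T" "cat T'" and Ph: "sqf C T Ph" and Ph': "sqf C' T' Ph'"
  and G: "is_functor T' T G" and H: "is_functor T T' H"
  and iso: "isof T T (G oo H) id_func" "isof T' T' (H oo G) id_func"
 shows "equivalent_categories C C'"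
proof -
 obtain Ps where Ps: "eqf T C Ps" "!!Y. Y : Obj T ==> FObj Ph (FObj Ps Y) = Y" "!!g X Y. g : hom T X Y ==> FArr Ph (FArr Ps g) = g"
  by(rule sqf_section[OF cats(1,3) Ph]) (rule that, simp_all)
 obtain Ps' where Ps': "eqf T' C' Ps'" "!!Y. Y : Obj T' ==> FObj Ph' (FObj Ps' Y) = Y" "!!g X Y. g : hom T' X Y ==> FArr Ph' (FArr Ps' g) = g"
  by(rule sqf_section[OF cats(2,4) Ph']) (rule that, simp_all)
 note p = sqfD(1)[OF Ph] and p' = sqfD(1)[OF Ph'] and s = eqfD(1)[OF Ps(1)] and s' = eqfD(1)[OF Ps'(1)]
 show ?thesis unfolding equivalent_categories_def
 proof(intro exI conjI)
  show "isof C C ((Ps oo (G oo Ph')) oo (Ps' oo (H oo Ph))) id_func"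
   by(rule isomorphic_via[OF cats Ph Ph' Ps Ps' G H iso(1)])
  show "isof C' C' ((Ps' oo (H oo Ph)) oo (Ps oo (G oo Ph'))) id_func"
   by(rule isomorphic_via[OF cats(2,1,4,3) Ph' Ph Ps' Ps H G iso(2)])
  show "is_functor C C' (Ps' oo (H oo Ph))"
   by(rule comp_functor[OF cats(1) comp_functor[OF cats(1) p H] s'])
  show "is_functor C' C (Ps oo (G oo Ph'))"
   by(rule comp_functor[OF cats(2) comp_functor[OF cats(2) p' G] s])
 qed
qed

section \<open>The topos of a tripos and its finite limits\<close>

section \<open>The category of partial equivalence relations over a tripos\<close>

type_synonym ('u, 'a) tob = "'u set * ('u => 'u => 'a set)"
type_synonym ('u, 'a) tarr = "('u, 'a) tob \<times> ('u => 'u => 'a set) * ('u, 'a) tob"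

text \<open>Objects of the tripos-to-topos construction. The clauses on \<open>fst P\<close> make
  the carrier exactly the set of elements with inhabited existence predicate
  \<open>snd P x x\<close>.\<close>

definition tobj :: "'a pas => ('u, 'a) tob => bool" where
 "tobj A P <-> small TYPE('u) (fst P) & (ALL x y. snd P x y ~= {} --> x : fst P & y : fst P) &
  (ALL x:fst P. snd P x x ~= {}) & ent2 A (snd P) (%x y. snd P y x) &
  ent3 A (%x y z. cj A (snd P x y) (snd P y z)) (%x y z. snd P x z)"

definition frel :: "'a pas => ('u, 'a) tob => ('u, 'a) tob => ('u => 'u => 'a set) => bool" where
 "frel A P Q F <-> ent2 A F (%x y. cj A (snd P x x) (snd Q y y)) &
  ent3 A (%x x' y. cj A (F x y) (snd P x x')) (%x x' y. F x' y) &
  ent3 A (%x y y'. cj A (F x y) (snd Q y y')) (%x y y'. F x y') &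
  ent3 A (%x y y'. cj A (F x y) (F x y')) (%x y y'. snd Q y y') &
  ent A (%x. snd P x x) (%x. \<Union>y. F x y)"

lemma tobjD:
 assumes "tobj A (P :: ('u, 'a) tob)"
 shows "small TYPE('u) (fst P)" "snd P x y ~= {} ==> x : fst P" "snd P x y ~= {} ==> y : fst P"
  "x : fst P ==> snd P x x ~= {}"
 using assms unfolding tobj_def by simp_all

lemma tobj_sym:
 "pca A ==> tobj A P ==> fc2 A W e (snd P) x y ==> fc2 A W e (snd P) y x"
 by(rule ent2D[where ph = "snd P"]) (simp_all add: tobj_def)

lemma tobj_trans:
 "pca A ==> tobj A P ==> fc2 A W e (snd P) x y ==> fc2 A W e (snd P) y z ==>
  fc2 A W e (snd P) x z"
 by(rule ent3D[where ph = "%x y z. cj A (snd P x y) (snd P y z)" and y = y]) (simp_all add: tobj_def fc_cj)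

lemma tobj_refl1:
 "pca A ==> tobj A P ==> fc2 A W e (snd P) x y ==> fc2 A W e (snd P) x x"
 by(rule tobj_trans[where y = y]) (auto intro: tobj_sym)

lemma tobj_refl2:
 "pca A ==> tobj A P ==> fc2 A W e (snd P) x y ==> fc2 A W e (snd P) y y"
 by(rule tobj_trans[where y = x]) (auto intro: tobj_sym)

lemma tobjI:
 fixes P :: "('u, 'a) tob"
 assumes "pca A" "small TYPE('u) (fst P)" "!!x y. snd P x y ~= {} ==> x : fst P & y : fst P"
  "!!x. x : fst P ==> snd P x x ~= {}"
  "!!(W :: ('u, 'a) st2) e x y. fc2 A W e (snd P) x y ==> fc2 A W e (snd P) y x"
  "!!(W :: ('u, 'a) st3) e x y z. fc2 A W e (snd P) x y ==> fc2 A W e (snd P) y z ==>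
   fc2 A W e (snd P) x z"
 shows "tobj A P"
 unfolding tobj_def
proof(intro conjI)
 show "ent2 A (snd P) (%x y. snd P y x)" by(rule ent2I[OF assms(1,5)])
 show "ent3 A (%x y z. cj A (snd P x y) (snd P y z)) (%x y z. snd P x z)"
  by(rule ent3I[OF assms(1)]) (simp add: fc_cj[OF assms(1)], erule conjE, rule assms(6))
qed (use assms(2-4) in auto)

lemma frelD:
 assumes A: "pca A" and F: "frel A P Q F" and f: "fc2 A W e F x y"
 shows "fc2 A W e (snd P) x x" "fc2 A W e (snd Q) y y"
  "fc2 A W e (snd P) x x' ==> fc2 A W e F x' y"
  "fc2 A W e (snd Q) y y' ==> fc2 A W e F x y'"
  "fc2 A W e F x y' ==> fc2 A W e (snd Q) y y'"
proof -
 note F' = F[unfolded frel_def]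
 have "fc A W e (%w. cj A (snd P (x w) (x w)) (snd Q (y w) (y w)))"
  by(rule ent2D[OF A conjunct1[OF F'] f])
 thus "fc2 A W e (snd P) x x" "fc2 A W e (snd Q) y y" by(simp_all add: fc_cj[OF A])
 show "fc2 A W e F x' y" if "fc2 A W e (snd P) x x'"
  by(rule ent3D[OF A, where ph = "%x x' y. cj A (F x y) (snd P x x')" and x = x and ps = "%x x' y. F x' y"])
   (use F' f that in "simp_all add: fc_cj[OF A]")
 show "fc2 A W e F x y'" if "fc2 A W e (snd Q) y y'"
  by(rule ent3D[OF A, where ph = "%x y y'. cj A (F x y) (snd Q y y')" and y = y])
   (use F' f that in "simp_all add: fc_cj[OF A]")
 show "fc2 A W e (snd Q) y y'" if "fc2 A W e F x y'"
  by(rule ent3D[OF A, where ph = "%x y y'. cj A (F x y) (F x y')" and x = x and ps = "%x y y'. snd Q y y'"])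
   (use F' f that in "simp_all add: fc_cj[OF A]")
qed

lemma frel_total:
 assumes A: "pca A" and F: "frel A P Q F" and f: "fc2 A W e (snd P) x x"
 obtains y where "fc2 A W e F x y"
 using entD[OF A, where ph = "%x. snd P x x" and ps = "%x. \<Union>y. F x y", of W e x] F f
 unfolding frel_def fc_UN by blast

lemma frelI:
 fixes F :: "'u => 'u => 'a set"
 assumes A: "pca A"
  and s: "!!(W :: ('u, 'a) st2) e x y. fc2 A W e F x y ==>
   fc2 A W e (snd P) x x & fc2 A W e (snd Q) y y"
  and l: "!!(W :: ('u, 'a) st3) e x x' y. fc2 A W e F x y ==> fc2 A W e (snd P) x x' ==>
   fc2 A W e F x' y"
  and r: "!!(W :: ('u, 'a) st3) e x y y'. fc2 A W e F x y ==> fc2 A W e (snd Q) y y' ==>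
   fc2 A W e F x y'"
  and u: "!!(W :: ('u, 'a) st3) e x y y'. fc2 A W e F x y ==> fc2 A W e F x y' ==>
   fc2 A W e (snd Q) y y'"
  and t: "!!(W :: ('u, 'a) st1) e x. fc2 A W e (snd P) x x ==> EX y. fc2 A W e F x y"
 shows "frel A P Q F"
 unfolding frel_def
proof(intro conjI)
 show "ent2 A F (%x y. cj A (snd P x x) (snd Q y y))"
  by(rule ent2I[OF A]) (simp add: fc_cj[OF A] s)
 show "ent3 A (%x x' y. cj A (F x y) (snd P x x')) (%x x' y. F x' y)"
  by(rule ent3I[OF A]) (simp add: fc_cj[OF A], erule conjE, rule l)
 show "ent3 A (%x y y'. cj A (F x y) (snd Q y y')) (%x y y'. F x y')"
  by(rule ent3I[OF A]) (simp add: fc_cj[OF A], erule conjE, rule r)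
 show "ent3 A (%x y y'. cj A (F x y) (F x y')) (%x y y'. snd Q y y')"
  by(rule ent3I[OF A]) (simp add: fc_cj[OF A], erule conjE, rule u)
 show "ent A (%x. snd P x x) (%x. \<Union>y. F x y)"
  by(rule entI[OF A]) (simp add: fc_UN t)
qed

definition rc :: "'a pas => ('u => 'v => 'a set) => ('v => 'x => 'a set) => 'u => 'x => 'a set" where
 "rc A F G x z = (\<Union>y. cj A (F x y) (G y z))"

lemma fc_rc: "pca A ==> fc2 A W e (rc A F G) x z <->
  (EX y. fc2 A W e F x y & fc2 A W e G y z)"
 unfolding rc_def fc_UN by(simp add: fc_cj)

definition eqr :: "'a pas => ('u => 'u => 'a set) => ('u => 'u => 'a set) => bool" where
 "eqr A F G <-> ent2 A F G & ent2 A G F"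

text \<open>An arrow is a class of equivalent functional relations. A chosen representative stands
  for the class, so that equality of arrows is equality of predicates.\<close>

definition nf :: "'a pas => ('u => 'u => 'a set) => 'u => 'u => 'a set" where
 "nf A F = (SOME F'. eqr A F F')"

definition mk :: "'a pas => ('u, 'a) tob => ('u => 'u => 'a set) => ('u, 'a) tob => ('u, 'a) tarr" where
 "mk A P F Q = (P, nf A F, Q)"

definition TT :: "'a pas => ('u, 'a) tcat" where
 "TT A = \<lparr>Obj = {P. tobj A P},
  Arr = {(P, F, Q). tobj A P & tobj A Q & frel A P Q F & nf A F = F},
  Dom = (%(P, F, Q). P), Cod = (%(P, F, Q). Q),
  Idn = (%P. mk A P (snd P) P),
  Cmp = (%(_, G, R) (P, F, _). mk A P (rc A F G) R)\<rparr>"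

lemma ent2_refl: "pca A ==> ent2 A F F"
 by(rule ent2I)

lemma ent2_trans: "pca A ==> ent2 A F G ==> ent2 A G H ==> ent2 A F H"
 by(rule ent2I) (auto intro: ent2D)

lemma eqr_sym: "eqr A F G ==> eqr A G F"
 unfolding eqr_def by simp

lemma eqr_trans: "pca A ==> eqr A F G ==> eqr A G H ==> eqr A F H"
 unfolding eqr_def using ent2_trans[of A F G H] ent2_trans[of A H G F] by simp

lemma nf_eqr: "pca A ==> eqr A F (nf A F)"
 unfolding nf_def by(rule someI[of _ F]) (simp add: eqr_def ent2_refl)

lemma nf_eq: assumes A: "pca A" shows "nf A F = nf A G <-> eqr A F G"
proof
 assume "nf A F = nf A G"
 thus "eqr A F G" using nf_eqr[OF A, of F] eqr_sym[OF nf_eqr[OF A, of G]] eqr_trans[OF A] by simp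
next
 assume "eqr A F G"
 hence "eqr A F = eqr A G" using eqr_trans[OF A] eqr_sym[of A F G] by(intro ext) blast
 thus "nf A F = nf A G" unfolding nf_def by simp
qed

lemma nf_nf: "pca A ==> nf A (nf A F) = nf A F"
 by(simp add: nf_eq eqr_sym[OF nf_eqr])

lemma fc_eqr: "pca A ==> eqr A F G ==> fc2 A W e F x y <-> fc2 A W e G x y"
 unfolding eqr_def using ent2D by blast

lemma fc_nf: "pca A ==> fc2 A W e (nf A F) x y <-> fc2 A W e F x y"
 using fc_eqr[OF _ nf_eqr] by blast

lemma eqrI:
 fixes F :: "'u => 'u => 'a set"
 assumes "pca A" "!!(W :: ('u, 'a) st2) e x y. fc2 A W e F x y <-> fc2 A W e G x y"
 shows "eqr A F G"
 unfolding eqr_def by(intro conjI; rule ent2I[OF assms(1)]) (simp_all add: assms(2))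

lemma mk_eq: "pca A ==> mk A P F Q = mk A P G Q <-> eqr A F G"
 unfolding mk_def by(simp add: nf_eq)

lemma frel_eqr:
 assumes A: "pca A" and e: "eqr A F G" and F: "frel A P Q F"
 shows "frel A P Q G"
 by(rule frelI[OF A]; (unfold fc_eqr[OF A e, symmetric])?)
  (auto intro: frelD[OF A F] elim: frel_total[OF A F])

lemma frel_nf: "pca A ==> frel A P Q (nf A F) <-> frel A P Q F"
 using frel_eqr[OF _ nf_eqr] frel_eqr[OF _ eqr_sym[OF nf_eqr]] by blast

text \<open>Totality of \<open>F\<close> supplies a value, and single-valuedness of \<open>G\<close>
  identifies it with the given one. So a single inclusion suffices for equality of arrows.\<close>

lemma frel_le:
 assumes A: "pca A" and F: "frel A P Q F" and G: "frel A P Q G" and le: "ent2 A F G"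
 shows "eqr A F G"
proof -
 have "ent2 A G F"
 proof(rule ent2I[OF A])
  fix W :: "('b * 'b * 'a) set" and e x y assume g: "fc2 A W e G x y"
  obtain y' where f: "fc2 A W e F x y'" by(rule frel_total[OF A F frelD(1)[OF A G g]])
  from frelD(5)[OF A G ent2D[OF A le f] g] show "fc2 A W e F x y" by(rule frelD(4)[OF A F f])
 qed
 thus ?thesis using le unfolding eqr_def by simp
qed

lemma frel_id: "pca A ==> tobj A P ==> frel A P P (snd P)"
 by(rule frelI) (auto intro: tobj_refl1 tobj_refl2 tobj_trans tobj_sym)

lemma frel_rc:
 assumes A: "pca A" and F: "frel A P Q F" and G: "frel A Q R G"
 shows "frel A P R (rc A F G)"
proof(rule frelI[OF A]; unfold fc_rc[OF A])
 fix W :: "('b * 'a) set" and e x assume "fc2 A W e (snd P) x x"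
 then obtain y where y: "fc2 A W e F x y" by(rule frel_total[OF A F])
 obtain z where "fc2 A W e G y z" by(rule frel_total[OF A G frelD(2)[OF A F y]])
 thus "EX z y. fc2 A W e F x y & fc2 A W e G y z" using y by blast
next
 fix W :: "('b * 'b * 'b * 'a) set" and e x z z'
 assume "EX y. fc2 A W e F x y & fc2 A W e G y z"
  "EX y. fc2 A W e F x y & fc2 A W e G y z'"
 then obtain y y' where y: "fc2 A W e F x y" "fc2 A W e G y z"
  "fc2 A W e F x y'" "fc2 A W e G y' z'" by blast
 show "fc2 A W e (snd R) z z'"
  by(rule frelD(5)[OF A G frelD(3)[OF A G y(2) frelD(5)[OF A F y(1,3)]] y(4)])
qed (blast intro: frelD(3)[OF A F] frelD(4)[OF A G] dest: frelD(1)[OF A F] frelD(2)[OF A G])+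

lemma TT_simps [simp]:
 "P : Obj (TT A) <-> tobj A P" "Dom (TT A) (mk A P F Q) = P" "Cod (TT A) (mk A P F Q) = Q"
 "Idn (TT A) P = mk A P (snd P) P"
 by(simp_all add: TT_def mk_def)

lemma TT_hom:
 assumes A: "pca A"
 shows "f : hom (TT A) P Q <-> tobj A P & tobj A Q & (EX F. frel A P Q F & f = mk A P F Q)"
proof
 assume f: "f : hom (TT A) P Q"
 obtain P' F Q' where "f = (P', F, Q')" by(metis prod_cases3)
 thus "tobj A P & tobj A Q & (EX F. frel A P Q F & f = mk A P F Q)"
  using f by(auto simp: hom_def TT_def mk_def intro!: exI[of _ F])
next
 assume "tobj A P & tobj A Q & (EX F. frel A P Q F & f = mk A P F Q)"
 thus "f : hom (TT A) P Q"
  by(auto simp: hom_def TT_def mk_def frel_nf[OF A] nf_nf[OF A])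
qed

lemma mk_hom: "pca A ==> tobj A P ==> tobj A Q ==> frel A P Q F ==> mk A P F Q : hom (TT A) P Q"
 by(auto simp: TT_hom)

lemma TT_homE:
 assumes "pca A" "f : hom (TT A) P Q"
 obtains F where "frel A P Q F" "f = mk A P F Q" "tobj A P" "tobj A Q"
 using assms unfolding TT_hom[OF assms(1)] by blast

lemma TT_cmp: "pca A ==> Cmp (TT A) (mk A Q G R) (mk A P F Q') = mk A P (rc A F G) R"
proof -
 assume A: "pca A"
 have "eqr A (rc A (nf A F) (nf A G)) (rc A F G)" by(rule eqrI[OF A]) (simp add: fc_rc[OF A] fc_nf[OF A])
 thus ?thesis unfolding TT_def by(simp add: mk_def nf_eq[OF A])
qed

lemma TT_cat: assumes A: "pca A" shows "cat (TT A)"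
 unfolding cat_def
proof(intro conjI allI ballI impI)
 fix f assume "f : Arr (TT A)"
 thus "Dom (TT A) f : Obj (TT A)" "Cod (TT A) f : Obj (TT A)" by(auto simp: TT_def)
next
 fix P assume "P : Obj (TT A)"
 thus "Idn (TT A) P : hom (TT A) P P" by(simp add: mk_hom A frel_id)
next
 fix X Y Z f g assume "f : hom (TT A) X Y" "g : hom (TT A) Y Z"
 thus "Cmp (TT A) g f : hom (TT A) X Z"
  by(elim TT_homE[OF A]) (simp add: TT_cmp[OF A] mk_hom[OF A] frel_rc[OF A])
next
 fix X Y f assume "f : hom (TT A) X Y"
 then obtain F where F: "frel A X Y F" "f = mk A X F Y" "tobj A X" "tobj A Y" by(rule TT_homE[OF A])
 have "eqr A (rc A (snd X) F) F"
  by(rule eqrI[OF A], unfold fc_rc[OF A])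
   (blast intro: frelD(3)[OF A F(1)] tobj_sym[OF A F(3)] dest: frelD(1)[OF A F(1)])
 thus "Cmp (TT A) f (Idn (TT A) X) = f" by(simp add: F(2) TT_cmp[OF A] mk_eq[OF A])
 have "eqr A (rc A F (snd Y)) F"
  by(rule eqrI[OF A], unfold fc_rc[OF A])
   (blast intro: frelD(4)[OF A F(1)] tobj_sym[OF A F(4)] dest: frelD(2)[OF A F(1)])
 thus "Cmp (TT A) (Idn (TT A) Y) f = f" by(simp add: F(2) TT_cmp[OF A] mk_eq[OF A])
next
 fix X Y Z W f g h assume "f : hom (TT A) X Y" "g : hom (TT A) Y Z" "h : hom (TT A) Z W"
 thus "Cmp (TT A) h (Cmp (TT A) g f) = Cmp (TT A) (Cmp (TT A) h g) f"
 proof(elim TT_homE[OF A], goal_cases)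
  case (1 F G H)
  have "eqr A (rc A (rc A F G) H) (rc A F (rc A G H))"
   by(rule eqrI[OF A], unfold fc_rc[OF A]) blast
  thus ?case by(simp add: 1 TT_cmp[OF A] mk_eq[OF A])
 qed
qed

text \<open>A bijection rather than an injection: every element of the universe is then a pair, and
  sets of pairs can be given by conditions on \<open>ufst\<close> and \<open>usnd\<close>.\<close>

definition upair :: "'u => 'u => 'u" where "upair x y = (SOME f :: 'u * 'u => 'u. bij f) (x, y)"
definition ufst :: "'u => 'u" where "ufst a = fst (inv (SOME f :: 'u * 'u => 'u. bij f) a)"
definition usnd :: "'u => 'u" where "usnd a = snd (inv (SOME f :: 'u * 'u => 'u. bij f) a)"

lemma ex_pair_bij:
 assumes U: "set_universe TYPE('u)"
 shows "EX f :: 'u * 'u => 'u. bij f"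
proof -
 obtain f :: "'u * 'u => 'u" where f: "inj f" using ex_pair_encoding[OF U] by blast
 have "inj (%x :: 'u. (x, x))" by(simp add: inj_on_def)
 from Schroeder_Bernstein[OF f subset_UNIV this subset_UNIV] show ?thesis .
qed

lemma ups:
 fixes x y a :: 'u
 assumes U: "set_universe TYPE('u)"
 shows "ufst (upair x y) = x" "usnd (upair x y) = y" "upair (ufst a) (usnd a) = a"
proof -
 have b: "bij (SOME f :: 'u * 'u => 'u. bij f)" by(rule someI_ex[OF ex_pair_bij[OF U]])
 show "ufst (upair x y) = x" "usnd (upair x y) = y" "upair (ufst a) (usnd a) = a"
  using b by(simp_all add: upair_def ufst_def usnd_def bij_is_inj surj_f_inv_f bij_is_surj)
qed

lemma small_upair:
 fixes X Y S :: "'u set"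
 assumes U: "set_universe TYPE('u)" and X: "small TYPE('u) X" and Y: "small TYPE('u) Y"
  and S: "!!a. a : S ==> ufst a : X & usnd a : Y"
 shows "small TYPE('u) S"
proof(rule small_subset)
 show "small TYPE('u) ((%(x, y). upair x y) ` (X \<times> Y))" by(intro small_image small_Times[OF U] X Y)
 show "S \<subseteq> (%(x, y). upair x y) ` (X \<times> Y)"
 proof
  fix a assume "a : S"
  thus "a : (%(x, y). upair x y) ` (X \<times> Y)"
   using S[of a] by(intro image_eqI[of _ _ "(ufst a, usnd a)"]) (auto simp: ups[OF U])
 qed
qed

definition conv :: "('u => 'v => 'a set) => 'v => 'u => 'a set" where "conv F y x = F x y"

lemma fc_conv [simp]: "fc2 A W e (conv F) x y <-> fc2 A W e F y x"
 by(simp add: conv_def)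

lemma mk_iso:
 assumes A: "pca A" and P: "tobj A P" and Q: "tobj A Q" and F: "frel A P Q F" and G: "frel A Q P (conv F)"
 shows "iso_in (TT A) (mk A P F Q) (mk A Q (conv F) P) P Q"
proof -
 have "eqr A (rc A F (conv F)) (snd P)"
 proof(rule frel_le[OF A frel_rc[OF A F G] frel_id[OF A P]], rule ent2I[OF A])
  fix W :: "('b * 'b * 'a) set" and e x y assume "fc2 A W e (rc A F (conv F)) x y"
  thus "fc2 A W e (snd P) x y"
   using frelD(5)[OF A G, unfolded fc_conv] unfolding fc_rc[OF A] fc_conv by blast
 qed
 moreover have "eqr A (rc A (conv F) F) (snd Q)"
 proof(rule frel_le[OF A frel_rc[OF A G F] frel_id[OF A Q]], rule ent2I[OF A])
  fix W :: "('b * 'b * 'a) set" and e x y assume "fc2 A W e (rc A (conv F) F) x y"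
  thus "fc2 A W e (snd Q) x y"
   using frelD(5)[OF A F] unfolding fc_rc[OF A] fc_conv by blast
 qed
 ultimately show ?thesis
  unfolding iso_in_def by(simp add: TT_cmp[OF A] mk_eq[OF A] mk_hom[OF A] assms)
qed

section \<open>Finite limits\<close>

definition tob1 :: "('u, 'a) tob" where
 "tob1 = ({undefined}, %x y. if x = undefined & y = undefined then UNIV else {})"

lemma fc_if_UNIV:
 assumes A: "pca A"
 shows "fc A W e (%w. if p w then UNIV else {}) <-> (ALL w:W. p w)"
proof
 assume "fc A W e (%w. if p w then UNIV else {})"
 from fc_ne[OF this] show "ALL w:W. p w" by(metis (full_types))
qed (rule fc_const[OF A], simp)

text \<open>Terminality expressed internally: one element is uniformly equal to all existing ones.
  Being an entailment at a fixed \<open>q\<close>, this is carried along by every applicative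
  morphism.\<close>

definition tterm :: "'a pas => ('u, 'a) tob => bool" where
 "tterm A P <-> (EX q:fst P. ent A (%x. snd P x x) (%x. snd P x q))"

lemma fc_point: "pca A ==> tobj A P ==> q : fst P ==> fc A W e (%w. snd P q q)"
 by(drule tobjD(4), assumption) (auto intro: fc_const)

lemma tterm_terminal:
 fixes P :: "('u, 'a) tob"
 assumes A: "pca A" and P: "tobj A P" and t: "tterm A P"
 shows "is_terminal (TT A) P"
 unfolding is_terminal_def
proof(intro conjI ballI)
 obtain q where q: "q : fst P" "ent A (%x. snd P x x) (%x. snd P x q)" using t unfolding tterm_def by blast
 have all: "fc2 A W e (snd P) x y"
  if x: "fc2 A W e (snd P) x x" and y: "fc2 A W e (snd P) y y" for W e x y
  by(rule tobj_trans[OF A P entD[OF A q(2) x] tobj_sym[OF A P entD[OF A q(2) y]]])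
 fix X :: "('u, 'a) tob" assume "X : Obj (TT A)"
 hence X: "tobj A X" by simp
 define F where "F x y = cj A (snd X x x) (snd P y y)" for x y
 have F: "frel A X P F"
  unfolding F_def by(rule frelI[OF A]; unfold fc_cj[OF A])
   (use fc_point[OF A P q(1)] in \<open>auto intro: all tobj_refl1[OF A X] tobj_refl2[OF A X] tobj_refl2[OF A P] exI[of _ "%_. q"]\<close>)
 show "EX! f. f : hom (TT A) X P"
 proof(rule ex1I)
  show "mk A X F P : hom (TT A) X P" by(rule mk_hom[OF A X P F])
  fix g assume "g : hom (TT A) X P"
  then obtain G where G: "frel A X P G" "g = mk A X G P" by(rule TT_homE[OF A])
  have "eqr A G F" by(rule frel_le[OF A G(1) F], rule ent2I[OF A])
   (unfold F_def fc_cj[OF A], blast dest: frelD(1)[OF A G(1)] frelD(2)[OF A G(1)])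
  thus "g = mk A X F P" unfolding G(2) by(simp add: mk_eq[OF A])
 qed
qed (simp add: P)

lemma fc_undefined: "pca A ==> fc2 A W e (snd tob1) x y <-> (ALL w:W. x w = undefined & y w = undefined)"
 unfolding tob1_def snd_conv by(rule fc_if_UNIV)

lemma tob1:
 assumes A: "pca A" and U: "set_universe TYPE('u)"
 shows "tobj A (tob1 :: ('u, 'a) tob)" "tterm A (tob1 :: ('u, 'a) tob)"
proof -
 show "tobj A (tob1 :: ('u, 'a) tob)"
  by(rule tobjI[OF A]; (unfold fc_undefined[OF A])?) (auto simp: tob1_def small_finite[OF U] split: if_splits)
 show "tterm A (tob1 :: ('u, 'a) tob)"
  unfolding tterm_def
  by(rule bexI[of _ undefined], rule entI[OF A], unfold fc_undefined[OF A]) (auto simp: tob1_def)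
qed

lemma terminal_tterm:
 fixes P :: "('u, 'a) tob"
 assumes A: "pca A" and U: "set_universe TYPE('u)" and t: "is_terminal (TT A) P"
 shows "tterm A P"
proof -
 have P: "tobj A P" using t unfolding is_terminal_def by simp
 note T = tob1[OF A U] 
 obtain f where f: "f : hom (TT A) tob1 P" using t T(1) unfolding is_terminal_def by(metis TT_simps(1))
 obtain g where g: "g : hom (TT A) P tob1"
  using tterm_terminal[OF A T] P unfolding is_terminal_def by(metis TT_simps(1))
 obtain F where F: "frel A tob1 P F" "f = mk A tob1 F P" using f by(rule TT_homE[OF A])
 obtain G where G: "frel A P tob1 G" "g = mk A P G tob1" using g by(rule TT_homE[OF A])
 \<comment> \<open>A terminal object has one endomorphism, so its identity factors through
   \<open>tob1\<close>. The value of \<open>F\<close> at the point of \<open>tob1\<close> is the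
   required element.\<close>
 have "mk A P (rc A G F) P = mk A P (snd P) P"
 proof -
  from t have "EX! f. f : hom (TT A) P P" unfolding is_terminal_def by blast
  thus ?thesis
   using mk_hom[OF A P P frel_rc[OF A G(1) F(1)]] mk_hom[OF A P P frel_id[OF A P]] by blast
 qed
 hence e: "eqr A (snd P) (rc A G F)" by(simp add: mk_eq[OF A] eqr_sym)
 obtain y where y: "fc A {()} (%_. undefined) (%w. F undefined (y w))"
  by(rule frel_total[OF A F(1), of "{()}" "%_. undefined" "%_. undefined"]) (simp add: fc_undefined[OF A])
 have q: "y () : fst P" using fc_ne[OF frelD(2)[OF A F(1) y], of "()"] tobjD(2)[OF P] by simp
 obtain c where c: "c : F undefined (y ())" using fc_ne[OF y, of "()"] by auto
 have y': "fc A W e (%w. F undefined (y ()))" for W :: "('u, 'a) st1" and e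
  by(rule fc_const[OF A c])
 have "ent A (%x. snd P x x) (%x. snd P x (y ()))"
 proof(rule entI[OF A])
  fix W :: "('u, 'a) st1" and e x assume x: "fc2 A W e (snd P) x x"
  then obtain u where u: "fc2 A W e G x u" "fc2 A W e F u x"
   unfolding fc_eqr[OF A e] fc_rc[OF A] by blast
  have "fc A W e (%w. snd (tob1 :: ('u, 'a) tob) (u w) undefined)"
   using frelD(2)[OF A G(1) u(1)] by(simp add: fc_undefined[OF A])
  from frelD(4)[OF A G(1) u(1) this] have "fc A W e (%w. rc A G F (x w) (y ()))"
   unfolding fc_rc[OF A] by(intro exI[of _ "%_. undefined"] conjI y')
  thus "fc A W e (%w. snd P (x w) (y ()))" unfolding fc_eqr[OF A e] .
 qed
 thus ?thesis unfolding tterm_def using q by blast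
qed

text \<open>The square commutes, the projections are jointly injective, and each matching pair comes
  from \<open>D\<close>. The three entailments involve only conjunction and existential
  quantification, the operations preserved by direct images.\<close>

definition pbc :: "'a pas => ('u, 'a) tob => ('u => 'u => 'a set) => ('u => 'u => 'a set) =>
  ('u => 'u => 'a set) => ('u => 'u => 'a set) => bool" where
 "pbc A D F G p q <-> eqr A (rc A p F) (rc A q G) &
  ent2 A (%d d'. cj A (rc A p (conv p) d d') (rc A q (conv q) d d')) (snd D) &
  ent2 A (rc A F (conv G)) (rc A (conv p) q)"

lemma pbcD:
 assumes A: "pca A" and pb: "pbc A D F G p q"
 shows "fc2 A W e p d x ==> fc2 A W e p d' x ==>
   fc2 A W e q d y ==> fc2 A W e q d' y ==> fc2 A W e (snd D) d d'"
  "fc2 A W e F x z ==> fc2 A W e G y z ==>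
   EX d. fc2 A W e p d x & fc2 A W e q d y"
 using ent2D[OF A conjunct1[OF conjunct2[OF pb[unfolded pbc_def]]], of W e d d'] 
  ent2D[OF A conjunct2[OF conjunct2[OF pb[unfolded pbc_def]]], of W e x y]
 unfolding fc_cj[OF A] fc_rc[OF A] fc_conv by blast+

lemma pbc_pullback:
 fixes X Y Z D :: "('u, 'a) tob"
 assumes A: "pca A" and ob: "tobj A X" "tobj A Y" "tobj A Z" "tobj A D"
  and F: "frel A X Z F" and G: "frel A Y Z G" and p: "frel A D X p" and q: "frel A D Y q"
  and pb: "pbc A D F G p q"
 shows "is_pullback (TT A) (mk A X F Z) (mk A Y G Z) (mk A D p X) (mk A D q Y)"
proof(rule pbI[OF mk_hom[OF A ob(4,1) p] mk_hom[OF A ob(4,2) q] mk_hom[OF A ob(1,3) F] mk_hom[OF A ob(2,3) G]])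
 show "Cmp (TT A) (mk A X F Z) (mk A D p X) = Cmp (TT A) (mk A Y G Z) (mk A D q Y)"
  using pb by(simp add: TT_cmp[OF A] mk_eq[OF A] pbc_def)
 fix u v V assume u: "u : hom (TT A) V X" and v: "v : hom (TT A) V Y"
  and uv: "Cmp (TT A) (mk A X F Z) u = Cmp (TT A) (mk A Y G Z) v"
 obtain R where R: "frel A V X R" "u = mk A V R X" "tobj A V" using u by(rule TT_homE[OF A])
 obtain S where S: "frel A V Y S" "v = mk A V S Y" using v by(rule TT_homE[OF A])
 have RS: "eqr A (rc A R F) (rc A S G)" using uv by(simp add: R(2) S(2) TT_cmp[OF A] mk_eq[OF A])
 define H where "H v d = cj A (rc A R (conv p) v d) (rc A S (conv q) v d)" for v d
 have H_fc: "fc2 A W e H v d <-> (EX x. fc2 A W e R v x & fc2 A W e p d x) &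
   (EX x. fc2 A W e S v x & fc2 A W e q d x)" for W e v d
  unfolding H_def fc_cj[OF A] fc_rc[OF A] fc_conv ..
 have H: "frel A V D H"
 proof(rule frelI[OF A]; (unfold H_fc)?; (elim exE conjE)?)
  fix W :: "('u, 'a) st3" and e v d d' x y x' y'
  assume h: "fc2 A W e R v x" "fc2 A W e p d x"
   "fc2 A W e S v y" "fc2 A W e q d y"
   "fc2 A W e R v x'" "fc2 A W e p d' x'"
   "fc2 A W e S v y'" "fc2 A W e q d' y'"
  show "fc2 A W e (snd D) d d'"
   by(rule pbcD(1)[OF A pb h(2) _ h(4)])
    (rule frelD(4)[OF A p h(6) frelD(5)[OF A R(1) h(5,1)]], rule frelD(4)[OF A q h(8) frelD(5)[OF A S(1) h(7,3)]])
 next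
  fix W :: "('u, 'a) st1" and e v assume "fc2 A W e (snd V) v v"
  then obtain x where x: "fc2 A W e R v x" by(rule frel_total[OF A R(1)])
  obtain z where z: "fc2 A W e F x z" by(rule frel_total[OF A F frelD(2)[OF A R(1) x]])
  have "fc2 A W e (rc A R F) v z" unfolding fc_rc[OF A] using x z by blast
  hence "fc2 A W e (rc A S G) v z" unfolding fc_eqr[OF A RS] .
  then obtain y where y: "fc2 A W e S v y" "fc2 A W e G y z" unfolding fc_rc[OF A] by blast
  from pbcD(2)[OF A pb z y(2)] show "EX d. (EX x. fc2 A W e R v x & fc2 A W e p d x) &
   (EX x. fc2 A W e S v x & fc2 A W e q d x)" using x y by blast
 qed (blast intro: frelD(3)[OF A R(1)] frelD(3)[OF A S(1)] frelD(3)[OF A p] frelD(3)[OF A q] dest: frelD(1)[OF A p] frelD(1)[OF A R(1)])+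
 show "EX! h. h : hom (TT A) V D & Cmp (TT A) (mk A D p X) h = u & Cmp (TT A) (mk A D q Y) h = v"
 proof(rule ex1I[of _ "mk A V H D"], intro conjI)
  show "mk A V H D : hom (TT A) V D" by(rule mk_hom[OF A R(3) ob(4) H])
  have "eqr A (rc A H p) R"
   by(rule frel_le[OF A frel_rc[OF A H p] R(1)], rule ent2I[OF A], unfold fc_rc[OF A] H_fc)
    (blast intro: frelD(4)[OF A R(1)] frelD(5)[OF A p])
  thus "Cmp (TT A) (mk A D p X) (mk A V H D) = u" by(simp add: R(2) TT_cmp[OF A] mk_eq[OF A])
  have "eqr A (rc A H q) S"
   by(rule frel_le[OF A frel_rc[OF A H q] S(1)], rule ent2I[OF A], unfold fc_rc[OF A] H_fc)
    (blast intro: frelD(4)[OF A S(1)] frelD(5)[OF A q])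
  thus "Cmp (TT A) (mk A D q Y) (mk A V H D) = v" by(simp add: S(2) TT_cmp[OF A] mk_eq[OF A])
  fix k assume k: "k : hom (TT A) V D & Cmp (TT A) (mk A D p X) k = u & Cmp (TT A) (mk A D q Y) k = v"
  then obtain K where K: "frel A V D K" "k = mk A V K D" using TT_homE[OF A] by metis
  have Kp: "eqr A (rc A K p) R" and Kq: "eqr A (rc A K q) S"
   using k by(simp_all add: K(2) R(2) S(2) TT_cmp[OF A] mk_eq[OF A])
  have "eqr A K H"
  proof(rule frel_le[OF A K(1) H], rule ent2I[OF A], unfold H_fc)
   fix W :: "('u, 'a) st2" and e v d assume d: "fc2 A W e K v d"
   obtain x where x: "fc2 A W e p d x" by(rule frel_total[OF A p frelD(2)[OF A K(1) d]])
   obtain y where y: "fc2 A W e q d y" by(rule frel_total[OF A q frelD(2)[OF A K(1) d]])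
   have "fc2 A W e (rc A K p) v x" "fc2 A W e (rc A K q) v y"
    unfolding fc_rc[OF A] using d x y by blast+
   thus "(EX x. fc2 A W e R v x & fc2 A W e p d x) &
    (EX x. fc2 A W e S v x & fc2 A W e q d x)"
    unfolding fc_eqr[OF A Kp] fc_eqr[OF A Kq] using x y by blast
  qed
  thus "k = mk A V H D" by(simp add: K(2) mk_eq[OF A])
 qed
qed

lemma canonical_pullback:
 fixes X Y Z :: "('u, 'a) tob"
 assumes A: "pca A" and U: "set_universe TYPE('u)" and ob: "tobj A X" "tobj A Y" "tobj A Z"
  and F: "frel A X Z F" and G: "frel A Y Z G"
 obtains D p q where "tobj A D" "frel A D X p" "frel A D Y q" "pbc A D F G p q"
proof -
 \<comment> \<open>Componentwise equality of two coded pairs, with evidence that the components of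
   \<open>a\<close> have a common image; the same for \<open>b\<close> follows.\<close>
 define de where "de a b = cj A (snd X (ufst a) (ufst b)) (cj A (snd Y (usnd a) (usnd b)) (rc A F (conv G) (ufst a) (usnd a)))" for a b
 have d_fc: "fc2 A W e de a b <-> fc A W e (%w. snd X (ufst (a w)) (ufst (b w))) &
   fc A W e (%w. snd Y (usnd (a w)) (usnd (b w))) &
   (EX z. fc A W e (%w. F (ufst (a w)) (z w)) & fc A W e (%w. G (usnd (a w)) (z w)))" for W e a b
  unfolding de_def fc_cj[OF A] fc_rc[OF A] fc_conv ..
 define S where "S = {a. de a a ~= {}}"
 define D where "D = (S, de)"
 have [simp]: "fst D = S" "snd D = de" by(simp_all add: D_def)
 have dsym: "fc2 A W e de b a" if "fc2 A W e de a b" for W e a b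
 proof -
  from that obtain z where 1: "fc A W e (%w. snd X (ufst (a w)) (ufst (b w)))" "fc A W e (%w. snd Y (usnd (a w)) (usnd (b w)))"
   "fc A W e (%w. F (ufst (a w)) (z w))" "fc A W e (%w. G (usnd (a w)) (z w))" unfolding d_fc by blast
  show ?thesis unfolding d_fc
   using tobj_sym[OF A ob(1) 1(1)] tobj_sym[OF A ob(2) 1(2)] frelD(3)[OF A F 1(3,1)] frelD(3)[OF A G 1(4,2)] by blast
 qed
 have dtrans: "fc2 A W e de a c" if "fc2 A W e de a b" "fc2 A W e de b c" for W e a b c
  using that tobj_trans[OF A ob(1), of W e "%w. ufst (a w)" "%w. ufst (b w)" "%w. ufst (c w)"]
   tobj_trans[OF A ob(2), of W e "%w. usnd (a w)" "%w. usnd (b w)" "%w. usnd (c w)"]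
  unfolding d_fc by blast
 have ne: "de a a ~= {} & de b b ~= {}" if "de a b ~= {}" for a b
 proof -
  have 1: "fc A {()} (%_. undefined) (%_. de a b)" using that by(auto intro: fc_const[OF A])
  show ?thesis
   using fc_ne[OF dtrans[OF 1 dsym[OF 1]], of "()"] fc_ne[OF dtrans[OF dsym[OF 1] 1], of "()"] by simp
 qed
 have D: "tobj A D"
 proof(rule tobjI[OF A])
  show "small TYPE('u) (fst D)"
   by(rule small_upair[OF U tobjD(1)[OF ob(1)] tobjD(1)[OF ob(2)]])
    (auto simp: S_def de_def intro: tobjD(2)[OF ob(1)] tobjD(2)[OF ob(2)])
 qed (use ne dsym dtrans in "auto simp: S_def")
 define p where "p a x = cj A (de a a) (snd X (ufst a) x)" for a x
 define q where "q a y = cj A (de a a) (snd Y (usnd a) y)" for a y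
 have p_fc: "fc2 A W e p a x <-> fc2 A W e de a a & fc A W e (%w. snd X (ufst (a w)) (x w))" for W e a x
  unfolding p_def fc_cj[OF A] ..
 have q_fc: "fc2 A W e q a x <-> fc2 A W e de a a & fc A W e (%w. snd Y (usnd (a w)) (x w))" for W e a x
  unfolding q_def fc_cj[OF A] ..
 have d1: "fc A W e (%w. snd X (ufst (a w)) (ufst (b w)))" "fc A W e (%w. snd Y (usnd (a w)) (usnd (b w)))"
  if "fc2 A W e de a b" for W e a b using that unfolding d_fc by blast+
 have px: "fc A W e (%w. snd X (ufst (b w)) (x w))"
  if "fc2 A W e de a b" "fc A W e (%w. snd X (ufst (a w)) (x w))" for W e a b x
  by(rule tobj_trans[OF A ob(1) tobj_sym[OF A ob(1) d1(1)[OF that(1)]] that(2)])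
 have qy: "fc A W e (%w. snd Y (usnd (b w)) (x w))"
  if "fc2 A W e de a b" "fc A W e (%w. snd Y (usnd (a w)) (x w))" for W e a b x
  by(rule tobj_trans[OF A ob(2) tobj_sym[OF A ob(2) d1(2)[OF that(1)]] that(2)])
 have p: "frel A D X p"
 proof(rule frelI[OF A]; (unfold p_fc \<open>snd D = de\<close>)?; (elim conjE)?)
  fix W :: "('u, 'a) st3" and e a x x'
  assume 1: "fc A W e (%w. snd X (ufst (a w)) (x w))"
  show "fc2 A W e (snd X) x x'" if "fc A W e (%w. snd X (ufst (a w)) (x' w))"
   by(rule tobj_trans[OF A ob(1) tobj_sym[OF A ob(1) 1] that])
  show "fc2 A W e de a a & fc A W e (%w. snd X (ufst (a w)) (x' w))"
   if "fc2 A W e de a a" "fc2 A W e (snd X) x x'"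
   by(rule conjI[OF that(1) tobj_trans[OF A ob(1) 1 that(2)]])
 next
  fix W :: "('u, 'a) st2" and e a x
  assume 1: "fc2 A W e de a a" "fc A W e (%w. snd X (ufst (a w)) (x w))"
  show "fc2 A W e de a a & fc2 A W e (snd X) x x"
   by(rule conjI[OF 1(1) tobj_refl2[OF A ob(1) 1(2)]])
 next
  fix W :: "('u, 'a) st3" and e a b x
  assume 1: "fc2 A W e de a b" "fc A W e (%w. snd X (ufst (a w)) (x w))"
  show "fc2 A W e de b b & fc A W e (%w. snd X (ufst (b w)) (x w))"
   by(rule conjI[OF dtrans[OF dsym[OF 1(1)] 1(1)] px[OF 1]])
 next
  fix W :: "('u, 'a) st1" and e a
  assume 1: "fc2 A W e de a a"
  show "EX x. fc2 A W e de a a & fc A W e (%w. snd X (ufst (a w)) (x w))"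
   by(intro exI[of _ "%w. ufst (a w)"] conjI 1 d1(1)[OF 1])
 qed
 have q: "frel A D Y q"
 proof(rule frelI[OF A]; (unfold q_fc \<open>snd D = de\<close>)?; (elim conjE)?)
  fix W :: "('u, 'a) st3" and e a x x'
  assume 1: "fc A W e (%w. snd Y (usnd (a w)) (x w))"
  show "fc2 A W e (snd Y) x x'" if "fc A W e (%w. snd Y (usnd (a w)) (x' w))"
   by(rule tobj_trans[OF A ob(2) tobj_sym[OF A ob(2) 1] that])
  show "fc2 A W e de a a & fc A W e (%w. snd Y (usnd (a w)) (x' w))"
   if "fc2 A W e de a a" "fc2 A W e (snd Y) x x'"
   by(rule conjI[OF that(1) tobj_trans[OF A ob(2) 1 that(2)]])
 next
  fix W :: "('u, 'a) st2" and e a x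
  assume 1: "fc2 A W e de a a" "fc A W e (%w. snd Y (usnd (a w)) (x w))"
  show "fc2 A W e de a a & fc2 A W e (snd Y) x x"
   by(rule conjI[OF 1(1) tobj_refl2[OF A ob(2) 1(2)]])
 next
  fix W :: "('u, 'a) st3" and e a b x
  assume 1: "fc2 A W e de a b" "fc A W e (%w. snd Y (usnd (a w)) (x w))"
  show "fc2 A W e de b b & fc A W e (%w. snd Y (usnd (b w)) (x w))"
   by(rule conjI[OF dtrans[OF dsym[OF 1(1)] 1(1)] qy[OF 1]])
 next
  fix W :: "('u, 'a) st1" and e a
  assume 1: "fc2 A W e de a a"
  show "EX x. fc2 A W e de a a & fc A W e (%w. snd Y (usnd (a w)) (x w))"
   by(intro exI[of _ "%w. usnd (a w)"] conjI 1 d1(2)[OF 1])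
 qed
 have "pbc A D F G p q"
  unfolding pbc_def
 proof(intro conjI)
  show "eqr A (rc A p F) (rc A q G)"
  proof(rule frel_le[OF A frel_rc[OF A p F] frel_rc[OF A q G]], rule ent2I[OF A], unfold fc_rc[OF A] p_fc q_fc, elim exE conjE)
   fix W :: "('u, 'a) st2" and e a z x
   assume 1: "fc2 A W e de a a" "fc A W e (%w. snd X (ufst (a w)) (x w))" "fc2 A W e F x z"
   then obtain z' where z: "fc A W e (%w. F (ufst (a w)) (z' w))" "fc A W e (%w. G (usnd (a w)) (z' w))"
    unfolding d_fc by blast
   have "fc2 A W e (snd Z) z' z"
    by(rule frelD(5)[OF A F z(1) frelD(3)[OF A F 1(3) tobj_sym[OF A ob(1) 1(2)]]])
   from frelD(4)[OF A G z(2) this] show "EX y. (fc2 A W e de a a & fc A W e (%w. snd Y (usnd (a w)) (y w))) &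
     fc2 A W e G y z"
    using 1(1) d1(2)[OF 1(1)] by(intro exI[of _ "%w. usnd (a w)"]) simp
  qed
  show "ent2 A (%d d'. cj A (rc A p (conv p) d d') (rc A q (conv q) d d')) (snd D)"
  proof(rule ent2I[OF A], unfold fc_cj[OF A] fc_rc[OF A] fc_conv p_fc q_fc \<open>snd D = de\<close>, elim exE conjE)
   fix W :: "('u, 'a) st2" and e a b x y
   assume 1: "fc2 A W e de a a" "fc A W e (%w. snd X (ufst (a w)) (x w))" "fc A W e (%w. snd X (ufst (b w)) (x w))"
    "fc A W e (%w. snd Y (usnd (a w)) (y w))" "fc A W e (%w. snd Y (usnd (b w)) (y w))"
   show "fc2 A W e de a b"
    using 1(1) tobj_trans[OF A ob(1) 1(2) tobj_sym[OF A ob(1) 1(3)]] tobj_trans[OF A ob(2) 1(4) tobj_sym[OF A ob(2) 1(5)]]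
    unfolding d_fc by simp
  qed
  show "ent2 A (rc A F (conv G)) (rc A (conv p) q)"
  proof(rule ent2I[OF A], unfold fc_rc[OF A] fc_conv p_fc q_fc d_fc, elim exE conjE)
   fix W :: "('u, 'a) st2" and e x y z assume 1: "fc2 A W e F x z" "fc2 A W e G y z"
   note 2 = frelD(1)[OF A F 1(1)] frelD(1)[OF A G 1(2)]
   show "EX a. ((fc A W e (%w. snd X (ufst (a w)) (ufst (a w))) & fc A W e (%w. snd Y (usnd (a w)) (usnd (a w))) &
     (EX z. fc A W e (%w. F (ufst (a w)) (z w)) & fc A W e (%w. G (usnd (a w)) (z w)))) &
     fc A W e (%w. snd X (ufst (a w)) (x w))) &
    (fc A W e (%w. snd X (ufst (a w)) (ufst (a w))) & fc A W e (%w. snd Y (usnd (a w)) (usnd (a w))) &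
     (EX z. fc A W e (%w. F (ufst (a w)) (z w)) & fc A W e (%w. G (usnd (a w)) (z w)))) &
    fc A W e (%w. snd Y (usnd (a w)) (y w))"
    by(rule exI[of _ "%w. upair (x w) (y w)"]) (use 1 2 in "auto simp: ups[OF U]")
  qed
 qed
 with D p q show ?thesis by(rule that)
qed

text \<open>The conditions hold for the canonical pullback, and the comparison maps \<open>h\<close>
  and \<open>k\<close> carry them to any other one. Joint injectivity uses that \<open>k\<close>
  followed by \<open>h\<close> is the identity of \<open>D\<close>.\<close>

lemma pullback_pbc:
 fixes X Y Z D :: "('u, 'a) tob"
 assumes A: "pca A" and U: "set_universe TYPE('u)" and ob: "tobj A X" "tobj A Y" "tobj A Z" "tobj A D"
  and F: "frel A X Z F" and G: "frel A Y Z G" and p: "frel A D X p" and q: "frel A D Y q"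
  and pb: "is_pullback (TT A) (mk A X F Z) (mk A Y G Z) (mk A D p X) (mk A D q Y)"
 shows "pbc A D F G p q"
proof -
 obtain E p0 q0 where E: "tobj A E" and p0: "frel A E X p0" and q0: "frel A E Y q0" and pb0: "pbc A E F G p0 q0"
  by(rule canonical_pullback[OF A U ob(1-3) F G])
 note pE = pbc_pullback[OF A ob(1-3) E F G p0 q0 pb0]
 note u = pbD(6)[OF pb, simplified] and uE = pbD(6)[OF pE, simplified]
 have c: "Cmp (TT A) (mk A X F Z) (mk A D p X) = Cmp (TT A) (mk A Y G Z) (mk A D q Y)" using pbD(5)[OF pb] .
 have cE: "Cmp (TT A) (mk A X F Z) (mk A E p0 X) = Cmp (TT A) (mk A Y G Z) (mk A E q0 Y)" using pbD(5)[OF pE] .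
 obtain h where h: "h : hom (TT A) E D" "Cmp (TT A) (mk A D p X) h = mk A E p0 X" "Cmp (TT A) (mk A D q Y) h = mk A E q0 Y"
  using u[OF mk_hom[OF A E ob(1) p0] mk_hom[OF A E ob(2) q0] cE] by blast
 obtain k where k: "k : hom (TT A) D E" "Cmp (TT A) (mk A E p0 X) k = mk A D p X" "Cmp (TT A) (mk A E q0 Y) k = mk A D q Y"
  using uE[OF mk_hom[OF A ob(4,1) p] mk_hom[OF A ob(4,2) q] c] by blast
 obtain H where H: "frel A E D H" "h = mk A E H D" using h(1) by(rule TT_homE[OF A])
 obtain K where K: "frel A D E K" "k = mk A D K E" using k(1) by(rule TT_homE[OF A])
 have hp: "eqr A (rc A H p) p0" and hq: "eqr A (rc A H q) q0" using h by(simp_all add: H(2) TT_cmp[OF A] mk_eq[OF A])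
 have kp: "eqr A p (rc A K p0)" and kq: "eqr A q (rc A K q0)"
  using k eqr_sym by(simp_all add: K(2) TT_cmp[OF A] mk_eq[OF A])
 have hk: "eqr A (rc A K H) (snd D)"
 proof -
  have "Cmp (TT A) (mk A D p X) (mk A D (rc A K H) D) = mk A D p X"
   "Cmp (TT A) (mk A D q Y) (mk A D (rc A K H) D) = mk A D q Y"
  proof -
   have c: "mk A D (rc A K H) D = Cmp (TT A) h k" by(simp add: H(2) K(2) TT_cmp[OF A])
   note as = cat_assoc[OF TT_cat[OF A] k(1) h(1)]
   show "Cmp (TT A) (mk A D p X) (mk A D (rc A K H) D) = mk A D p X"
    unfolding c as[OF mk_hom[OF A ob(4,1) p]] h(2) k(2) ..
   show "Cmp (TT A) (mk A D q Y) (mk A D (rc A K H) D) = mk A D q Y"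
    unfolding c as[OF mk_hom[OF A ob(4,2) q]] h(3) k(3) ..
  qed
  moreover have "Cmp (TT A) (mk A D p X) (mk A D (snd D) D) = mk A D p X"
   "Cmp (TT A) (mk A D q Y) (mk A D (snd D) D) = mk A D q Y"
   using cat_idr[OF TT_cat[OF A] mk_hom[OF A ob(4,1) p]] cat_idr[OF TT_cat[OF A] mk_hom[OF A ob(4,2) q]] by simp_all
  ultimately have "mk A D (rc A K H) D = mk A D (snd D) D"
   using u[OF mk_hom[OF A ob(4,1) p] mk_hom[OF A ob(4,2) q] c] mk_hom[OF A ob(4,4) frel_rc[OF A K(1) H(1)]]
    mk_hom[OF A ob(4,4) frel_id[OF A ob(4)]] by blast
  thus ?thesis by(simp add: mk_eq[OF A])
 qed
 show ?thesis unfolding pbc_def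
 proof(intro conjI)
  show "eqr A (rc A p F) (rc A q G)" using c by(simp add: TT_cmp[OF A] mk_eq[OF A])
  show "ent2 A (rc A F (conv G)) (rc A (conv p) q)"
  proof(rule ent2I[OF A], unfold fc_rc[OF A] fc_conv, elim exE conjE)
   fix W :: "('u, 'a) st2" and e x y z assume 1: "fc2 A W e F x z" "fc2 A W e G y z"
   from pbcD(2)[OF A pb0 1] obtain a where a: "fc2 A W e p0 a x" "fc2 A W e q0 a y" by blast
   obtain d where d: "fc2 A W e H a d" "fc2 A W e p d x"
    using a(1) unfolding fc_eqr[OF A hp, symmetric] fc_rc[OF A] by blast
   obtain d' where d': "fc2 A W e H a d'" "fc2 A W e q d' y"
    using a(2) unfolding fc_eqr[OF A hq, symmetric] fc_rc[OF A] by blast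
   have "fc2 A W e q d y" by(rule frelD(3)[OF A q d'(2) frelD(5)[OF A H(1) d'(1) d(1)]])
   with d(2) show "EX d. fc2 A W e p d x & fc2 A W e q d y" by blast
  qed
  show "ent2 A (%d d'. cj A (rc A p (conv p) d d') (rc A q (conv q) d d')) (snd D)"
  proof(rule ent2I[OF A], unfold fc_cj[OF A] fc_rc[OF A] fc_conv, elim exE conjE)
   fix W :: "('u, 'a) st2" and e d d' x y
   assume 1: "fc2 A W e p d x" "fc2 A W e p d' x"
    "fc2 A W e q d y" "fc2 A W e q d' y"
   have *: "EX a. fc2 A W e K d a & fc2 A W e p0 a x & fc2 A W e q0 a y"
    if 1: "fc2 A W e p d x" "fc2 A W e q d y" for d
   proof -
    obtain a where a: "fc2 A W e K d a" "fc2 A W e p0 a x"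
     using 1(1) unfolding fc_eqr[OF A kp] fc_rc[OF A] by blast
    obtain b where b: "fc2 A W e K d b" "fc2 A W e q0 b y"
     using 1(2) unfolding fc_eqr[OF A kq] fc_rc[OF A] by blast
    from a frelD(3)[OF A q0 b(2) frelD(5)[OF A K(1) b(1) a(1)]] show ?thesis by blast
   qed
   obtain a where a: "fc2 A W e K d a" "fc2 A W e p0 a x" "fc2 A W e q0 a y"
    using *[OF 1(1,3)] by blast
   obtain b where b: "fc2 A W e K d' b" "fc2 A W e p0 b x" "fc2 A W e q0 b y"
    using *[OF 1(2,4)] by blast
   from frelD(4)[OF A K(1) b(1) pbcD(1)[OF A pb0 b(2) a(2) b(3) a(3)]]
   have b': "fc2 A W e K d' a" .
   obtain c where c: "fc2 A W e H a c" by(rule frel_total[OF A H(1) frelD(1)[OF A p0 a(2)]])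
   have "fc2 A W e (rc A K H) d c" "fc2 A W e (rc A K H) d' c"
    unfolding fc_rc[OF A] using a(1) b' c by blast+
   hence 2: "fc2 A W e (snd D) d c" "fc2 A W e (snd D) d' c" unfolding fc_eqr[OF A hk] .
   show "fc2 A W e (snd D) d d'" by(rule tobj_trans[OF A ob(4) 2(1) tobj_sym[OF A ob(4) 2(2)]])
  qed
 qed
qed

section \<open>Identification of the exact completion of assemblies with the topos of the
  tripos\<close>

section \<open>The realizability topos as a category of partial equivalence relations\<close>

lemma Ass_simps [simp]:
 "Obj (Ass TYPE('u) A) = (assemblies :: ('u, 'a) assembly set)"
 "Dom (Ass TYPE('u) A) = fst" "Cod (Ass TYPE('u) A) = (%f. snd (snd f))"
 "Idn (Ass TYPE('u) A) P = (P, restrict (%x. x) (fst P), P)"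
 "Cmp (Ass TYPE('u) A) g f = (fst f, compose (fst (fst f)) (fst (snd g)) (fst (snd f)), snd (snd g))"
 by(auto simp: Ass_def fun_eq_iff split: prod.splits)

lemma asmD:
 fixes P :: "('u, 'a) assembly"
 assumes "P : assemblies" shows "small TYPE('u) (fst P)" "snd P x ~= {} <-> x : fst P"
 using assms by(cases P, simp add: assemblies_def)+

lemma asmI:
 fixes X :: "'u set"
 shows "small TYPE('u) X ==> (!!x. E x ~= {} <-> x : X) ==> (X, E) : assemblies"
 by(auto simp: assemblies_def)

lemma Ass_arr:
 "(P, f, Q) : Arr (Ass TYPE('u) A) <-> (P :: ('u, 'a) assembly) : assemblies & Q : assemblies &
  f : fst P \<rightarrow>\<^sub>E fst Q & ent A (snd P) (%z. snd Q (f z))"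
proof -
 have "(EX a. tracks A a P f Q) <-> ent A (snd P) (%z. snd Q (f z))" if "P : assemblies"
  unfolding tracks_def ent_def using asmD(2)[OF that] by(metis equals0D)
 thus ?thesis by(auto simp: Ass_def)
qed

lemma arr_fc:
 fixes P :: "('u, 'a) assembly"
 assumes "pca A" "(P, f, Q) : Arr (Ass TYPE('u) A)" "fc1 A W e (snd P) z"
 shows "fc A W e (%w. snd Q (f (z w)))"
 by(rule entD[OF assms(1), where ph = "snd P" and i = z]) (use assms(2,3) in "simp_all add: Ass_arr")

lemma arr_app:
 fixes P :: "('u, 'a) assembly"
 shows "(P, f, Q) : Arr (Ass TYPE('u) A) ==> z : fst P ==> f z : fst Q"
 by(auto simp: Ass_arr)

lemma arr_eqI:
 fixes P :: "('u, 'a) assembly"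
 shows "(P, f, Q) : Arr (Ass TYPE('u) A) ==> (P, g, Q) : Arr (Ass TYPE('u) A) ==> (!!z. z : fst P ==> f z = g z) ==> f = g"
 by(auto simp: Ass_arr intro: PiE_ext)

lemma compose_eq:
 fixes P :: "('u, 'a) assembly"
 assumes "(P, f, Q) : Arr (Ass TYPE('u) A)" "!!z. z : fst P ==> g (k z) = f z"
 shows "compose (fst P) g k = f"
proof
 fix z
 show "compose (fst P) g k z = f z"
  using assms PiE_arb[of f "fst P" "%_. fst Q" z] by(cases "z : fst P") (simp_all add: compose_def Ass_arr)
qed

lemma fc_in: "P : assemblies ==> fc1 A W e (snd P) z ==> w : W ==> z w : fst P"
 using fc_ne asmD(2) by metis

text \<open>The predicate on pairs given by a span: the realizers of whatever lies over
  \<open>x\<close> and \<open>y\<close>. If the span is jointly monic, at most one element lies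
  there and the predicate determines the span up to isomorphism.\<close>

definition mat :: "('u, 'a) assembly_arr \<times> ('u, 'a) assembly_arr => 'u => 'u => 'a set" where
 "mat ph x y = (\<Union>z\<in>{z : fst (fst (fst ph)). fst (snd (fst ph)) z = x & fst (snd (snd ph)) z = y}. snd (fst (fst ph)) z)"

lemma fc_mat: "fc2 A W e (mat ((R, f0, X), (R', f1, Y))) x y <->
  (EX z. (ALL w:W. z w : fst R & f0 (z w) = x w & f1 (z w) = y w) & fc1 A W e (snd R) z)"
 unfolding mat_def by(subst fc_Un) auto

definition span :: "'a pas => ('u, 'a) assembly => ('u, 'a) assembly => ('u, 'a) assembly => ('u => 'u) => ('u => 'u) => bool" where
 "span A X Y R f0 f1 <-> (R, f0, X) : Arr (Ass TYPE('u) A) & (R, f1, Y) : Arr (Ass TYPE('u) A) &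
  (ALL z:fst R. ALL z':fst R. f0 z = f0 z' --> f1 z = f1 z' --> z = z')"

lemma rel_span:
 fixes X Y :: "('u, 'a) assembly"
 assumes A: "pca A" and U: "set_universe TYPE('u)"
 shows "relation (Ass TYPE('u) A) X Y ph <-> (EX R f0 f1. ph = ((R, f0, X), (R, f1, Y)) & span A X Y R f0 f1)"
proof
 assume r: "relation (Ass TYPE('u) A) X Y ph"
 obtain R f0 X' R' f1 Y' where p: "ph = ((R, f0, X'), (R', f1, Y'))" by(metis prod.collapse)
 have e: "X' = X" "Y' = Y" "R' = R" and 0: "(R, f0, X) : Arr (Ass TYPE('u) A)" and 1: "(R, f1, Y) : Arr (Ass TYPE('u) A)"
  and m: "!!u v. u : Arr (Ass TYPE('u) A) ==> v : Arr (Ass TYPE('u) A) ==>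
   snd (snd u) = R ==> snd (snd v) = R ==> fst u = fst v ==>
   compose (fst (fst u)) f0 (fst (snd u)) = compose (fst (fst u)) f0 (fst (snd v)) ==>
   compose (fst (fst u)) f1 (fst (snd u)) = compose (fst (fst u)) f1 (fst (snd v)) ==> u = v"
  using r unfolding relation_def p by auto
 have "z = z'" if z: "z : fst R" "z' : fst R" "f0 z = f0 z'" "f1 z = f1 z'" for z z'
 proof -
  \<comment> \<open>The one-point assembly realized by everything. All constant maps out of it are
    tracked, so it tests joint monicity elementwise.\<close>
  define I :: "('u, 'a) assembly" where "I = ({undefined}, %x. if x = undefined then UNIV else {})"
  have I: "I : assemblies" unfolding I_def by(rule asmI[OF small_finite[OF U]]) auto
  have R: "R : assemblies" using 0 by(simp add: Ass_arr)
  have c: "(I, \<lambda>x\<in>{undefined :: 'u}. z, R) : Arr (Ass TYPE('u) A)" if z: "z : fst R" for z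
  proof -
   obtain b where b: "b : snd R z" using z asmD(2)[OF R] by blast
   have "ent A (snd I) (%x. snd R ((\<lambda>x\<in>{undefined :: 'u}. z) x))"
    by(rule entI[OF A], rule fc_const[OF A, of _ b]) (use fc_ne[of A] b in "fastforce simp: I_def split: if_splits")
   thus ?thesis using I R z by(simp add: Ass_arr) (simp add: I_def)
  qed
  have "(I, \<lambda>x\<in>{undefined :: 'u}. z, R) = (I, \<lambda>x\<in>{undefined :: 'u}. z', R)"
   by(rule m[OF c[OF z(1)] c[OF z(2)]]) (simp_all add: I_def z compose_def restrict_def fun_eq_iff)
  thus "z = z'" by(simp add: fun_eq_iff restrict_def split: if_splits)
 qed
 thus "EX R f0 f1. ph = ((R, f0, X), (R, f1, Y)) & span A X Y R f0 f1"
  using 0 1 unfolding p e span_def by blast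
next
 assume "EX R f0 f1. ph = ((R, f0, X), (R, f1, Y)) & span A X Y R f0 f1"
 then obtain R f0 f1 where p: "ph = ((R, f0, X), (R, f1, Y))" and s: "span A X Y R f0 f1" by blast
 have "u = v" if u: "u : Arr (Ass TYPE('u) A)" and v: "v : Arr (Ass TYPE('u) A)"
  and c: "snd (snd u) = R" "snd (snd v) = R" "fst u = fst v"
   "compose (fst (fst u)) f0 (fst (snd u)) = compose (fst (fst u)) f0 (fst (snd v))"
   "compose (fst (fst u)) f1 (fst (snd u)) = compose (fst (fst u)) f1 (fst (snd v))" for u v
 proof -
  obtain Z f g where [simp]: "u = (Z, f, R)" "v = (Z, g, R)" using c by(metis prod.collapse)
  have "f z = g z" if z: "z : fst Z" for z
  proof -
   have "f0 (f z) = f0 (g z)" "f1 (f z) = f1 (g z)" using fun_cong[OF c(4), of z] fun_cong[OF c(5), of z] z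
    by(simp_all add: compose_def)
   thus ?thesis using s u v arr_app[of Z f R A z] arr_app[of Z g R A z] z unfolding span_def by simp
  qed
  thus ?thesis using arr_eqI[of Z f R A g] u v by simp
 qed
 thus "relation (Ass TYPE('u) A) X Y ph" using s unfolding relation_def p span_def by auto
qed

lemma fc_if:
 assumes "pca A"
 shows "fc A W e (%w. if p w then ph w else {}) <-> (ALL w:W. p w) & fc A W e ph"
proof
 assume 1: "fc A W e (%w. if p w then ph w else {})"
 have "ALL w:W. p w"
 proof
  fix w assume "w : W" from fc_ne[OF 1 this] show "p w" by(cases "p w") simp_all
 qed
 moreover have "fc A W e ph" by(rule fc_mono[OF 1]) (simp split: if_split)
 ultimately show "(ALL w:W. p w) & fc A W e ph" ..
next
 assume 1: "(ALL w:W. p w) & fc A W e ph"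
 show "fc A W e (%w. if p w then ph w else {})" by(rule fc_mono[OF conjunct2[OF 1]]) (use 1 in simp)
qed

definition pbo :: "'a pas => ('u, 'a) assembly => ('u => 'u) => ('u, 'a) assembly => ('u => 'u) => ('u, 'a) assembly" where
 "pbo A R f S g = (let E = %a. if f (ufst a) = g (usnd a) then cj A (snd R (ufst a)) (snd S (usnd a)) else {}
  in ({a. E a ~= {}}, E))"

lemma fst_pbo: "a : fst (pbo A R f S g) <-> snd (pbo A R f S g) a ~= {}"
 by(simp add: pbo_def Let_def)

lemma fc_pbo: "pca A ==> fc1 A W e (snd (pbo A R f S g)) a <->
  (ALL w:W. f (ufst (a w)) = g (usnd (a w))) & fc A W e (%w. snd R (ufst (a w))) & fc A W e (%w. snd S (usnd (a w)))"
 unfolding pbo_def Let_def snd_conv by(simp only: fc_if fc_cj)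

lemma in_pbo:
 assumes "R : assemblies" "S : assemblies"
 shows "a : fst (pbo A R f S g) <-> ufst a : fst R & usnd a : fst S & f (ufst a) = g (usnd a)"
 unfolding fst_pbo using asmD(2)[OF assms(1)] asmD(2)[OF assms(2)] by(simp add: pbo_def Let_def)

definition rto :: "('u, 'a) assembly_arr \<times> ('u, 'a) assembly_arr => ('u, 'a) tob" where
 "rto r = (fst (snd (snd (fst r))), mat r)"

definition rta :: "'a pas => ('u, 'a) assembly_arr exreg_arr => ('u, 'a) tarr" where
 "rta A f = mk A (rto (fst f)) (mat (SOME ph. ph : fst (snd f))) (rto (snd (snd f)))"

definition RTF :: "'a pas => (('u, 'a) assembly_arr \<times> ('u, 'a) assembly_arr, ('u, 'a) assembly_arr exreg_arr,
  ('u, 'a) tob, ('u, 'a) tarr) func" where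
 "RTF A = \<lparr>FObj = rto, FArr = rta A\<rparr>"

context
 fixes A :: "'a pas" and dummy :: "'u itself"
 assumes A: "pca A" and U: "set_universe TYPE('u)"
begin
abbreviation (input) CC :: "(('u, 'a) assembly, ('u, 'a) assembly_arr) category" where "CC \<equiv> Ass TYPE('u) A"

lemma relationE:
 assumes "relation CC X Y ph"
 obtains R f0 f1 where "ph = ((R, f0, X), (R, f1, Y))" "(R, f0, X) : Arr CC" "(R, f1, Y) : Arr CC"
  "!!z z'. z : fst R ==> z' : fst R ==> f0 z = f0 z' ==> f1 z = f1 z' ==> z = z'"
  "R : assemblies" "X : assemblies" "Y : assemblies"
proof -
 obtain R f0 f1 where "ph = ((R, f0, X), (R, f1, Y))" "span A X Y R f0 f1" using assms rel_span[OF A U] by blast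
 thus ?thesis using that unfolding span_def Ass_arr by blast
qed

lemma relation_strict:
 assumes "relation CC X Y ph" "fc2 A W e (mat ph) x y"
 shows "fc1 A W e (snd X) x" "fc1 A W e (snd Y) y"
proof -
 obtain R f0 f1 where p: "ph = ((R, f0, X), (R, f1, Y))" and 0: "(R, f0, X) : Arr CC" and 1: "(R, f1, Y) : Arr CC"
  using assms(1) by(rule relationE)
 obtain z where z: "ALL w:W. z w : fst R & f0 (z w) = x w & f1 (z w) = y w" "fc1 A W e (snd R) z"
  using assms(2) unfolding p fc_mat by blast
 show "fc1 A W e (snd X) x" "fc1 A W e (snd Y) y"
  by(rule fc_mono[OF arr_fc[OF A 0 z(2)]], use z(1) in simp)
   (rule fc_mono[OF arr_fc[OF A 1 z(2)]], use z(1) in simp)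
qed

lemma relation_obj: "relation CC X Y ph ==> X : assemblies" "relation CC X Y ph ==> Y : assemblies"
 by(erule relationE, assumption)+

lemma relation_cod: "relation CC X Y ph ==> snd (snd (fst ph)) = X" "relation CC X Y ph ==> snd (snd (snd ph)) = Y"
 by(erule relationE, simp)+

lemma relation_swap:
 assumes "relation CC X Y ph"
 shows "relation CC Y X (prod.swap ph)" "mat (prod.swap ph) = conv (mat ph)"
proof -
 obtain R f0 f1 where p: "ph = ((R, f0, X), (R, f1, Y))" and s: "(R, f0, X) : Arr CC" "(R, f1, Y) : Arr CC"
  "!!z z'. z : fst R ==> z' : fst R ==> f0 z = f0 z' ==> f1 z = f1 z' ==> z = z'"
  using assms by(rule relationE) blast
 thus "relation CC Y X (prod.swap ph)" unfolding rel_span[OF A U] span_def by simp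
 show "mat (prod.swap ph) = conv (mat ph)" by(auto simp: p mat_def conv_def fun_eq_iff)
qed

text \<open>Tabulation of a predicate: the apex consists of the coded pairs at which
  \<open>M\<close> is inhabited, realized by \<open>M\<close> itself, and the legs are the
  coordinates.\<close>

lemma relation_ex:
 assumes X: "X : (assemblies :: ('u, 'a) assembly set)" and Y: "Y : assemblies"
  and M: "ent2 A M (%x y. cj A (snd X x) (snd Y y))"
 obtains ph where "relation CC X Y ph" "mat ph = M"
proof -
 define S where "S = {a. M (ufst a) (usnd a) ~= {}}"
 define R where "R = (S, %a. M (ufst a) (usnd a))"
 have Mfc: "fc1 A W e (snd X) x & fc1 A W e (snd Y) y" if "fc2 A W e M x y" for W :: "'x set" and e x y
  using ent2D[OF A M that] by(simp add: fc_cj[OF A])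
 have Mne: "x : fst X & y : fst Y" if "M x y ~= {}" for x y
 proof -
  have 1: "fc A {()} (%_. undefined) (%_. M x y)" using that by(auto intro: fc_const[OF A])
  show ?thesis using Mfc[OF 1] fc_ne[of A "{()}" "%_. undefined" _ "()"] asmD(2)[OF X] asmD(2)[OF Y] by blast
 qed
 have Mne': "x : fst X & y : fst Y" if "c : M x y" for c x y using Mne that by blast
 have R: "R : assemblies" unfolding R_def
  by(rule asmI, rule small_upair[OF U asmD(1)[OF X] asmD(1)[OF Y]]) (auto simp: S_def dest: Mne')
 have "(R, restrict ufst S, X) : Arr CC"
  unfolding Ass_arr
 proof(intro conjI R X)
  show "restrict ufst S : fst R \<rightarrow>\<^sub>E fst X" using Mne' by(auto simp: R_def S_def)
  show "ent A (snd R) (%z. snd X (restrict ufst S z))"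
  proof(rule entI[OF A])
   fix W :: "('u, 'a) st1" and e z assume z: "fc1 A W e (snd R) z"
   hence "fc A W e (%w. M (ufst (z w)) (usnd (z w)))" by(simp add: R_def)
   from conjunct1[OF Mfc[OF this]] show "fc A W e (%w. snd X (restrict ufst S (z w)))"
    by(rule fc_mono) (use fc_in[OF R z] in "simp add: R_def")
  qed
 qed
 moreover have "(R, restrict usnd S, Y) : Arr CC"
  unfolding Ass_arr
 proof(intro conjI R Y)
  show "restrict usnd S : fst R \<rightarrow>\<^sub>E fst Y" using Mne' by(auto simp: R_def S_def)
  show "ent A (snd R) (%z. snd Y (restrict usnd S z))"
  proof(rule entI[OF A])
   fix W :: "('u, 'a) st1" and e z assume z: "fc1 A W e (snd R) z"
   hence "fc A W e (%w. M (ufst (z w)) (usnd (z w)))" by(simp add: R_def)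
   from conjunct2[OF Mfc[OF this]] show "fc A W e (%w. snd Y (restrict usnd S (z w)))"
    by(rule fc_mono) (use fc_in[OF R z] in "simp add: R_def")
  qed
 qed
 moreover have "z = z'" if "z : fst R" "z' : fst R" "restrict ufst S z = restrict ufst S z'" "restrict usnd S z = restrict usnd S z'" for z z'
 proof -
  have "ufst z = ufst z'" "usnd z = usnd z'" using that by(simp_all add: R_def)
  hence "upair (ufst z) (usnd z) = upair (ufst z') (usnd z')" by(rule arg_cong2)
  thus ?thesis unfolding ups(3)[OF U] .
 qed
 ultimately have "relation CC X Y ((R, restrict ufst S, X), (R, restrict usnd S, Y))"
  unfolding rel_span[OF A U] span_def by blast
 moreover have "mat ((R, restrict ufst S, X), (R, restrict usnd S, Y)) = M"
 proof(intro ext set_eqI)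
  fix x y c
  have "c : M x y" if "z : S" "restrict ufst S z = x" "restrict usnd S z = y" "c : snd R z" for z
   using that by(auto simp: R_def)
  moreover have "upair x y : {z : S. restrict ufst S z = x & restrict usnd S z = y}" if "c : M x y"
   using that by(auto simp: S_def ups[OF U])
  moreover have "c : snd R (upair x y) <-> c : M x y" by(simp add: R_def ups[OF U])
  ultimately show "c : mat ((R, restrict ufst S, X), (R, restrict usnd S, Y)) x y <-> c : M x y"
   unfolding mat_def by(auto simp: R_def intro!: exI[of _ "upair x y"])
 qed
 ultimately show ?thesis by(rule that)
qed

text \<open>A map of apexes moves realizers. Conversely an inclusion of predicates allows choosing
  an element over each pair, and joint monicity of the second span identifies the witnesses supplied
  by forcing with the chosen ones.\<close>

lemma rel_le_mat:
 assumes "relation CC X Y ph" "relation CC X Y ps"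
 shows "rel_le CC ph ps <-> ent2 A (mat ph) (mat ps)"
proof -
 obtain R f0 f1 where p: "ph = ((R, f0, X), (R, f1, Y))" and f0: "(R, f0, X) : Arr CC" and f1: "(R, f1, Y) : Arr CC"
  and R: "R : assemblies" using assms(1) by(rule relationE)
 obtain S g0 g1 where q: "ps = ((S, g0, X), (S, g1, Y))" and g0: "(S, g0, X) : Arr CC" and g1: "(S, g1, Y) : Arr CC"
  and inj: "!!z z'. z : fst S ==> z' : fst S ==> g0 z = g0 z' ==> g1 z = g1 z' ==> z = z'"
  and S: "S : assemblies" using assms(2) by(rule relationE) blast
 show ?thesis
 proof
  assume "rel_le CC ph ps"
  then obtain h where h: "(R, h, S) : Arr CC" "compose (fst R) g0 h = f0" "compose (fst R) g1 h = f1"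
   unfolding rel_le_def p q by(auto simp: hom_def)
  have e: "g0 (h z) = f0 z" "g1 (h z) = f1 z" if "z : fst R" for z
   using fun_cong[OF h(2), of z] fun_cong[OF h(3), of z] that by(simp_all add: compose_def)
  show "ent2 A (mat ph) (mat ps)"
  proof(rule ent2I[OF A], unfold p q fc_mat, elim exE conjE)
   fix W :: "('u, 'a) st2" and e' x y z assume z: "ALL w:W. z w : fst R & f0 (z w) = x w & f1 (z w) = y w" "fc1 A W e' (snd R) z"
   show "EX z. (ALL w:W. z w : fst S & g0 (z w) = x w & g1 (z w) = y w) & fc1 A W e' (snd S) z"
    using arr_fc[OF A h(1) z(2)] e z(1) arr_app[OF h(1)] by(intro exI[of _ "%w. h (z w)"]) auto
  qed
 next
  assume le: "ent2 A (mat ph) (mat ps)"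
  have "ALL z:fst R. EX s. s : fst S & g0 s = f0 z & g1 s = f1 z"
  proof
   fix z assume z: "z : fst R"
   then obtain b where "b : snd R z" using asmD(2)[OF R] by blast
   hence "fc A {()} (%_. undefined) (%_. mat ph (f0 z) (f1 z))"
    unfolding p fc_mat using z by(auto intro!: exI[of _ "%_. z"] fc_const[OF A])
   from ent2D[OF A le this] show "EX s. s : fst S & g0 s = f0 z & g1 s = f1 z" unfolding q fc_mat by auto
  qed
  from bchoice[OF this] obtain h where h: "!!z. z : fst R ==> h z : fst S & g0 (h z) = f0 z & g1 (h z) = f1 z" by blast
  have "ent A (snd R) (%z. snd S (restrict h (fst R) z))"
  proof(rule entI[OF A])
   fix W :: "('u, 'a) st1" and e z assume z: "fc1 A W e (snd R) z"
   note zR = fc_in[OF R z]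
   have "fc A W e (%w. mat ph (f0 (z w)) (f1 (z w)))" unfolding p fc_mat using z zR by blast
   from ent2D[OF A le this] obtain s where s: "ALL w:W. s w : fst S & g0 (s w) = f0 (z w) & g1 (s w) = f1 (z w)"
    "fc1 A W e (snd S) s" unfolding q fc_mat by blast
   show "fc A W e (%w. snd S (restrict h (fst R) (z w)))"
   proof(rule fc_mono[OF s(2)])
    fix w assume w: "w : W"
    have "s w = h (z w)" by(rule inj) (use s(1) w h[OF zR[OF w]] in simp_all)
    thus "snd S (s w) \<subseteq> snd S (restrict h (fst R) (z w))" using zR[OF w] by simp
   qed
  qed
  hence "(R, restrict h (fst R), S) : Arr CC" using R S h by(auto simp: Ass_arr)
  moreover have "compose (fst R) g0 (restrict h (fst R)) = f0" "compose (fst R) g1 (restrict h (fst R)) = f1"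
   by(rule compose_eq[OF f0], simp add: h, rule compose_eq[OF f1], simp add: h)
  ultimately show "rel_le CC ph ps" unfolding rel_le_def p q
   by(intro bexI[of _ "(R, restrict h (fst R), S)"]) (simp_all add: hom_def)
 qed
qed

text \<open>Replace the codomain of \<open>e\<close> by its image \<open>T'\<close> with the
  realizers inherited from \<open>P\<close>. The coequalized pair is still coequalized, so the
  universal property gives a tracked map from \<open>T\<close> to \<open>T'\<close>; it turns out to
  be the identity function, and its tracker proves the claim.\<close>

lemma regular_epi_ent:
 assumes re: "regular_epi CC (P, e, T)"
 shows "ent A (snd T) (%t. \<Union>c\<in>{c : fst P. e c = t}. snd P c)"
proof -
 define F where "F t = (\<Union>c\<in>{c : fst P. e c = t}. snd P c)" for t
 define T' where "T' = (e ` fst P, F)"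
 have e: "(P, e, T) : Arr CC" using re unfolding regular_epi_def by blast
 obtain u v where u0: "u : Arr CC" "v : Arr CC" and c: "Dom CC u = Dom CC v & Cod CC u = Dom CC (P, e, T) &
   Cod CC v = Dom CC (P, e, T) & Cmp CC (P, e, T) u = Cmp CC (P, e, T) v &
   (ALL h:Arr CC. Dom CC h = Dom CC (P, e, T) & Cmp CC h u = Cmp CC h v -->
    (EX! m. m : hom CC (Cod CC (P, e, T)) (Cod CC h) & Cmp CC m (P, e, T) = h))"
  using re unfolding regular_epi_def by blast
 hence u: "fst u = fst v" "snd (snd u) = P" "snd (snd v) = P" by simp_all
 from c have "Cmp CC (P, e, T) u = Cmp CC (P, e, T) v" by(elim conjE)
 hence uv: "compose (fst (fst u)) e (fst (snd u)) = compose (fst (fst u)) e (fst (snd v))" by(simp add: u(1))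
 have univ: "EX! m. m : hom CC T (snd (snd h)) & Cmp CC m (P, e, T) = h"
  if "h : Arr CC" "fst h = P" "Cmp CC h u = Cmp CC h v" for h
  using c that by(simp del: Ass_simps(5))
 have P: "P : assemblies" and T: "T : assemblies" and eP: "e : fst P \<rightarrow>\<^sub>E fst T" using e by(auto simp: Ass_arr)
 have Fne: "F t ~= {} <-> (EX c. c : fst P & e c = t)" for t unfolding F_def using asmD(2)[OF P] by auto
 have T': "T' : assemblies" unfolding T'_def
  by(rule asmI, rule small_image[OF asmD(1)[OF P]], unfold Fne) auto
 have F_fc: "fc1 A W r F t <-> (EX c. (ALL w:W. c w : fst P & e (c w) = t w) & fc1 A W r (snd P) c)" for W :: "'w set" and r t
  unfolding F_def by(subst fc_Un) auto
 have h: "(P, e, T') : Arr CC"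
  unfolding Ass_arr
 proof(intro conjI P T')
  show "ent A (snd P) (%z. snd T' (e z))"
  proof(rule entI[OF A])
   fix W :: "('u, 'a) st1" and r z assume z: "fc1 A W r (snd P) z"
   have "fc A W r (%w. F (e (z w)))" unfolding F_fc
    by(rule exI[of _ z]) (use z fc_in[OF P z] in simp)
   thus "fc A W r (%w. snd T' (e (z w)))" by(simp add: T'_def)
  qed
 qed (use eP in "auto simp: T'_def")
 have "Cmp CC (P, e, T') u = Cmp CC (P, e, T') v" using uv u(1) by simp
 from univ[OF h _ this] have "EX! m. m : hom CC T T' & Cmp CC m (P, e, T) = (P, e, T')" by(simp del: Ass_simps(5))
 then obtain m where m: "m : hom CC T T'" "Cmp CC m (P, e, T) = (P, e, T')" by blast
 obtain m' where m': "m = (T, m', T')" using m(1) by(cases m) (auto simp: hom_def)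
 have mA: "(T, m', T') : Arr CC" using m(1) m' by(simp add: hom_def)
 have me: "m' (e c) = e c" if "c : fst P" for c
  using m(2) that unfolding m' by(auto simp: compose_def fun_eq_iff split: if_splits)
 have sub: "fc1 A W r (snd T) t" if "fc1 A W r F t" for W :: "'w set" and r t
 proof -
  obtain c where c: "ALL w:W. c w : fst P & e (c w) = t w" "fc1 A W r (snd P) c" using \<open>fc1 A W r F t\<close> unfolding F_fc by blast
  show ?thesis by(rule fc_mono[OF arr_fc[OF A e c(2)]]) (use c(1) in simp)
 qed
 \<comment> \<open>As an endomorphism of \<open>T\<close>, \<open>m'\<close> agrees with the
   identity after \<open>e\<close>; uniqueness of factorizations makes it the identity.\<close>
 have n: "(T, m', T) : Arr CC"
  unfolding Ass_arr
 proof(intro conjI T)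
  have "m' : fst T \<rightarrow>\<^sub>E fst T'" using mA by(simp add: Ass_arr)
  moreover have "fst T' \<subseteq> fst T" using eP by(auto simp: T'_def)
  ultimately show "m' : fst T \<rightarrow>\<^sub>E fst T" by(auto simp: PiE_iff)
  show "ent A (snd T) (%z. snd T (m' z))"
   by(rule entI[OF A], rule sub) (use arr_fc[OF A mA] in "auto simp: T'_def")
 qed
 have "Cmp CC (P, e, T) u = Cmp CC (P, e, T) v" using uv u(1) by simp
 from univ[OF e _ this] have ex1: "EX! k. k : hom CC T T & Cmp CC k (P, e, T) = (P, e, T)" by(simp del: Ass_simps(5))
 have "compose (fst P) m' e = e" by(rule compose_eq[OF e]) (rule me)
 hence 1: "(T, m', T) : hom CC T T & Cmp CC (T, m', T) (P, e, T) = (P, e, T)" using n by(simp add: hom_def)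
 have "(T, restrict (%x. x) (fst T), T) : Arr CC"
  unfolding Ass_arr
 proof(intro conjI T)
  show "ent A (snd T) (%z. snd T (restrict (%x. x) (fst T) z))"
  proof(rule entI[OF A])
   fix W :: "('u, 'a) st1" and r t assume t: "fc1 A W r (snd T) t"
   show "fc A W r (%w. snd T (restrict (%x. x) (fst T) (t w)))"
    by(rule fc_mono[OF t]) (use fc_in[OF T t] in simp)
  qed
 qed auto
 moreover have "compose (fst P) (restrict (%x. x) (fst T)) e = e" by(rule compose_eq[OF e]) (use arr_app[OF e] in simp)
 ultimately have 2: "(T, restrict (%x. x) (fst T), T) : hom CC T T & Cmp CC (T, restrict (%x. x) (fst T), T) (P, e, T) = (P, e, T)"
  by(simp add: hom_def)
 from ex1 1 2 have "(T, m', T) = (T, restrict (%x. x) (fst T), T)" by blast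
 hence id: "m' t = t" if "t : fst T" for t using that by simp
 have "ent A (snd T) F"
 proof(rule entI[OF A])
  fix W :: "('u, 'a) st1" and r t assume t: "fc1 A W r (snd T) t"
  have "fc A W r (%w. snd T' (m' (t w)))" by(rule arr_fc[OF A mA t])
  thus "fc1 A W r F t" by(rule fc_mono) (use id fc_in[OF T t] in "auto simp: T'_def")
 qed
 thus ?thesis by(simp add: F_def[abs_def])
qed

lemma pbo_assembly:
 assumes "R : (assemblies :: ('u, 'a) assembly set)" "S : assemblies"
 shows "pbo A R f S g : assemblies"
proof -
 have "(fst (pbo A R f S g), snd (pbo A R f S g)) : assemblies"
 proof(rule asmI)
  show "small TYPE('u) (fst (pbo A R f S g))"
   by(rule small_upair[OF U asmD(1)[OF assms(1)] asmD(1)[OF assms(2)]]) (simp add: in_pbo[OF assms])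
 qed (simp add: fst_pbo)
 thus ?thesis by simp
qed

lemma Ass_pullback:
 assumes f: "(R, f, Y) : Arr CC" and g: "(S, g, Y) : Arr CC"
 defines "P \<equiv> pbo A R f S g"
 shows "is_pullback CC (R, f, Y) (S, g, Y) (P, restrict ufst (fst P), R) (P, restrict usnd (fst P), S)"
proof -
 have R: "R : assemblies" and S: "S : assemblies" using f g by(simp_all add: Ass_arr)
 have P: "P : assemblies" unfolding P_def by(rule pbo_assembly[OF R S])
 have inP: "a : fst P <-> ufst a : fst R & usnd a : fst S & f (ufst a) = g (usnd a)" for a
  unfolding P_def by(rule in_pbo[OF R S])
 have pA: "(P, restrict ufst (fst P), R) : Arr CC"
  unfolding Ass_arr
 proof(intro conjI P R)
  show "restrict ufst (fst P) : fst P \<rightarrow>\<^sub>E fst R" by(auto simp: inP)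
  show "ent A (snd P) (%z. snd R (restrict ufst (fst P) z))"
  proof(rule entI[OF A])
   fix W :: "('u, 'a) st1" and r z assume z: "fc1 A W r (snd P) z"
   hence "fc A W r (%w. snd R (ufst (z w)))" unfolding P_def fc_pbo[OF A] by blast
   thus "fc A W r (%w. snd R (restrict ufst (fst P) (z w)))" by(rule fc_mono) (use fc_in[OF P z] in simp)
  qed
 qed
 have qA: "(P, restrict usnd (fst P), S) : Arr CC"
  unfolding Ass_arr
 proof(intro conjI P S)
  show "restrict usnd (fst P) : fst P \<rightarrow>\<^sub>E fst S" by(auto simp: inP)
  show "ent A (snd P) (%z. snd S (restrict usnd (fst P) z))"
  proof(rule entI[OF A])
   fix W :: "('u, 'a) st1" and r z assume z: "fc1 A W r (snd P) z"
   hence "fc A W r (%w. snd S (usnd (z w)))" unfolding P_def fc_pbo[OF A] by blast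
   thus "fc A W r (%w. snd S (restrict usnd (fst P) (z w)))" by(rule fc_mono) (use fc_in[OF P z] in simp)
  qed
 qed
 show ?thesis
 proof(rule pbI)
  show "(P, restrict ufst (fst P), R) : hom CC P R" "(P, restrict usnd (fst P), S) : hom CC P S"
   "(R, f, Y) : hom CC R Y" "(S, g, Y) : hom CC S Y" using f g pA qA by(simp_all add: hom_def)
  have "compose (fst P) f (restrict ufst (fst P)) = compose (fst P) g (restrict usnd (fst P))"
   by(simp add: compose_def fun_eq_iff inP restrict_def)
  thus "Cmp CC (R, f, Y) (P, restrict ufst (fst P), R) = Cmp CC (S, g, Y) (P, restrict usnd (fst P), S)" by simp
 next
  fix u v V assume u0: "u : hom CC V R" and v0: "v : hom CC V S" and eq0: "Cmp CC (R, f, Y) u = Cmp CC (S, g, Y) v"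
  obtain k where k: "u = (V, k, R)" "(V, k, R) : Arr CC" using u0 by(cases u) (auto simp: hom_def)
  obtain l where l: "v = (V, l, S)" "(V, l, S) : Arr CC" using v0 by(cases v) (auto simp: hom_def)
  have V: "V : assemblies" using k(2) by(simp add: Ass_arr)
  from eq0 have "compose (fst V) f k = compose (fst V) g l" by(simp add: k l)
  from fun_cong[OF this] have eq: "f (k z) = g (l z)" if "z : fst V" for z using that by(simp add: compose_def) (metis (full_types))
  define h where "h = restrict (%z. upair (k z) (l z)) (fst V)"
  have hz: "ufst (h z) = k z" "usnd (h z) = l z" if "z : fst V" for z using that by(simp_all add: h_def ups[OF U])
  have hA: "(V, h, P) : Arr CC"
   unfolding Ass_arr
  proof(intro conjI V P)
   show "h : fst V \<rightarrow>\<^sub>E fst P"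
   proof(rule PiE_I)
    fix z assume z: "z : fst V"
    show "h z : fst P" unfolding inP hz[OF z] using arr_app[OF k(2) z] arr_app[OF l(2) z] eq[OF z] by simp
   qed (simp add: h_def)
   show "ent A (snd V) (%z. snd P (h z))"
   proof(rule entI[OF A])
    fix W :: "('u, 'a) st1" and r z assume z: "fc1 A W r (snd V) z"
    note zV = fc_in[OF V z]
    show "fc A W r (%w. snd P (h (z w)))" unfolding P_def fc_pbo[OF A]
    proof(intro conjI)
     show "ALL w:W. f (ufst (h (z w))) = g (usnd (h (z w)))" using hz zV eq by simp
     show "fc A W r (%w. snd R (ufst (h (z w))))"
      by(rule fc_mono[OF arr_fc[OF A k(2) z]]) (simp add: hz zV)
     show "fc A W r (%w. snd S (usnd (h (z w))))"
      by(rule fc_mono[OF arr_fc[OF A l(2) z]]) (simp add: hz zV)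
    qed
   qed
  qed
  note hP = arr_app[OF hA]
  show "EX! h. h : hom CC V P & Cmp CC (P, restrict ufst (fst P), R) h = u & Cmp CC (P, restrict usnd (fst P), S) h = v"
  proof(rule ex1I[of _ "(V, h, P)"], intro conjI)
   show "(V, h, P) : hom CC V P" using hA by(simp add: hom_def)
   have "compose (fst V) (restrict ufst (fst P)) h = k" by(rule compose_eq[OF k(2)]) (simp add: hz hP)
   thus "Cmp CC (P, restrict ufst (fst P), R) (V, h, P) = u" by(simp add: k)
   have "compose (fst V) (restrict usnd (fst P)) h = l" by(rule compose_eq[OF l(2)]) (simp add: hz hP)
   thus "Cmp CC (P, restrict usnd (fst P), S) (V, h, P) = v" by(simp add: l)
  next
   fix m assume m0: "m : hom CC V P & Cmp CC (P, restrict ufst (fst P), R) m = u & Cmp CC (P, restrict usnd (fst P), S) m = v"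
   obtain n where n: "m = (V, n, P)" "(V, n, P) : Arr CC" using m0 by(cases m) (auto simp: hom_def)
   have "n = h"
   proof(rule arr_eqI[OF n(2) hA])
    fix z assume z: "z : fst V"
    have c: "compose (fst V) (restrict ufst (fst P)) n = k" "compose (fst V) (restrict usnd (fst P)) n = l"
     using m0 by(simp_all add: n k l)
    have "ufst (n z) = k z" "usnd (n z) = l z"
     using fun_cong[OF c(1), of z] fun_cong[OF c(2), of z] z arr_app[OF n(2) z] by(simp_all add: compose_def)
    hence "upair (ufst (n z)) (usnd (n z)) = h z" using z by(simp add: h_def)
    thus "n z = h z" unfolding ups(3)[OF U] .
   qed
   thus "m = (V, h, P)" using n by simp
  qed
 qed
qed

text \<open>\<open>e\<close> coequalizes its kernel pair \<open>D\<close>. A map respecting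
  \<open>D\<close> descends along any choice of preimages, and the hypothesis provides realizers of
  preimages on which its tracker can work.\<close>

lemma ent_regular_epi:
 assumes e: "(P, e, T) : Arr CC" and c: "ent A (snd T) (%t. \<Union>c\<in>{c : fst P. e c = t}. snd P c)"
 shows "regular_epi CC (P, e, T)"
proof -
 define D where "D = pbo A P e P e"
 note pb = Ass_pullback[OF e e, folded D_def]
 note pD = pbD[OF pb, simplified, simplified hom_def, simplified]
 have P: "P : assemblies" and T: "T : assemblies" using e by(simp_all add: Ass_arr)
 have cov: "EX c. (ALL w:W. c w : fst P & e (c w) = t w) & fc1 A W r (snd P) c" if "fc1 A W r (snd T) t" for W :: "'w set" and r t
  using entD[OF A c that] by(subst (asm) fc_Un) auto
 have surj: "EX c. c : fst P & e c = t" if t: "t : fst T" for t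
 proof -
  obtain b where "b : snd T t" using t asmD(2)[OF T] by blast
  hence "fc A {()} (%_. undefined) (%_. snd T t)" by(rule fc_const[OF A])
  from cov[OF this] show ?thesis by blast
 qed
 have "EX! m. m : hom CC T H & Cmp CC m (P, e, T) = (P, h, H)"
  if h: "(P, h, H) : Arr CC" and eq: "compose (fst D) h (restrict ufst (fst D)) = compose (fst D) h (restrict usnd (fst D))" for h H
 proof -
  have H: "H : assemblies" using h by(simp add: Ass_arr)
  have hh: "h c = h c'" if "c : fst P" "c' : fst P" "e c = e c'" for c c'
  proof -
   have "upair c c' : fst D" unfolding D_def in_pbo[OF P P] using that by(simp add: ups[OF U])
   thus ?thesis using fun_cong[OF eq, of "upair c c'"] by(simp add: compose_def ups[OF U])
  qed
  have "ALL t:fst T. EX c. c : fst P & e c = t" using surj by blast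
  from bchoice[OF this] obtain s where s: "!!t. t : fst T ==> s t : fst P & e (s t) = t" by blast
  define m where "m = restrict (%t. h (s t)) (fst T)"
  have me: "m (e c) = h c" if c: "c : fst P" for c
   using arr_app[OF e c] s[of "e c"] hh[of "s (e c)" c] c by(simp add: m_def)
  have mA: "(T, m, H) : Arr CC"
   unfolding Ass_arr
  proof(intro conjI T H)
   show "m : fst T \<rightarrow>\<^sub>E fst H" using s arr_app[OF h] by(auto simp: m_def)
   show "ent A (snd T) (%t. snd H (m t))"
   proof(rule entI[OF A])
    fix W :: "('u, 'a) st1" and r t assume "fc1 A W r (snd T) t"
    from cov[OF this] obtain c where c: "ALL w:W. c w : fst P & e (c w) = t w" "fc1 A W r (snd P) c" by blast
    show "fc A W r (%w. snd H (m (t w)))"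
    proof(rule fc_mono[OF arr_fc[OF A h c(2)]])
     fix w assume "w : W"
     hence "m (t w) = h (c w)" using me[of "c w"] c(1) by auto
     thus "snd H (h (c w)) \<subseteq> snd H (m (t w))" by simp
    qed
   qed
  qed
  have ce: "compose (fst P) m e = h" by(rule compose_eq[OF h]) (rule me)
  show ?thesis
  proof(rule ex1I[of _ "(T, m, H)"])
   show "(T, m, H) : hom CC T H & Cmp CC (T, m, H) (P, e, T) = (P, h, H)" using mA ce by(simp add: hom_def)
   fix n assume n0: "n : hom CC T H & Cmp CC n (P, e, T) = (P, h, H)"
   obtain n' where n: "n = (T, n', H)" "(T, n', H) : Arr CC" using n0 by(cases n) (auto simp: hom_def)
   have "n' = m"
   proof(rule arr_eqI[OF n(2) mA])
    fix t assume "t : fst T"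
    then obtain c where c: "c : fst P" "e c = t" using surj by blast
    have "compose (fst P) n' e = h" using n0 by(simp add: n)
    from fun_cong[OF this, of c] show "n' t = m t" using c me[of c] by(simp add: compose_def)
   qed
   thus "n = (T, m, H)" using n by simp
  qed
 qed
 note univ = this
 show ?thesis
  unfolding regular_epi_def
 proof(intro conjI bexI)
  show "(P, e, T) : Arr CC" by(rule e)
  show "Dom CC (D, restrict ufst (fst D), P) = Dom CC (D, restrict usnd (fst D), P)"
   "Cod CC (D, restrict ufst (fst D), P) = Dom CC (P, e, T)" "Cod CC (D, restrict usnd (fst D), P) = Dom CC (P, e, T)" by simp_all
  show "Cmp CC (P, e, T) (D, restrict ufst (fst D), P) = Cmp CC (P, e, T) (D, restrict usnd (fst D), P)"
   using pbD(5)[OF pb] .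
  show "(D, restrict ufst (fst D), P) : Arr CC" "(D, restrict usnd (fst D), P) : Arr CC"
   using homD(1)[OF pbD(1)[OF pb]] homD(1)[OF pbD(2)[OF pb]] by auto
  show "ALL h:Arr CC. Dom CC h = Dom CC (P, e, T) & Cmp CC h (D, restrict ufst (fst D), P) = Cmp CC h (D, restrict usnd (fst D), P) -->
   (EX! m. m : hom CC (Cod CC (P, e, T)) (Cod CC h) & Cmp CC m (P, e, T) = h)"
  proof(intro ballI impI)
   fix k assume k: "k : Arr CC" "Dom CC k = Dom CC (P, e, T) & Cmp CC k (D, restrict ufst (fst D), P) = Cmp CC k (D, restrict usnd (fst D), P)"
   then obtain h H where kh: "k = (P, h, H)" by(cases k) auto
   show "EX! m. m : hom CC (Cod CC (P, e, T)) (Cod CC k) & Cmp CC m (P, e, T) = k"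
    using univ[of h H] k unfolding kh by simp
  qed
 qed
qed

text \<open>By joint monicity the element found over the two coordinates can only be
  \<open>z\<close>.\<close>

lemma relation_fc:
 assumes "relation CC X Y ((R, f0, X), (R, f1, Y))" "fc A W e (%w. mat ((R, f0, X), (R, f1, Y)) (f0 (z w)) (f1 (z w)))"
  "!!w. w : W ==> z w : fst R"
 shows "fc1 A W e (snd R) z"
proof -
 obtain R' g0 g1 where *: "((R, f0, X), (R, f1, Y)) = ((R', g0, X), (R', g1, Y))"
  "!!z z'. z : fst R' ==> z' : fst R' ==> g0 z = g0 z' ==> g1 z = g1 z' ==> z = z'"
  using assms(1) by(rule relationE) blast
 obtain s where s: "ALL w:W. s w : fst R & f0 (s w) = f0 (z w) & f1 (s w) = f1 (z w)" "fc1 A W e (snd R) s"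
  using assms(2) unfolding fc_mat by blast
 show ?thesis
 proof(rule fc_mono[OF s(2)])
  fix w assume w: "w : W"
  have "s w = z w" by(rule *(2)) (use *(1) s(1) w assms(3)[OF w] in simp_all)
  thus "snd R (s w) \<subseteq> snd R (z w)" by simp
 qed
qed

text \<open>The pullback accounts for the conjunction in \<open>rc\<close> and the regular
  epimorphism for its existential quantifier. An arbitrary pullback square is compared with the
  explicit one \<open>P0\<close>.\<close>

lemma rel_comp_mat:
 assumes r: "relation CC X Y ph" and s: "relation CC Y Z ps"
 shows "rel_comp CC ph ps t <-> relation CC X Z t & eqr A (rc A (mat ph) (mat ps)) (mat t)"
proof -
 obtain R f0 f1 where p: "ph = ((R, f0, X), (R, f1, Y))" and f0: "(R, f0, X) : Arr CC" and f1: "(R, f1, Y) : Arr CC"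
  and R: "R : assemblies" using r by(rule relationE)
 obtain S g0 g1 where q: "ps = ((S, g0, Y), (S, g1, Z))" and g0: "(S, g0, Y) : Arr CC" and g1: "(S, g1, Z) : Arr CC"
  and S: "S : assemblies" using s by(rule relationE)
 have fc: "fc2 A W e (rc A (mat ph) (mat ps)) x z <-> (EX a b. (ALL w:W. a w : fst R & b w : fst S & f0 (a w) = x w &
   f1 (a w) = g0 (b w) & g1 (b w) = z w) & fc1 A W e (snd R) a & fc1 A W e (snd S) b)" for W :: "'w set" and e x z
  unfolding fc_rc[OF A] p q fc_mat
 proof
  assume "EX y. (EX a. (ALL w:W. a w : fst R & f0 (a w) = x w & f1 (a w) = y w) & fc1 A W e (snd R) a) &
    (EX b. (ALL w:W. b w : fst S & g0 (b w) = y w & g1 (b w) = z w) & fc1 A W e (snd S) b)"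
  then obtain y a b where "ALL w:W. a w : fst R & f0 (a w) = x w & f1 (a w) = y w" "fc1 A W e (snd R) a"
   "ALL w:W. b w : fst S & g0 (b w) = y w & g1 (b w) = z w" "fc1 A W e (snd S) b" by blast
  thus "EX a b. (ALL w:W. a w : fst R & b w : fst S & f0 (a w) = x w & f1 (a w) = g0 (b w) & g1 (b w) = z w) &
    fc1 A W e (snd R) a & fc1 A W e (snd S) b"
   by(intro exI[of _ a] exI[of _ b]) simp
 next
  assume "EX a b. (ALL w:W. a w : fst R & b w : fst S & f0 (a w) = x w & f1 (a w) = g0 (b w) & g1 (b w) = z w) &
    fc1 A W e (snd R) a & fc1 A W e (snd S) b"
  then obtain a b where *: "ALL w:W. a w : fst R & b w : fst S & f0 (a w) = x w & f1 (a w) = g0 (b w) & g1 (b w) = z w"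
    "fc1 A W e (snd R) a" "fc1 A W e (snd S) b" by blast
  show "EX y. (EX a. (ALL w:W. a w : fst R & f0 (a w) = x w & f1 (a w) = y w) & fc1 A W e (snd R) a) &
    (EX b. (ALL w:W. b w : fst S & g0 (b w) = y w & g1 (b w) = z w) & fc1 A W e (snd S) b)"
   by(intro exI[of _ "%w. f1 (a w)"] conjI exI[of _ a] exI[of _ b]) (use * in simp_all)
 qed
 define P0 where "P0 = pbo A R f1 S g0"
 note pb0 = Ass_pullback[OF f1 g0, folded P0_def]
 have P0: "P0 : assemblies" unfolding P0_def by(rule pbo_assembly[OF R S])
 have inP0: "a : fst P0 <-> ufst a : fst R & usnd a : fst S & f1 (ufst a) = g0 (usnd a)" for a
  unfolding P0_def by(rule in_pbo[OF R S])
 have fcP0: "fc1 A W e (snd P0) a <-> (ALL w:W. f1 (ufst (a w)) = g0 (usnd (a w))) &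
   fc A W e (%w. snd R (ufst (a w))) & fc A W e (%w. snd S (usnd (a w)))" for W :: "'w set" and e a
  unfolding P0_def by(rule fc_pbo[OF A])
 show ?thesis
 proof
  assume rcmp: "rel_comp CC ph ps t"
  hence t: "relation CC X Z t" unfolding rel_comp_def p q by simp
  obtain T t0 t1 where tt: "t = ((T, t0, X), (T, t1, Z))" and t0: "(T, t0, X) : Arr CC" and t1: "(T, t1, Z) : Arr CC"
   and T: "T : assemblies" using t by(rule relationE)
  obtain pp qq ee where pb: "is_pullback CC (R, f1, Y) (S, g0, Y) pp qq" and re: "regular_epi CC ee"
   and e0: "ee : hom CC (Dom CC pp) T" and ce: "Cmp CC (T, t0, X) ee = Cmp CC (R, f0, X) pp" "Cmp CC (T, t1, Z) ee = Cmp CC (S, g1, Z) qq"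
   using rcmp unfolding rel_comp_def p q tt by auto
  obtain P a where pp: "pp = (P, a, R)" "(P, a, R) : Arr CC" using pbD(1)[OF pb] by(cases pp) (auto simp: hom_def)
  obtain b where qq: "qq = (P, b, S)" "(P, b, S) : Arr CC" using pbD(2)[OF pb] pp by(cases qq) (auto simp: hom_def)
  obtain e where ee: "ee = (P, e, T)" "(P, e, T) : Arr CC" using e0 pp by(cases ee) (auto simp: hom_def)
  have P: "P : assemblies" using pp(2) by(simp add: Ass_arr)
  have cz: "t0 (e c) = f0 (a c)" "t1 (e c) = g1 (b c)" "f1 (a c) = g0 (b c)" if "c : fst P" for c
  proof -
   have "compose (fst P) t0 e = compose (fst P) f0 a" "compose (fst P) t1 e = compose (fst P) g1 b"
    "compose (fst P) f1 a = compose (fst P) g0 b"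
    using ce pbD(5)[OF pb] by(simp_all add: pp qq ee)
   from this[THEN fun_cong, of c] show "t0 (e c) = f0 (a c)" "t1 (e c) = g1 (b c)" "f1 (a c) = g0 (b c)"
    using that by(simp_all add: compose_def)
  qed
  obtain k0 where k0: "k0 : hom CC P0 P" "Cmp CC pp k0 = (P0, restrict ufst (fst P0), R)" "Cmp CC qq k0 = (P0, restrict usnd (fst P0), S)"
  proof -
   have "EX! k. k : hom CC P0 P & Cmp CC pp k = (P0, restrict ufst (fst P0), R) & Cmp CC qq k = (P0, restrict usnd (fst P0), S)"
    using pbD(6)[OF pb, of "(P0, restrict ufst (fst P0), R)" P0 "(P0, restrict usnd (fst P0), S)"]
     pbD(1,2,5)[OF pb0] by(simp add: pp del: Ass_simps(5))
   thus ?thesis using that by blast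
  qed
  obtain k where k: "k0 = (P0, k, P)" "(P0, k, P) : Arr CC" using k0(1) by(cases k0) (auto simp: hom_def)
  have kk: "a (k c) = ufst c" "b (k c) = usnd c" if "c : fst P0" for c
  proof -
   have "compose (fst P0) a k = restrict ufst (fst P0)" "compose (fst P0) b k = restrict usnd (fst P0)"
    using k0(2,3) by(simp_all add: pp qq k)
   from this[THEN fun_cong, of c] show "a (k c) = ufst c" "b (k c) = usnd c" using that by(simp_all add: compose_def)
  qed
  have "eqr A (rc A (mat ph) (mat ps)) (mat t)"
  proof(rule eqrI[OF A], rule iffI)
   fix W :: "('u, 'a) st2" and r x z
   assume "fc2 A W r (rc A (mat ph) (mat ps)) x z"
   then obtain c d where c: "ALL w:W. c w : fst R & d w : fst S & f0 (c w) = x w & f1 (c w) = g0 (d w) & g1 (d w) = z w"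
    "fc1 A W r (snd R) c" "fc1 A W r (snd S) d" unfolding fc by blast
   have u: "fc A W r (%w. snd P0 (upair (c w) (d w)))" unfolding fcP0 using c by(simp add: ups[OF U])
   note uin = fc_in[OF P0 u]
   show "fc2 A W r (mat t) x z" unfolding tt fc_mat
   proof(intro exI conjI ballI)
    show "fc A W r (%w. snd T (e (k (upair (c w) (d w)))))" by(rule arr_fc[OF A ee(2) arr_fc[OF A k(2) u]])
    fix w assume w: "w : W"
    note kin = arr_app[OF k(2) uin[OF w]]
    show "e (k (upair (c w) (d w))) : fst T" by(rule arr_app[OF ee(2) kin])
    show "t0 (e (k (upair (c w) (d w)))) = x w" "t1 (e (k (upair (c w) (d w)))) = z w"
     using cz[OF kin] kk[OF uin[OF w]] c(1) w by(simp_all add: ups[OF U])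
   qed
  next
   fix W :: "('u, 'a) st2" and r x z
   assume "fc2 A W r (mat t) x z"
   then obtain y where y: "ALL w:W. y w : fst T & t0 (y w) = x w & t1 (y w) = z w" "fc1 A W r (snd T) y"
    unfolding tt fc_mat by blast
   have "fc A W r (%w. \<Union>c\<in>{c : fst P. e c = y w}. snd P c)"
    by(rule entD[OF A regular_epi_ent y(2)]) (use re ee in simp)
   then obtain c where c: "ALL w:W. c w : fst P & e (c w) = y w" "fc1 A W r (snd P) c"
    by(subst (asm) fc_Un) auto
   show "fc2 A W r (rc A (mat ph) (mat ps)) x z" unfolding fc
   proof(intro exI conjI)
    show "fc A W r (%w. snd R (a (c w)))" "fc A W r (%w. snd S (b (c w)))"
     by(rule arr_fc[OF A pp(2) c(2)]) (rule arr_fc[OF A qq(2) c(2)])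
    show "ALL w:W. a (c w) : fst R & b (c w) : fst S & f0 (a (c w)) = x w & f1 (a (c w)) = g0 (b (c w)) & g1 (b (c w)) = z w"
    proof
     fix w assume w: "w : W"
     hence cw: "c w : fst P" "e (c w) = y w" using c(1) by simp_all
     show "a (c w) : fst R & b (c w) : fst S & f0 (a (c w)) = x w & f1 (a (c w)) = g0 (b (c w)) & g1 (b (c w)) = z w"
      using arr_app[OF pp(2) cw(1)] arr_app[OF qq(2) cw(1)] cz[OF cw(1)] cw(2) y(1) w by simp
    qed
   qed
  qed
  with t show "relation CC X Z t & eqr A (rc A (mat ph) (mat ps)) (mat t)" ..
 next
  assume tt': "relation CC X Z t & eqr A (rc A (mat ph) (mat ps)) (mat t)"
  hence t: "relation CC X Z t" and eq: "eqr A (rc A (mat ph) (mat ps)) (mat t)" by simp_all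
  obtain T t0 t1 where tt: "t = ((T, t0, X), (T, t1, Z))" and t0: "(T, t0, X) : Arr CC" and t1: "(T, t1, Z) : Arr CC"
   and T: "T : assemblies" using t by(rule relationE)
  have P0c: "fc A W r (%w. mat t (f0 (ufst (c w))) (g1 (usnd (c w))))" if c: "fc1 A W r (snd P0) c" for W :: "'w set" and r c
  proof -
   have "fc A W r (%w. rc A (mat ph) (mat ps) (f0 (ufst (c w))) (g1 (usnd (c w))))"
    unfolding fc by(intro exI[of _ "%w. ufst (c w)"] exI[of _ "%w. usnd (c w)"] conjI)
     (use fc_in[OF P0 c] c in "simp_all add: inP0 fcP0")
   thus ?thesis unfolding fc_eqr[OF A eq] .
  qed
  have "ALL c:fst P0. EX y. y : fst T & t0 y = f0 (ufst c) & t1 y = g1 (usnd c)"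
  proof
   fix c assume "c : fst P0"
   then obtain b where "b : snd P0 c" using asmD(2)[OF P0] by blast
   hence "fc A {()} (%_. undefined) (%_. snd P0 c)" by(rule fc_const[OF A])
   from P0c[OF this] show "EX y. y : fst T & t0 y = f0 (ufst c) & t1 y = g1 (usnd c)" unfolding tt fc_mat by auto
  qed
  from bchoice[OF this] obtain e' where e': "!!c. c : fst P0 ==> e' c : fst T & t0 (e' c) = f0 (ufst c) & t1 (e' c) = g1 (usnd c)" by blast
  define e where "e = restrict e' (fst P0)"
  have e: "e c : fst T" "t0 (e c) = f0 (ufst c)" "t1 (e c) = g1 (usnd c)" if "c : fst P0" for c using e'[OF that] that by(simp_all add: e_def)
  have eA: "(P0, e, T) : Arr CC"
   unfolding Ass_arr
  proof(intro conjI P0 T)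
   show "e : fst P0 \<rightarrow>\<^sub>E fst T" using e(1) by(auto simp: e_def)
   show "ent A (snd P0) (%c. snd T (e c))"
   proof(rule entI[OF A])
    fix W :: "('u, 'a) st1" and r c assume c: "fc1 A W r (snd P0) c"
    note cin = fc_in[OF P0 c]
    show "fc A W r (%w. snd T (e (c w)))"
    proof(rule relation_fc[OF t[unfolded tt]])
     show "fc A W r (%w. mat ((T, t0, X), T, t1, Z) (t0 (e (c w))) (t1 (e (c w))))"
      by(rule fc_mono[OF P0c[OF c, unfolded tt]]) (simp add: e[OF cin])
    qed (rule e(1)[OF cin])
   qed
  qed
  have "ent A (snd T) (%y. \<Union>c\<in>{c : fst P0. e c = y}. snd P0 c)"
  proof(rule entI[OF A])
   fix W :: "('u, 'a) st1" and r y assume y: "fc1 A W r (snd T) y"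
   note yin = fc_in[OF T y]
   have "fc A W r (%w. mat t (t0 (y w)) (t1 (y w)))" unfolding tt fc_mat using y yin by(intro exI[of _ y]) simp
   then obtain a b where ab: "ALL w:W. a w : fst R & b w : fst S & f0 (a w) = t0 (y w) & f1 (a w) = g0 (b w) & g1 (b w) = t1 (y w)"
    "fc1 A W r (snd R) a" "fc1 A W r (snd S) b" unfolding fc_eqr[OF A eq, symmetric] fc by blast
   have u: "fc A W r (%w. snd P0 (upair (a w) (b w)))" unfolding fcP0 using ab by(simp add: ups[OF U])
   obtain T' h0 h1 where *: "((T, t0, X), (T, t1, Z)) = ((T', h0, X), (T', h1, Z))"
    "!!z z'. z : fst T' ==> z' : fst T' ==> h0 z = h0 z' ==> h1 z = h1 z' ==> z = z'"
    using t[unfolded tt] by(rule relationE) blast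
   have "e (upair (a w) (b w)) = y w" if w: "w : W" for w
    by(rule *(2)) (use *(1) e[OF fc_in[OF P0 u w]] yin[OF w] ab(1) w in "simp_all add: ups[OF U]")
   thus "fc A W r (%w. \<Union>c\<in>{c : fst P0. e c = y w}. snd P0 c)"
    by(subst fc_Un) (use u fc_in[OF P0 u] in \<open>auto intro!: exI[of _ "%w. upair (a w) (b w)"]\<close>)
  qed
  from ent_regular_epi[OF eA this] have re: "regular_epi CC (P0, e, T)" .
  have "compose (fst P0) t0 e = compose (fst P0) f0 (restrict ufst (fst P0))"
   "compose (fst P0) t1 e = compose (fst P0) g1 (restrict usnd (fst P0))"
   using e by(simp_all add: compose_def fun_eq_iff restrict_def)
  thus "rel_comp CC ph ps t"
   unfolding rel_comp_def p q tt using t[unfolded tt] pb0 re eA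
   by(intro conjI exI[of _ "(P0, restrict ufst (fst P0), R)"] exI[of _ "(P0, restrict usnd (fst P0), S)"] exI[of _ "(P0, e, T)"])
    (simp_all add: hom_def)
 qed
qed

abbreviation (input) RR where "RR \<equiv> RT TYPE('u) A"

lemma rel_comp_ex:
 assumes r: "relation CC X Y ph" and s: "relation CC Y Z ps"
 obtains t where "relation CC X Z t" "mat t = rc A (mat ph) (mat ps)" "rel_comp CC ph ps t"
proof -
 have "ent2 A (rc A (mat ph) (mat ps)) (%x y. cj A (snd X x) (snd Z y))"
 proof(rule ent2I[OF A], unfold fc_rc[OF A] fc_cj[OF A], elim exE conjE)
  fix W :: "('u, 'a) st2" and e x z y
  assume "fc2 A W e (mat ph) x y" "fc2 A W e (mat ps) y z"
  from relation_strict(1)[OF r this(1)] relation_strict(2)[OF s this(2)]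
  show "fc1 A W e (snd X) x & fc1 A W e (snd Z) z" ..
 qed
 from relation_ex[OF relation_obj(1)[OF r] relation_obj(2)[OF s] this]
 obtain t where t: "relation CC X Z t" "mat t = rc A (mat ph) (mat ps)" .
 hence "rel_comp CC ph ps t" unfolding rel_comp_mat[OF r s] by(simp add: eqr_def ent2_refl[OF A])
 with t show ?thesis by(rule that)
qed

text \<open>All composites have equivalent predicates, so a statement about every composite may be
  evaluated at the one from \<open>rel_comp_ex\<close>.\<close>

lemma rel_comp_le:
 assumes r: "relation CC X Y ph" and s: "relation CC Y Z ps" and k: "relation CC X Z ch"
 shows "(ALL t. rel_comp CC ph ps t --> rel_le CC t ch) <-> ent2 A (rc A (mat ph) (mat ps)) (mat ch)"
  "(ALL t. rel_comp CC ph ps t --> rel_le CC ch t) <-> ent2 A (mat ch) (rc A (mat ph) (mat ps))"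
proof -
 obtain t0 where t0: "relation CC X Z t0" "mat t0 = rc A (mat ph) (mat ps)" "rel_comp CC ph ps t0" by(rule rel_comp_ex[OF r s])
 show "(ALL t. rel_comp CC ph ps t --> rel_le CC t ch) <-> ent2 A (rc A (mat ph) (mat ps)) (mat ch)" (is "?L <-> ?R")
 proof
  assume ?L
  hence "rel_le CC t0 ch" using t0(3) by blast
  thus ?R unfolding rel_le_mat[OF t0(1) k] t0(2) .
 next
  assume R: ?R
  show ?L
  proof(intro allI impI)
   fix t assume "rel_comp CC ph ps t"
   hence t: "relation CC X Z t" "eqr A (rc A (mat ph) (mat ps)) (mat t)" unfolding rel_comp_mat[OF r s] by simp_all
   hence "ent2 A (mat t) (rc A (mat ph) (mat ps))" unfolding eqr_def by simp
   from ent2_trans[OF A this R] show "rel_le CC t ch" unfolding rel_le_mat[OF t(1) k] .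
  qed
 qed
 show "(ALL t. rel_comp CC ph ps t --> rel_le CC ch t) <-> ent2 A (mat ch) (rc A (mat ph) (mat ps))" (is "?L <-> ?R")
 proof
  assume ?L
  hence "rel_le CC ch t0" using t0(3) by blast
  thus ?R unfolding rel_le_mat[OF k t0(1)] t0(2) .
 next
  assume R: ?R
  show ?L
  proof(intro allI impI)
   fix t assume "rel_comp CC ph ps t"
   hence t: "relation CC X Z t" "eqr A (rc A (mat ph) (mat ps)) (mat t)" unfolding rel_comp_mat[OF r s] by simp_all
   hence "ent2 A (rc A (mat ph) (mat ps)) (mat t)" unfolding eqr_def by simp
   from ent2_trans[OF A R this] show "rel_le CC ch t" unfolding rel_le_mat[OF k t(1)] .
  qed
 qed
qed

lemma diagonal_relation:
 assumes X: "X : (assemblies :: ('u, 'a) assembly set)"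
 shows "relation CC X X (Idn CC X, Idn CC X)" "mat (Idn CC X, Idn CC X) = (%x y. if x = y then snd X x else {})"
proof -
 have "ent A (snd X) (%z. snd X (restrict (%x. x) (fst X) z))"
 proof(rule entI[OF A])
  fix W :: "('u, 'a) st1" and r t assume t: "fc1 A W r (snd X) t"
  show "fc A W r (%w. snd X (restrict (%x. x) (fst X) (t w)))"
   by(rule fc_mono[OF t]) (use fc_in[OF X t] in simp)
 qed
 hence "(X, restrict (%x. x) (fst X), X) : Arr CC" using X by(simp add: Ass_arr)
 thus "relation CC X X (Idn CC X, Idn CC X)" unfolding rel_span[OF A U] span_def by simp
 show "mat (Idn CC X, Idn CC X) = (%x y. if x = y then snd X x else {})"
 proof(intro ext)
  fix x y show "mat (Idn CC X, Idn CC X) x y = (if x = y then snd X x else {})"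
   using asmD(2)[OF X, of x] by(cases "x : fst X") (auto simp: mat_def)
 qed
qed

lemma equivalence_iff:
 "eqrel CC X r <-> relation CC X X r & ent A (snd X) (%x. mat r x x) &
  ent2 A (conv (mat r)) (mat r) & ent2 A (rc A (mat r) (mat r)) (mat r)"
proof(cases "relation CC X X r")
 case r: True
 note X = relation_obj(1)[OF r] note s = relation_swap[OF r]
 have "ent2 A (%x y. if x = y then snd X x else {}) (mat r) <-> ent A (snd X) (%x. mat r x x)"
  unfolding ent2_def ent_def by(metis empty_iff)
 thus ?thesis
  unfolding equivalence_relation_def rel_comp_le(1)[OF r r r] rel_le_mat[OF s(1) r] s(2)
   rel_le_mat[OF diagonal_relation(1)[OF X] r] diagonal_relation(2)[OF X] by simp
next
 case False
 thus ?thesis unfolding equivalence_relation_def by simp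
qed

lemma tobj_rto:
 assumes e: "eqrel CC X r"
 shows "tobj A (rto r)" "fst (rto r) = fst X" "snd (rto r) = mat r"
  "ent A (snd X) (%x. mat r x x)" "relation CC X X r"
proof -
 note e' = e[unfolded equivalence_iff]
 thus r: "relation CC X X r" and refl: "ent A (snd X) (%x. mat r x x)" by simp_all
 note X = relation_obj(1)[OF r]
 show 1: "fst (rto r) = fst X" "snd (rto r) = mat r" using relation_cod(1)[OF r] by(simp_all add: rto_def)
 show "tobj A (rto r)"
 proof(rule tobjI[OF A]; unfold 1)
  show "small TYPE('u) (fst X)" by(rule asmD(1)[OF X])
 next
  fix x y assume "mat r x y ~= {}"
  hence f: "fc A {()} (%_. undefined) (%_. mat r x y)" by(auto intro: fc_const[OF A])
  show "x : fst X & y : fst X"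
   using relation_strict(1)[OF r f] relation_strict(2)[OF r f] fc_ne asmD(2)[OF X] by(metis singletonI)
 next
  fix x assume "x : fst X"
  then obtain b where "b : snd X x" using asmD(2)[OF X] by blast
  thus "mat r x x ~= {}" using refl unfolding ent_def by blast
 next
  fix W :: "('u, 'a) st2" and e x y assume "fc2 A W e (mat r) x y"
  thus "fc2 A W e (mat r) y x" using ent2D[OF A, of "conv (mat r)" "mat r" W e y x] e' by simp
 next
  fix W :: "('u, 'a) st3" and e x y z
  assume "fc2 A W e (mat r) x y" "fc2 A W e (mat r) y z"
  hence "fc2 A W e (rc A (mat r) (mat r)) x z" unfolding fc_rc[OF A] by blast
  thus "fc2 A W e (mat r) x z" using ent2D[OF A] e' by blast
 qed
qed

lemma rto_surj:
 assumes P: "tobj A (P :: ('u, 'a) tob)"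
 obtains X r where "X : assemblies" "eqrel CC X r" "rto r = P"
proof -
 define X where "X = (fst P, %x. snd P x x)"
 have X: "X : assemblies" unfolding X_def by(rule asmI[OF tobjD(1)[OF P]]) (use tobjD(2,4)[OF P] in blast)
 have "ent2 A (snd P) (%x y. cj A (snd X x) (snd X y))"
  by(rule ent2I[OF A], unfold fc_cj[OF A]) (simp add: X_def tobj_refl1[OF A P] tobj_refl2[OF A P])
 from relation_ex[OF X X this] obtain r where r: "relation CC X X r" "mat r = snd P" .
 have "eqrel CC X r" unfolding equivalence_iff r(2)
 proof(intro conjI r(1))
  show "ent A (snd X) (%x. snd P x x)" by(rule entI[OF A]) (simp add: X_def)
  show "ent2 A (conv (snd P)) (snd P)" by(rule ent2I[OF A]) (simp add: tobj_sym[OF A P])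
  show "ent2 A (rc A (snd P) (snd P)) (snd P)"
   by(rule ent2I[OF A], unfold fc_rc[OF A]) (blast intro: tobj_trans[OF A P])
 qed
 moreover have "rto r = P" using relation_cod(1)[OF r(1)] r(2) by(simp add: rto_def X_def)
 ultimately show ?thesis using X that by blast
qed

lemma functional_iff:
 assumes r: "eqrel CC X r" and s: "eqrel CC Y s"
 shows "functional_relation CC r s ph <-> relation CC X Y ph & frel A (rto r) (rto s) (mat ph)"
proof -
 note R = tobj_rto[OF r] and S = tobj_rto[OF s]
 note Rs = R(1)[THEN tobj_sym[OF A], unfolded R(3)] and Ss = S(1)[THEN tobj_sym[OF A], unfolded S(3)]
 have c: "Cod CC (fst r) = X" "Cod CC (fst s) = Y" using relation_cod(1)[OF R(5)] relation_cod(1)[OF S(5)] by simp_all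
 show ?thesis
 proof(cases "relation CC X Y ph")
  case p: True
  note sw = relation_swap[OF p]
  have f: "functional_relation CC r s ph <-> ent2 A (rc A (mat r) (mat ph)) (mat ph) & ent2 A (rc A (mat ph) (mat s)) (mat ph) &
   ent2 A (rc A (conv (mat ph)) (mat ph)) (mat s) & ent2 A (mat r) (rc A (mat ph) (conv (mat ph)))"
   unfolding functional_relation_def c rel_comp_le(1)[OF R(5) p p] rel_comp_le(1)[OF p S(5) p]
    rel_comp_le(1)[OF sw(1) p S(5)] rel_comp_le(2)[OF p sw(1) R(5)] sw(2) using p by simp
  have "functional_relation CC r s ph <-> frel A (rto r) (rto s) (mat ph)"
  proof
   assume "functional_relation CC r s ph"
   note f' = this[unfolded f]
   show "frel A (rto r) (rto s) (mat ph)"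
   proof(rule frelI[OF A]; unfold R(3) S(3))
    fix W :: "('u, 'a) st2" and e x y assume "fc2 A W e (mat ph) x y"
    from entD[OF A R(4) relation_strict(1)[OF p this]] entD[OF A S(4) relation_strict(2)[OF p this]]
    show "fc2 A W e (mat r) x x & fc2 A W e (mat s) y y" ..
   next
    fix W :: "('u, 'a) st3" and e x x' y assume "fc2 A W e (mat ph) x y" "fc2 A W e (mat r) x x'"
    hence "fc2 A W e (rc A (mat r) (mat ph)) x' y" unfolding fc_rc[OF A] using Rs by blast
    thus "fc2 A W e (mat ph) x' y" by(rule ent2D[OF A conjunct1[OF f']])
   next
    fix W :: "('u, 'a) st3" and e x y y' assume "fc2 A W e (mat ph) x y" "fc2 A W e (mat s) y y'"
    hence "fc2 A W e (rc A (mat ph) (mat s)) x y'" unfolding fc_rc[OF A] by blast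
    thus "fc2 A W e (mat ph) x y'" by(rule ent2D[OF A conjunct1[OF conjunct2[OF f']]])
   next
    fix W :: "('u, 'a) st3" and e x y y' assume "fc2 A W e (mat ph) x y" "fc2 A W e (mat ph) x y'"
    hence "fc2 A W e (rc A (conv (mat ph)) (mat ph)) y y'" unfolding fc_rc[OF A] fc_conv by blast
    thus "fc2 A W e (mat s) y y'" by(rule ent2D[OF A conjunct1[OF conjunct2[OF conjunct2[OF f']]]])
   next
    fix W :: "('u, 'a) st1" and e x assume "fc2 A W e (mat r) x x"
    from ent2D[OF A conjunct2[OF conjunct2[OF conjunct2[OF f']]] this]
    show "EX y. fc2 A W e (mat ph) x y" unfolding fc_rc[OF A] by blast
   qed
  next
   assume F: "frel A (rto r) (rto s) (mat ph)"
   note d = frelD[OF A F, unfolded R(3) S(3)]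
   show "functional_relation CC r s ph" unfolding f
   proof(intro conjI; rule ent2I[OF A]; unfold fc_rc[OF A] fc_conv; (elim exE conjE)?)
    fix W :: "('u, 'a) st2" and e x y assume xy: "fc2 A W e (mat r) x y"
    hence "fc2 A W e (snd (rto r)) x x" using tobj_refl1[OF A R(1)] by(simp add: R(3))
    then obtain z where "fc2 A W e (mat ph) x z" by(rule frel_total[OF A F])
    thus "EX z. fc2 A W e (mat ph) x z & fc2 A W e (mat ph) y z" using d(3)[OF _ xy] by blast
   qed (erule (1) d(3)[OF _ Rs] d(4) d(5))+
  qed
  thus ?thesis using p by simp
 next
  case False
  thus ?thesis unfolding functional_relation_def c by simp
 qed
qed

lemma rel_class_iff:
 assumes p: "relation CC X Y ph"
 shows "ps : rel_class CC ph <-> relation CC X Y ps & eqr A (mat ph) (mat ps)"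
proof -
 have c: "Cod CC (fst ph) = X" "Cod CC (snd ph) = Y" using relation_cod[OF p] by simp_all
 show ?thesis unfolding rel_class_def c
  by(cases "relation CC X Y ps") (simp_all add: rel_le_mat[OF p] rel_le_mat[OF _ p] eqr_def)
qed

lemma rel_class_eq:
 assumes "relation CC X Y ph" "relation CC X Y ps"
 shows "rel_class CC ph = rel_class CC ps <-> eqr A (mat ph) (mat ps)"
proof
 assume "rel_class CC ph = rel_class CC ps"
 thus "eqr A (mat ph) (mat ps)" using assms rel_class_iff eqr_sym by(metis eqr_def ent2_refl[OF A])
next
 assume "eqr A (mat ph) (mat ps)"
 thus "rel_class CC ph = rel_class CC ps"
  using rel_class_iff[OF assms(1)] rel_class_iff[OF assms(2)] eqr_trans[OF A] eqr_sym by blast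
qed

lemma RT_obj: "r : Obj RR <-> (EX X:assemblies. eqrel CC X r)"
 by(simp add: RT_def ex_reg_def Let_def)

lemma RT_hom: "f : hom RR r s <-> r : Obj RR & s : Obj RR &
  (EX ph. functional_relation CC r s ph & f = (r, rel_class CC ph, s))"
proof -
 obtain a K b where "f = (a, K, b)" by(metis prod_cases3)
 thus ?thesis by(simp add: RT_def ex_reg_def Let_def hom_def del: split_paired_Ex)
   (cases "a = r"; cases "b = s"; simp del: split_paired_Ex)
qed

lemma rta_eq:
 assumes p: "relation CC X Y ph"
 shows "rta A (r, rel_class CC ph, s) = mk A (rto r) (mat ph) (rto s)"
proof -
 have "EX ps. ps : rel_class CC ph" using rel_class_iff[OF p] p by(metis eqr_def ent2_refl[OF A])
 hence "(SOME ps. ps : rel_class CC ph) : rel_class CC ph" by(rule someI_ex)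
 thus ?thesis unfolding rta_def by(simp add: mk_eq[OF A] rel_class_iff[OF p] eqr_sym)
qed

lemma RT_homE:
 assumes "f : hom RR r s"
 obtains X Y ph where "eqrel CC X r" "eqrel CC Y s" "relation CC X Y ph"
  "frel A (rto r) (rto s) (mat ph)" "f = (r, rel_class CC ph, s)" "rta A f = mk A (rto r) (mat ph) (rto s)"
proof -
 obtain X Y ph where *: "eqrel CC X r" "eqrel CC Y s" "functional_relation CC r s ph" "f = (r, rel_class CC ph, s)"
  using assms unfolding RT_hom RT_obj by blast
 hence "relation CC X Y ph" "frel A (rto r) (rto s) (mat ph)" unfolding functional_iff[OF *(1,2)] by simp_all
 thus ?thesis using that * rta_eq by blast
qed

lemma RT_homI:
 assumes "eqrel CC X r" "eqrel CC Y s" "relation CC X Y ph" "frel A (rto r) (rto s) (mat ph)"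
 shows "(r, rel_class CC ph, s) : hom RR r s"
 unfolding RT_hom RT_obj
 using assms functional_iff[OF assms(1,2)] relation_obj[OF assms(3)] by blast

lemma rta_inj:
 assumes "f : hom RR r s" "g : hom RR r s" "rta A f = rta A g"
 shows "f = g"
proof -
 obtain X Y ph where f: "eqrel CC X r" "eqrel CC Y s" "relation CC X Y ph" "f = (r, rel_class CC ph, s)"
  "rta A f = mk A (rto r) (mat ph) (rto s)" using assms(1) by(rule RT_homE)
 obtain X' Y' ps where g: "eqrel CC X' r" "eqrel CC Y' s" "relation CC X' Y' ps" "g = (r, rel_class CC ps, s)"
  "rta A g = mk A (rto r) (mat ps) (rto s)" using assms(2) by(rule RT_homE)
 \<comment> \<open>An equivalence relation determines its assembly, the codomain of its
   legs.\<close>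
 have "X' = X" "Y' = Y"
  using relation_cod(1)[OF tobj_rto(5)[OF f(1)]] relation_cod(1)[OF tobj_rto(5)[OF g(1)]]
   relation_cod(1)[OF tobj_rto(5)[OF f(2)]] relation_cod(1)[OF tobj_rto(5)[OF g(2)]] by simp_all
 hence "relation CC X Y ps" using g(3) by simp
 moreover have "eqr A (mat ph) (mat ps)" using assms(3) f(5) g(5) by(simp add: mk_eq[OF A])
 ultimately show ?thesis using rel_class_eq[OF f(3)] f(4) g(4) by simp
qed

lemma RT_idn:
 assumes "r : Obj RR"
 shows "Idn RR r : hom RR r r" "rta A (Idn RR r) = Idn (TT A) (rto r)" "tobj A (rto r)"
proof -
 obtain X where X: "eqrel CC X r" using assms unfolding RT_obj by blast
 note R = tobj_rto[OF X]
 have i: "Idn RR r = (r, rel_class CC r, r)" by(simp add: RT_def ex_reg_def Let_def)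
 show "tobj A (rto r)" by(rule R(1))
 show "Idn RR r : hom RR r r" unfolding i
  by(rule RT_homI[OF X X R(5)]) (use frel_id[OF A R(1)] in "simp add: R(3)")
 show "rta A (Idn RR r) = Idn (TT A) (rto r)" unfolding i rta_eq[OF R(5)] by(simp add: R(3))
qed

lemma RT_cmp:
 assumes "f : hom RR r s" "g : hom RR s t"
 shows "Cmp RR g f : hom RR r t" "rta A (Cmp RR g f) = Cmp (TT A) (rta A g) (rta A f)"
proof -
 obtain X Y ph where f: "eqrel CC X r" "eqrel CC Y s" "relation CC X Y ph" "f = (r, rel_class CC ph, s)"
  "rta A f = mk A (rto r) (mat ph) (rto s)" "frel A (rto r) (rto s) (mat ph)" using assms(1) by(rule RT_homE)
 obtain Y' Z ps where g: "eqrel CC Y' s" "eqrel CC Z t" "relation CC Y' Z ps" "g = (s, rel_class CC ps, t)"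
  "rta A g = mk A (rto s) (mat ps) (rto t)" "frel A (rto s) (rto t) (mat ps)" using assms(2) by(rule RT_homE)
 have "Y' = Y"
  using relation_cod(1)[OF tobj_rto(5)[OF f(2)]] relation_cod(1)[OF tobj_rto(5)[OF g(1)]] by simp
 hence g3: "relation CC Y Z ps" using g(3) by simp
 obtain ch where c: "relation CC X Z ch" "mat ch = rc A (mat ph) (mat ps)" by(rule rel_comp_ex[OF f(3) g3])
 have "{ch. EX ph':rel_class CC ph. EX ps':rel_class CC ps. rel_comp CC ph' ps' ch} = rel_class CC ch"
 proof(intro set_eqI iffI; (unfold mem_Collect_eq)?; (elim bexE)?)
  fix \<xi> ph' ps' assume "ph' : rel_class CC ph" "ps' : rel_class CC ps" and x: "rel_comp CC ph' ps' \<xi>"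
  hence *: "relation CC X Y ph'" "eqr A (mat ph) (mat ph')" "relation CC Y Z ps'" "eqr A (mat ps) (mat ps')"
   unfolding rel_class_iff[OF f(3)] rel_class_iff[OF g3] by simp_all
  have "eqr A (rc A (mat ph) (mat ps)) (rc A (mat ph') (mat ps'))"
   by(rule eqrI[OF A]) (simp add: fc_rc[OF A] fc_eqr[OF A *(2)] fc_eqr[OF A *(4)])
  thus "\<xi> : rel_class CC ch" unfolding rel_class_iff[OF c(1)] c(2) using x eqr_trans[OF A]
   unfolding rel_comp_mat[OF *(1,3)] by blast
 next
  fix \<xi> assume "\<xi> : rel_class CC ch"
  hence "rel_comp CC ph ps \<xi>" unfolding rel_class_iff[OF c(1)] c(2) rel_comp_mat[OF f(3) g3] .
  moreover have "ph : rel_class CC ph" "ps : rel_class CC ps"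
   unfolding rel_class_iff[OF f(3)] rel_class_iff[OF g3] using f(3) g3 by(simp_all add: eqr_def ent2_refl[OF A])
  ultimately show "EX ph':rel_class CC ph. EX ps':rel_class CC ps. rel_comp CC ph' ps' \<xi>" by blast
 qed
 hence gf: "Cmp RR g f = (r, rel_class CC ch, t)" unfolding f(4) g(4) by(simp add: RT_def ex_reg_def Let_def)
 have "frel A (rto r) (rto t) (mat ch)" unfolding c(2) by(rule frel_rc[OF A f(6) g(6)])
 from RT_homI[OF f(1) g(2) c(1) this] show "Cmp RR g f : hom RR r t" unfolding gf .
 show "rta A (Cmp RR g f) = Cmp (TT A) (rta A g) (rta A f)"
  unfolding gf rta_eq[OF c(1)] f(5) g(5) c(2) by(simp add: TT_cmp[OF A])
qed

lemma rta_hom: "f : hom RR r s ==> rta A f : hom (TT A) (rto r) (rto s)"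
 by(erule RT_homE) (simp add: mk_hom[OF A] tobj_rto(1))

lemma RT_cat: "cat RR"
 unfolding cat_def
proof(intro conjI allI ballI impI)
 fix f assume "f : Arr RR"
 thus "Dom RR f : Obj RR" "Cod RR f : Obj RR" using hom_self[of f RR] unfolding RT_hom by simp_all
next
 fix X Y Z f g assume "f : hom RR X Y" "g : hom RR Y Z"
 thus "Cmp RR g f : hom RR X Z" by(rule RT_cmp)
next
 fix X Y f assume f: "f : hom RR X Y"
 hence o: "X : Obj RR" "Y : Obj RR" unfolding RT_hom by simp_all
 note T = TT_cat[OF A]
 show "Cmp RR f (Idn RR X) = f"
  by(rule rta_inj[OF RT_cmp(1)[OF RT_idn(1)[OF o(1)] f] f])
   (simp only: RT_cmp(2)[OF RT_idn(1)[OF o(1)] f] RT_idn(2)[OF o(1)] cat_idr[OF T rta_hom[OF f]])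
 show "Cmp RR (Idn RR Y) f = f"
  by(rule rta_inj[OF RT_cmp(1)[OF f RT_idn(1)[OF o(2)]] f])
   (simp only: RT_cmp(2)[OF f RT_idn(1)[OF o(2)]] RT_idn(2)[OF o(2)] cat_idl[OF T rta_hom[OF f]])
next
 fix X Y Z W f g h assume f: "f : hom RR X Y" and g: "g : hom RR Y Z" and h: "h : hom RR Z W"
 note gf = RT_cmp[OF f g] and hg = RT_cmp[OF g h]
 show "Cmp RR h (Cmp RR g f) = Cmp RR (Cmp RR h g) f"
  by(rule rta_inj[OF RT_cmp(1)[OF gf(1) h] RT_cmp(1)[OF f hg(1)]])
   (simp only: RT_cmp(2)[OF gf(1) h] RT_cmp(2)[OF f hg(1)] gf(2) hg(2) cat_assoc[OF TT_cat[OF A] rta_hom[OF f] rta_hom[OF g] rta_hom[OF h]])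
qed (rule RT_idn)

text \<open>The bridge from the definition of \<open>RT\<close> to the calculus of predicates; the
  toposes occurring later are treated through this functor.\<close>

lemma RT_sqf: "sqf RR (TT A) (RTF A)"
proof -
 have s [simp]: "FObj (RTF A) = rto" "FArr (RTF A) = rta A" by(simp_all add: RTF_def)
 have F: "is_functor RR (TT A) (RTF A)"
  by(rule is_functorI[OF RT_cat]) (simp_all add: RT_idn(2,3) rta_hom RT_cmp(2) del: TT_simps(4))
 moreover have "fully_faithful RR (TT A) (RTF A)"
  unfolding fully_faithful_def s
 proof(intro ballI bij_betw_imageI)
  fix r s assume rs: "r : Obj RR" "s : Obj RR"
  show "inj_on (rta A) (hom RR r s)" using rta_inj by(auto simp: inj_on_def)
  obtain X Y where e: "eqrel CC X r" "eqrel CC Y s" using rs unfolding RT_obj by blast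
  note R = tobj_rto[OF e(1)] and S = tobj_rto[OF e(2)]
  show "rta A ` hom RR r s = hom (TT A) (rto r) (rto s)"
  proof(intro subset_antisym subsetI)
   fix g assume "g : hom (TT A) (rto r) (rto s)"
   then obtain G where G: "frel A (rto r) (rto s) G" "g = mk A (rto r) G (rto s)" by(rule TT_homE[OF A])
   have "ent2 A G (%x y. cj A (snd X x) (snd Y y))"
   proof(rule ent2I[OF A], unfold fc_cj[OF A])
    fix W :: "('u, 'a) st2" and e x y assume "fc2 A W e G x y"
    from frelD(1,2)[OF A G(1) this, unfolded R(3) S(3)] show "fc1 A W e (snd X) x & fc1 A W e (snd Y) y"
     using relation_strict(1)[OF R(5)] relation_strict(1)[OF S(5)] by blast
   qed
   from relation_ex[OF relation_obj(1)[OF R(5)] relation_obj(1)[OF S(5)] this]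
   obtain ph where p: "relation CC X Y ph" "mat ph = G" .
   hence "g = rta A (r, rel_class CC ph, s)" unfolding rta_eq[OF p(1)] G(2) by simp
   moreover have "(r, rel_class CC ph, s) : hom RR r s" using RT_homI[OF e p(1)] p(2) G(1) by simp
   ultimately show "g : rta A ` hom RR r s" by blast
  qed (use rta_hom in blast)
 qed
 moreover have "EX r:Obj RR. FObj (RTF A) r = P" if P: "P : Obj (TT A)" for P
 proof -
  have "tobj A P" using P by simp
  then obtain X r where r: "X : assemblies" "eqrel CC X r" "rto r = P" by(rule rto_surj)
  have "r : Obj RR" unfolding RT_obj by(rule bexI[of _ X]) (use r in simp_all)
  thus ?thesis unfolding s by(rule bexI[rotated]) (rule r(3))
 qed
 ultimately show ?thesis unfolding sqf_def by simp
qed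

end





section \<open>Functors induced by applicative morphisms\<close>

section \<open>Applicative morphisms\<close>

definition amor :: "'a pas => 'b pas => ('a => 'b set) => bool" where
 "amor A B ga <-> (ALL a. ga a ~= {}) & (EX r. ALL a a' c b b'. A a a' = Some c --> b : ga a --> b' : ga a' -->
  (EX x y. B r b = Some x & B x b' = Some y & y : ga c))"

text \<open>Direct image of predicates along \<open>ga\<close>. It commutes with unions literally
  and with \<open>cj\<close> up to equivalence, hence preserves regular logic. The functor
  \<open>gfun\<close> built on it keeps carriers and changes realizers only.\<close>

definition im :: "('a => 'b set) => 'a set => 'b set" where "im ga ph = (\<Union>a\<in>ph. ga a)"

lemma fc_im: "fc1 B W e (im ga) ph <-> (EX a. (ALL w:W. a w : ph w) & fc1 B W e ga a)"
 unfolding im_def by(rule fc_Un)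

lemma im_Un: "im ga (\<Union>j. ph j) = (\<Union>j. im ga (ph j))"
 by(auto simp: im_def)

definition gob :: "('a => 'b set) => ('u, 'a) tob => ('u, 'b) tob" where
 "gob ga P = (fst P, %x y. im ga (snd P x y))"

definition gar :: "('a => 'b set) => ('u => 'u => 'a set) => 'u => 'u => 'b set" where
 "gar ga F x y = im ga (F x y)"

definition gfun :: "'b pas => ('a => 'b set) => (('u, 'a) tob, ('u, 'a) tarr, ('u, 'b) tob, ('u, 'b) tarr) func" where
 "gfun B ga = \<lparr>FObj = gob ga, FArr = (%(P, F, Q). mk B (gob ga P) (gar ga F) (gob ga Q))\<rparr>"

lemma gob_simps [simp]: "fst (gob ga P) = fst P" "snd (gob ga P) = gar ga (snd P)"
 by(simp_all add: gob_def gar_def fun_eq_iff)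

context
 fixes A :: "'a pas" and B :: "'b pas" and ga :: "'a => 'b set"
 assumes A: "pca A" and B: "pca B" and ga: "amor A B ga"
begin

lemma amor_ne: "ga a ~= {}"
 using ga unfolding amor_def by blast

lemma amor_const: "fc B W e (%w. ga k)"
proof -
 obtain c where "c : ga k" using amor_ne[of k] by blast
 thus ?thesis by(rule fc_const[OF B])
qed

lemma amor_app:
 assumes "fc1 B W e ga a" "fc1 B W e ga a'" "!!w. w : W ==> A (a w) (a' w) = Some (c w)"
 shows "fc1 B W e ga c"
proof -
 obtain r where r: "!!a a' c b b'. A a a' = Some c ==> b : ga a ==> b' : ga a' ==>
  EX x y. B r b = Some x & B x b' = Some y & y : ga c" using ga unfolding amor_def by blast
 obtain q q' where q: "cp B W e q" "ALL w:W. q w : ga (a w)" "cp B W e q'" "ALL w:W. q' w : ga (a' w)"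
  using assms(1,2) unfolding fc_cp by blast
 have "ALL w:W. EX x y. B r (q w) = Some x & B x (q' w) = Some y & y : ga (c w)"
 proof
  fix w assume w: "w : W"
  show "EX x y. B r (q w) = Some x & B x (q' w) = Some y & y : ga (c w)"
   by(rule r[OF assms(3)[OF w] bspec[OF q(2) w] bspec[OF q(4) w]])
 qed
 from bchoice[OF this] obtain x where "ALL w:W. EX y. B r (q w) = Some (x w) & B (x w) (q' w) = Some y & y : ga (c w)" by blast
 from bchoice[OF this] obtain y where xy: "ALL w:W. B r (q w) = Some (x w) & B (x w) (q' w) = Some (y w) & y w : ga (c w)" by blast
 have "cp B W e x" by(rule cp_app1[OF B q(1), where r = r]) (use xy in simp)
 hence "cp B W e y" by(rule cp_app[OF B _ q(3)]) (use xy in simp)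
 thus ?thesis unfolding fc_cp using xy by blast
qed

lemma amor_cp:
 assumes "fc1 B W e ga a" "cp A W a c"
 shows "fc1 B W e ga c"
proof -
 obtain k where "ALL w:W. A k (a w) = Some (c w)" using assms(2) unfolding cp_def by blast
 thus ?thesis by(intro amor_app[OF amor_const[of W e k] assms(1)]) simp
qed

text \<open>Transfer between stages: the elements \<open>a\<close> turn the stage over
  \<open>B\<close> into one over \<open>A\<close>. What is computed there has images in
  \<open>B\<close>, since \<open>ga\<close> respects application.\<close>

lemma amor_fc:
 assumes "fc1 B W e ga a" "fc A W a ph"
 shows "fc1 B W e (im ga) ph"
proof -
 obtain c where "cp A W a c" "ALL w:W. c w : ph w" using assms(2) unfolding fc_cp by blast
 thus ?thesis unfolding fc_im by(intro exI[of _ c] conjI amor_cp[OF assms(1)])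
qed

lemma amor_pair:
 assumes "fc1 B W e ga a" "fc1 B W e ga a'"
 shows "fc B W e (%w. ga (pp A (a w) (a' w)))"
proof -
 have *: "A (P_of A) x = Some (the (A (P_of A) x))" "A (the (A (P_of A) x)) y = Some (pp A x y)" for x y
  using pca_pair(1)[OF A, of x y] by(auto simp: app_eq_Some)
 have "fc B W e (%w. ga (the (A (P_of A) (a w))))"
  by(rule amor_app[OF amor_const[of W e "P_of A"] assms(1)]) (rule *)
 thus ?thesis by(rule amor_app[OF _ assms(2)]) (rule *)
qed

lemma fc_im_cj: "fc B W e (%w. im ga (cj A (ph w) (ps w))) <-> fc1 B W e (im ga) ph & fc1 B W e (im ga) ps"
proof
 assume "fc B W e (%w. im ga (cj A (ph w) (ps w)))"
 then obtain a where a: "ALL w:W. a w : cj A (ph w) (ps w)" "fc1 B W e ga a" unfolding fc_im by blast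
 have "fc2 A W a (cj A) ph ps" by(rule fc_mem[OF A]) (use a in simp)
 thus "fc1 B W e (im ga) ph & fc1 B W e (im ga) ps"
  unfolding fc_cj[OF A] using amor_fc[OF a(2)] by blast
next
 assume "fc1 B W e (im ga) ph & fc1 B W e (im ga) ps"
 then obtain a a' where a: "ALL w:W. a w : ph w" "fc1 B W e ga a" "ALL w:W. a' w : ps w" "fc1 B W e ga a'"
  unfolding fc_im by blast
 show "fc B W e (%w. im ga (cj A (ph w) (ps w)))"
  unfolding fc_im by(rule exI[of _ "%w. pp A (a w) (a' w)"]) (use a amor_pair[OF a(2,4)] in "auto simp: cj_def")
qed

text \<open>Choosing the elements of \<open>A\<close> that witness membership in the direct image
  turns an argument at stages over \<open>A\<close> into one over \<open>B\<close>.\<close>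

lemma im1:
 assumes "fc1 B W e (im ga) ph" "!!a. fc A W a ph ==> fc A W a ch"
 shows "fc1 B W e (im ga) ch"
proof -
 obtain a where a: "ALL w:W. a w : ph w" "fc1 B W e ga a" using assms(1) unfolding fc_im by blast
 show ?thesis by(rule amor_fc[OF a(2) assms(2)]) (rule fc_mem[OF A], use a in simp)
qed

lemma im2:
 assumes "fc1 B W e (im ga) ph" "fc1 B W e (im ga) ps"
  "!!a. fc A W a ph ==> fc A W a ps ==> fc A W a ch"
 shows "fc1 B W e (im ga) ch"
 by(rule im1[where ph = "%w. cj A (ph w) (ps w)"]) (use assms in "simp_all add: fc_im_cj fc_cj[OF A]")

lemma im_ent: "ent A ph ps ==> ent B (%i. im ga (ph i)) (%i. im ga (ps i))"
 by(rule entI[OF B], erule im1) (rule entD[OF A])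

lemma im_ent2: "ent2 A F G ==> ent2 B (gar ga F) (gar ga G)"
 unfolding gar_def[abs_def] by(rule ent2I[OF B], erule im1) (rule ent2D[OF A])

lemma im_eqr: "eqr A F G ==> eqr B (gar ga F) (gar ga G)"
 unfolding eqr_def using im_ent2 by blast

lemma fc_gar_rc: "fc2 B W e (gar ga (rc A F G)) x z <-> fc2 B W e (rc B (gar ga F) (gar ga G)) x z"
 unfolding gar_def[abs_def] rc_def im_Un fc_UN fc_im_cj fc_cj[OF B] ..

lemma im_rc: "eqr B (gar ga (rc A F G)) (rc B (gar ga F) (gar ga G))"
 by(rule eqrI[OF B]) (rule fc_gar_rc)

lemma gob_tobj:
 assumes P: "tobj A (P :: ('u, 'a) tob)" shows "tobj B (gob ga P)"
proof(rule tobjI[OF B]; unfold gob_simps)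
 show "small TYPE('u) (fst P)" by(rule tobjD(1)[OF P])
 show "gar ga (snd P) x y ~= {} ==> x : fst P & y : fst P" for x y
  using tobjD(2,3)[OF P, of x y] by(auto simp: gar_def im_def)
 show "x : fst P ==> gar ga (snd P) x x ~= {}" for x
  using tobjD(4)[OF P, of x] amor_ne by(auto simp: gar_def im_def)
next
 fix W :: "('u, 'b) st2" and e x y assume "fc2 B W e (gar ga (snd P)) x y"
 thus "fc2 B W e (gar ga (snd P)) y x" unfolding gar_def by(rule im1) (rule tobj_sym[OF A P])
next
 fix W :: "('u, 'b) st3" and e x y z
 assume "fc2 B W e (gar ga (snd P)) x y" "fc2 B W e (gar ga (snd P)) y z"
 thus "fc2 B W e (gar ga (snd P)) x z" unfolding gar_def by(rule im2) (rule tobj_trans[OF A P])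
qed

lemma gar_frel:
 assumes F: "frel A P Q (F :: 'u => 'u => 'a set)" shows "frel B (gob ga P) (gob ga Q) (gar ga F)"
proof(rule frelI[OF B]; unfold gob_simps gar_def)
 fix W :: "('u, 'b) st2" and e x y assume 1: "fc B W e (%w. im ga (F (x w) (y w)))"
 show "fc B W e (%w. im ga (snd P (x w) (x w))) & fc B W e (%w. im ga (snd Q (y w) (y w)))"
  by(rule conjI; rule im1[OF 1]) (erule frelD[OF A F])+
next
 fix W :: "('u, 'b) st3" and e x x' y
 assume "fc B W e (%w. im ga (F (x w) (y w)))" "fc B W e (%w. im ga (snd P (x w) (x' w)))"
 thus "fc B W e (%w. im ga (F (x' w) (y w)))" by(rule im2) (rule frelD(3)[OF A F])
next
 fix W :: "('u, 'b) st3" and e x y y'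
 assume "fc B W e (%w. im ga (F (x w) (y w)))" "fc B W e (%w. im ga (snd Q (y w) (y' w)))"
 thus "fc B W e (%w. im ga (F (x w) (y' w)))" by(rule im2) (rule frelD(4)[OF A F])
next
 fix W :: "('u, 'b) st3" and e x y y'
 assume "fc B W e (%w. im ga (F (x w) (y w)))" "fc B W e (%w. im ga (F (x w) (y' w)))"
 thus "fc B W e (%w. im ga (snd Q (y w) (y' w)))" by(rule im2) (rule frelD(5)[OF A F])
next
 fix W :: "('u, 'b) st1" and e x assume "fc B W e (%w. im ga (snd P (x w) (x w)))"
 hence "fc B W e (%w. im ga (\<Union>y. F (x w) y))"
  by(rule im1) (erule frel_total[OF A F], unfold fc_UN, blast)
 thus "EX y. fc B W e (%w. im ga (F (x w) (y w)))" unfolding im_Un fc_UN .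
qed

lemma gfun_simps [simp]: "FObj (gfun B ga) P = gob ga P"
 "FArr (gfun B ga) (mk A P F Q) = mk B (gob ga P) (gar ga F) (gob ga Q)"
proof -
 have "eqr B (gar ga (nf A F)) (gar ga F)" by(rule im_eqr[OF eqr_sym[OF nf_eqr[OF A]]])
 thus "FArr (gfun B ga) (mk A P F Q) = mk B (gob ga P) (gar ga F) (gob ga Q)"
  by(simp add: gfun_def mk_def nf_eq[OF B])
qed (simp add: gfun_def)

lemma gfun_functor: "is_functor (TT A) (TT B) (gfun B ga)"
proof(rule is_functorI[OF TT_cat[OF A]])
 fix f X Y assume "f : hom (TT A) X Y"
 thus "FArr (gfun B ga) f : hom (TT B) (FObj (gfun B ga) X) (FObj (gfun B ga) Y)"
  by(elim TT_homE[OF A]) (simp add: mk_hom[OF B] gob_tobj gar_frel)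
next
 fix f g X Y Z assume "f : hom (TT A) X Y" "g : hom (TT A) Y Z"
 thus "FArr (gfun B ga) (Cmp (TT A) g f) = Cmp (TT B) (FArr (gfun B ga) g) (FArr (gfun B ga) f)"
  by(elim TT_homE[OF A]) (simp add: TT_cmp[OF A] TT_cmp[OF B] mk_eq[OF B] im_rc)
qed (simp_all add: gob_tobj)

lemma pbc_image:
 fixes D :: "('u, 'a) tob"
 assumes p: "pbc A D F G p q"
 shows "pbc B (gob ga D) (gar ga F) (gar ga G) (gar ga p) (gar ga q)"
 unfolding pbc_def
proof(intro conjI)
 have c: "gar ga (conv H) = conv (gar ga H)" for H by(simp add: gar_def conv_def fun_eq_iff)
 have "eqr A (rc A p F) (rc A q G)" using p unfolding pbc_def by simp
 thus "eqr B (rc B (gar ga p) (gar ga F)) (rc B (gar ga q) (gar ga G))"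
  using eqr_trans[OF B eqr_sym[OF im_rc] eqr_trans[OF B im_eqr im_rc]] by blast
 have "ent2 A (%d d'. cj A (rc A p (conv p) d d') (rc A q (conv q) d d')) (snd D)" using p unfolding pbc_def by simp
 note 1 = im_ent2[OF this]
 show "ent2 B (%d d'. cj B (rc B (gar ga p) (conv (gar ga p)) d d') (rc B (gar ga q) (conv (gar ga q)) d d')) (snd (gob ga D))"
  unfolding gob_simps
 proof(rule ent2I[OF B], rule ent2D[OF B 1])
  fix W :: "('u, 'b) st2" and e d d'
  assume "fc B W e (%w. cj B (rc B (gar ga p) (conv (gar ga p)) (d w) (d' w)) (rc B (gar ga q) (conv (gar ga q)) (d w) (d' w)))"
  hence "fc2 B W e (gar ga (rc A p (conv p))) d d'" "fc2 B W e (gar ga (rc A q (conv q))) d d'"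
   unfolding fc_cj[OF B] fc_gar_rc c by simp_all
  thus "fc2 B W e (gar ga (%d d'. cj A (rc A p (conv p) d d') (rc A q (conv q) d d'))) d d'"
   unfolding gar_def fc_im_cj by simp
 qed
 have "ent2 A (rc A F (conv G)) (rc A (conv p) q)" using p unfolding pbc_def by simp
 from im_ent2[OF this]
 show "ent2 B (rc B (gar ga F) (conv (gar ga G))) (rc B (conv (gar ga p)) (gar ga q))"
  unfolding c[symmetric]
  by(intro ent2I[OF B]) (simp add: fc_gar_rc[symmetric], rule ent2D[OF B])
qed

text \<open>Limits are recognized by \<open>tterm\<close> and \<open>pbc\<close>, transferred as
  entailments, and recognized again over \<open>B\<close>.\<close>

lemma gfun_lex:
 assumes U: "set_universe TYPE('u)"
 shows "lx (TT A :: ('u, 'a) tcat) (TT B) (gfun B ga)"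
 unfolding preserves_finite_limits_def
proof(intro conjI allI impI)
 fix T :: "('u, 'a) tob" assume t: "is_terminal (TT A) T"
 hence T: "tobj A T" unfolding is_terminal_def by simp
 obtain q where q: "q : fst T" "ent A (%x. snd T x x) (%x. snd T x q)"
  using terminal_tterm[OF A U t] unfolding tterm_def by blast
 have "tterm B (gob ga T)" unfolding tterm_def using q(1) im_ent[OF q(2)] by(auto simp: gar_def intro!: bexI[of _ q])
 from tterm_terminal[OF B gob_tobj[OF T] this] show "is_terminal (TT B) (FObj (gfun B ga) T)" by simp
next
 fix f g p q :: "('u, 'a) tarr" assume pb: "is_pullback (TT A) f g p q"
 obtain F where F: "frel A (Dom (TT A) f) (Cod (TT A) f) F" "f = mk A (Dom (TT A) f) F (Cod (TT A) f)" "tobj A (Dom (TT A) f)" "tobj A (Cod (TT A) f)"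
  using pbD(3)[OF pb] by(rule TT_homE[OF A])
 obtain G where G: "frel A (Dom (TT A) g) (Cod (TT A) f) G" "g = mk A (Dom (TT A) g) G (Cod (TT A) f)" "tobj A (Dom (TT A) g)"
  using pbD(4)[OF pb] by(rule TT_homE[OF A])
 obtain p' where p: "frel A (Dom (TT A) p) (Dom (TT A) f) p'" "p = mk A (Dom (TT A) p) p' (Dom (TT A) f)" "tobj A (Dom (TT A) p)"
  using pbD(1)[OF pb] by(rule TT_homE[OF A])
 obtain q' where q: "frel A (Dom (TT A) p) (Dom (TT A) g) q'" "q = mk A (Dom (TT A) p) q' (Dom (TT A) g)"
  using pbD(2)[OF pb] by(rule TT_homE[OF A])
 have "is_pullback (TT A) (mk A (Dom (TT A) f) F (Cod (TT A) f)) (mk A (Dom (TT A) g) G (Cod (TT A) f))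
   (mk A (Dom (TT A) p) p' (Dom (TT A) f)) (mk A (Dom (TT A) p) q' (Dom (TT A) g))"
  using pb unfolding F(2)[symmetric] G(2)[symmetric] p(2)[symmetric] q(2)[symmetric] .
 from pbc_image[OF pullback_pbc[OF A U F(3) G(3) F(4) p(3) F(1) G(1) p(1) q(1) this]]
 have "is_pullback (TT B) (FArr (gfun B ga) (mk A (Dom (TT A) f) F (Cod (TT A) f))) (FArr (gfun B ga) (mk A (Dom (TT A) g) G (Cod (TT A) f)))
   (FArr (gfun B ga) (mk A (Dom (TT A) p) p' (Dom (TT A) f))) (FArr (gfun B ga) (mk A (Dom (TT A) p) q' (Dom (TT A) g)))"
  unfolding gfun_simps
  by(intro pbc_pullback[OF B] gob_tobj gar_frel F(1,3,4) G(1,3) p(1,3) q(1))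
 thus "is_pullback (TT B) (FArr (gfun B ga) f) (FArr (gfun B ga) g) (FArr (gfun B ga) p) (FArr (gfun B ga) q)"
  unfolding F(2)[symmetric] G(2)[symmetric] p(2)[symmetric] q(2)[symmetric] .
qed

end

text \<open>By the two hypotheses, \<open>b\<close> and the realizers of its image under the
  composite compute each other. Carriers do not change, so \<open>snd P\<close> itself serves as the
  isomorphism between \<open>P\<close> and its image.\<close>

lemma gfun_comp_iso:
 fixes A :: "'a pas" and B :: "'b pas"
 assumes A: "pca A" and B: "pca B" and ga: "amor A B ga" and de: "amor B A de"
  and 1: "ent B (%b. {b}) (%b. im ga (de b))" and 2: "ent B (%b. im ga (de b)) (%b. {b})"
 shows "isof (TT B :: ('u, 'b) tcat) (TT B) ((gfun B ga) oo (gfun A de)) id_func"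
proof -
 have u: "im ga (im de ph) = (\<Union>b\<in>ph. im ga (de b))" for ph by(auto simp: im_def)
 have e: "fc B W e (%w. im ga (im de (ph w))) <-> fc B W e ph" for W :: "'w set" and e ph
 proof
  assume "fc B W e (%w. im ga (im de (ph w)))"
  then obtain b where b: "ALL w:W. b w : ph w" "fc B W e (%w. im ga (de (b w)))" unfolding u fc_Un by blast
  show "fc B W e ph" by(rule fc_mono[OF entD[OF B 2 b(2)]]) (use b in simp)
 next
  assume "fc B W e ph"
  then obtain b where b: "cp B W e b" "ALL w:W. b w : ph w" unfolding fc_cp by blast
  hence "fc B W e (%w. {b w})" unfolding fc_cp by auto
  from entD[OF B 1 this] show "fc B W e (%w. im ga (im de (ph w)))" unfolding u fc_Un using b(2) by blast
 qed
 have eq: "eqr B (gar ga (gar de F)) F" for F :: "'u => 'u => 'b set"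
  by(rule eqrI[OF B]) (unfold gar_def, rule e)
 note fce = fc_eqr[OF B eq]
 define t where "t P = mk B (gob ga (gob de P)) (snd P) P" for P :: "('u, 'b) tob"
 have ob: "tobj B (gob ga (gob de P))" if "tobj B P" for P :: "('u, 'b) tob"
  by(rule gob_tobj[OF A B ga gob_tobj[OF B A de that]])
 have fr: "frel B (gob ga (gob de P)) P (snd P)" "frel B P (gob ga (gob de P)) (snd P)" if P: "tobj B P" for P :: "('u, 'b) tob"
  using frel_id[OF B P] unfolding frel_def gob_simps
  by - (intro conjI ent2I[OF B] ent3I[OF B] entI[OF B]; simp add: fc_cj[OF B] fce fc_UN;
   blast intro: tobj_refl1[OF B P] tobj_refl2[OF B P] tobj_sym[OF B P] tobj_trans[OF B P])+
 show ?thesis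
  unfolding isomorphic_functors_def
 proof(intro exI conjI ballI)
  show "nat_trans (TT B) (TT B) ((gfun B ga) oo (gfun A de)) id_func t"
   unfolding nat_trans_def
  proof(intro conjI ballI)
   fix P :: "('u, 'b) tob" assume "P : Obj (TT B)"
   hence P: "tobj B P" by simp
   show "t P : hom (TT B) (FObj ((gfun B ga) oo (gfun A de)) P) (FObj id_func P)"
    by(simp add: t_def gfun_simps[OF A B ga] gfun_simps[OF B A de] mk_hom[OF B] ob P fr)
  next
   fix f :: "('u, 'b) tarr" assume "f : Arr (TT B)"
   note f = hom_self[OF this]
   then obtain F where F: "frel B (Dom (TT B) f) (Cod (TT B) f) F" "f = mk B (Dom (TT B) f) F (Cod (TT B) f)"
    "tobj B (Dom (TT B) f)" "tobj B (Cod (TT B) f)" by(rule TT_homE[OF B])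
   define X Y where "X = Dom (TT B) f" and "Y = Cod (TT B) f"
   have F': "frel B X Y F" "f = mk B X F Y" "tobj B X" "tobj B Y" using F unfolding X_def Y_def by simp_all
   have "eqr B (rc B (gar ga (gar de F)) (snd Y)) (rc B (snd X) F)"
    by(rule eqrI[OF B], unfold fc_rc[OF B] fce)
     (blast intro: frelD(3)[OF B F'(1)] frelD(4)[OF B F'(1)] tobj_sym[OF B F'(3)] tobj_sym[OF B F'(4)] dest: frelD(1)[OF B F'(1)] frelD(2)[OF B F'(1)])
   thus "Cmp (TT B) (t (Cod (TT B) f)) (FArr ((gfun B ga) oo (gfun A de)) f) =
     Cmp (TT B) (FArr id_func f) (t (Dom (TT B) f))"
    unfolding X_def[symmetric] Y_def[symmetric]
    by(simp add: F'(2) t_def gfun_simps[OF A B ga] gfun_simps[OF B A de] TT_cmp[OF B] mk_eq[OF B])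
  qed
  fix P :: "('u, 'b) tob" assume "P : Obj (TT B)"
  hence P: "tobj B P" by simp
  have "frel B P (gob ga (gob de P)) (conv (snd P))"
   by(rule frel_eqr[OF B _ fr(2)[OF P]], rule eqrI[OF B]) (auto intro: tobj_sym[OF B P])
  from mk_iso[OF B ob[OF P] P fr(1)[OF P] this]
  show "is_iso (TT B) (t P)" unfolding t_def using is_iso_in[OF mk_hom[OF B ob[OF P] P fr(1)[OF P]]] by blast
 qed
qed

section \<open>Computational density and the right adjoint\<close>

section \<open>Computationally dense morphisms\<close>

text \<open>Computational density in condensed form: one decoder for all elements of
  \<open>B\<close>. Applied to codes of realizers it provides the right adjoint
  \<open>up\<close>.\<close>

definition cdense :: "'b pas => ('a => 'b set) => bool" where
 "cdense B ga <-> (EX t g. ALL b. ALL c:ga (g b). B t c = Some b)"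

text \<open>Right adjoint to direct image on predicates, provided that \<open>t\<close> decodes a
  program and runs it: \<open>fc_up_down\<close> plays the part of the counit, \<open>fc_upI\<close>
  that of the unit.\<close>

definition up :: "'b pas => ('a => 'b set) => 'b => 'b set => 'a set" where
 "up B ga t ps = {a. ALL c:ga a. EX v. B t c = Some v & v : ps}"

lemma fc_up_down:
 assumes B: "pca B" and u: "fc B W e (%w. im ga (up B ga t (ps w)))"
 shows "fc B W e ps"
proof -
 obtain a where a: "ALL w:W. a w : up B ga t (ps w)" "fc1 B W e ga a" using u unfolding fc_im by blast
 obtain q where q: "cp B W e q" "ALL w:W. q w : ga (a w)" using a(2) unfolding fc_cp by blast
 have "fc B W q ps" unfolding fc_def
 proof(rule exI[of _ t], rule ballI)
  fix w assume "w : W"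
  thus "EX c. B t (q w) = Some c & c : ps w" using a(1) q(2) unfolding up_def by blast
 qed
 from fc_trans[OF B q(1) this] show ?thesis .
qed

text \<open>Names in the universe for all predicates supported on \<open>Z\<close>. A small set of
  them suffices because the product of \<open>Z\<close> with the type \<open>'b\<close> is small and
  power sets preserve smallness.\<close>

lemma small_functions:
 fixes Z :: "'u set"
 assumes U: "set_universe TYPE('u)" and Z: "small TYPE('u) Z" and B: "small TYPE('u) (UNIV :: 'b set)"
 shows "EX (S :: 'u set) (d :: 'u => 'u => 'b set). small TYPE('u) S &
  (ALL f. (ALL z. f z ~= {} --> z : Z) --> (EX s:S. d s = f))"
proof -
 define Q where "Q = Pow (Z \<times> (UNIV :: 'b set))"
 have s: "small TYPE('u) Q" unfolding Q_def by(intro small_Pow[OF U] small_Times[OF U] Z B)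
 obtain j :: "('u, 'b) st1 => 'u" where j: "inj_on j Q" using small_inj[OF U s] .
 define d where "d s z = {b. (z, b) : inv_into Q j s}" for s z
 have "EX s:j ` Q. d s = f" if f: "!!z. f z ~= {} ==> z : Z" for f
 proof
  define R where "R = {(z, b). b : f z}"
  have R: "R : Q" using f by(auto simp: R_def Q_def)
  thus "j R : j ` Q" by(rule imageI)
  show "d (j R) = f" unfolding d_def inv_into_f_f[OF j R] by(auto simp: R_def)
 qed
 with small_image[OF s] show ?thesis by(intro exI[of _ "j ` Q"] exI[of _ d]) simp
qed

context
 fixes A :: "'a pas" and B :: "'b pas" and ga :: "'a => 'b set" and t :: 'b and g :: "'b => 'a"
 assumes A: "pca A" and B: "pca B" and ga: "amor A B ga"
  and t: "!!r x c. c : ga (pp A (g r) x) ==> EX c':ga x. ALL v. B r c' = Some v --> B t c = Some v"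
begin

text \<open>Adjoining to \<open>w\<close> an image of its datum \<open>e w\<close> makes a stage
  over \<open>B\<close>. A realizer \<open>r\<close> for that stage is stored as its code
  \<open>g r\<close> paired with \<open>e w\<close>, and \<open>t\<close> unpacks and runs
  it.\<close>

lemma fc_upI:
 assumes "!!(W' :: ('w * 'b) set) e' p. (!!v. v : W' ==> p v : W) ==>
  (!!ch. fc A W e ch ==> fc B W' e' (%v. im ga (ch (p v)))) ==> fc1 B W' e' ps p"
 shows "fc A (W :: 'w set) e (%w. up B ga t (ps w))"
proof -
 define W' where "W' = {(w, c). w : W & c : ga (e w)}"
 have "fc1 B W' snd ps fst"
 proof(rule assms)
  fix ch assume "fc A W e ch"
  hence "fc A W' (%v. e (fst v)) (%v. ch (fst v))" unfolding fc_def W'_def by auto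
  moreover have "fc B W' snd (%v. ga (e (fst v)))" by(rule fc_mem[OF B]) (auto simp: W'_def)
  ultimately show "fc B W' snd (%v. im ga (ch (fst v)))" by(intro amor_fc[OF A B ga, of _ _ "%v. e (fst v)"])
 qed (auto simp: W'_def)
 then obtain r where r: "!!w c. w : W ==> c : ga (e w) ==> EX v. B r c = Some v & v : ps w"
  unfolding fc_def W'_def by auto
 have "cp A W e (%w. pp A (g r) (e w))" by(rule cp_pair[OF A cp_const[OF A] cp_id[OF A]])
 moreover have "pp A (g r) (e w) : up B ga t (ps w)" if w: "w : W" for w
  unfolding up_def
 proof(intro CollectI ballI)
  fix c assume "c : ga (pp A (g r) (e w))"
  from t[OF this] obtain c' where c': "c' : ga (e w)" "ALL v. B r c' = Some v --> B t c = Some v" by blast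
  from r[OF w c'(1)] c'(2) show "EX v. B t c = Some v & v : ps w" by blast
 qed
 ultimately show ?thesis unfolding fc_cp by blast
qed

lemma fc_up1:
 assumes "fc1 A W e (up B ga t) ph" "!!(W' :: ('w * 'b) set) e' p. fc1 B W' e' ph p ==> fc1 B W' e' ps p"
 shows "fc A (W :: 'w set) e (%w. up B ga t (ps w))"
proof(rule fc_upI)
 fix W' :: "('w * 'b) set" and e' p
 assume "!!ch. fc A W e ch ==> fc B W' e' (%v. im ga (ch (p v)))"
 from fc_up_down[OF B this[OF assms(1)]] show "fc1 B W' e' ps p" by(rule assms(2))
qed

lemma fc_up2:
 assumes "fc1 A W e (up B ga t) ph" "fc1 A W e (up B ga t) ph'"
  "!!(W' :: ('w * 'b) set) e' p. fc1 B W' e' ph p ==> fc1 B W' e' ph' p ==> fc1 B W' e' ps p"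
 shows "fc A (W :: 'w set) e (%w. up B ga t (ps w))"
proof(rule fc_upI)
 fix W' :: "('w * 'b) set" and e' p
 assume "!!ch. fc A W e ch ==> fc B W' e' (%v. im ga (ch (p v)))"
 from fc_up_down[OF B this[OF assms(1)]] fc_up_down[OF B this[OF assms(2)]] show "fc1 B W' e' ps p" by(rule assms(3))
qed

text \<open>The right adjoint takes \<open>Z\<close> to its object of named singletons, with
  equality moved to \<open>A\<close> by \<open>up\<close>. An arrow from the image of
  \<open>Y\<close> to \<open>Z\<close> is a functional relation \<open>G\<close>, and its transpose
  sends \<open>y\<close> to a name of \<open>G y\<close>.\<close>

lemma univ_exists:
 fixes Z :: "('u, 'b) tob"
 assumes U: "set_universe TYPE('u)" and sB: "small TYPE('u) (UNIV :: 'b set)" and Z: "tobj B Z"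
 shows "EX V eps. ua (TT A) (TT B) (gfun B ga) Z V eps"
proof -
 obtain S :: "'u set" and d :: "'u => 'u => 'b set" where S: "small TYPE('u) S"
  "!!f. (!!z. f z ~= {} ==> z : fst Z) ==> EX s:S. d s = f"
  using small_functions[OF U tobjD(1)[OF Z] sB] by auto
 text \<open>Realizers that \<open>s\<close> is a subsingleton, and that \<open>s\<close> and \<open>s'\<close> are the same singleton.\<close>
 define sub where "sub s = {b. ALL z z'. ALL c:cj B (d s z) (d s z'). EX v. B b c = Some v & v : snd Z z z'}" for s
 define eqs where "eqs s s' = cj B (\<Union>z. \<Union>z'. cj B (d s z) (cj B (d s' z') (snd Z z z'))) (cj B (sub s) (sub s'))" for s s'
 have sub: "fc2 B W e (snd Z) z z'"
  if s: "fc1 B W e sub s" and z: "fc2 B W e d s z" "fc2 B W e d s z'" for W :: "'w set" and e s z z'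
 proof -
  obtain q where q: "cp B W e q" "ALL w:W. q w : sub (s w)" using s unfolding fc_cp by blast
  have "fc B W e (%w. cj B (d (s w) (z w)) (d (s w) (z' w)))" using z by(simp add: fc_cj[OF B])
  then obtain c where c: "cp B W e c" "ALL w:W. c w : cj B (d (s w) (z w)) (d (s w) (z' w))" unfolding fc_cp by blast
  have "ALL w:W. EX v. B (q w) (c w) = Some v & v : snd Z (z w) (z' w)" using q(2) c(2) unfolding sub_def by blast
  from bchoice[OF this] obtain v where v: "ALL w:W. B (q w) (c w) = Some (v w) & v w : snd Z (z w) (z' w)" by blast
  have "cp B W e v" by(rule cp_app[OF B q(1) c(1)]) (use v in simp)
  thus ?thesis unfolding fc_cp using v by blast
 qed
 have eqs: "fc2 B W e eqs s s' <-> (EX z z'. fc2 B W e d s z & fc2 B W e d s' z' &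
   fc2 B W e (snd Z) z z') & fc1 B W e sub s & fc1 B W e sub s'" for W :: "'w set" and e s s'
  unfolding eqs_def fc_cj[OF B] fc_UN ..
 have eqs_sym: "fc2 B W e eqs s' s" if "fc2 B W e eqs s s'" for W :: "'w set" and e s s'
  using that unfolding eqs by(blast intro: tobj_sym[OF B Z])
 have eqs_trans: "fc2 B W e eqs s s''"
  if 1: "fc2 B W e eqs s s'" and 2: "fc2 B W e eqs s' s''" for W :: "'w set" and e s s' s''
 proof -
  obtain z z' where z: "fc2 B W e d s z" "fc2 B W e d s' z'" "fc2 B W e (snd Z) z z'"
   "fc1 B W e sub s" "fc1 B W e sub s'" using 1 unfolding eqs by blast
  obtain y y' where y: "fc2 B W e d s' y" "fc2 B W e d s'' y'" "fc2 B W e (snd Z) y y'"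
   "fc1 B W e sub s''" using 2 unfolding eqs by blast
  have "fc2 B W e (snd Z) z y'"
   by(rule tobj_trans[OF B Z tobj_trans[OF B Z z(3) sub[OF z(5,2) y(1)]] y(3)])
  thus ?thesis unfolding eqs using z y by blast
 qed
 \<comment> \<open>Restricting to names in \<open>S\<close> keeps \<open>V\<close> small.\<close>
 define om where "om s s' = (if s : S & s' : S then up B ga t (eqs s s') else {})" for s s'
 define V where "V = ({s. om s s ~= {}}, om)"
 have w_fc: "fc2 A W e om s s' <-> (ALL w:W. s w : S & s' w : S) & fc A W e (%w. up B ga t (eqs (s w) (s' w)))" for W :: "'w set" and e s s'
  unfolding om_def by(rule fc_if[OF A])
 have w_sym: "fc2 A W e om s' s" if "fc2 A W e om s s'" for W :: "'w set" and e s s'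
  using that unfolding w_fc by(elim conjE, intro conjI) (blast, rule fc_up1, assumption, rule eqs_sym)
 have w_trans: "fc2 A W e om s s''"
  if "fc2 A W e om s s'" "fc2 A W e om s' s''" for W :: "'w set" and e s s' s''
  using that unfolding w_fc by(elim conjE, intro conjI) (blast, rule fc_up2, assumption, assumption, rule eqs_trans)
 have w_down: "fc2 B W e eqs s s'" if "fc B W e (%w. im ga (om (s w) (s' w)))" for W :: "'w set" and e s s'
  by(rule fc_up_down[OF B fc_mono[OF that]]) (auto simp: om_def im_def)
 have V: "tobj A V"
 proof(rule tobjI[OF A]; unfold V_def fst_conv snd_conv)
  show "small TYPE('u) {s. om s s ~= {}}" by(rule small_subset[OF S(1)]) (auto simp: om_def)
  fix s s' assume "om s s' ~= {}"
  then obtain b where "b : om s s'" by blast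
  hence 1: "fc A {()} (%_. undefined) (%_. om s s')" by(rule fc_const[OF A])
  show "s : {s. om s s ~= {}} & s' : {s. om s s ~= {}}"
   using fc_ne[OF w_trans[OF 1 w_sym[OF 1]], of "()"] fc_ne[OF w_trans[OF w_sym[OF 1] 1], of "()"] by simp
 qed (auto intro: w_sym w_trans)
 have sV [simp]: "snd V = om" by(simp add: V_def)
 \<comment> \<open>The counit relates a name to whatever equals an element of the subset it
   denotes.\<close>
 define E where "E s z = cj B (im ga (om s s)) (\<Union>z'. cj B (d s z') (snd Z z' z))" for s z
 have E_fc: "fc2 B W e E s z <-> fc B W e (%w. im ga (om (s w) (s w))) &
   (EX z'. fc2 B W e d s z' & fc2 B W e (snd Z) z' z)" for W :: "'w set" and e s z
  unfolding E_def fc_cj[OF B] fc_UN ..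
 have E: "frel B (gob ga V) Z E"
 proof(rule frelI[OF B]; unfold gob_simps sV gar_def E_fc)
  fix W :: "('u, 'b) st2" and e s z
  assume "fc B W e (%w. im ga (om (s w) (s w))) & (EX z'. fc2 B W e d s z' & fc2 B W e (snd Z) z' z)"
  thus "fc B W e (%w. im ga (om (s w) (s w))) & fc2 B W e (snd Z) z z"
   by(blast intro: tobj_refl2[OF B Z])
 next
  fix W :: "('u, 'b) st3" and e s s' z
  assume 1: "fc B W e (%w. im ga (om (s w) (s w))) & (EX z'. fc2 B W e d s z' & fc2 B W e (snd Z) z' z)"
   and 2: "fc B W e (%w. im ga (om (s w) (s' w)))"
  then obtain z' where z': "fc2 B W e d s z'" "fc2 B W e (snd Z) z' z" by blast
  obtain y y' where y: "fc2 B W e d s y" "fc2 B W e d s' y'" "fc2 B W e (snd Z) y y'"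
   "fc1 B W e sub s" using w_down[OF 2] unfolding eqs by blast
  have "fc B W e (%w. im ga (om (s' w) (s' w)))" by(rule im1[OF A B ga 2]) (rule w_trans[OF w_sym])
  moreover have "fc2 B W e (snd Z) y' z"
   by(rule tobj_trans[OF B Z tobj_sym[OF B Z y(3)] tobj_trans[OF B Z sub[OF y(4,1) z'(1)] z'(2)]])
  ultimately show "fc B W e (%w. im ga (om (s' w) (s' w))) & (EX z'. fc2 B W e d s' z' & fc2 B W e (snd Z) z' z)"
   using y(2) by blast
 next
  fix W :: "('u, 'b) st3" and e s z y
  assume "fc B W e (%w. im ga (om (s w) (s w))) & (EX z'. fc2 B W e d s z' & fc2 B W e (snd Z) z' z)"
   and "fc2 B W e (snd Z) z y"
  thus "fc B W e (%w. im ga (om (s w) (s w))) & (EX z'. fc2 B W e d s z' & fc2 B W e (snd Z) z' y)"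
   by(blast intro: tobj_trans[OF B Z])
 next
  fix W :: "('u, 'b) st3" and e s z y
  assume 1: "fc B W e (%w. im ga (om (s w) (s w))) & (EX z'. fc2 B W e d s z' & fc2 B W e (snd Z) z' z)"
   and "fc B W e (%w. im ga (om (s w) (s w))) & (EX z'. fc2 B W e d s z' & fc2 B W e (snd Z) z' y)"
  then obtain z' y' where z': "fc2 B W e d s z'" "fc2 B W e (snd Z) z' z"
   and y': "fc2 B W e d s y'" "fc2 B W e (snd Z) y' y" by blast
  have "fc1 B W e sub s" using w_down[OF conjunct1[OF 1]] unfolding eqs by blast
  from sub[OF this z'(1) y'(1)] show "fc2 B W e (snd Z) z y"
   by(rule tobj_trans[OF B Z tobj_sym[OF B Z z'(2)] tobj_trans[OF B Z _ y'(2)]])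
 next
  fix W :: "('u, 'b) st1" and e s assume 1: "fc B W e (%w. im ga (om (s w) (s w)))"
  thus "EX z. fc B W e (%w. im ga (om (s w) (s w))) & (EX z'. fc2 B W e d s z' & fc2 B W e (snd Z) z' z)"
   using w_down[OF 1] unfolding eqs by blast
 qed
 have "EX! k. k : hom (TT A) Y V & Cmp (TT B) (mk B (gob ga V) E Z) (FArr (gfun B ga) k) = f"
  if Y: "tobj A Y" and f: "f : hom (TT B) (gob ga Y) Z" for Y f
 proof -
  obtain G where G: "frel B (gob ga Y) Z G" "f = mk B (gob ga Y) G Z" using f by(rule TT_homE[OF B])
  note GD = frelD[OF B G(1), unfolded gob_simps gar_def]
  have "EX s:S. d s = G y" for y
  proof(rule S(2))
   fix z assume "G y z ~= {}"
   then obtain b where "b : G y z" by blast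
   hence "fc B {()} (%_. undefined) (%_. G y z)" by(rule fc_const[OF B])
   from fc_ne[OF GD(2)[OF this], of "()"] show "z : fst Z" using tobjD(2)[OF Z] by simp
  qed
  hence "ALL y. EX s. s : S & d s = G y" by blast
  from choice[OF this] obtain s where s: "!!y. s y : S" "!!y. d (s y) = G y" by blast
  obtain r where r: "!!y z z'. ALL b:cj B (G y z) (G y z'). EX c. B r b = Some c & c : snd Z z z'"
   using G(1) unfolding frel_def ent3_def by blast
  have ssub: "fc B W e (%w. sub (s (y w)))" for W :: "'w set" and e y
   by(rule fc_const[OF B, of _ r]) (use r in "simp add: sub_def s(2)")
  have key: "fc A W e (%w. om (s (y w)) (s (y' w)))" if yy: "fc2 A W e (snd Y) y y'" for W :: "'w set" and e y y'
   unfolding w_fc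
  proof(intro conjI fc_upI)
   fix W' :: "('w * 'b) set" and e' p assume "!!ch. fc A W e ch ==> fc B W' e' (%v. im ga (ch (p v)))"
   note 1 = this[OF yy] this[OF tobj_refl1[OF A Y yy]]
   obtain z where z: "fc B W' e' (%v. G (y (p v)) (z v))"
    by(rule frel_total[OF B G(1), of W' e' "%v. y (p v)"]) (use 1(2) in "simp add: gar_def")
   have z': "fc B W' e' (%v. G (y' (p v)) (z v))"
    by(rule GD(3)[where x = "%v. y (p v)"]) (use z 1(1) in simp_all)
   have "fc2 B W' e' (snd Z) z z" by(rule GD(2)[OF z])
   thus "fc B W' e' (%v. eqs (s (y (p v))) (s (y' (p v))))"
    unfolding eqs s(2) using z z' by(intro conjI ssub) blast
  qed (simp add: s(1))
  \<comment> \<open>The transpose relates \<open>y\<close> to all names equal to the chosen name of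
    \<open>G y\<close>.\<close>
  define K where "K y v = cj A (snd Y y y) (om (s y) v)" for y v
  have K_fc: "fc2 A W e K y v <-> fc2 A W e (snd Y) y y & fc A W e (%w. om (s (y w)) (v w))" for W :: "'w set" and e y v
   unfolding K_def fc_cj[OF A] ..
  have K: "frel A Y V K"
  proof(rule frelI[OF A]; unfold K_fc sV; (elim conjE)?)
   fix W :: "('u, 'a) st2" and e y v
   assume 1: "fc2 A W e (snd Y) y y" "fc A W e (%w. om (s (y w)) (v w))"
   show "fc2 A W e (snd Y) y y & fc2 A W e om v v"
    using 1(1) w_trans[OF w_sym[OF 1(2)] 1(2)] ..
  next
   fix W :: "('u, 'a) st3" and e y y' v
   assume 1: "fc A W e (%w. om (s (y w)) (v w))" "fc2 A W e (snd Y) y y'"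
   show "fc2 A W e (snd Y) y' y' & fc A W e (%w. om (s (y' w)) (v w))"
    using tobj_refl2[OF A Y 1(2)] w_trans[OF w_sym[OF key[OF 1(2)]] 1(1)] ..
  next
   fix W :: "('u, 'a) st3" and e y v v'
   assume 1: "fc2 A W e (snd Y) y y" "fc A W e (%w. om (s (y w)) (v w))" "fc2 A W e om v v'"
   show "fc2 A W e (snd Y) y y & fc A W e (%w. om (s (y w)) (v' w))"
    using 1(1) w_trans[OF 1(2,3)] ..
  next
   fix W :: "('u, 'a) st3" and e y v v'
   assume 1: "fc A W e (%w. om (s (y w)) (v w))" "fc A W e (%w. om (s (y w)) (v' w))"
   show "fc2 A W e om v v'" by(rule w_trans[OF w_sym[OF 1(1)] 1(2)])
  next
   fix W :: "('u, 'a) st1" and e y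
   assume 1: "fc2 A W e (snd Y) y y"
   show "EX v. fc2 A W e (snd Y) y y & fc A W e (%w. om (s (y w)) (v w))"
    by(intro exI[of _ "%w. s (y w)"] conjI 1 key)
  qed
  have gs: "FArr (gfun B ga) (mk A Y K' V) = mk B (gob ga Y) (gar ga K') (gob ga V)" for K'
   by(rule gfun_simps[OF A B ga])
  show ?thesis
  proof(rule ex1I[of _ "mk A Y K V"], intro conjI)
   show "mk A Y K V : hom (TT A) Y V" by(rule mk_hom[OF A Y V K])
   have "eqr B (rc B (gar ga K) E) G"
   proof(rule frel_le[OF B frel_rc[OF B gar_frel[OF A B ga K] E] G(1)], rule ent2I[OF B], unfold fc_rc[OF B], elim exE conjE)
    fix W :: "('u, 'b) st2" and e y z v
    assume 1: "fc2 B W e (gar ga K) y v" "fc2 B W e E v z"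
    obtain z' where z': "fc2 B W e d v z'" "fc2 B W e (snd Z) z' z" using 1(2) unfolding E_fc by blast
    have "fc B W e (%w. im ga (om (s (y w)) (v w)))"
     by(rule im1[OF A B ga 1(1)[unfolded gar_def]]) (simp add: K_fc)
    from w_down[OF this] obtain z1 z2 where z: "fc2 B W e G y z1" "fc2 B W e d v z2"
     "fc2 B W e (snd Z) z1 z2" "fc1 B W e sub v" unfolding eqs s(2) by blast
    show "fc2 B W e G y z"
     by(rule GD(4)[OF z(1) tobj_trans[OF B Z tobj_trans[OF B Z z(3) sub[OF z(4,2) z'(1)]] z'(2)]])
   qed
   thus "Cmp (TT B) (mk B (gob ga V) E Z) (FArr (gfun B ga) (mk A Y K V)) = f"
    unfolding gs by(simp add: TT_cmp[OF B] mk_eq[OF B] G(2))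
   fix k assume k: "k : hom (TT A) Y V & Cmp (TT B) (mk B (gob ga V) E Z) (FArr (gfun B ga) k) = f"
   obtain K' where K': "frel A Y V K'" "k = mk A Y K' V" using conjunct1[OF k] by(rule TT_homE[OF A])
   have c: "eqr B (rc B (gar ga K') E) G" using k unfolding K'(2) gs by(simp add: TT_cmp[OF B] mk_eq[OF B] G(2))
   \<comment> \<open>If \<open>k\<close> has the right composite, an element of the singleton named
     by \<open>v\<close> lies in \<open>G y\<close>, so \<open>v\<close> and \<open>s y\<close> name
     the same singleton.\<close>
   have "eqr A K' K"
   proof(rule frel_le[OF A K'(1) K], rule ent2I[OF A], unfold K_fc w_fc, intro conjI fc_upI)
    fix W :: "('u, 'a) st2" and e y v assume yv: "fc2 A W e K' y v"
    show "fc2 A W e (snd Y) y y" by(rule frelD(1)[OF A K'(1) yv])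
    have vv: "fc2 A W e om v v" using frelD(2)[OF A K'(1) yv] by simp
    thus "ALL w:W. s (y w) : S & v w : S" unfolding w_fc using s(1) by blast
    fix W' :: "(('u * 'u * 'a) * 'b) set" and e' p assume st: "!!ch. fc A W e ch ==> fc B W' e' (%v. im ga (ch (p v)))"
    from w_down[OF st[OF vv]] obtain z where z: "fc B W' e' (%x. d (v (p x)) (z x))" "fc B W' e' (%x. sub (v (p x)))"
     unfolding eqs by blast
    have zz: "fc2 B W' e' (snd Z) z z" by(rule sub[OF z(2,1,1)])
    have "fc B W' e' (%x. E (v (p x)) (z x))" unfolding E_fc using st[OF vv] z(1) zz by blast
    moreover have "fc B W' e' (%x. gar ga K' (y (p x)) (v (p x)))" unfolding gar_def by(rule st[OF yv])
    ultimately have "fc B W' e' (%x. rc B (gar ga K') E (y (p x)) (z x))" unfolding fc_rc[OF B] by(intro exI conjI)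
    hence "fc B W' e' (%x. G (y (p x)) (z x))" unfolding fc_eqr[OF B c] .
    thus "fc B W' e' (%x. eqs (s (y (p x))) (v (p x)))" unfolding eqs s(2) using z zz by(intro conjI ssub) blast+
   qed
   thus "k = mk A Y K V" by(simp add: K'(2) mk_eq[OF A])
  qed
 qed
 hence "ua (TT A) (TT B) (gfun B ga) Z V (mk B (gob ga V) E Z)"
  unfolding ua_def gfun_simps(1)[OF A B ga] using V mk_hom[OF B gob_tobj[OF A B ga V] Z E] by simp
 thus ?thesis by blast
qed

end

lemma gfun_lexadj:
 fixes A :: "'a pas" and B :: "'b pas"
 assumes A: "pca A" and B: "pca B" and ga: "amor A B ga" and cd: "cdense B ga"
  and U: "set_universe TYPE('u)" and sB: "small TYPE('u) (UNIV :: 'b set)"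
 shows "lexadj (TT A :: ('u, 'a) tcat) (TT B) (gfun B ga)"
proof -
 obtain t g where tg: "!!b c. c : ga (g b) ==> B t c = Some b" using cd unfolding cdense_def by blast
 define W :: "('a * 'a * 'b) set" where "W = {(x, y, c). c : ga (pp A x y)}"
 have m: "fc B W (%(x, y, c). c) (%(x, y, c). ga (pp A x y))" by(rule fc_mem[OF B]) (auto simp: W_def)
 have p: "fc B W (%(x, y, c). c) (%(x, y, c). ga x)" "fc B W (%(x, y, c). c) (%(x, y, c). ga y)"
  using amor_app[OF A B ga amor_const[OF A B ga, of W _ "P0_of A"] m[unfolded case_prod_unfold], of "%w. fst w"]
   amor_app[OF A B ga amor_const[OF A B ga, of W _ "P1_of A"] m[unfolded case_prod_unfold], of "%w. fst (snd w)"]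
  by(simp_all add: case_prod_unfold pca_pair(2,3)[OF A])
 obtain u0 where u0: "!!x y c. c : ga (pp A x y) ==> EX c'. B u0 c = Some c' & c' : ga x"
  using p(1) unfolding fc_def W_def by auto
 obtain u1 where u1: "!!x y c. c : ga (pp A x y) ==> EX c'. B u1 c = Some c' & c' : ga y"
  using p(2) unfolding fc_def W_def by auto
 \<comment> \<open>\<open>t'\<close> splits its argument, decodes the first half with
   \<open>t\<close>, and applies the result to the second half.\<close>
 obtain t' where t': "!!x v. ev B (x ## (%_. t)) ((Cn t $ (Cn u0 $ Vr 0)) $ (Cn u1 $ Vr 0)) = Some v ==> B t' x = Some v"
  by(rule lam1[OF B]) blast
 have *: "EX c':ga x. ALL v. B r c' = Some v --> B t' c = Some v" if c: "c : ga (pp A (g r) x)" for r x c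
 proof -
  obtain c0 c1 where "B u0 c = Some c0" "c0 : ga (g r)" "B u1 c = Some c1" "c1 : ga x" using u0[OF c] u1[OF c] by blast
  thus ?thesis using tg by(auto intro!: bexI[of _ c1] t')
 qed
 show ?thesis
  unfolding lexadj_def
  using gfun_functor[OF A B ga] gfun_lex[OF A B ga U] univ_exists[OF A B ga * U sB] by simp
qed

section \<open>Global points, discrete and constant objects, epimorphisms\<close>

section \<open>Points\<close>

lemma fc_nz: "pca A ==> ph ~= {} ==> fc A W e (%_. ph)"
 by(auto intro: fc_const)

lemma fc_one: "fc A {()} e (%_. ph) ==> ph ~= {}"
 by(drule fc_ne[where w = "()"]) simp_all

lemma ent2_ne: "ent2 A F G ==> F x y ~= {} ==> G x y ~= {}"
 unfolding ent2_def by blast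

definition ptr :: "('u, 'a) tob => 'u => 'u => 'u => 'a set" where
 "ptr P q x y = (if x = undefined then snd P q y else {})"

definition pt :: "'a pas => ('u, 'a) tob => 'u => ('u, 'a) tarr" where
 "pt A P q = mk A tob1 (ptr P q) P"

lemma nz_sym:
 assumes "pca A" "tobj A P" "snd P x y ~= {}" shows "snd P y x ~= {}"
 by(rule fc_one[OF tobj_sym[OF assms(1,2) fc_nz[OF assms(1,3)]]])

lemma nz_frel:
 assumes A: "pca A" and F: "frel A P Q F" and x: "F x y ~= {}"
 shows "snd P x x ~= {}" "snd Q y y ~= {}" "snd P x x' ~= {} ==> F x' y ~= {}" "snd Q y y' ~= {} ==> F x y' ~= {}"
  "F x y' ~= {} ==> snd Q y y' ~= {}"
proof -
 note x' = fc_nz[OF A x]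
 show "snd P x x ~= {}" by(rule fc_one[OF frelD(1)[OF A F x']])
 show "snd Q y y ~= {}" by(rule fc_one[OF frelD(2)[OF A F x']])
 show "snd P x x' ~= {} ==> F x' y ~= {}" by(rule fc_one[OF frelD(3)[OF A F x' fc_nz[OF A]]])
 show "snd Q y y' ~= {} ==> F x y' ~= {}" by(rule fc_one[OF frelD(4)[OF A F x' fc_nz[OF A]]])
 show "F x y' ~= {} ==> snd Q y y' ~= {}" by(rule fc_one[OF frelD(5)[OF A F x' fc_nz[OF A]]])
qed

lemma nz_total:
 assumes A: "pca A" and F: "frel A P Q F" and x: "snd P x x ~= {}"
 obtains y where "F x y ~= {}"
proof -
 obtain y where "fc A {()} (%_. undefined) (%w. F x (y w))" by(rule frel_total[OF A F fc_nz[OF A x]])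
 from fc_ne[OF this, of "()"] show ?thesis using that by simp
qed

lemma ptr_fc: "pca A ==> fc2 A W e (ptr P q) x y <-> (ALL w:W. x w = undefined) & fc1 A W e (snd P q) y"
 unfolding ptr_def by(rule fc_if)

lemma pt_frel:
 fixes P :: "('u, 'a) tob"
 assumes A: "pca A" and P: "tobj A P" and q: "q : fst P"
 shows "frel A tob1 P (ptr P q)"
proof(rule frelI[OF A]; unfold ptr_fc[OF A] fc_undefined[OF A])
 fix W :: "('u, 'a) st1" and e x assume "ALL w:W. x w = undefined & x w = undefined"
 thus "EX y. (ALL w:W. x w = undefined) & fc1 A W e (snd P q) y"
  using fc_point[OF A P q, of W e] by(intro exI[of _ "%_. q"]) simp
next
 fix W :: "('u, 'a) st2" and e x y assume "(ALL w:W. x w = undefined) & fc1 A W e (snd P q) y"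
 thus "(ALL w:W. x w = undefined & x w = undefined) & fc2 A W e (snd P) y y"
  using tobj_refl2[OF A P, of W e "%_. q" y] by simp
next
 fix W :: "('u, 'a) st3" and e x y y'
 assume 1: "(ALL w:W. x w = undefined) & fc1 A W e (snd P q) y"
 show "(ALL w:W. x w = undefined) & fc1 A W e (snd P q) y'" if "fc2 A W e (snd P) y y'"
  using 1 tobj_trans[OF A P conjunct2[OF 1] that] by simp
 show "fc2 A W e (snd P) y y'" if "(ALL w:W. x w = undefined) & fc1 A W e (snd P q) y'"
  by(rule tobj_trans[OF A P tobj_sym[OF A P conjunct2[OF 1]] conjunct2[OF that]])
qed auto

lemma pt_hom:
 assumes "pca A" "set_universe TYPE('u)" "tobj A (P :: ('u, 'a) tob)" "q : fst P"
 shows "pt A P q : hom (TT A) tob1 P"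
 unfolding pt_def by(rule mk_hom[OF assms(1) tob1(1)[OF assms(1,2)] assms(3) pt_frel[OF assms(1,3,4)]])

text \<open>Over the one-element object a functional relation is fixed by any one of its
  values.\<close>

lemma pt_ex:
 fixes P :: "('u, 'a) tob"
 assumes A: "pca A" and f: "f : hom (TT A) tob1 P"
 shows "EX q:fst P. f = pt A P q"
proof -
 obtain F where F: "frel A tob1 P F" "f = mk A tob1 F P" "tobj A P" using f by(rule TT_homE[OF A])
 obtain q where q: "F undefined q ~= {}" by(rule nz_total[OF A F(1), of undefined]) (auto simp: tob1_def)
 hence qP: "q : fst P" using nz_frel(2)[OF A F(1) q] tobjD(2)[OF F(3)] by blast
 have "eqr A (ptr P q) F"
 proof(rule frel_le[OF A pt_frel[OF A F(3) qP] F(1)], rule ent2I[OF A], unfold ptr_fc[OF A], elim conjE)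
  fix W :: "('u, 'a) st2" and e and x y :: "'u * 'u * 'a => 'u" assume x: "ALL w:W. x w = undefined" and y: "fc1 A W e (snd P q) y"
  have "fc1 A W e (F undefined) y" by(rule frelD(4)[OF A F(1) fc_nz[OF A q] y])
  thus "fc2 A W e F x y" by(rule fc_mono) (use x in simp)
 qed
 thus ?thesis using qP by(intro bexI[of _ q]) (simp_all add: pt_def F(2) mk_eq[OF A] eqr_sym)
qed

text \<open>For a fixed pair of elements any single realizer is uniform, so equality of points loses
  all computational content.\<close>

lemma pt_eq:
 fixes P :: "('u, 'a) tob"
 assumes A: "pca A" and P: "tobj A P" and q: "q : fst P"
 shows "pt A P q = pt A P q' <-> snd P q q' ~= {}"
proof
 assume "pt A P q = pt A P q'"
 hence "ent2 A (ptr P q) (ptr P q')" unfolding pt_def mk_eq[OF A] eqr_def by simp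
 from ent2_ne[OF this, of undefined q] have "ptr P q' undefined q ~= {}"
  using tobjD(4)[OF P q] by(simp add: ptr_def)
 thus "snd P q q' ~= {}" using nz_sym[OF A P] by(simp add: ptr_def)
next
 assume 1: "snd P q q' ~= {}"
 have "eqr A (ptr P q) (ptr P q')"
 proof(rule eqrI[OF A], unfold ptr_fc[OF A])
  fix W :: "('u, 'a) st2" and e and x y :: "'u * 'u * 'a => 'u"
  show "((ALL w:W. x w = undefined) & fc1 A W e (snd P q) y) = ((ALL w:W. x w = undefined) & fc1 A W e (snd P q') y)"
   using tobj_trans[OF A P fc_nz[OF A 1], of W e y] tobj_trans[OF A P fc_nz[OF A nz_sym[OF A P 1]], of W e y] by blast
 qed
 thus "pt A P q = pt A P q'" unfolding pt_def mk_eq[OF A] .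
qed

lemma pt_cmp:
 fixes P Q :: "('u, 'a) tob"
 assumes A: "pca A" and P: "tobj A P" and Q: "tobj A Q" and F: "frel A P Q F" and q: "q : fst P" and y: "y : fst Q"
 shows "Cmp (TT A) (mk A P F Q) (pt A P q) = pt A Q y <-> F q y ~= {}"
proof
 assume "Cmp (TT A) (mk A P F Q) (pt A P q) = pt A Q y"
 hence "eqr A (rc A (ptr P q) F) (ptr Q y)" unfolding pt_def by(simp add: TT_cmp[OF A] mk_eq[OF A])
 hence "ent2 A (ptr Q y) (rc A (ptr P q) F)" unfolding eqr_def by simp
 from ent2_ne[OF this, of undefined y] have "rc A (ptr P q) F undefined y ~= {}"
  using tobjD(4)[OF Q y] by(simp add: ptr_def)
 then obtain p where "snd P q p ~= {}" "F p y ~= {}" by(auto simp: rc_def ptr_def)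
 thus "F q y ~= {}" using nz_frel(3)[OF A F] nz_sym[OF A P] by blast
next
 assume 1: "F q y ~= {}"
 have "eqr A (ptr Q y) (rc A (ptr P q) F)"
 proof(rule frel_le[OF A pt_frel[OF A Q y] frel_rc[OF A pt_frel[OF A P q] F]], rule ent2I[OF A], unfold ptr_fc[OF A] fc_rc[OF A], elim conjE)
  fix W :: "('u, 'a) st2" and e and x z :: "'u * 'u * 'a => 'u" assume x: "ALL w:W. x w = undefined" and z: "fc1 A W e (snd Q y) z"
  show "EX p. ((ALL w:W. x w = undefined) & fc1 A W e (snd P q) p) & fc2 A W e F p z"
   by(intro exI[of _ "%_. q"] conjI x fc_point[OF A P q] frelD(4)[OF A F fc_nz[OF A 1] z])
 qed
 thus "Cmp (TT A) (mk A P F Q) (pt A P q) = pt A Q y"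
  unfolding pt_def by(simp add: TT_cmp[OF A] mk_eq[OF A] eqr_sym)
qed

section \<open>Discrete objects\<close>

lemma fc_cong: "fc A W e ph ==> (!!w. w : W ==> ph w = ps w) ==> fc A W e ps"
 by(erule fc_mono) simp

definition dob :: "('u => 'a set) => ('u, 'a) tob" where
 "dob E = ({x. E x ~= {}}, %x y. if x = y then E x else {})"

lemma dob_fc: "pca A ==> fc2 A W e (snd (dob E)) x y <-> (ALL w:W. x w = y w) & fc1 A W e E x"
 unfolding dob_def snd_conv by(rule fc_if)

lemma fst_dob [simp]: "x : fst (dob E) <-> E x ~= {}"
 by(simp add: dob_def)

lemma dob_tobj:
 assumes A: "pca A" and s: "small TYPE('u) {x :: 'u. E x ~= {}}"
 shows "tobj A (dob E)"
proof(rule tobjI[OF A]; (unfold dob_fc[OF A])?)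
 show "small TYPE('u) (fst (dob E))" using s by(simp add: dob_def)
 show "snd (dob E) x y ~= {} ==> x : fst (dob E) & y : fst (dob E)" for x y by(simp add: dob_def split: if_splits)
 show "x : fst (dob E) ==> snd (dob E) x x ~= {}" for x by(simp add: dob_def)
next
 fix W :: "('u, 'a) st2" and e x y assume "(ALL w:W. x w = y w) & fc1 A W e E x"
 thus "(ALL w:W. y w = x w) & fc1 A W e E y" 
  using fc_cong[of A W e "%w. E (x w)" "%w. E (y w)"] by simp
qed simp

definition frc :: "('u => 'a set) => ('u => 'u) => 'u => 'u => 'a set" where
 "frc E f x y = (if y = f x then E x else {})"

lemma frc_fc: "pca A ==> fc2 A W e (frc E f) x y <-> (ALL w:W. y w = f (x w)) & fc1 A W e E x"
 unfolding frc_def by(rule fc_if)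

lemma frc_frel:
 fixes E :: "'u => 'a set"
 assumes A: "pca A" and e: "ent A E (%x. E' (f x))"
 shows "frel A (dob E) (dob E') (frc E f)"
proof(rule frelI[OF A]; unfold dob_fc[OF A] frc_fc[OF A]; (elim conjE)?)
 fix W :: "('u, 'a) st2" and r x y assume 1: "ALL w:W. y w = f (x w)" "fc1 A W r E x"
 have "fc1 A W r E' y" by(rule fc_cong[OF entD[OF A e 1(2)]]) (use 1(1) in simp)
 thus "((ALL w:W. x w = x w) & fc1 A W r E x) & (ALL w:W. y w = y w) & fc1 A W r E' y" using 1(2) by simp
next
 fix W :: "('u, 'a) st3" and r x x' y
 assume 1: "ALL w:W. y w = f (x w)" "ALL w:W. x w = x' w" "fc1 A W r E x"
 have "fc1 A W r E x'" by(rule fc_cong[OF 1(3)]) (use 1(2) in simp)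
 thus "(ALL w:W. y w = f (x' w)) & fc1 A W r E x'" using 1 by simp
next
 fix W :: "('u, 'a) st3" and r x y y'
 assume 1: "ALL w:W. y w = f (x w)" "ALL w:W. y' w = f (x w)" "fc1 A W r E x"
 have "fc1 A W r E' y" by(rule fc_cong[OF entD[OF A e 1(3)]]) (use 1(1) in simp)
 thus "(ALL w:W. y w = y' w) & fc1 A W r E' y" using 1 by simp
qed auto

lemma dob_pbc:
 assumes A: "pca A" and fp: "!!d. E d ~= {} ==> f (p d) = g (q d)"
  and inj: "!!d d'. E d ~= {} ==> E d' ~= {} ==> p d = p d' ==> q d = q d' ==> d = d'"
  and eE: "ent A E (%x. E1 (p x))" "ent A E (%x. E2 (q x))"
  and c: "!!(W :: ('u, 'a) st2) e x y. fc1 A W e E1 x ==> fc1 A W e E2 y ==> ALL w:W. f (x w) = g (y w) ==>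
   EX d. fc1 A W e E d & (ALL w:W. p (d w) = x w & q (d w) = y w)"
 shows "pbc A (dob (E :: 'u => 'a set)) (frc E1 f) (frc E2 g) (frc E p) (frc E q)"
 unfolding pbc_def
proof(intro conjI)
 show "eqr A (rc A (frc E p) (frc E1 f)) (rc A (frc E q) (frc E2 g))"
 proof(rule eqrI[OF A], rule iffI; unfold fc_rc[OF A] frc_fc[OF A]; elim exE conjE)
  fix W :: "('u, 'a) st2" and e d z x
  assume 1: "fc1 A W e E d" "ALL w:W. x w = p (d w)" "ALL w:W. z w = f (x w)"
  show "EX y. ((ALL w:W. y w = q (d w)) & fc1 A W e E d) & (ALL w:W. z w = g (y w)) & fc1 A W e E2 y"
   by(rule exI[of _ "%w. q (d w)"]) (use 1 fp fc_ne[OF 1(1)] entD[OF A eE(2) 1(1)] in simp)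
 next
  fix W :: "('u, 'a) st2" and e d z x
  assume 1: "fc1 A W e E d" "ALL w:W. x w = q (d w)" "ALL w:W. z w = g (x w)"
  show "EX y. ((ALL w:W. y w = p (d w)) & fc1 A W e E d) & (ALL w:W. z w = f (y w)) & fc1 A W e E1 y"
   by(rule exI[of _ "%w. p (d w)"]) (use 1 fp fc_ne[OF 1(1)] entD[OF A eE(1) 1(1)] in simp)
 qed
 show "ent2 A (%d d'. cj A (rc A (frc E p) (conv (frc E p)) d d') (rc A (frc E q) (conv (frc E q)) d d')) (snd (dob E))"
 proof(rule ent2I[OF A]; unfold fc_cj[OF A] fc_rc[OF A] fc_conv frc_fc[OF A] dob_fc[OF A]; elim exE conjE)
  fix W :: "('u, 'a) st2" and e d d' x y
  assume 1: "fc1 A W e E d" "ALL w:W. x w = p (d w)" "fc1 A W e E d'" "ALL w:W. x w = p (d' w)"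
   "ALL w:W. y w = q (d w)" "ALL w:W. y w = q (d' w)"
  have "d w = d' w" if w: "w : W" for w by(rule inj) (use 1 w fc_ne[OF 1(1) w] fc_ne[OF 1(3) w] in simp_all)
  thus "(ALL w:W. d w = d' w) & fc1 A W e E d" using 1(1) by simp
 qed
 show "ent2 A (rc A (frc E1 f) (conv (frc E2 g))) (rc A (conv (frc E p)) (frc E q))"
 proof(rule ent2I[OF A]; unfold fc_rc[OF A] fc_conv frc_fc[OF A]; elim exE conjE)
  fix W :: "('u, 'a) st2" and e x y z
  assume 1: "ALL w:W. z w = f (x w)" "fc1 A W e E1 x" "ALL w:W. z w = g (y w)" "fc1 A W e E2 y"
  have "ALL w:W. f (x w) = g (y w)" using 1(1,3) by simp
  from c[OF 1(2,4) this] show "EX d. ((ALL w:W. x w = p (d w)) & fc1 A W e E d) & (ALL w:W. y w = q (d w)) & fc1 A W e E d"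
   by(elim exE conjE, intro exI conjI) auto
 qed
qed

text \<open>\<open>dob (nab X)\<close> is the constant object on the set \<open>X\<close>: realizers
  say nothing about its elements.\<close>

definition nab :: "'u set => 'u => 'a set" where "nab X x = (if x : X then UNIV else {})"

lemma nab_fc: "pca A ==> fc1 A W e (nab X) x <-> (ALL w:W. x w : X)"
 unfolding nab_def by(rule fc_if_UNIV)

lemma nab_ne [simp]: "nab X x = {} <-> x \<notin> X" "nab X x ~= {} <-> x : X"
 by(simp_all add: nab_def)

section \<open>Epimorphisms\<close>

definition epi :: "('o, 'm) category => 'm => 'o => bool" where
 "epi C f Y <-> (ALL Z. ALL g:hom C Y Z. ALL h:hom C Y Z. Cmp C g f = Cmp C h f --> g = h)"

lemma surj_epi:
 fixes P :: "('u, 'a) tob"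
 assumes A: "pca A" and F: "frel A P Q F"
  and s: "ent A (%y. snd Q y y) (%y. \<Union>x. F x y)"
 shows "epi (TT A) (mk A P F Q) Q"
 unfolding epi_def
proof(intro allI ballI impI)
 fix Z :: "('u, 'a) tob" and g h assume gh: "g : hom (TT A) Q Z" "h : hom (TT A) Q Z"
  and eq: "Cmp (TT A) g (mk A P F Q) = Cmp (TT A) h (mk A P F Q)"
 obtain G where G: "frel A Q Z G" "g = mk A Q G Z" using gh(1) by(rule TT_homE[OF A])
 obtain H where H: "frel A Q Z H" "h = mk A Q H Z" using gh(2) by(rule TT_homE[OF A])
 have e: "eqr A (rc A F G) (rc A F H)" using eq by(simp add: G(2) H(2) TT_cmp[OF A] mk_eq[OF A])
 have "eqr A G H"
 proof(rule frel_le[OF A G(1) H(1)], rule ent2I[OF A])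
  fix W :: "('u, 'a) st2" and r y z assume yz: "fc2 A W r G y z"
  obtain x where x: "fc2 A W r F x y" using entD[OF A s frelD(1)[OF A G(1) yz]] unfolding fc_UN by blast
  have "fc2 A W r (rc A F G) x z" unfolding fc_rc[OF A] using x yz by blast
  then obtain y' where y': "fc2 A W r F x y'" "fc2 A W r H y' z"
   unfolding fc_eqr[OF A e] fc_rc[OF A] by blast
  show "fc2 A W r H y z" by(rule frelD(3)[OF A H(1) y'(2) frelD(5)[OF A F y'(1) x]])
 qed
 thus "g = h" by(simp add: G(2) H(2) mk_eq[OF A])
qed

definition imp :: "'a pas => 'a set => 'a set => 'a set" where
 "imp A ph ps = {b. ALL c:ph. EX v. A b c = Some v & v : ps}"

lemma fc_impD:
 assumes A: "pca A" and i: "fc2 A W e (imp A) ph ps" and p: "fc A W e ph"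
 shows "fc A W e ps"
proof -
 obtain q c where q: "cp A W e q" "ALL w:W. q w : imp A (ph w) (ps w)" and c: "cp A W e c" "ALL w:W. c w : ph w"
  using i p unfolding fc_cp by blast
 have "ALL w:W. EX v. A (q w) (c w) = Some v & v : ps w" using q(2) c(2) unfolding imp_def by blast
 from bchoice[OF this] obtain v where v: "ALL w:W. A (q w) (c w) = Some (v w) & v w : ps w" by blast
 have "cp A W e v" by(rule cp_app[OF A q(1) c(1)]) (use v in simp)
 thus ?thesis unfolding fc_cp using v by blast
qed

lemma fc_impI:
 fixes A :: "'a pas"
 assumes A: "pca A" and i: "!!(W' :: ('w * 'a) set) e' p. (!!ch. fc A W e ch ==> fc1 A W' e' ch p) ==>
  fc1 A W' e' ph p ==> fc1 A W' e' ps p"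
 shows "fc A (W :: 'w set) e (%w. imp A (ph w) (ps w))"
proof -
 define W' where "W' = {(w, b). w : W & b : ph w}"
 define e' where "e' = (%v. pp A (e (fst v)) (snd v))"
 have p: "cp A W' e' (%v. e (fst v))" "cp A W' e' snd"
  using cp_fst[OF A cp_id[OF A, of W' e', unfolded e'_def]] cp_snd[OF A cp_id[OF A, of W' e', unfolded e'_def]]
  unfolding e'_def by(simp_all add: eta_contract_eq)
 have "fc1 A W' e' ps fst"
 proof(rule i[of W' e' fst])
  fix ch assume "fc A W e ch"
  hence "fc A W' (%v. e (fst v)) (%v. ch (fst v))" unfolding fc_def W'_def by auto
  thus "fc1 A W' e' ch fst" by(rule fc_trans[OF A p(1)])
 next
  show "fc1 A W' e' ph fst" unfolding fc_cp using p(2) by(intro exI[of _ snd]) (auto simp: W'_def)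
 qed
 then obtain r where r: "!!w b. w : W ==> b : ph w ==> EX v. A r (pp A (e w) b) = Some v & v : ps w"
  unfolding fc_def W'_def e'_def by auto
 obtain s f where s: "!!x. A s x = Some (f x)"
  "!!x y v. ev A (y ## x ## (%_. r)) (Cn r $ Pair_t A (Vr 1) (Vr 0)) = Some v ==> A (f x) y = Some v"
  by(rule lam2[OF A]) blast
 have "f (e w) : imp A (ph w) (ps w)" if w: "w : W" for w
  unfolding imp_def
 proof(intro CollectI ballI)
  fix b assume b: "b : ph w"
  obtain v where v: "A r (pp A (e w) b) = Some v" "v : ps w" using r[OF w b] by blast
  have "ev A (b ## e w ## (%_. r)) (Pair_t A (Vr 1) (Vr 0)) = Some (pp A (e w) b)" by(rule ev_Pair[OF A]) simp_all
  hence "ev A (b ## e w ## (%_. r)) (Cn r $ Pair_t A (Vr 1) (Vr 0)) = Some v" using v(1) by simp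
  from s(2)[OF this] show "EX v. A (f (e w)) b = Some v & v : ps w" using v(2) by blast
 qed
 thus ?thesis unfolding fc_def using s(1) by blast
qed

text \<open>The maps \<open>true\<close> and \<open>y \<mapsto> (EX x. F x y)\<close> into the object of truth values agree after composition
 with \<open>F\<close>.\<close>

lemma epi_surj:
 fixes P Q :: "('u, 'a) tob"
 assumes A: "pca A" and U: "set_universe TYPE('u)" and sA: "small TYPE('u) (UNIV :: 'a set)"
  and F: "frel A P Q F" and Q: "tobj A Q" and P: "tobj A P"
  and ep: "epi (TT A) (mk A P F Q) Q"
 shows "ent A (%y. snd Q y y) (%y. \<Union>x. F x y)"
proof -
 obtain S :: "'u set" and d :: "'u => 'u => 'a set" where S: "small TYPE('u) S"
  "!!f. (!!z. f z ~= {} ==> z : {undefined}) ==> EX s:S. d s = f"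
  using small_functions[OF U small_finite[OF U, of "{undefined}"] sA] by auto
 define val where "val s = d s undefined" for s
 have "EX s. s : S & val s = ph" for ph
 proof -
  have "EX s:S. d s = (%z. if z = undefined then ph else {})" by(rule S(2)) (simp split: if_splits)
  then obtain s where "s : S" "d s = (%z. if z = undefined then ph else {})" ..
  thus ?thesis by(intro exI[of _ s]) (simp add: val_def)
 qed
 hence "ALL ph. EX s. s : S & val s = ph" by blast
 from choice[OF this] obtain c where c: "!!ph. c ph : S" "!!ph. val (c ph) = ph" by blast
 \<comment> \<open>Names of truth values, equal when they imply each other: the subobject
   classifier.\<close>
 define om where "om s s' = (if s : S & s' : S then cj A (imp A (val s) (val s')) (imp A (val s') (val s)) else {})" for s s'
 have w: "fc2 A W e om s s' <-> (ALL w:W. s w : S & s' w : S) &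
   fc A W e (%w. imp A (val (s w)) (val (s' w))) & fc A W e (%w. imp A (val (s' w)) (val (s w)))" for W :: "'w set" and e s s'
  unfolding om_def fc_if[OF A] fc_cj[OF A] ..
 have imp_trans: "fc2 A W e (imp A) ph ch"
  if 1: "fc2 A W e (imp A) ph ps" "fc2 A W e (imp A) ps ch" for W :: "'w set" and e ph ps ch
 proof(rule fc_impI[OF A])
  fix W' :: "('w * 'a) set" and e' p assume st: "!!ch. fc A W e ch ==> fc1 A W' e' ch p" and 2: "fc1 A W' e' ph p"
  show "fc1 A W' e' ch p" by(rule fc_impD[OF A st[OF 1(2)] fc_impD[OF A st[OF 1(1)] 2]])
 qed
 have imp_const: "fc2 A W e (imp A) ph ps" if 1: "fc A W e ps" for W :: "'w set" and e ph ps
 proof(rule fc_impI[OF A])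
  fix W' :: "('w * 'a) set" and e' p assume st: "!!ch. fc A W e ch ==> fc1 A W' e' ch p"
  show "fc1 A W' e' ps p" by(rule st[OF 1])
 qed
 have imp_refl: "fc2 A W e (imp A) ph ph" for W :: "'w set" and e ph
  by(rule fc_impI[OF A])
 define Om where "Om = ({s. om s s ~= {}}, om)"
 have w_sym: "fc2 A W e om s' s" if "fc2 A W e om s s'" for W :: "'w set" and e s s'
  using that unfolding w by simp
 have w_trans: "fc2 A W e om s s''"
  if "fc2 A W e om s s'" "fc2 A W e om s' s''" for W :: "'w set" and e s s' s''
  using that imp_trans[of W e "%w. val (s w)" "%w. val (s' w)" "%w. val (s'' w)"]
   imp_trans[of W e "%w. val (s'' w)" "%w. val (s' w)" "%w. val (s w)"] unfolding w by simp
 have Om: "tobj A Om"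
 proof(rule tobjI[OF A]; unfold Om_def fst_conv snd_conv)
  show "small TYPE('u) {s. om s s ~= {}}" by(rule small_subset[OF S(1)]) (auto simp: om_def)
  fix s s' assume "om s s' ~= {}"
  note 1 = fc_nz[OF A this]
  show "s : {s. om s s ~= {}} & s' : {s. om s s ~= {}}"
   using fc_one[OF w_trans[OF 1 w_sym[OF 1]]] fc_one[OF w_trans[OF w_sym[OF 1] 1]] by simp
 qed (auto intro: w_sym w_trans)
 have sO [simp]: "snd Om = om" by(simp add: Om_def)
 define I where "I y = (\<Union>x. F x y)" for y
 have I_fc: "fc1 A W e I y <-> (EX x. fc2 A W e F x y)" for W :: "'w set" and e y
  unfolding I_def fc_UN ..
 have I_ext: "fc A W e (%w. om (c (I (y w))) (c (I (y' w))))" if yy: "fc2 A W e (snd Q) y y'" for W :: "'w set" and e y y'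
  unfolding w c(2)
 proof(intro conjI fc_impI[OF A])
  fix W' :: "('w * 'a) set" and e' p assume st: "!!ch. fc A W e ch ==> fc1 A W' e' ch p"
  note 1 = st[OF yy] note 2 = tobj_sym[OF A Q 1]
  show "fc A W' e' (%v. I (y' (p v)))" if "fc A W' e' (%v. I (y (p v)))"
   using that frelD(4)[OF A F _ 1] unfolding I_fc by blast
  show "fc A W' e' (%v. I (y (p v)))" if "fc A W' e' (%v. I (y' (p v)))"
   using that frelD(4)[OF A F _ 2] unfolding I_fc by blast
 qed (simp add: c(1))
 define T where "T y s = cj A (snd Q y y) (cj A (om s s) (val s))" for y s
 have T_fc: "fc2 A W e T y s <-> fc2 A W e (snd Q) y y & fc2 A W e om s s & fc1 A W e val s" for W :: "'w set" and e y s
  unfolding T_def fc_cj[OF A] ..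
 define M where "M y s = cj A (snd Q y y) (om (c (I y)) s)" for y s
 have M_fc: "fc2 A W e M y s <-> fc2 A W e (snd Q) y y & fc A W e (%w. om (c (I (y w))) (s w))" for W :: "'w set" and e y s
  unfolding M_def fc_cj[OF A] ..
 have top: "fc A W e (%w. T (y w) (c UNIV)) <-> fc2 A W e (snd Q) y y" for W :: "'w set" and e y
  unfolding T_fc w c(2) using c(1) imp_refl[of W e "%_. UNIV"] fc_nz[OF A, of UNIV W e] by simp
 have T: "frel A Q Om T"
 proof(rule frelI[OF A]; unfold T_fc sO; (elim conjE)?)
  fix W :: "('u, 'a) st3" and e y s s'
  assume 1: "fc2 A W e om s s" "fc2 A W e om s' s'" "fc1 A W e val s" "fc1 A W e val s'"
  show "fc2 A W e om s s'" using 1(1,2) imp_const[OF 1(3)] imp_const[OF 1(4)] unfolding w by simp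
 next
  fix W :: "('u, 'a) st3" and e y s s'
  assume 1: "fc2 A W e om s s'" "fc1 A W e val s" "fc2 A W e (snd Q) y y"
  have "fc A W e (%w. imp A (val (s w)) (val (s' w)))" using 1(1) unfolding w by simp
  from fc_impD[OF A this 1(2)] show "fc2 A W e (snd Q) y y & fc2 A W e om s' s' & fc1 A W e val s'"
   using 1(3) w_trans[OF w_sym[OF 1(1)] 1(1)] by simp
 next
  fix W :: "('u, 'a) st1" and e y assume "fc2 A W e (snd Q) y y"
  thus "EX s. fc2 A W e (snd Q) y y & fc2 A W e om s s & fc1 A W e val s"
   using top[of W e y] unfolding T_fc by(intro exI[of _ "%_. c UNIV"]) simp
 qed (auto intro: tobj_refl2[OF A Q])
 have M: "frel A Q Om M"
 proof(rule frelI[OF A]; unfold M_fc sO; (elim conjE)?)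
  fix W :: "('u, 'a) st2" and e y s
  assume 1: "fc2 A W e (snd Q) y y" "fc A W e (%w. om (c (I (y w))) (s w))"
  show "fc2 A W e (snd Q) y y & fc2 A W e om s s" using 1(1) w_trans[OF w_sym[OF 1(2)] 1(2)] ..
 next
  fix W :: "('u, 'a) st3" and e y y' s
  assume 1: "fc2 A W e (snd Q) y y'" "fc A W e (%w. om (c (I (y w))) (s w))"
  show "fc2 A W e (snd Q) y' y' & fc A W e (%w. om (c (I (y' w))) (s w))"
   using tobj_refl2[OF A Q 1(1)] w_trans[OF w_sym[OF I_ext[OF 1(1)]] 1(2)] ..
 next
  fix W :: "('u, 'a) st3" and e y s s'
  assume 1: "fc2 A W e (snd Q) y y" "fc A W e (%w. om (c (I (y w))) (s w))"
  show "fc2 A W e (snd Q) y y & fc A W e (%w. om (c (I (y w))) (s' w))" if "fc2 A W e om s s'"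
   using 1(1) w_trans[OF 1(2) that] ..
  show "fc2 A W e om s s'" if "fc A W e (%w. om (c (I (y w))) (s' w))"
   by(rule w_trans[OF w_sym[OF 1(2)] that])
 next
  fix W :: "('u, 'a) st1" and e y assume 1: "fc2 A W e (snd Q) y y"
  show "EX s. fc2 A W e (snd Q) y y & fc A W e (%w. om (c (I (y w))) (s w))"
   by(intro exI[of _ "%w. c (I (y w))"] conjI 1 I_ext)
 qed
 have "eqr A (rc A F T) (rc A F M)"
 proof(rule frel_le[OF A frel_rc[OF A F T] frel_rc[OF A F M]], rule ent2I[OF A], unfold fc_rc[OF A] T_fc M_fc, elim exE conjE)
  fix W :: "('u, 'a) st2" and e x y s
  assume 1: "fc2 A W e F x y" "fc2 A W e (snd Q) y y" "fc2 A W e om s s" "fc1 A W e val s"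
  have "fc1 A W e I y" unfolding I_fc using 1(1) by blast
  from imp_const[OF this] have "fc A W e (%w. om (c (I (y w))) (s w))"
   using 1(3) imp_const[OF 1(4)] unfolding w c(2) using c(1) by simp
  thus "EX y. fc2 A W e F x y & fc2 A W e (snd Q) y y & fc A W e (%w. om (c (I (y w))) (s w))"
   using 1(1,2) by blast
 qed
 hence "Cmp (TT A) (mk A Q T Om) (mk A P F Q) = Cmp (TT A) (mk A Q M Om) (mk A P F Q)" by(simp add: TT_cmp[OF A] mk_eq[OF A])
 hence "mk A Q T Om = mk A Q M Om"
  using ep mk_hom[OF A Q Om T] mk_hom[OF A Q Om M] unfolding epi_def by blast
 hence TM: "eqr A T M" by(simp add: mk_eq[OF A])
 show ?thesis unfolding I_def[symmetric]
 proof(rule entI[OF A])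
  fix W :: "('u, 'a) st1" and e y assume "fc2 A W e (snd Q) y y"
  hence "fc A W e (%w. T (y w) (c UNIV))" unfolding top .
  \<comment> \<open>\<open>UNIV\<close> is true at every stage, so equality of the two maps at its
    name makes \<open>I y\<close> true as well.\<close>
  from this[unfolded fc_eqr[OF A TM, of W e y "%_. c UNIV"]]
  have "fc A W e (%w. imp A UNIV (I (y w)))" unfolding M_fc w c(2) by simp
  thus "fc1 A W e I y" by(rule fc_impD[OF A]) (rule fc_nz[OF A], simp)
 qed
qed

section \<open>From an inclusion of toposes to an applicative morphism\<close>

section \<open>Inverse images of inclusions\<close>

lemma two_elements:
 assumes U: "set_universe TYPE('u)"
 shows "EX x :: 'u. x ~= undefined"
proof(rule ccontr)
 assume "\<nexists>x :: 'u. x ~= undefined"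
 hence "(UNIV :: 'u set) = {undefined}" by auto
 hence "finite (UNIV :: 'u set)" by(metis finite.simps)
 thus False using infinite_universe[OF U] by simp
qed

text \<open>Equality in a constant object needs no realizer, so agreement on points is already
  uniform.\<close>

lemma pt_nab_eq:
 fixes Y :: "('u, 'a) tob"
 assumes A: "pca A" and N: "tobj A (dob (nab X) :: ('u, 'a) tob)"
  and f: "f : hom (TT A) Y (dob (nab X))" and g: "g : hom (TT A) Y (dob (nab X))"
  and eq: "!!q. q : fst Y ==> Cmp (TT A) f (pt A Y q) = Cmp (TT A) g (pt A Y q)"
 shows "f = g"
proof -
 obtain F where F: "frel A Y (dob (nab X)) F" "f = mk A Y F (dob (nab X))" "tobj A Y" using f by(rule TT_homE[OF A])
 obtain G where G: "frel A Y (dob (nab X)) G" "g = mk A Y G (dob (nab X))" using g by(rule TT_homE[OF A])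
 have FG: "G l x ~= {}" if "F l x ~= {}" for l x
 proof -
  have l: "l : fst Y" "x : fst (dob (nab X) :: ('u, 'a) tob)" 
   using nz_frel(1,2)[OF A F(1) that] tobjD(2)[OF F(3)] tobjD(2)[OF N] by blast+
  have "Cmp (TT A) f (pt A Y l) = pt A (dob (nab X)) x" using that by(simp add: F(2) pt_cmp[OF A F(3) N F(1) l])
  thus ?thesis using eq[OF l(1)] by(simp add: G(2) pt_cmp[OF A F(3) N G(1) l])
 qed
 have "eqr A F G"
 proof(rule frel_le[OF A F(1) G(1)], rule ent2I[OF A])
  fix W :: "('u, 'a) st2" and e l x assume 1: "fc2 A W e F l x"
  obtain x' where x': "fc2 A W e G l x'" by(rule frel_total[OF A G(1) frelD(1)[OF A F(1) 1]])
  have "x' w = x w" if w: "w : W" for w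
  proof -
   have "snd (dob (nab X)) (x' w) (x w) ~= ({} :: 'a set)"
    by(rule nz_frel(5)[OF A G(1) fc_ne[OF x' w] FG[OF fc_ne[OF 1 w]]])
   thus ?thesis by(simp add: dob_def split: if_splits)
  qed
  thus "fc2 A W e G l x" by(intro fc_cong[OF x']) simp
 qed
 thus ?thesis by(simp add: F(2) G(2) mk_eq[OF A])
qed

lemma nab_tobj: "pca A ==> small TYPE('u) X ==> tobj A (dob (nab X) :: ('u, 'a) tob)"
 by(rule dob_tobj) (simp_all add: nab_def)

definition fnr :: "('u, 'a) tob => ('u => 'u) => 'u => 'u => 'a set" where
 "fnr Y r q x = (if x = r q then snd Y q q else {})"

lemma fnr_fc: "pca A ==> fc2 A W e (fnr Y r) q x <-> (ALL w:W. x w = r (q w)) & fc2 A W e (snd Y) q q"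
 unfolding fnr_def by(rule fc_if)

lemma fnr_frel:
 fixes Y :: "('u, 'a) tob"
 assumes A: "pca A" and Y: "tobj A Y" and r: "!!q. q : fst Y ==> r q : X"
  and eq: "!!q q'. snd Y q q' ~= {} ==> r q = r q'"
 shows "frel A Y (dob (nab X)) (fnr Y r)"
proof(rule frelI[OF A]; unfold dob_fc[OF A] fnr_fc[OF A] nab_fc[OF A]; (elim conjE)?)
 fix W :: "('u, 'a) st2" and e q x assume 1: "ALL w:W. x w = r (q w)" "fc2 A W e (snd Y) q q"
 have "q w : fst Y" if "w : W" for w using fc_ne[OF 1(2) that] tobjD(2)[OF Y] by blast
 thus "fc2 A W e (snd Y) q q & (ALL w:W. x w = x w) & (ALL w:W. x w : X)" using 1 r by simp
next
 fix W :: "('u, 'a) st3" and e q q' x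
 assume 1: "ALL w:W. x w = r (q w)" "fc2 A W e (snd Y) q q'"
 thus "(ALL w:W. x w = r (q' w)) & fc2 A W e (snd Y) q' q'"
  using eq[OF fc_ne[OF 1(2)]] tobj_refl2[OF A Y 1(2)] by simp
next
 fix W :: "('u, 'a) st3" and e q x x'
 assume 1: "ALL w:W. x w = r (q w)" "ALL w:W. x' w = r (q w)" "fc2 A W e (snd Y) q q"
 have "q w : fst Y" if "w : W" for w using fc_ne[OF 1(3) that] tobjD(2)[OF Y] by blast
 thus "(ALL w:W. x w = x' w) & (ALL w:W. x w : X)" using 1 r by simp
qed auto

locale topos_incl =
 fixes A :: "'a pas" and B :: "'b pas"
  and L :: "(('u, 'a) tob, ('u, 'a) tarr, ('u, 'b) tob, ('u, 'b) tarr) func"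
 assumes A: "pca A" and B: "pca B" and U: "set_universe TYPE('u)"
  and sA: "small TYPE('u) (UNIV :: 'a set)" and sB: "small TYPE('u) (UNIV :: 'b set)"
  and L: "lexincl (TT A) (TT B) L"
begin

abbreviation "CA == Cmp (TT A)"
abbreviation "CB == Cmp (TT B)"
abbreviation "HA == hom (TT A)"
abbreviation "HB == hom (TT B)"
abbreviation "LO == FObj L"
abbreviation "LA == FArr L"
abbreviation "LE P == snd (FObj L P)"

lemmas TA = TT_cat[OF A] and TB = TT_cat[OF B]
lemmas Lf = lexinclD(1)[OF L] and Llex = lexinclD(2)[OF L]

lemma L_ob: "tobj A P ==> tobj B (LO P)"
 using fun_obj[OF Lf] by simp

lemma L_univ:
 assumes "tobj B Z"
 obtains V eps eps' where "ua (TT A) (TT B) L Z V eps" "tobj A V" "iso_in (TT B) eps eps' (LO V) Z"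
proof -
 obtain V eps where V: "ua (TT A) (TT B) L Z V eps" "is_iso (TT B) eps" using lexinclD(3)[OF L, of Z] assms by auto
 obtain eps' where "iso_in (TT B) eps eps' (LO V) Z" using V(2) is_iso_in[OF uaD(2)[OF V(1)]] by blast
 thus ?thesis using that V(1) uaD(1)[OF V(1)] by simp
qed

text \<open>\<open>L\<close> preserves the terminal object only up to isomorphism; \<open>io\<close>
  and \<open>ka\<close> are the comparison maps by which points are corrected.\<close>

definition io where "io = (THE f. f : HB tob1 (LO tob1))"
definition ka where "ka = (THE f. f : HB (LO tob1) tob1)"

lemma term1: "is_terminal (TT A) (tob1 :: ('u, 'a) tob)" "is_terminal (TT B) (tob1 :: ('u, 'b) tob)" "is_terminal (TT B) (LO tob1)"
proof -
 show 1: "is_terminal (TT A) (tob1 :: ('u, 'a) tob)" by(rule tterm_terminal[OF A tob1[OF A U]])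
 show "is_terminal (TT B) (tob1 :: ('u, 'b) tob)" by(rule tterm_terminal[OF B tob1[OF B U]])
 show "is_terminal (TT B) (LO tob1)" by(rule lexD(1)[OF Llex 1])
qed

lemma term_eq: "is_terminal C T ==> cat C ==> f : hom C X T ==> g : hom C X T ==> f = g"
 unfolding is_terminal_def by(metis cat_obj(1))

lemma term_ex1: "is_terminal C T ==> X : Obj C ==> EX! f. f : hom C X T"
 unfolding is_terminal_def by blast

lemma iota: "io : HB tob1 (LO tob1)" "ka : HB (LO tob1) tob1"
 "CB ka io = Idn (TT B) tob1" "CB io ka = Idn (TT B) (LO tob1)"
proof -
 have o: "(tob1 :: ('u, 'b) tob) : Obj (TT B)" "LO tob1 : Obj (TT B)" using tob1(1)[OF B U] L_ob[OF tob1(1)[OF A U]] by simp_all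
 show 1: "io : HB tob1 (LO tob1)" unfolding io_def by(rule theI'[OF term_ex1[OF term1(3) o(1)]])
 show 2: "ka : HB (LO tob1) tob1" unfolding ka_def by(rule theI'[OF term_ex1[OF term1(2) o(2)]])
 show "CB ka io = Idn (TT B) tob1" by(rule term_eq[OF term1(2) TB cat_comp[OF TB 1 2] cat_id[OF TB o(1)]])
 show "CB io ka = Idn (TT B) (LO tob1)" by(rule term_eq[OF term1(3) TB cat_comp[OF TB 2 1] cat_id[OF TB o(2)]])
qed

text \<open>If \<open>P\<close> is empty then it is initial, and so is \<open>L P\<close>; but a map from a point to \<open>L P\<close> would
 identify the two points of a two-element object.\<close>

lemma L_point_nonempty:
 assumes P: "tobj A P" and s: "s : HB tob1 (LO P)"
 shows "fst P ~= {}"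
proof
 assume e: "fst P = {}"
 obtain u :: 'u where u: "u ~= undefined" using two_elements[OF U] by blast
 define Z :: "('u, 'b) tob" where "Z = dob (nab {undefined, u})"
 have Z: "tobj B Z" unfolding Z_def by(rule nab_tobj[OF B small_finite[OF U]]) simp
 have zs: "undefined : fst Z" "u : fst Z" by(simp_all add: Z_def)
 obtain V eps eps' where V: "ua (TT A) (TT B) L Z V eps" "tobj A V" by(rule L_univ[OF Z])
 have LP: "LO P : Obj (TT B)" using L_ob[OF P] by simp
 obtain b where b: "b : HB (LO P) tob1" using term_ex1[OF term1(2) LP] by blast
 have bs: "CB b s = Idn (TT B) tob1"
  by(rule term_eq[OF term1(2) TB cat_comp[OF TB s b] cat_id[OF TB]]) (simp add: tob1(1)[OF B U])
 have eq: "g = g'" if g: "g : HB (LO P) Z" "g' : HB (LO P) Z" for g g'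
 proof -
  have Po: "P : Obj (TT A)" using P by simp
  obtain k where k: "k : HA P V" "CB eps (LA k) = g" using ua_ex[OF V(1) Po g(1)] by blast
  obtain k' where k': "k' : HA P V" "CB eps (LA k') = g'" using ua_ex[OF V(1) Po g(2)] by blast
  obtain F where F: "frel A P V F" "k = mk A P F V" using k(1) by(rule TT_homE[OF A])
  obtain F' where F': "frel A P V F'" "k' = mk A P F' V" using k'(1) by(rule TT_homE[OF A])
  have "F x y = {}" for x y using nz_frel(1)[OF A F(1), of x y] tobjD(2)[OF P, of x x] e by blast
  moreover have "F' x y = {}" for x y using nz_frel(1)[OF A F'(1), of x y] tobjD(2)[OF P, of x x] e by blast
  ultimately have "F = F'" by(intro ext) simp
  thus ?thesis using F(2) F'(2) k(2) k'(2) by simp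
 qed
 have "pt B Z z = CB (CB (pt B Z z) b) s" if "z : fst Z" for z
 proof -
  note h = pt_hom[OF B U Z that]
  show ?thesis unfolding cat_assoc[OF TB s b h, symmetric] bs cat_idr[OF TB h] ..
 qed
 moreover have "CB (pt B Z undefined) b = CB (pt B Z u) b"
  by(rule eq) (rule cat_comp[OF TB b pt_hom[OF B U Z]], rule zs)+
 ultimately have "pt B Z undefined = pt B Z u" using zs by metis
 hence "snd Z undefined u ~= {}" by(simp add: pt_eq[OF B Z zs(1)])
 thus False using u by(simp add: Z_def dob_def)
qed

definition pl :: "('u, 'a) tob => 'u => ('u, 'b) tarr" where
 "pl P q = CB (LA (pt A P q)) io"

lemma Lpt_hom: "tobj A P ==> q : fst P ==> LA (pt A P q) : HB (LO tob1) (LO P)"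
 by(rule fun_hom[OF Lf pt_hom[OF A U]])

lemma pl_hom: "tobj A P ==> q : fst P ==> pl P q : HB tob1 (LO P)"
 unfolding pl_def by(rule cat_comp[OF TB iota(1) Lpt_hom])

lemma pl_map:
 assumes k: "k : HA P Q" and P: "tobj A P" "q : fst P" and y: "CA k (pt A P q) = pt A Q y"
 shows "CB (LA k) (pl P q) = pl Q y"
 unfolding pl_def cat_assoc[OF TB iota(1) Lpt_hom[OF P] fun_hom[OF Lf k]]
  fun_cmp[OF Lf pt_hom[OF A U P] k, symmetric] y ..

text \<open>Pull \<open>f\<close> back along the point \<open>sg\<close>. By left exactness
  \<open>s\<close> lifts to the image of this pullback, which therefore has a point; hence the
  pullback has an element, and its projection to \<open>P\<close> is the required
  \<open>q\<close>.\<close>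

lemma pullback_point:
 assumes P: "tobj A P" and Q: "tobj A Q" and f: "f : HA P Q" and sg: "sg : HA tob1 Q"
  and s: "s : HB tob1 (LO P)" and eq: "CB (LA f) s = CB (LA sg) io"
 shows "EX q:fst P. CA f (pt A P q) = sg"
proof -
 obtain F where F: "frel A P Q F" "f = mk A P F Q" using f by(rule TT_homE[OF A])
 obtain S where S: "frel A tob1 Q S" "sg = mk A tob1 S Q" using sg by(rule TT_homE[OF A])
 note o1 = tob1(1)[OF A U]
 obtain D p q where D: "tobj A D" "frel A D P p" "frel A D tob1 q" "pbc A D F S p q"
  by(rule canonical_pullback[OF A U P o1 Q F(1) S(1)])
 define m where "m = mk A D p P" define n where "n = mk A D q tob1"
 have m: "m : HA D P" unfolding m_def by(rule mk_hom[OF A D(1) P D(2)])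
 have n: "n : HA D tob1" unfolding n_def by(rule mk_hom[OF A D(1) o1 D(3)])
 have pb: "is_pullback (TT A) f sg m n" unfolding F(2) S(2) m_def n_def
  by(rule pbc_pullback[OF A P o1 Q D(1) F(1) S(1) D(2,3,4)])
 note pbL = lexD(2)[OF Llex pb]
 note e = homD(2)[OF fun_hom[OF Lf f]] homD(2)[OF fun_hom[OF Lf sg]] homD(2)[OF fun_hom[OF Lf m]]
 have "EX h. h : HB tob1 (LO D)"
  using ex1_implies_ex[OF pbD(6)[OF pbL, unfolded e, OF s iota(1) eq]] by blast
 then obtain d where d: "d : fst D" using L_point_nonempty[OF D(1)] by blast
 note pd = pt_hom[OF A U D(1) d]
 obtain r where r: "r : fst P" "CA m (pt A D d) = pt A P r" using pt_ex[OF A cat_comp[OF TA pd m]] by blast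
 have nd: "CA n (pt A D d) = Idn (TT A) tob1"
  by(rule term_eq[OF term1(1) TA cat_comp[OF TA pd n] cat_id[OF TA]]) (simp add: o1)
 have "CA f (pt A P r) = sg"
  unfolding r(2)[symmetric] cat_assoc[OF TA pd m f] pbD(5)[OF pb] cat_assoc[OF TA pd n sg, symmetric] nd cat_idr[OF TA sg] ..
 thus ?thesis using r(1) by blast
qed

text \<open>This is \<open>pullback_point\<close> with one of the two points of \<open>P\<close> in
  the role of \<open>f\<close>.\<close>

lemma pl_inj:
 assumes P: "tobj A P" "q : fst P" "q' : fst P" and eq: "pl P q = pl P q'"
 shows "snd P q q' ~= {}"
proof -
 note h = pt_hom[OF A U P(1,2)] and h' = pt_hom[OF A U P(1,3)]
 obtain y where y: "y : fst (tob1 :: ('u, 'a) tob)" "CA (pt A P q) (pt A tob1 y) = pt A P q'"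
  using pullback_point[OF tob1(1)[OF A U] P(1) h h' iota(1) eq[unfolded pl_def]] by blast
 have "pt A tob1 y = Idn (TT A) tob1"
  by(rule term_eq[OF term1(1) TA pt_hom[OF A U tob1(1)[OF A U] y(1)] cat_id[OF TA]]) (simp add: tob1(1)[OF A U])
 hence "pt A P q = pt A P q'" using y(2) cat_idr[OF TA h] by metis
 thus ?thesis using pt_eq[OF A P(1,2)] by blast
qed

text \<open>Transpose \<open>s\<close> to a point \<open>sg\<close> of \<open>V\<close>, the value
  of the direct image at \<open>LO P\<close>. The counit can be cancelled, so the unit
  \<open>eta\<close> takes \<open>s\<close> to the image of \<open>sg\<close>, and
  \<open>pullback_point\<close> applies to \<open>eta\<close>.\<close>

lemma pl_surj:
 assumes P: "tobj A P" and s: "s : HB tob1 (LO P)"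
 shows "EX q:fst P. s = pl P q"
proof -
 obtain V eps eps' where V: "ua (TT A) (TT B) L (LO P) V eps" "tobj A V" "iso_in (TT B) eps eps' (LO V) (LO P)"
  by(rule L_univ[OF L_ob[OF P]])
 note eps = uaD(2)[OF V(1)]
 have LP: "LO P : Obj (TT B)" "P : Obj (TT A)" "(tob1 :: ('u, 'a) tob) : Obj (TT A)" using L_ob[OF P] P tob1(1)[OF A U] by simp_all
 obtain eta where eta: "eta : HA P V" "CB eps (LA eta) = Idn (TT B) (LO P)"
  using ua_ex[OF V(1) LP(2) cat_id[OF TB LP(1)]] by blast
 obtain sg where sg: "sg : HA tob1 V" "CB eps (LA sg) = CB s ka"
  using ua_ex[OF V(1) LP(3) cat_comp[OF TB iota(2) s]] by blast
 have inv: "x = y" if "x : HB tob1 (LO V)" "y : HB tob1 (LO V)" "CB eps x = CB eps y" for x y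
 proof -
  note i = V(3)[unfolded iso_in_def]
  have "z = CB eps' (CB eps z)" if z: "z : HB tob1 (LO V)" for z
  proof -
   have "eps' : HB (LO P) (LO V)" "CB eps' eps = Idn (TT B) (LO V)" using i by simp_all
   thus ?thesis using cat_assoc[OF TB z eps] cat_idl[OF TB z] by metis
  qed
  thus ?thesis using that by metis
 qed
 note Leta = fun_hom[OF Lf eta(1)] note Lsg = fun_hom[OF Lf sg(1)]
 have "CB (LA eta) s = CB (LA sg) io"
 proof(rule inv[OF cat_comp[OF TB s Leta] cat_comp[OF TB iota(1) Lsg]])
  show "CB eps (CB (LA eta) s) = CB eps (CB (LA sg) io)"
   unfolding cat_assoc[OF TB s Leta eps] cat_assoc[OF TB iota(1) Lsg eps] eta(2) sg(2)
    cat_assoc[OF TB iota(1,2) s, symmetric] iota(3) cat_idl[OF TB s] cat_idr[OF TB s] ..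
 qed
 from pullback_point[OF P V(2) eta(1) sg(1) s this]
 obtain q where q: "q : fst P" "CA eta (pt A P q) = sg" by blast
 have "CB eps (CB (LA eta) (pl P q)) = CB eps (CB (LA eta) s)"
  unfolding \<open>CB (LA eta) s = CB (LA sg) io\<close> pl_def cat_assoc[OF TB iota(1) Lpt_hom[OF P q(1)] Leta]
   fun_cmp[OF Lf pt_hom[OF A U P q(1)] eta(1), symmetric] q(2) ..
 hence "pl P q = s" unfolding cat_assoc[OF TB s Leta eps] cat_assoc[OF TB pl_hom[OF P q(1)] Leta eps] eta(2)
   cat_idl[OF TB s] cat_idl[OF TB pl_hom[OF P q(1)]] .
 thus ?thesis using q(1) by blast
qed

text \<open>\<open>lk P l q\<close>: the point \<open>l\<close> of \<open>L P\<close> is the image of the point \<open>q\<close> of \<open>P\<close>.\<close>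

definition lk :: "('u, 'a) tob => 'u => 'u => bool" where
 "lk P l q <-> l : fst (LO P) & q : fst P & pt B (LO P) l = pl P q"

lemma lk_ex1: "tobj A P ==> l : fst (LO P) ==> EX q. lk P l q"
 unfolding lk_def using pl_surj[OF _ pt_hom[OF B U L_ob]] by blast

lemma lk_ex2: "tobj A P ==> q : fst P ==> EX l. lk P l q"
 unfolding lk_def using pt_ex[OF B pl_hom] by metis

lemma lk_map:
 assumes P: "tobj A P" and Q: "tobj A Q" and F: "frel A P Q F" and M: "frel B (LO P) (LO Q) M"
  and FM: "LA (mk A P F Q) = mk B (LO P) M (LO Q)" and l: "lk P l q" "lk Q l' q'"
 shows "M l l' ~= {} <-> F q q' ~= {}"
proof -
 note l' = l[unfolded lk_def]
 have h: "l : fst (LO P)" "l' : fst (LO Q)" "q : fst P" "q' : fst Q" using l' by simp_all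
 note k = mk_hom[OF A P Q F]
 obtain q'' where q'': "q'' : fst Q" "CA (mk A P F Q) (pt A P q) = pt A Q q''"
  using pt_ex[OF A cat_comp[OF TA pt_hom[OF A U P h(3)] k]] by blast
 have "M l l' ~= {} <-> pl Q q'' = pl Q q'"
  using pt_cmp[OF B L_ob[OF P] L_ob[OF Q] M h(1,2)] l' pl_map[OF k P h(3) q''(2)] unfolding FM by simp
 also have "\<dots> <-> pt A Q q'' = pt A Q q'"
  using pl_inj[OF Q q''(1) h(4)] pt_eq[OF A Q q''(1)] unfolding pl_def by metis
 also have "\<dots> <-> F q q' ~= {}" using pt_cmp[OF A P Q F h(3,4)] q''(2) by simp
 finally show ?thesis .
qed

lemma lk_same:
 assumes P: "tobj A P" and l: "lk P l q" "lk P l' q'"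
 shows "LE P l l' ~= {} <-> snd P q q' ~= {}"
proof(rule lk_map[OF P P frel_id[OF A P] frel_id[OF B L_ob[OF P]] _ l])
 have "P : Obj (TT A)" using P by simp
 from fun_id[OF Lf this] show "LA (mk A P (snd P) P) = mk B (LO P) (LE P) (LO P)" by simp
qed

end

lemma fc_sing: "fc A W e (%w. {q w}) <-> cp A W e q"
 unfolding fc_cp by(auto elim: cp_cong)

text \<open>The existence predicate of a partitioned assembly. Such assemblies cover all objects
  and, unlike general ones, are pullbacks of \<open>A\<close>.\<close>

definition sgl :: "'u set => ('u => 'a) => 'u => 'a set" where
 "sgl X p x = (if x : X then {p x} else {})"

lemma sgl_fc: "pca A ==> fc1 A W e (sgl X p) x <-> (ALL w:W. x w : X) & cp A W e (%w. p (x w))"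
 unfolding sgl_def by(subst fc_if) (simp_all add: fc_sing)

lemma sgl_ne [simp]: "sgl X p x = {} <-> x \<notin> X" "sgl X p x ~= {} <-> x : X"
 by(simp_all add: sgl_def)

definition code :: "'a => 'u" where "code = (SOME f. inj f)"
definition decode :: "'u => 'a" where "decode = inv code"

lemma decode_code:
 assumes U: "set_universe TYPE('u)" and "small TYPE('u) (UNIV :: 'a set)"
 shows "decode (code a :: 'u) = (a :: 'a)"
proof -
 obtain f :: "'a => 'u" where "inj f" using small_inj[OF assms] by blast
 hence "inj (code :: 'a => 'u)" unfolding code_def by(rule someI[of inj])
 thus ?thesis unfolding decode_def by simp
qed

context topos_incl
begin

abbreviation NA :: "'u set => ('u, 'a) tob" where "NA X \<equiv> dob (nab X)"
abbreviation NB :: "'u set => ('u, 'b) tob" where "NB X \<equiv> dob (nab X)"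

lemma dob_lk_unique: "tobj A (dob E) ==> lk (dob E) l q ==> lk (dob E) l q' ==> q = q'"
proof -
 assume P: "tobj A (dob E)" and l: "lk (dob E) l q" "lk (dob E) l q'"
 have "l : fst (LO (dob E))" using l(1) unfolding lk_def by simp
 from tobjD(4)[OF L_ob[OF P] this] have "snd (dob E) q q' ~= {}" using lk_same[OF P l] by blast
 thus "q = q'" by(simp add: dob_def split: if_splits)
qed

lemma FArr_mk:
 assumes "tobj A P" "tobj A Q" "frel A P Q F"
 obtains M where "frel B (LO P) (LO Q) M" "LA (mk A P F Q) = mk B (LO P) M (LO Q)"
 using TT_homE[OF B fun_hom[OF Lf mk_hom[OF A assms]]] by metis

lemma fc_mem_fst: "tobj B P ==> fc2 B W e (snd P) x y ==> w : W ==> x w : fst P & y w : fst P"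
 using fc_ne tobjD(2,3) by fast

text \<open>\<open>T\<close> sends an element to the point it lies over. Its inverse is
  \<open>L m\<close> after the inverse of the counit, where \<open>m\<close> from \<open>V\<close>
  to \<open>NA X\<close> is the action of the counit on points. The two equations needed concern
  maps into constant objects, so they are checked on points.\<close>

lemma L_nabla:
 assumes X: "small TYPE('u) X"
 shows "EX T G. frel B (LO (NA X)) (NB X) T & frel B (NB X) (LO (NA X)) G &
  eqr B (rc B T G) (LE (NA X)) & eqr B (rc B G T) (snd (NB X)) &
  (ALL l x. T l x ~= {} --> lk (NA X) l x)"
proof -
 have N: "tobj A (NA X)" and Z: "tobj B (NB X)" by(rule nab_tobj[OF A X], rule nab_tobj[OF B X])
 note LN = L_ob[OF N]
 obtain V eps eps' where V: "ua (TT A) (TT B) L (NB X) V eps" "tobj A V" "iso_in (TT B) eps eps' (LO V) (NB X)"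
  by(rule L_univ[OF Z])
 note eps = uaD(2)[OF V(1)]
 have eps': "eps' : HB (NB X) (LO V)" "CB eps eps' = Idn (TT B) (NB X)" using V(3) unfolding iso_in_def by simp_all
 have "ALL q:fst V. EX x. x : X & CB eps (pl V q) = pt B (NB X) x"
 proof
  fix q assume "q : fst V"
  from pt_ex[OF B cat_comp[OF TB pl_hom[OF V(2) this] eps]]
  show "EX x. x : X & CB eps (pl V q) = pt B (NB X) x" by auto
 qed
 from bchoice[OF this] obtain r where r: "ALL q:fst V. r q : X & CB eps (pl V q) = pt B (NB X) (r q)" by blast
 have ptZ: "x = y" if "x : X" "pt B (NB X) x = pt B (NB X) y" for x y
  using pt_eq[OF B Z, of x y] that by(simp add: dob_def split: if_splits)
 have ptN: "x = y" if "x : X" "pt A (NA X) x = pt A (NA X) y" for x y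
  using pt_eq[OF A N, of x y] that by(simp add: dob_def split: if_splits)
 have rq: "r q = r q'" if q: "snd V q q' ~= {}" for q q'
 proof -
  have qs: "q : fst V" "q' : fst V" using tobjD(2,3)[OF V(2) q] by simp_all
  have "pt A V q = pt A V q'" using pt_eq[OF A V(2) qs(1)] q by blast
  hence "pl V q = pl V q'" by(simp add: pl_def)
  thus ?thesis using r qs ptZ by metis
 qed
 have rX: "q : fst V ==> r q : X" for q using r by blast
 define m where "m = mk A V (fnr V r) (NA X)"
 have mf: "frel A V (NA X) (fnr V r)" by(rule fnr_frel[OF A V(2) rX rq])
 have m: "m : HA V (NA X)" unfolding m_def by(rule mk_hom[OF A V(2) N mf])
 have mpt: "CA m (pt A V q) = pt A (NA X) (r q)" if q: "q : fst V" for q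
  unfolding m_def using pt_cmp[OF A V(2) N mf q, of "r q"] rX[OF q] tobjD(4)[OF V(2) q] by(simp add: fnr_def)
 have "ALL l:fst (LO (NA X)). EX x. lk (NA X) l x" using lk_ex1[OF N] by blast
 from bchoice[OF this] obtain pii where pii: "ALL l:fst (LO (NA X)). lk (NA X) l (pii l)" by blast
 define T where "T = fnr (LO (NA X)) pii"
 have pX: "pii l : X" if "l : fst (LO (NA X))" for l using pii that unfolding lk_def by simp
 have peq: "pii l = pii l'" if l: "LE (NA X) l l' ~= {}" for l l'
 proof -
  have ls: "lk (NA X) l (pii l)" "lk (NA X) l' (pii l')" using tobjD(2,3)[OF LN l] pii by blast+
  have "snd (NA X) (pii l) (pii l') ~= {}" using l lk_same[OF N ls] by blast
  thus ?thesis by(simp add: dob_def split: if_splits)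
 qed
 have Tf: "frel B (LO (NA X)) (NB X) T" unfolding T_def by(rule fnr_frel[OF B LN pX peq])
 define ta where "ta = mk B (LO (NA X)) T (NB X)"
 have ta: "ta : HB (LO (NA X)) (NB X)" unfolding ta_def by(rule mk_hom[OF B LN Z Tf])
 have tapl: "CB ta (pl (NA X) x) = pt B (NB X) x" if x: "x : X" for x
 proof -
  have "x : fst (NA X)" using x by simp
  from lk_ex2[OF N this] obtain l where l: "lk (NA X) l x" by blast
  hence ls: "l : fst (LO (NA X))" "pl (NA X) x = pt B (LO (NA X)) l" unfolding lk_def by simp_all
  have "pii l = x" using dob_lk_unique[OF N _ l] pii ls(1) by blast
  hence "T l x ~= {}" using tobjD(4)[OF LN ls(1)] by(simp add: T_def fnr_def)
  thus ?thesis unfolding ls(2) ta_def using pt_cmp[OF B LN Z Tf ls(1), of x] x by simp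
 qed
 note Lm = fun_hom[OF Lf m]
 have te: "CB ta (LA m) = eps"
 proof(rule pt_nab_eq[OF B Z cat_comp[OF TB Lm ta] eps])
  fix l assume "l : fst (LO V)"
  then obtain q where q: "lk V l q" using lk_ex1[OF V(2)] by blast
  hence ls: "pt B (LO V) l = pl V q" "q : fst V" unfolding lk_def by simp_all
  have "CB eps (pl V q) = pt B (NB X) (r q)" using r ls(2) by blast
  thus "CB (CB ta (LA m)) (pt B (LO V) l) = CB eps (pt B (LO V) l)"
   unfolding ls(1) cat_assoc[OF TB pl_hom[OF V(2) ls(2)] Lm ta, symmetric] pl_map[OF m V(2) ls(2) mpt[OF ls(2)]]
    tapl[OF rX[OF ls(2)]] by(rule sym)
 qed
 have No: "NA X : Obj (TT A)" using N by simp
 obtain n where n: "n : HA (NA X) V" "CB eps (LA n) = ta"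
  using ua_ex[OF V(1) No ta] by blast
 note Ln = fun_hom[OF Lf n(1)]
 have mn: "CA m n = Idn (TT A) (NA X)"
 proof(rule pt_nab_eq[OF A N cat_comp[OF TA n(1) m] cat_id[OF TA No]])
  fix x assume x: "x : fst (NA X)"
  note h = pt_hom[OF A U N x]
  obtain q where q: "q : fst V" "CA n (pt A (NA X) x) = pt A V q" using pt_ex[OF A cat_comp[OF TA h n(1)]] by blast
  have "pt B (NB X) (r q) = CB eps (pl V q)" using r q(1) by simp
  also have "\<dots> = CB ta (pl (NA X) x)"
   unfolding pl_map[OF n(1) N x q(2), symmetric] cat_assoc[OF TB pl_hom[OF N x] Ln eps] n(2) ..
  also have "\<dots> = pt B (NB X) x" using tapl x by simp
  finally have "r q = x" using ptZ rX[OF q(1)] by blast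
  thus "CA (CA m n) (pt A (NA X) x) = CA (Idn (TT A) (NA X)) (pt A (NA X) x)"
   unfolding cat_assoc[OF TA h n(1) m, symmetric] q(2) mpt[OF q(1)] cat_idl[OF TA h] by simp
 qed
 define g where "g = CB (LA m) eps'"
 have g: "g : HB (NB X) (LO (NA X))" unfolding g_def by(rule cat_comp[OF TB eps'(1) Lm])
 have tg: "CB ta g = Idn (TT B) (NB X)" unfolding g_def cat_assoc[OF TB eps'(1) Lm ta] te eps'(2) ..
 have e': "CB eps' eps = Idn (TT B) (LO V)" using V(3) unfolding iso_in_def by simp
 have "CB eps' ta = LA n" unfolding n(2)[symmetric] cat_assoc[OF TB Ln eps eps'(1)] e' cat_idl[OF TB Ln] ..
 hence gt: "CB g ta = Idn (TT B) (LO (NA X))"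
  unfolding g_def cat_assoc[OF TB ta eps'(1) Lm, symmetric] using fun_cmp[OF Lf n(1) m] mn fun_id[OF Lf No] by simp
 obtain G where G: "frel B (NB X) (LO (NA X)) G" "g = mk B (NB X) G (LO (NA X))" using g by(rule TT_homE[OF B])
 have "eqr B (rc B T G) (LE (NA X))" using gt unfolding G(2) ta_def by(simp add: TT_cmp[OF B] mk_eq[OF B])
 moreover have "eqr B (rc B G T) (snd (NB X))" using tg unfolding G(2) ta_def by(simp add: TT_cmp[OF B] mk_eq[OF B])
 moreover have "ALL l x. T l x ~= {} --> lk (NA X) l x"
 proof(intro allI impI)
  fix l x assume T: "T l x ~= {}"
  hence "x = pii l" "LE (NA X) l l ~= {}" by(simp_all add: T_def fnr_def split: if_splits)
  thus "lk (NA X) l x" using pii tobjD(2)[OF LN] by blast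
 qed
 ultimately show ?thesis using Tf G(1) by blast
qed

lemma nabla_surj:
 assumes X: "small TYPE('u) X" and x: "!!w. w : W ==> x w : X"
 shows "EX l. fc2 B W e (LE (NA X)) l l & (ALL w:W. lk (NA X) (l w) (x w))"
proof -
 obtain T G where TG: "frel B (LO (NA X)) (NB X) T" "frel B (NB X) (LO (NA X)) G"
  "eqr B (rc B G T) (snd (NB X))" "!!l x. T l x ~= {} ==> lk (NA X) l x" using L_nabla[OF X] by blast
 have xx: "fc2 B W e (snd (NB X)) x x" unfolding dob_fc[OF B] nab_fc[OF B] using x by simp
 obtain l where l: "fc2 B W e G x l" by(rule frel_total[OF B TG(2) xx])
 note ll = frelD(2)[OF B TG(2) l]
 obtain y where y: "fc2 B W e T l y" by(rule frel_total[OF B TG(1) ll])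
 have "fc2 B W e (rc B G T) x y" unfolding fc_rc[OF B] using l y by blast
 hence "ALL w:W. x w = y w" unfolding fc_eqr[OF B TG(3)] dob_fc[OF B] by simp
 hence "ALL w:W. lk (NA X) (l w) (x w)" using TG(4) fc_ne[OF y] by simp
 thus ?thesis using ll by blast
qed

text \<open>Along the isomorphism \<open>T\<close> both elements become equal in the constant object
  over \<open>B\<close>, where equality carries no realizers.\<close>

lemma nabla_inj:
 assumes X: "small TYPE('u) X"
  and l: "fc2 B W e (LE (NA X)) l l" "fc2 B W e (LE (NA X)) l' l'"
  and x: "!!w. w : W ==> lk (NA X) (l w) (x w)" "!!w. w : W ==> lk (NA X) (l' w) (x w)"
 shows "fc2 B W e (LE (NA X)) l l'"
proof -
 have N: "tobj A (NA X)" by(rule nab_tobj[OF A X])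
 note LN = L_ob[OF N]
 obtain T G where TG: "frel B (LO (NA X)) (NB X) T" "frel B (NB X) (LO (NA X)) G"
  "eqr B (rc B T G) (LE (NA X))" "!!l x. T l x ~= {} ==> lk (NA X) l x" using L_nabla[OF X] by blast
 obtain y where y: "fc2 B W e T l y" by(rule frel_total[OF B TG(1) l(1)])
 obtain y' where y': "fc2 B W e T l' y'" by(rule frel_total[OF B TG(1) l(2)])
 have yx: "y w = x w" if w: "w : W" for w by(rule dob_lk_unique[OF N TG(4)[OF fc_ne[OF y w]] x(1)[OF w]])
 have yx': "y' w = x w" if w: "w : W" for w by(rule dob_lk_unique[OF N TG(4)[OF fc_ne[OF y' w]] x(2)[OF w]])
 have y'': "fc2 B W e T l' y" by(rule fc_cong[OF y']) (simp add: yx yx')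
 obtain z where z: "fc2 B W e G y z" by(rule frel_total[OF B TG(2) frelD(2)[OF B TG(1) y]])
 have "fc2 B W e (rc B T G) l z" unfolding fc_rc[OF B] using y z by blast
 note 1 = this[unfolded fc_eqr[OF B TG(3)]]
 have "fc2 B W e (rc B T G) l' z" unfolding fc_rc[OF B] using y'' z by blast
 note 2 = this[unfolded fc_eqr[OF B TG(3)]]
 show ?thesis by(rule tobj_trans[OF B LN 1 tobj_sym[OF B LN 2]])
qed

lemma L_move:
 assumes E: "tobj A (dob E)" "tobj A (dob E')" and f: "ent A E (%x. E' (f x))"
  and l: "fc2 B W e (LE (dob E)) l l" "!!w. w : W ==> lk (dob E) (l w) (x w)"
  and M: "frel B (LO (dob E)) (LO (dob E')) M" "LA (mk A (dob E) (frc E f) (dob E')) = mk B (LO (dob E)) M (LO (dob E'))"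
 shows "EX l'. fc2 B W e (LE (dob E')) l' l' & fc2 B W e M l l' & (ALL w:W. lk (dob E') (l' w) (f (x w)))"
proof -
 obtain l' where l': "fc2 B W e M l l'" by(rule frel_total[OF B M(1) l(1)])
 note 1 = frelD(2)[OF B M(1) l']
 have "lk (dob E') (l' w) (f (x w))" if w: "w : W" for w
 proof -
  have "l' w : fst (LO (dob E'))" using fc_mem_fst[OF L_ob[OF E(2)] 1 w] by blast
  then obtain y where y: "lk (dob E') (l' w) y" using lk_ex1[OF E(2)] by blast
  have "frc E f (x w) y ~= {}" using lk_map[OF E frc_frel[where E = E and E' = E' and f = f, OF A f] M l(2)[OF w] y] fc_ne[OF l' w] by blast
  hence "y = f (x w)" by(simp add: frc_def split: if_splits)
  thus ?thesis using y by simp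
 qed
 thus ?thesis using 1 l' by blast
qed

text \<open>\<open>L\<close> keeps the pullback over the constant object on \<open>R\<close>. By
  \<open>nabla_inj\<close>, elements over \<open>Ea\<close> and \<open>Eb\<close> agree there as
  soon as their points do, and then both come from one element over \<open>E\<close>.\<close>

lemma L_join:
 assumes E: "tobj A (dob E)" "tobj A (dob Ea)" "tobj A (dob Eb)" and R: "small TYPE('u) R"
  and f: "ent A Ea (%x. nab R (f x))" and g: "ent A Eb (%x. nab R (g x))"
  and p: "ent A E (%d. Ea (p d))" and q: "ent A E (%d. Eb (q d))"
  and pb: "pbc A (dob E) (frc Ea f) (frc Eb g) (frc E p) (frc E q)"
  and l: "fc2 B W e (LE (dob Ea)) l l" "!!w. w : W ==> lk (dob Ea) (l w) (x w)"
  and l': "fc2 B W e (LE (dob Eb)) l' l'" "!!w. w : W ==> lk (dob Eb) (l' w) (x' w)"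
  and eq: "!!w. w : W ==> f (x w) = g (x' w)"
 shows "EX d. fc2 B W e (LE (dob E)) d d & (ALL w:W. EX c. lk (dob E) (d w) c & p c = x w & q c = x' w)"
proof -
 have N: "tobj A (NA R)" by(rule nab_tobj[OF A R])
 note Ef = frc_frel[where E = Ea and E' = "nab R" and f = f, OF A f] and Eg = frc_frel[where E = Eb and E' = "nab R" and f = g, OF A g]
  and Ep = frc_frel[where E = E and E' = Ea and f = p, OF A p] and Eq = frc_frel[where E = E and E' = Eb and f = q, OF A q]
 obtain F where F: "frel B (LO (dob Ea)) (LO (NA R)) F" "LA (mk A (dob Ea) (frc Ea f) (NA R)) = mk B (LO (dob Ea)) F (LO (NA R))"
  by(rule FArr_mk[OF E(2) N Ef])
 obtain G where G: "frel B (LO (dob Eb)) (LO (NA R)) G" "LA (mk A (dob Eb) (frc Eb g) (NA R)) = mk B (LO (dob Eb)) G (LO (NA R))"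
  by(rule FArr_mk[OF E(3) N Eg])
 obtain P where P: "frel B (LO (dob E)) (LO (dob Ea)) P" "LA (mk A (dob E) (frc E p) (dob Ea)) = mk B (LO (dob E)) P (LO (dob Ea))"
  by(rule FArr_mk[OF E(1,2) Ep])
 obtain Q where Q: "frel B (LO (dob E)) (LO (dob Eb)) Q" "LA (mk A (dob E) (frc E q) (dob Eb)) = mk B (LO (dob E)) Q (LO (dob Eb))"
  by(rule FArr_mk[OF E(1,3) Eq])
 have "is_pullback (TT A) (mk A (dob Ea) (frc Ea f) (NA R)) (mk A (dob Eb) (frc Eb g) (NA R)) (mk A (dob E) (frc E p) (dob Ea)) (mk A (dob E) (frc E q) (dob Eb))"
  by(rule pbc_pullback[OF A E(2,3) N E(1) Ef Eg Ep Eq pb])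
 from lexD(2)[OF Llex this, unfolded F(2) G(2) P(2) Q(2)]
 have pbL: "pbc B (LO (dob E)) F G P Q"
  by(rule pullback_pbc[OF B U L_ob[OF E(2)] L_ob[OF E(3)] L_ob[OF N] L_ob[OF E(1)] F(1) G(1) P(1) Q(1)])
 obtain z where z: "fc2 B W e (LE (NA R)) z z" "fc2 B W e F l z" "ALL w:W. lk (NA R) (z w) (f (x w))"
  using L_move[where f = f and E = Ea and E' = "nab R", OF E(2) N f l F] by blast
 obtain z' where z': "fc2 B W e (LE (NA R)) z' z'" "fc2 B W e G l' z'" "ALL w:W. lk (NA R) (z' w) (g (x' w))"
  using L_move[where f = g and E = Eb and E' = "nab R", OF E(3) N g l' G] by blast
 have "fc2 B W e (LE (NA R)) z' z"
  by(rule nabla_inj[OF R z'(1) z(1), of "%w. f (x w)"]) (use z(3) z'(3) eq in simp_all)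
 note gz = frelD(4)[OF B G(1) z'(2) this]
 obtain d where d: "fc2 B W e P d l" "fc2 B W e Q d l'" using pbcD(2)[OF B pbL z(2) gz] by blast
 note 1 = frelD(1)[OF B P(1) d(1)]
 have "EX c. lk (dob E) (d w) c & p c = x w & q c = x' w" if w: "w : W" for w
 proof -
  have "d w : fst (LO (dob E))" using fc_mem_fst[OF L_ob[OF E(1)] 1 w] by blast
  then obtain c where c: "lk (dob E) (d w) c" using lk_ex1[OF E(1)] by blast
  have "frc E p c (x w) ~= {}" using lk_map[OF E(1,2) Ep P c l(2)[OF w]] fc_ne[OF d(1) w] by blast
  moreover have "frc E q c (x' w) ~= {}" using lk_map[OF E(1,3) Eq Q c l'(2)[OF w]] fc_ne[OF d(2) w] by blast
  ultimately have "p c = x w" "q c = x' w" by(simp_all add: frc_def split: if_splits)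
  thus ?thesis using c by blast
 qed
 thus ?thesis using 1 by blast
qed

abbreviation PA :: "'u set => ('u => 'a) => ('u, 'a) tob" where "PA X p \<equiv> dob (sgl X p)"

abbreviation carr :: "('u, 'a) tob" where "carr \<equiv> PA (range (code :: 'a => 'u)) decode"

text \<open>\<open>carr\<close> is \<open>A\<close> as an object of its own topos. The images of
  \<open>a\<close> are the realizers, over \<open>B\<close>, of those elements of
  \<open>LO carr\<close> that lie over the point \<open>a\<close>.\<close>

definition gam :: "'a => 'b set" where
 "gam a = (\<Union>l. if lk carr l (code a) then LE carr l l else {})"

lemma PA_tobj: "small TYPE('u) X ==> tobj A (PA X p)"
 by(rule dob_tobj[OF A]) simp

lemma carr_tobj: "tobj A carr"
 by(rule PA_tobj) (rule small_image[OF sA])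

lemmas decA = decode_code[OF U sA] and decB = decode_code[OF U sB]

lemma gam_fc: "fc1 B W e gam a <->
  (EX l. (ALL w:W. lk carr (l w) (code (a w))) & fc2 B W e (LE carr) l l)"
 unfolding gam_def fc_UN fc_if[OF B] ..

lemma gam_ne: "gam a ~= {}"
proof -
 have "code a : fst carr" by simp
 from lk_ex2[OF carr_tobj this] obtain l where l: "lk carr l (code a)" by blast
 hence "l : fst (LO carr)" unfolding lk_def by simp
 from tobjD(4)[OF L_ob[OF carr_tobj] this] l show ?thesis unfolding gam_def by auto
qed

lemma PA_move:
 assumes X: "small TYPE('u) X" and f: "ent A (sgl X p) (%x. sgl (range (code :: 'a => 'u)) decode (f x))"
  and l: "fc2 B W e (LE (PA X p)) l l" "!!w. w : W ==> lk (PA X p) (l w) (x w)"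
  and a: "!!w. w : W ==> f (x w) = code (a w)"
 shows "fc1 B W e gam a"
proof -
 obtain M where M: "frel B (LO (PA X p)) (LO carr) M"
  "LA (mk A (PA X p) (frc (sgl X p) f) carr) = mk B (LO (PA X p)) M (LO carr)"
  by(rule FArr_mk[OF PA_tobj[OF X] carr_tobj frc_frel[where f = f and E = "sgl X p" and E' = "sgl (range (code :: 'a => 'u)) decode", OF A f]])
 show ?thesis using L_move[where f = f and E = "sgl X p" and E' = "sgl (range (code :: 'a => 'u)) decode", OF PA_tobj[OF X] carr_tobj f l M] a unfolding gam_fc by fastforce
qed

lemma ent_PA: "ent A (sgl X p) (%x. sgl (range (code :: 'a => 'u)) decode (code (p x) :: 'u))"
 by(rule entI[OF A], unfold sgl_fc[OF A] decA) simp

text \<open>A partitioned assembly is the pullback of \<open>carr\<close> along the map of constant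
  objects induced by \<open>p\<close>. As \<open>L\<close> preserves it, elements over
  \<open>x w\<close> in its image amount to elements of \<open>LO carr\<close> over
  \<open>p (x w)\<close>.\<close>

lemma gam_PA:
 assumes X: "small TYPE('u) X" and x: "!!w. w : W ==> x w : X"
 shows "fc B W e (%w. gam (p (x w))) <->
  (EX l. (ALL w:W. lk (PA X p) (l w) (x w)) & fc2 B W e (LE (PA X p)) l l)"
proof
 assume "EX l. (ALL w:W. lk (PA X p) (l w) (x w)) & fc2 B W e (LE (PA X p)) l l"
 then obtain l where l: "ALL w:W. lk (PA X p) (l w) (x w)" "fc2 B W e (LE (PA X p)) l l" by blast
 show "fc B W e (%w. gam (p (x w)))" by(rule PA_move[OF X ent_PA l(2)]) (use l(1) in simp_all)
next
 assume "fc B W e (%w. gam (p (x w)))"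
 then obtain l' where l': "ALL w:W. lk carr (l' w) (code (p (x w)))" "fc2 B W e (LE carr) l' l'"
  unfolding gam_fc by blast
 obtain l where l: "fc2 B W e (LE (NA X)) l l" "ALL w:W. lk (NA X) (l w) (x w)"
  using nabla_surj[OF X, of W x e] x by blast
 have e1: "ent A (nab X) (%x. nab (range (code :: 'a => 'u)) (code (p x) :: 'u))" by(rule entI[OF A], unfold nab_fc[OF A]) simp
 have e2: "ent A (sgl (range (code :: 'a => 'u)) decode) (%x. nab (range (code :: 'a => 'u)) (x :: 'u))" by(rule entI[OF A], unfold nab_fc[OF A] sgl_fc[OF A]) simp
 have e3: "ent A (sgl X p) (%x. nab X x)" by(rule entI[OF A], unfold nab_fc[OF A] sgl_fc[OF A]) simp
 have pb: "pbc A (PA X p) (frc (nab X) (%x. code (p x))) (frc (sgl (range (code :: 'a => 'u)) decode) (%x. x)) (frc (sgl X p) (%x. x)) (frc (sgl X p) (%x. code (p x)))"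
 proof(rule dob_pbc[OF A])
  fix W :: "('u, 'a) st2" and e x y
  assume 1: "fc1 A W e (nab X) x" "fc1 A W e (sgl (range (code :: 'a => 'u)) decode) y" "ALL w:W. code (p (x w)) = y w"
  have "cp A W e (%w. p (x w))"
   by(rule cp_cong[OF conjunct2[OF 1(2)[unfolded sgl_fc[OF A]]]]) (simp add: 1(3)[rule_format, symmetric] decA)
  thus "EX d. fc1 A W e (sgl X p) d & (ALL w:W. d w = x w & code (p (d w)) = y w)"
   using 1 unfolding sgl_fc[OF A] nab_fc[OF A] by blast
 qed (rule e3 ent_PA | simp)+
 obtain d where d: "fc2 B W e (LE (PA X p)) d d"
  "ALL w:W. EX c. lk (PA X p) (d w) c & c = x w & code (p c) = code (p (x w))"
  using L_join[where f = "%x. code (p x)" and g = "%x. x" and p = "%x. x" and q = "%x. code (p x)" and x = x and Ea = "nab X" and Eb = "sgl (range (code :: 'a => 'u)) decode", OF PA_tobj[OF X] nab_tobj[OF A X] carr_tobj small_image[OF sA] e1 e2 e3 ent_PA pb l(1) bspec[OF l(2)] l'(2) bspec[OF l'(1)] refl] by blast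
 thus "EX l. (ALL w:W. lk (PA X p) (l w) (x w)) & fc2 B W e (LE (PA X p)) l l" by blast
qed

text \<open>Application is a map into \<open>carr\<close> from the partitioned assembly of those
  pairs whose application is defined. The image of this map under \<open>L\<close> turns images of
  \<open>a\<close> and \<open>a'\<close> into an image of their application.\<close>

lemma amor_gam: "amor A B gam"
proof -
 define X :: "'u set" where "X = {upair (code a) (code a') | a a' c. A a a' = Some c}"
 define p p' :: "'u => 'a" where "p x = decode (ufst x)" and "p' x = decode (usnd x)" for x
 have pp: "p (upair (code a) (code a')) = a" "p' (upair (code a) (code a')) = a'" for a a'
  by(simp_all add: p_def p'_def ups[OF U] decA)
 have X: "small TYPE('u) X"
  by(rule small_upair[OF U small_image[OF sA, of code] small_image[OF sA, of code]]) (auto simp: X_def ups[OF U])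
 define W where "W = {(a, a', c, b, b'). A a a' = Some c & b : gam a & b' : gam a'}"
 define e where "e = (%w :: 'a * 'a * 'a * 'b * 'b. pp B (fst (snd (snd (snd w)))) (snd (snd (snd (snd w)))))"
 define x :: "'a * 'a * 'a * 'b * 'b => 'u" where "x w = upair (code (fst w)) (code (fst (snd w)))" for w
 have xX: "x w : X" if w: "w : W" for w
 proof -
  have "A (fst w) (fst (snd w)) = Some (fst (snd (snd w)))" using w by(auto simp: W_def)
  thus ?thesis unfolding x_def X_def by blast
 qed
 have px: "p (x w) = fst w" "p' (x w) = fst (snd w)" for w by(simp_all add: x_def pp)
 note e0 = cp_id[OF B, of W e, unfolded e_def]
 have "cp B W e (%w. fst (snd (snd (snd w))))" "cp B W e (%w. snd (snd (snd (snd w))))"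
  unfolding e_def using cp_fst[OF B e0] cp_snd[OF B e0] by simp_all
 hence 1: "fc B W e (%w. gam (p (x w)))" "fc B W e (%w. gam (p' (x w)))"
  unfolding px fc_cp by(auto simp: W_def)
 obtain l where l: "ALL w:W. lk (PA X p) (l w) (x w)" "fc2 B W e (LE (PA X p)) l l"
  using iffD1[OF gam_PA[where p = p and x = x and W = W and e = e, OF X xX] 1(1)] by blast
 obtain l' where l': "ALL w:W. lk (PA X p') (l' w) (x w)" "fc2 B W e (LE (PA X p')) l' l'"
  using iffD1[OF gam_PA[where p = p' and x = x and W = W and e = e, OF X xX] 1(2)] by blast
 define r where "r x = pp A (p x) (p' x)" for x
 have eN: "ent A (sgl X q) (%x. nab X x)" for q by(rule entI[OF A], unfold nab_fc[OF A] sgl_fc[OF A]) simp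
 have e1: "ent A (sgl X r) (%x. sgl X p x)"
  by(rule entI[OF A], unfold sgl_fc[OF A] r_def) (elim conjE, intro conjI, assumption, erule cp_fst[OF A])
 have e2: "ent A (sgl X r) (%x. sgl X p' x)"
  by(rule entI[OF A], unfold sgl_fc[OF A] r_def) (elim conjE, intro conjI, assumption, erule cp_snd[OF A])
 \<comment> \<open>The assembly realized by pairs is the intersection of the ones realized by first
   and by second components, so \<open>L_join\<close> can combine the two given elements.\<close>
 have pb: "pbc A (PA X r) (frc (sgl X p) (%x. x)) (frc (sgl X p') (%x. x)) (frc (sgl X r) (%x. x)) (frc (sgl X r) (%x. x))"
 proof(rule dob_pbc[OF A])
  fix W :: "('u, 'a) st2" and e x y
  assume 1: "fc1 A W e (sgl X p) x" "fc1 A W e (sgl X p') y" "ALL w:W. x w = y w"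
  have "cp A W e (%w. p' (x w))" by(rule cp_cong[OF conjunct2[OF 1(2)[unfolded sgl_fc[OF A]]]]) (simp add: 1(3))
  moreover have "cp A W e (%w. p (x w))" using 1(1) unfolding sgl_fc[OF A] by simp
  ultimately have "cp A W e (%w. r (x w))" unfolding r_def by(intro cp_pair[OF A])
  thus "EX d. fc1 A W e (sgl X r) d & (ALL w:W. d w = x w & d w = y w)"
   using 1 unfolding sgl_fc[OF A] by blast
 qed (rule e1 e2 | simp)+
 obtain d where d: "fc2 B W e (LE (PA X r)) d d"
  "ALL w:W. EX c. lk (PA X r) (d w) c & c = x w & c = x w"
  using L_join[where f = "%x. x" and g = "%x. x" and p = "%x. x" and q = "%x. x" and x = x and Ea = "sgl X p" and Eb = "sgl X p'", OF PA_tobj[OF X] PA_tobj[OF X] PA_tobj[OF X] X eN eN e1 e2 pb l(2) bspec[OF l(1)] l'(2) bspec[OF l'(1)] refl] by blast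
 define u :: "'u => 'u" where "u x = code (the (A (p x) (p' x)))" for x
 have u: "ent A (sgl X r) (%x. sgl (range (code :: 'a => 'u)) decode (u x))"
 proof(rule entI[OF A], unfold sgl_fc[OF A] u_def decA r_def, elim conjE)
  fix W :: "('u, 'a) st1" and e i assume 1: "ALL w:W. i w : X" "cp A W e (%w. pp A (p (i w)) (p' (i w)))"
  have "cp A W e (%w. the (A (p (i w)) (p' (i w))))"
   by(rule cp_app[OF A cp_fst[OF A 1(2)] cp_snd[OF A 1(2)]]) (use 1(1) in "force simp: X_def pp")
  thus "(ALL w:W. code (the (A (p (i w)) (p' (i w)))) : (range (code :: 'a => 'u))) & cp A W e (%w. the (A (p (i w)) (p' (i w))))" by simp
 qed
 have "fc B W e (%w. gam (fst (snd (snd w))))"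
  by(rule PA_move[OF X u d(1), of x]) (use d(2) in "auto simp: u_def px W_def")
 then obtain k where k0: "ALL w:W. EX v. B k (e w) = Some v & v : gam (fst (snd (snd w)))" unfolding fc_def by blast
 have k: "EX v. B k (pp B b b') = Some v & v : gam c" if "A a a' = Some c" "b : gam a" "b' : gam a'" for a a' c b b'
  using bspec[OF k0, of "(a, a', c, b, b')"] that by(simp add: W_def e_def)
 obtain s f where s: "!!x. B s x = Some (f x)"
  "!!x y v. ev B (y ## x ## (%_. k)) (Cn k $ Pair_t B (Vr 1) (Vr 0)) = Some v ==> B (f x) y = Some v"
  by(rule lam2[OF B]) blast
 have "EX x y. B s b = Some x & B x b' = Some y & y : gam c" if 1: "A a a' = Some c" "b : gam a" "b' : gam a'" for a a' c b b'
 proof -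
  obtain v where v: "B k (pp B b b') = Some v" "v : gam c" using k[OF 1] by blast
  have "ev B (b' ## b ## (%_. k)) (Pair_t B (Vr 1) (Vr 0)) = Some (pp B b b')" by(rule ev_Pair[OF B]) simp_all
  hence "ev B (b' ## b ## (%_. k)) (Cn k $ Pair_t B (Vr 1) (Vr 0)) = Some v" using v(1) by simp
  from s(2)[OF this] show ?thesis using s(1) v(2) by blast
 qed
 thus ?thesis unfolding amor_def using gam_ne by(intro conjI allI exI[of "%r. ALL a a' c b b'. A a a' = Some c --> b : gam a --> b' : gam a' --> (EX x y. B r b = Some x & B x b' = Some y & y : gam c)" s]) simp_all
qed

lemma L_epi:
 assumes P: "tobj A P" and V: "tobj A V" and k: "k : HA P V" and ep: "epi (TT A) k V"
 shows "epi (TT B) (LA k) (LO V)"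
 unfolding epi_def
proof(intro allI ballI impI)
 fix Z :: "('u, 'b) tob" and g h assume gh: "g : HB (LO V) Z" "h : HB (LO V) Z"
  and eq: "CB g (LA k) = CB h (LA k)"
 have "tobj B Z" using cat_obj(2)[OF TB gh(1)] by simp
 then obtain W eps eps' where W: "ua (TT A) (TT B) L Z W eps" "tobj A W" "iso_in (TT B) eps eps' (LO W) Z" by(rule L_univ)
 note eps = uaD(2)[OF W(1)]
 have Vo: "V : Obj (TT A)" using V by simp
 obtain g' where g': "g' : HA V W" "CB eps (LA g') = g" using ua_ex[OF W(1) Vo gh(1)] by blast
 obtain h' where h': "h' : HA V W" "CB eps (LA h') = h" using ua_ex[OF W(1) Vo gh(2)] by blast
 have "CA g' k = CA h' k"
 proof(rule ua_unique[OF W(1) TA Lf TB cat_comp[OF TA k g'(1)] cat_comp[OF TA k h'(1)]])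
  show "CB eps (LA (CA g' k)) = CB eps (LA (CA h' k))"
   unfolding fun_cmp[OF Lf k g'(1)] fun_cmp[OF Lf k h'(1)] cat_assoc[OF TB fun_hom[OF Lf k] fun_hom[OF Lf g'(1)] eps]
    cat_assoc[OF TB fun_hom[OF Lf k] fun_hom[OF Lf h'(1)] eps] g'(2) h'(2) eq ..
 qed
 hence "g' = h'" using ep g'(1) h'(1) unfolding epi_def by blast
 thus "g = h" using g'(2) h'(2) by simp
qed

text \<open>\<open>D\<close> is \<open>B\<close> as an object of its own topos, isomorphic to
  \<open>LO V\<close> by the counit. A partitioned assembly covers \<open>V\<close> and
  \<open>L\<close> preserves epimorphisms, so each \<open>b\<close> is hit by an element over some
  \<open>x b\<close>, and \<open>p (x b)\<close> is its code. Lifting through the cover encodes,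
  applying the cover decodes.\<close>

lemma inclusion_analysis:
 "EX ga h e t. amor A B ga & (ALL b. EX c. B e b = Some c & c : ga (h b)) & (ALL b. ALL c:ga (h b). B t c = Some b)"
proof -
 define R where "R = range (code :: 'b => 'u)"
 define D :: "('u, 'b) tob" where "D = dob (sgl R decode)"
 have D: "tobj B D" unfolding D_def by(rule dob_tobj[OF B]) (simp add: R_def small_image[OF sB])
 have Dfc: "fc2 B W e (snd D) x y <-> (ALL w:W. x w = y w & x w : R) & cp B W e (%w. decode (x w))" for W :: "'w set" and e x y
  unfolding D_def dob_fc[OF B] sgl_fc[OF B] by blast
 obtain V eps eps' where V: "ua (TT A) (TT B) L D V eps" "tobj A V" "iso_in (TT B) eps eps' (LO V) D" by(rule L_univ[OF D])
 note eps = uaD(2)[OF V(1)]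
 \<comment> \<open>Elements of \<open>V\<close> together with a realizer of their existence: the
   standard cover by a partitioned assembly.\<close>
 define X where "X = {upair v (code a) :: 'u | v a. a : snd V v v}"
 define p :: "'u => 'a" where "p x = decode (usnd x)" for x
 have pu: "p (upair v (code a)) = a" for v a by(simp add: p_def ups[OF U] decA)
 have vV: "v : fst V" if "a : snd V v v" for a v using tobjD(2)[OF V(2), of v v] that by blast
 have X: "small TYPE('u) X"
  by(rule small_upair[OF U tobjD(1)[OF V(2)] small_image[OF sA, of code]]) (auto simp: X_def ups[OF U] intro: vV)
 have pX: "p x : snd V (ufst x) (ufst x)" if "x : X" for x using that unfolding X_def by(auto simp: pu ups[OF U])
 define F where "F x v = (if x : X then cj A {p x} (snd V (ufst x) v) else {})" for x v
 have F_fc: "fc2 A W e F x v <-> (ALL w:W. x w : X) & cp A W e (%w. p (x w)) & fc A W e (%w. snd V (ufst (x w)) (v w))" for W :: "'w set" and e x v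
  unfolding F_def fc_if[OF A] fc_cj[OF A] fc_sing ..
 note P = PA_tobj[OF X, of p]
 have F: "frel A (PA X p) V F"
 proof(rule frelI[OF A]; unfold dob_fc[OF A] sgl_fc[OF A] F_fc; (elim conjE)?)
  fix W :: "('u, 'a) st3" and e x x' v
  assume 1: "ALL w:W. x w : X" "cp A W e (%w. p (x w))" "fc A W e (%w. snd V (ufst (x w)) (v w))" "ALL w:W. x w = x' w"
  have "cp A W e (%w. p (x' w))" by(rule cp_cong[OF 1(2)]) (simp add: 1(4))
  moreover have "fc A W e (%w. snd V (ufst (x' w)) (v w))" by(rule fc_cong[OF 1(3)]) (simp add: 1(4))
  ultimately show "(ALL w:W. x' w : X) & cp A W e (%w. p (x' w)) & fc A W e (%w. snd V (ufst (x' w)) (v w))" using 1(1,4) by simp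
 next
  fix W :: "('u, 'a) st1" and e x assume 1: "ALL w:W. x w : X" "cp A W e (%w. p (x w))"
  hence "fc A W e (%w. snd V (ufst (x w)) (ufst (x w)))" unfolding fc_cp using pX by(intro exI[of _ "%w. p (x w)"]) simp
  thus "EX v. (ALL w:W. x w : X) & cp A W e (%w. p (x w)) & fc A W e (%w. snd V (ufst (x w)) (v w))"
   using 1 by(intro exI[of _ "%w. ufst (x w)"]) simp
 next
  fix W :: "('u, 'a) st3" and e x v v'
  assume 1: "fc A W e (%w. snd V (ufst (x w)) (v w))" "fc A W e (%w. snd V (ufst (x w)) (v' w))"
  show "fc2 A W e (snd V) v v'" by(rule tobj_trans[OF A V(2) tobj_sym[OF A V(2) 1(1)] 1(2)])
 qed (auto intro: tobj_refl2[OF A V(2)] tobj_trans[OF A V(2)])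
 have s: "ent A (%v. snd V v v) (%v. \<Union>x. F x v)"
 proof(rule entI[OF A], unfold fc_UN F_fc)
  fix W :: "('u, 'a) st1" and e v assume 1: "fc2 A W e (snd V) v v"
  then obtain a where a: "cp A W e a" "ALL w:W. a w : snd V (v w) (v w)" unfolding fc_cp by blast
  have "ALL w:W. upair (v w) (code (a w)) : X" using a(2) unfolding X_def by blast
  thus "EX x. (ALL w:W. x w : X) & cp A W e (%w. p (x w)) & fc A W e (%w. snd V (ufst (x w)) (v w))"
   using 1 a(1) by(intro exI[of _ "%w. upair (v w) (code (a w))"]) (simp add: pu ups[OF U])
 qed
 define k where "k = mk A (PA X p) F V"
 have k: "k : HA (PA X p) V" unfolding k_def by(rule mk_hom[OF A P V(2) F])
 have "epi (TT A) k V" unfolding k_def by(rule surj_epi[OF A F s])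
 note epL = L_epi[OF P V(2) k this]
 note Lk = fun_hom[OF Lf k]
 obtain K where K: "frel B (LO (PA X p)) (LO V) K" "LA k = mk B (LO (PA X p)) K (LO V)" using Lk by(rule TT_homE[OF B])
 obtain E where E: "frel B (LO V) D E" "eps = mk B (LO V) E D" using eps by(rule TT_homE[OF B])
 define M where "M = rc B K E"
 have M: "frel B (LO (PA X p)) D M" unfolding M_def by(rule frel_rc[OF B K(1) E(1)])
 have mM: "mk B (LO (PA X p)) M D = CB eps (LA k)" unfolding K(2) E(2) TT_cmp[OF B] M_def ..
 have epM: "epi (TT B) (mk B (LO (PA X p)) M D) D" unfolding mM epi_def
 proof(intro allI ballI impI)
  fix Z g h assume g: "g : HB D Z" and h: "h : HB D Z"
   and eq: "CB g (CB eps (LA k)) = CB h (CB eps (LA k))"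
  have i: "eps' : HB D (LO V)" "CB eps eps' = Idn (TT B) D" using V(3) unfolding iso_in_def by simp_all
  have "CB g eps = CB h eps"
   using eq[unfolded cat_assoc[OF TB Lk eps g] cat_assoc[OF TB Lk eps h]] epL cat_comp[OF TB eps g] cat_comp[OF TB eps h]
   unfolding epi_def by blast
  hence "CB g (CB eps eps') = CB h (CB eps eps')"
   unfolding cat_assoc[OF TB i(1) eps g] cat_assoc[OF TB i(1) eps h] by simp
  thus "g = h" unfolding i(2) cat_idr[OF TB g] cat_idr[OF TB h] .
 qed
 note LP = L_ob[OF P]
 have sur: "ent B (%y. snd D y y) (%y. \<Union>x. M x y)" by(rule epi_surj[OF B U sB M D LP epM])
 \<comment> \<open>The generic element of \<open>D\<close> is \<open>b\<close> itself at the stage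
   of all \<open>b\<close>; surjectivity yields the elements \<open>l b\<close> of the cover
   uniformly.\<close>
 have "fc B UNIV (%b. b) (%b. snd D (code b) (code b))" unfolding Dfc decB using cp_id[OF B] by(simp add: R_def)
 from entD[OF B sur this] obtain l where l: "fc B UNIV (%b. b) (%b. M (l b) (code b))" unfolding fc_UN by blast
 note ll = frelD(1)[OF B M l]
 have lf: "l b : fst (LO (PA X p))" for b using fc_mem_fst[OF LP ll, of b] by simp
 hence "ALL b. EX x. lk (PA X p) (l b) x" using lk_ex1[OF P] by blast
 from choice[OF this] obtain x where x: "!!b. lk (PA X p) (l b) (x b)" by blast
 have xX: "x b : X" for b using x[of b] unfolding lk_def by simp
 have "fc B UNIV (%b. b) (%b. gam (p (x b)))"
  by(rule iffD2[OF gam_PA[where p = p and x = x, OF X xX]]) (use x ll in auto)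
 then obtain e where e: "!!b. EX c. B e b = Some c & c : gam (p (x b))" unfolding fc_def by blast
 \<comment> \<open>For decoding, the stage consists of all images \<open>c\<close> of the codes. The
   element obtained over \<open>x b\<close> may differ from \<open>l b\<close>, but it has the same
   point and hence the same value in \<open>D\<close>.\<close>
 define W where "W = {(b, c). c : gam (p (x b))}"
 have "fc B W snd (%w. gam (p (x (fst w))))" by(rule fc_mem[OF B]) (auto simp: W_def)
 then obtain l' where l': "ALL w:W. lk (PA X p) (l' w) (x (fst w))" "fc2 B W snd (LE (PA X p)) l' l'"
  using iffD1[OF gam_PA[where p = p and x = "%w. x (fst w)", OF X xX]] by blast
 obtain y where y: "fc2 B W snd M l' y" by(rule frel_total[OF B M l'(2)])
 have yb: "y w = code (fst w)" if w: "w : W" for w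
 proof -
  have 1: "lk (PA X p) (l' w) (x (fst w))" using l'(1) w by blast
  have "LE (PA X p) (l (fst w)) (l' w) ~= {}" using lk_same[OF P x 1] xX by(simp add: dob_def)
  hence "M (l' w) (code (fst w)) ~= {}" using nz_frel(3)[OF B M] fc_ne[OF l, of "fst w"] by blast
  hence "snd D (y w) (code (fst w)) ~= {}" using nz_frel(5)[OF B M fc_ne[OF y w]] by blast
  thus ?thesis by(simp add: D_def dob_def split: if_splits)
 qed
 have "cp B W snd (%w. decode (y w))" using frelD(2)[OF B M y] unfolding Dfc by simp
 hence "cp B W snd fst" by(rule cp_cong) (simp add: yb decB)
 then obtain t where "!!b c. c : gam (p (x b)) ==> B t c = Some b" unfolding cp_def W_def by auto
 thus ?thesis using amor_gam e by(intro exI[of _ gam] exI[of _ "%b. p (x b)"] exI[of _ e] exI[of _ t]) blast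
qed

end

section \<open>The pca \<open>A[f]\<close> and its universal property\<close>

section \<open>Adjoining a partial function\<close>

definition PairT :: "'a pas => 'a ct => 'a ct => 'a ct" where "PairT A t u = Pair_t A t u"
definition FstT :: "'a pas => 'a ct => 'a ct" where "FstT A t = Cn (P0_of A) $ t"
definition SndT :: "'a pas => 'a ct => 'a ct" where "SndT A t = Cn (P1_of A) $ t"

lemma ev_PFS:
 assumes "pca A"
 shows "ev A e t = Some a ==> ev A e u = Some b ==> ev A e (PairT A t u) = Some (pp A a b)"
  "ev A e t = Some (pp A a b) ==> ev A e (FstT A t) = Some a"
  "ev A e t = Some (pp A a b) ==> ev A e (SndT A t) = Some b"
 unfolding PairT_def FstT_def SndT_def
 using ev_Pair[OF assms] ev_Fst[OF assms] ev_Snd[OF assms] by blast+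

text \<open>\<open>beh f g us c\<close>: a machine which, after receiving the answers \<open>vs\<close>, outputs \<open>g vs\<close>, receives the
 answers \<open>us\<close> to its queries and then returns \<open>c\<close>.\<close>

fun beh :: "'a pas => ('a => 'a option) => ('a list => 'a option) => 'a list => 'a => bool" where
 "beh A f g [] c <-> g [] = Some (pp A (tru A) c)"
| "beh A f g (u # us) c <-> (EX d. g [] = Some (pp A (fls A) d) & f d = Some u) & beh A f (%vs. g (u # vs)) us c"

lemma beh_iff: "beh A f g us c <->
  (ALL k<length us. EX d. g (take k us) = Some (pp A (fls A) d) & f d = Some (us ! k)) &
  g us = Some (pp A (tru A) c)"
proof(induction us arbitrary: g)
 case (Cons u us)
 have "(ALL k<length (u # us). EX d. g (take k (u # us)) = Some (pp A (fls A) d) & f d = Some ((u # us) ! k)) <->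
  (EX d. g [] = Some (pp A (fls A) d) & f d = Some u) &
  (ALL k<length us. EX d. g (u # take k us) = Some (pp A (fls A) d) & f d = Some (us ! k))"
  by(simp only: length_Cons All_less_Suc2 take_0 nth_Cons_0 take_Suc_Cons nth_Cons_Suc)
 thus ?case unfolding beh.simps Cons.IH by blast
qed simp

lemma adjoin_result_beh: "adjoin_result A f a b c <-> (EX us. beh A f (%vs. A a (tup A (b # vs))) us c)"
 unfolding adjoin_result_def beh_iff ..

lemma beh_mono: "beh A f g us c ==> (!!vs v. g vs = Some v ==> g' vs = Some v) ==> beh A f g' us c"
 by(induction us arbitrary: g g') auto

text \<open>Two runs see the same queries and the same answers, and the Boolean tag tells both when
  to stop.\<close>

lemma beh_det:
 assumes A: "pca A" and n: "tru A ~= fls A"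
 shows "beh A f g us c ==> beh A f g us' c' ==> c = c'"
proof(induction us arbitrary: g us')
 case Nil thus ?case using n by(cases us') (auto simp: pca_pair_inject[OF A])
next
 case (Cons u us) thus ?case using n by(cases us') (auto simp: pca_pair_inject[OF A])
qed

lemma adjoin_Some:
 assumes "pca A" "tru A ~= fls A"
 shows "adjoin A f a b = Some c <-> (EX us. beh A f (%vs. A a (tup A (b # vs))) us c)"
 unfolding adjoin_result_beh[symmetric]
proof -
 have u: "adjoin_result A f a b c ==> adjoin_result A f a b c' ==> c = c'" for c c'
  unfolding adjoin_result_beh using beh_det[OF assms] by blast
 show "adjoin A f a b = Some c <-> adjoin_result A f a b c"
 proof(cases "EX c. adjoin_result A f a b c")
  case True
  then obtain c0 where c0: "adjoin_result A f a b c0" by blast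
  have "(THE c. adjoin_result A f a b c) = c0" by(rule the_equality, rule c0, rule u[OF _ c0])
  hence "adjoin A f a b = Some c0" unfolding adjoin_def using True by simp
  thus ?thesis using c0 u by auto
 qed (auto simp: adjoin_def)
qed

definition HdT :: "'a pas => 'a ct => 'a ct" where "HdT A t = FstT A (SndT A t)"
definition TlT :: "'a pas => 'a ct => 'a ct" where "TlT A t = SndT A (SndT A t)"
definition NilT :: "'a pas => 'a ct" where "NilT A = Cn (tup A [])"
definition ConsT :: "'a pas => 'a ct => 'a ct => 'a ct" where "ConsT A t u = PairT A (Cn (fls A)) (PairT A t u)"

lemma ev_list:
 assumes "pca A"
 shows "ev A e t = Some (tup A (a # as)) ==> ev A e (HdT A t) = Some a"
  "ev A e t = Some (tup A (a # as)) ==> ev A e (TlT A t) = Some (tup A as)"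
  "ev A e (NilT A) = Some (tup A [])"
  "ev A e t = Some a ==> ev A e u = Some (tup A as) ==> ev A e (ConsT A t u) = Some (tup A (a # as))"
  "ev A e t = Some (tup A (a # as)) ==> ev A e (FstT A t) = Some (fls A)"
  "ev A e t = Some (tup A []) ==> ev A e (FstT A t) = Some (tru A)"
 unfolding HdT_def TlT_def NilT_def ConsT_def by(auto intro!: ev_PFS[OF assms])

declare pca_tuple.simps [simp del]

abbreviation und :: "nat => 'a" where "und \<equiv> %_. undefined"

context
 fixes A :: "'a pas"
 assumes A: "pca A"
begin

lemmas evs = ev_PFS[OF A] ev_list[OF A] ev_If[OF A]

lemma ex_snoc: "EX s. ALL l u. A s (pp A (tup A l) u) = Some (tup A (l @ [u]))"
proof -
 let ?l = "FstT A (Vr 0)" and ?u = "SndT A (Vr 0)"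
 obtain r where r: "!!x v. ev A (x ## r ## und) (If A (FstT A ?l) (ConsT A ?u (NilT A))
   (ConsT A (HdT A ?l) (Vr 1 $ PairT A (TlT A ?l) ?u))) = Some v ==> A r x = Some v" by(rule pca_fix[OF A]) blast
 have "A r (pp A (tup A l) u) = Some (tup A (l @ [u]))" for l u
 proof(induction l)
  case Nil show ?case by(rule r, rule evs(10)) (simp_all add: evs)
 next
  case (Cons a l)
  have 0: "ev A (pp A (tup A (a # l)) u ## r ## und) ?l = Some (tup A (a # l))"
   by(rule evs) simp
  have 1: "ev A (pp A (tup A (a # l)) u ## r ## und) (PairT A (TlT A ?l) ?u) = Some (pp A (tup A l) u)"
   by(rule evs(1), rule evs(5), rule 0, rule evs(3)) simp
  show ?case unfolding append_Cons
   by(rule r, rule evs(11), rule evs(8), rule 0, rule evs(7), rule evs(4), rule 0) (simp add: 1 Cons.IH)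
 qed
 thus ?thesis by blast
qed

definition snoc where "snoc = (SOME s. ALL l u. A s (pp A (tup A l) u) = Some (tup A (l @ [u])))"

lemma snoc: "A snoc (pp A (tup A l) u) = Some (tup A (l @ [u]))"
proof -
 have "ALL l u. A snoc (pp A (tup A l) u) = Some (tup A (l @ [u]))"
  unfolding snoc_def by(rule someI_ex) (rule ex_snoc)
 thus ?thesis by blast
qed

text \<open>Run the machine \<open>a\<close> on the history \<open>l\<close> and the available answers \<open>ws\<close>; pass its result and the
 remaining answers to the continuation \<open>ka\<close>.\<close>

definition sarg where "sarg a l ws ka = pp A (pp A a ka) (pp A (tup A l) (tup A ws))"

lemma ex_sim: "EX s. ALL a l ws ka p v d u.
  (A a (tup A l) = Some (pp A (tru A) p) --> A ka (pp A p (tup A ws)) = Some v -->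
   A s (sarg a l ws ka) = Some v) &
  (A a (tup A l) = Some (pp A (fls A) d) -->
   A s (sarg a l [] ka) = Some (pp A (fls A) d)) &
  (A a (tup A l) = Some (pp A (fls A) d) --> A s (sarg a (l @ [u]) ws ka) = Some v -->
   A s (sarg a l (u # ws) ka) = Some v)"
proof -
 let ?a = "FstT A (FstT A (Vr 0))" and ?k = "SndT A (FstT A (Vr 0))" and ?l = "FstT A (SndT A (Vr 0))" and ?w = "SndT A (SndT A (Vr 0))"
 let ?o = "?a $ ?l"
 \<comment> \<open>A final result goes to the continuation. Otherwise the query is issued if no
   answers are left; with an answer at hand the simulation proceeds with a longer history.\<close>
 let ?t = "If A (FstT A ?o) (?k $ PairT A (SndT A ?o) ?w) (If A (FstT A ?w) ?o
  (Vr 1 $ PairT A (PairT A ?a ?k) (PairT A (Cn snoc $ PairT A ?l (HdT A ?w)) (TlT A ?w))))"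
 obtain r where r: "!!x v. ev A (x ## r ## und) ?t = Some v ==> A r x = Some v" by(rule pca_fix[OF A]) blast
 have c: "ev A (sarg a l ws ka ## e) ?a = Some a" "ev A (sarg a l ws ka ## e) ?k = Some ka"
  "ev A (sarg a l ws ka ## e) ?l = Some (tup A l)" "ev A (sarg a l ws ka ## e) ?w = Some (tup A ws)" for a l ws ka e
  unfolding sarg_def by(simp_all add: evs)
 have o: "A a (tup A l) = Some q ==> ev A (sarg a l ws ka ## e) ?o = Some q" for a l ws ka q e by(simp add: c)
 show ?thesis
 proof(intro exI[of _ r] allI conjI impI)
  fix a l ws ka p v assume 1: "A a (tup A l) = Some (pp A (tru A) p)" "A ka (pp A p (tup A ws)) = Some v"
  show "A r (sarg a l ws ka) = Some v"
  proof(rule r, rule evs(10), rule evs(2), rule o, rule 1(1))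
   have "ev A (sarg a l ws ka ## r ## und) (PairT A (SndT A ?o) ?w) = Some (pp A p (tup A ws))"
    by(rule evs(1), rule evs(3), rule o, rule 1(1), rule c)
   thus "ev A (sarg a l ws ka ## r ## und) (?k $ PairT A (SndT A ?o) ?w) = Some v" using 1(2) c by simp
  qed
 next
  fix a l ka d assume 1: "A a (tup A l) = Some (pp A (fls A) d)"
  show "A r (sarg a l [] ka) = Some (pp A (fls A) d)"
   by(rule r, rule evs(11), rule evs(2), rule o, rule 1, rule evs(10), rule evs(9), rule c, rule o, rule 1)
 next
  fix a l ws ka v d u
  assume 1: "A a (tup A l) = Some (pp A (fls A) d)" "A r (sarg a (l @ [u]) ws ka) = Some v"
  show "A r (sarg a l (u # ws) ka) = Some v"
  proof(rule r, rule evs(11), rule evs(2), rule o, rule 1(1), rule evs(11), rule evs(8), rule c)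
   let ?e = "sarg a l (u # ws) ka ## r ## und"
   have "ev A ?e (PairT A ?l (HdT A ?w)) = Some (pp A (tup A l) u)"
    by(rule evs(1), rule c, rule evs(4), rule c)
   hence "ev A ?e (Cn snoc $ PairT A ?l (HdT A ?w)) = Some (tup A (l @ [u]))" using snoc by simp
   hence "ev A ?e (PairT A (PairT A ?a ?k) (PairT A (Cn snoc $ PairT A ?l (HdT A ?w)) (TlT A ?w))) = Some (sarg a (l @ [u]) ws ka)"
    unfolding sarg_def[of a "l @ [u]"] by(intro evs(1) c evs(5)[where a = u])
   thus "ev A ?e (Vr 1 $ PairT A (PairT A ?a ?k) (PairT A (Cn snoc $ PairT A ?l (HdT A ?w)) (TlT A ?w))) = Some v"
    using 1(2) by simp
  qed
 qed
qed

definition sim where "sim = (SOME s. ALL a l ws ka p v d u.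
  (A a (tup A l) = Some (pp A (tru A) p) --> A ka (pp A p (tup A ws)) = Some v -->
   A s (sarg a l ws ka) = Some v) &
  (A a (tup A l) = Some (pp A (fls A) d) -->
   A s (sarg a l [] ka) = Some (pp A (fls A) d)) &
  (A a (tup A l) = Some (pp A (fls A) d) --> A s (sarg a (l @ [u]) ws ka) = Some v -->
   A s (sarg a l (u # ws) ka) = Some v))"

lemma sim: "A a (tup A l) = Some (pp A (tru A) p) ==> A ka (pp A p (tup A ws)) = Some v ==>
   A sim (sarg a l ws ka) = Some v"
  "A a (tup A l) = Some (pp A (fls A) d) ==> A sim (sarg a l [] ka) = Some (pp A (fls A) d)"
  "A a (tup A l) = Some (pp A (fls A) d) ==> A sim (sarg a (l @ [u]) ws ka) = Some v ==>
   A sim (sarg a l (u # ws) ka) = Some v"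
 using someI_ex[OF ex_sim, folded sim_def] by blast+

text \<open>The simulation uses up the answers \<open>us\<close> of the first machine, after which
  the continuation sees exactly the remaining ones: dialogues are concatenated.\<close>

lemma beh_sim:
 assumes "beh A f (%vs. A a (tup A (l @ vs))) us p" and k: "beh A f (%vs. A ka (pp A p (tup A vs))) ws r"
 shows "beh A f (%vs. A sim (sarg a l vs ka)) (us @ ws) r"
 using assms(1)
proof(induction us arbitrary: l)
 case Nil
 hence "A a (tup A l) = Some (pp A (tru A) p)" by simp
 thus ?case unfolding append_Nil by(intro beh_mono[OF k] sim(1))
next
 case (Cons u us)
 then obtain d where d: "A a (tup A l) = Some (pp A (fls A) d)" "f d = Some u" by auto
 have "beh A f (%vs. A a (tup A ((l @ [u]) @ vs))) us p" using Cons.prems by simp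
 from Cons.IH[OF this] have "beh A f (%vs. A sim (sarg a l (u # vs) ka)) (us @ ws) r"
  by(rule beh_mono) (rule sim(3)[OF d(1)])
 thus ?case using d sim(2)[OF d(1)] by(simp add: pca_pair_inject[OF A])
qed


context
 fixes f :: "'a => 'a option"
 assumes n: "tru A ~= fls A"
begin

lemma adj_pure: "A m (tup A [b]) = Some (pp A (tru A) v) ==> adjoin A f m b = Some v"
 unfolding adjoin_Some[OF A n] by(rule exI[of _ "[]"]) simp

lemma adj_lam2:
 obtains k g where "!!x. adjoin A f k x = Some (g x)" "!!x y v. ev A (y ## x ## e) t = Some v ==> A (g x) y = Some v"
proof -
 obtain a g where a: "!!x. A a x = Some (g x)" "!!x y v. ev A (y ## x ## e) t = Some v ==> A (g x) y = Some v"
  by(rule lam2[OF A]) blast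
 obtain k where k: "!!x v. ev A (x ## und) (PairT A (Cn (tru A)) (Cn a $ HdT A (Vr 0))) = Some v ==> A k x = Some v"
  by(rule lam1[OF A]) blast
 have "adjoin A f k x = Some (g x)" for x
 proof(rule adj_pure, rule k, rule evs(1))
  have "ev A (tup A [x] ## und) (HdT A (Vr 0)) = Some x" by(rule evs(4)) simp
  thus "ev A (tup A [x] ## und) (Cn a $ HdT A (Vr 0)) = Some (g x)" using a(1) by simp
 qed simp
 thus ?thesis using that a(2) by blast
qed

lemma adj_lam3:
 obtains k g h where "!!x. adjoin A f k x = Some (g x)" "!!x y. adjoin A f (g x) y = Some (h x y)"
  "!!x y z v. ev A (z ## y ## x ## e) t = Some v ==> A (h x y) z = Some v"
proof -
 obtain a g h where a: "!!x. A a x = Some (g x)" "!!x y. A (g x) y = Some (h x y)"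
  "!!x y z v. ev A (z ## y ## x ## e) t = Some v ==> A (h x y) z = Some v"
  by(rule lam3[OF A]) blast
 obtain k g' where k: "!!x. adjoin A f k x = Some (g' x)"
  "!!x y v. ev A (y ## x ## und) (PairT A (Cn (tru A)) (Cn a $ Vr 1 $ HdT A (Vr 0))) = Some v ==> A (g' x) y = Some v"
  by(rule adj_lam2) blast
 have "adjoin A f (g' x) y = Some (h x y)" for x y
 proof(rule adj_pure, rule k(2), rule evs(1))
  have "ev A (tup A [y] ## x ## und) (HdT A (Vr 0)) = Some y" by(rule evs(4)) simp
  thus "ev A (tup A [y] ## x ## und) (Cn a $ Vr 1 $ HdT A (Vr 0)) = Some (h x y)" using a(1,2) by simp
 qed simp
 thus ?thesis using that k(1) a(3) by blast
qed

text \<open>\<open>al\<close> realizes the canonical morphism from \<open>A\<close> to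
  \<open>A[f]\<close>, the identity on elements: it wraps an element of \<open>A\<close> as a
  machine that asks nothing.\<close>

lemma adj_app: "EX al. ALL a. EX x. adjoin A f al a = Some x & (ALL b c. A a b = Some c --> adjoin A f x b = Some c)"
proof -
 obtain k g where k: "!!x. adjoin A f k x = Some (g x)"
  "!!x y v. ev A (y ## x ## und) (PairT A (Cn (tru A)) (Vr 1 $ HdT A (Vr 0))) = Some v ==> A (g x) y = Some v"
  by(rule adj_lam2) blast
 have "adjoin A f (g a) b = Some c" if c: "A a b = Some c" for a b c
 proof(rule adj_pure, rule k(2), rule evs(1))
  have "ev A (tup A [b] ## a ## und) (HdT A (Vr 0)) = Some b" by(rule evs(4)) simp
  thus "ev A (tup A [b] ## a ## und) (Vr 1 $ HdT A (Vr 0)) = Some c" using c by simp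
 qed simp
 thus ?thesis using k(1) by blast
qed

lemma adj_oracle: "EX q. ALL d u. f d = Some u --> adjoin A f q d = Some u"
proof -
 let ?r = "TlT A (Vr 0)"
 obtain q where q: "!!x v. ev A (x ## und) (If A (FstT A ?r) (PairT A (Cn (fls A)) (HdT A (Vr 0)))
   (PairT A (Cn (tru A)) (HdT A ?r))) = Some v ==> A q x = Some v"
  by(rule lam1[OF A]) blast
 have q0: "A q (tup A [d]) = Some (pp A (fls A) d)" for d
  by(rule q, rule evs(10), rule evs(9), rule evs(5), simp, rule evs(1), simp, rule evs(4), simp)
 have q1: "A q (tup A [d, u]) = Some (pp A (tru A) u)" for d u
  by(rule q, rule evs(11), rule evs(8), rule evs(5), simp, rule evs(1), simp, rule evs(4), rule evs(5), simp)
 have "adjoin A f q d = Some u" if "f d = Some u" for d u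
  unfolding adjoin_Some[OF A n] by(rule exI[of _ "[u]"]) (use that in "simp add: q0 q1 pca_pair_inject[OF A]")
 thus ?thesis by blast
qed

lemma adj_S: "EX k g h. (ALL x. adjoin A f k x = Some (g x)) & (ALL x y. adjoin A f (g x) y = Some (h x y)) &
 (ALL a b c p q r. adjoin A f a c = Some p --> adjoin A f b c = Some q --> adjoin A f p q = Some r --> adjoin A f (h a b) c = Some r)"
proof -
 obtain k3 where k3: "!!x v. ev A (x ## und) (PairT A (Cn (tru A)) (FstT A (Vr 0))) = Some v ==> A k3 x = Some v"
  by(rule lam1[OF A]) blast
 let ?t = "%a l w k. Cn sim $ PairT A (PairT A a k) (PairT A l w)"
 have t: "A sim (sarg x [y] ws ka) = Some v ==> ev A e a = Some x ==> ev A e c = Some y ==> ev A e w = Some (tup A ws) ==>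
  ev A e k = Some ka ==> ev A e (?t a (ConsT A c (NilT A)) w k) = Some v" for e a x c y w ws k ka v
  unfolding sarg_def by(simp add: evs)
 obtain k2 g2 where k2: "!!x. A k2 x = Some (g2 x)" "!!x y v. ev A (y ## x ## und)
  (?t (Vr 1) (ConsT A (FstT A (Vr 0)) (NilT A)) (SndT A (Vr 0)) (Cn k3)) = Some v ==> A (g2 x) y = Some v"
  by(rule lam2[OF A]) blast
 obtain k1 f1 g1 where k1: "!!x. A k1 x = Some (f1 x)" "!!x y. A (f1 x) y = Some (g1 x y)" "!!x y z v. ev A (z ## y ## x ## und)
  (?t (Vr 2) (ConsT A (Vr 1) (NilT A)) (SndT A (Vr 0)) (Cn k2 $ FstT A (Vr 0))) = Some v ==> A (g1 x y) z = Some v"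
  by(rule lam3[OF A]) blast
 obtain k g h where k: "!!x. adjoin A f k x = Some (g x)" "!!x y. adjoin A f (g x) y = Some (h x y)" "!!x y z v. ev A (z ## y ## x ## und)
  (?t (Vr 2) (ConsT A (HdT A (Vr 0)) (NilT A)) (TlT A (Vr 0)) (Cn k1 $ Vr 1 $ HdT A (Vr 0))) = Some v ==> A (h x y) z = Some v"
  by(rule adj_lam3) blast
 have e3: "A k3 (pp A r (tup A ws)) = Some (pp A (tru A) r)" for r ws
  by(rule k3, rule evs(1), simp, rule evs(2)) simp
 have e2: "A (g2 p) (pp A q (tup A ws)) = Some v" if "A sim (sarg p [q] ws k3) = Some v" for p q ws v
  by(rule k2(2), rule t[OF that]) (simp_all add: evs)
 have e1: "A (g1 b c) (pp A p (tup A ws)) = Some v" if "A sim (sarg b [c] ws (g2 p)) = Some v" for b c p ws v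
  by(rule k1(3), rule t[OF that]) (simp_all add: evs k2(1) numeral_2_eq_2)
 have e0: "A (h a b) (tup A (c # ws)) = Some v" if "A sim (sarg a [c] ws (g1 b c)) = Some v" for a b c ws v
 proof(rule k(3), rule t[OF that])
  let ?e = "tup A (c # ws) ## b ## a ## und"
  show h: "ev A ?e (HdT A (Vr 0)) = Some c" by(rule evs(4)) simp
  show "ev A ?e (TlT A (Vr 0)) = Some (tup A ws)" by(rule evs(5)) simp
  show "ev A ?e (Cn k1 $ Vr 1 $ HdT A (Vr 0)) = Some (g1 b c)" using h by(simp add: k1)
 qed (simp add: numeral_2_eq_2)
 have "adjoin A f (h a b) c = Some r" if apq: "adjoin A f a c = Some p" "adjoin A f b c = Some q" "adjoin A f p q = Some r" for a b c p q r
 proof -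
  obtain us vs ws where
   u: "beh A f (%ws. A a (tup A ([c] @ ws))) us p" and v: "beh A f (%ws. A b (tup A ([c] @ ws))) vs q"
   and w: "beh A f (%ws. A p (tup A ([q] @ ws))) ws r"
   using apq unfolding adjoin_Some[OF A n] by auto
  have "beh A f (%ws. A k3 (pp A r (tup A ws))) [] r" by(simp add: e3)
  note b3 = beh_sim[OF w this]
  have "beh A f (%ws. A (g2 p) (pp A q (tup A ws))) (ws @ []) r" by(rule beh_mono[OF b3]) (rule e2)
  note b2 = beh_sim[OF v this]
  have "beh A f (%ws. A (g1 b c) (pp A p (tup A ws))) (vs @ ws @ []) r" by(rule beh_mono[OF b2]) (rule e1)
  note b1 = beh_sim[OF u this]
  have "beh A f (%ws. A (h a b) (tup A (c # ws))) (us @ vs @ ws @ []) r" by(rule beh_mono[OF b1]) (rule e0)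
  thus ?thesis unfolding adjoin_Some[OF A n] by blast
 qed
 thus ?thesis using k(1,2) by(intro exI[of _ k] exI[of _ g] exI[of _ h]) blast
qed

lemma adjoin_pca: "pca (adjoin A f)"
proof -
 obtain k g where k: "!!x. adjoin A f k x = Some (g x)"
  "!!x y v. ev A (y ## x ## und) (PairT A (Cn (tru A)) (Vr 1)) = Some v ==> A (g x) y = Some v"
  by(rule adj_lam2) blast
 have k': "adjoin A f (g a) b = Some a" for a b by(rule adj_pure, rule k(2)) (simp add: evs)
 obtain s p q where s: "ALL x. adjoin A f s x = Some (p x)" "ALL x y. adjoin A f (p x) y = Some (q x y)"
  "ALL a b c x y r. adjoin A f a c = Some x --> adjoin A f b c = Some y --> adjoin A f x y = Some r --> adjoin A f (q a b) c = Some r"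
  using adj_S by blast
 have "is_ks (adjoin A f) k s"
  unfolding is_ks_def using s by(auto simp: k(1) k' app_eq_Some)
 thus ?thesis unfolding pca_def by blast
qed

end
end

fun trm :: "'b => ('a => 'b) => 'a ct => 'b ct" where
 "trm r k (Vr n) = Vr n"
| "trm r k (Cn c) = Cn (k c)"
| "trm r k (t $ u) = Cn r $ trm r k t $ trm r k u"

lemma ev_trm:
 assumes r: "ALL a a' c b b'. A a a' = Some c --> b : ga a --> b' : ga a' --> (EX x y. B r b = Some x & B x b' = Some y & y : ga c)"
  and k: "!!c. k c : ga c" and e: "!!i. e' i : ga (e i)"
 shows "ev A e t = Some v ==> EX v'. ev B e' (trm r k t) = Some v' & v' : ga v"
proof(induction t arbitrary: v)
 case (Ap t u)
 obtain a a' where a: "ev A e t = Some a" "ev A e u = Some a'" "A a a' = Some v" using Ap.prems by(auto simp: app_eq_Some)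
 obtain b where b: "ev B e' (trm r k t) = Some b" "b : ga a" using Ap.IH(1)[OF a(1)] by blast
 obtain b' where b': "ev B e' (trm r k u) = Some b'" "b' : ga a'" using Ap.IH(2)[OF a(2)] by blast
 obtain x y where "B r b = Some x" "B x b' = Some y" "y : ga v" using r a(3) b(2) b'(2) by blast
 thus ?case using b(1) b'(1) by simp
qed (use k e in auto)

text \<open>The term is translated by \<open>trm\<close>, with the realizer \<open>r\<close> of the
  morphism in place of application. Thus programs written over \<open>A\<close> are available on
  images in \<open>B\<close>.\<close>

lemma amor_fun2:
 assumes A: "pca A" and B: "pca B" and ga: "amor A B ga"
 shows "EX m. ALL a b v. ev A (b ## a ## und) t = Some v --> (ALL x:ga a. ALL y:ga b. EX v':ga v. B m (pp B x y) = Some v')"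
proof -
 obtain r where r: "ALL a a' c b b'. A a a' = Some c --> b : ga a --> b' : ga a' --> (EX x y. B r b = Some x & B x b' = Some y & y : ga c)"
  using ga unfolding amor_def by blast
 have "ALL c. EX b. b : ga c" using ga unfolding amor_def by blast
 from choice[OF this] obtain k where k: "!!c. k c : ga c" by blast
 obtain l f where l: "!!x. B l x = Some (f x)" "!!x y v. ev B (y ## x ## (%_. k undefined)) (trm r k t) = Some v ==> B (f x) y = Some v"
  by(rule lam2[OF B]) blast
 obtain m where m: "!!x v. ev B (x ## und) (Cn l $ FstT B (Vr 0) $ SndT B (Vr 0)) = Some v ==> B m x = Some v" by(rule lam1[OF B]) blast
 have "EX v':ga v. B m (pp B x y) = Some v'" if 1: "ev A (b ## a ## und) t = Some v" "x : ga a" "y : ga b" for a b v x y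
 proof -
  have "(y ## x ## (%_. k undefined)) i : ga ((b ## a ## und) i)" for i using 1(2,3) k by(auto split: nat.split)
  from ev_trm[OF r k this 1(1)] obtain v' where v': "ev B (y ## x ## (%_. k undefined)) (trm r k t) = Some v'" "v' : ga v" by blast
  have "B m (pp B x y) = Some v'" by(rule m) (simp add: ev_PFS[OF B] l(1) l(2)[OF v'(1)])
  thus ?thesis using v'(2) by blast
 qed
 thus ?thesis by blast
qed

text \<open>Existence in the universal property of \<open>A[f]\<close>. \<open>B\<close> replays the
  dialogue: \<open>de\<close> decides from an image of the tag whether to stop, \<open>rh\<close>
  answers a query, and translated programs maintain an image of the history.\<close>

lemma adjoin_amor:
 fixes A :: "'a pas" and B :: "'b pas"
 assumes A: "pca A" and B: "pca B" and n: "tru A ~= fls A" and ga: "amor A B ga"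
  and d: "!!b. b : ga (tru A) ==> B de b = Some (tru B)" "!!b. b : ga (fls A) ==> B de b = Some (fls B)"
  and rh: "!!d u c. f d = Some u ==> c : ga d ==> EX v:ga u. B rh c = Some v"
 shows "amor (adjoin A f) B ga"
proof -
 obtain mf where mf: "!!a b v x y. ev A (b ## a ## und) (FstT A (Vr 1 $ Vr 0)) = Some v ==> x : ga a ==> y : ga b ==>
   EX v':ga v. B mf (pp B x y) = Some v'" using amor_fun2[OF A B ga] by metis
 obtain ms where ms: "!!a b v x y. ev A (b ## a ## und) (SndT A (Vr 1 $ Vr 0)) = Some v ==> x : ga a ==> y : ga b ==>
   EX v':ga v. B ms (pp B x y) = Some v'" using amor_fun2[OF A B ga] by metis
 obtain mn where mn: "!!a b v x y. ev A (b ## a ## und) (Cn (snoc A) $ PairT A (Vr 1) (Vr 0)) = Some v ==> x : ga a ==> y : ga b ==>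
   EX v':ga v. B mn (pp B x y) = Some v'" using amor_fun2[OF A B ga] by metis
 obtain mi where mi: "!!a b v x y. ev A (b ## a ## und) (ConsT A (Vr 0) (NilT A)) = Some v ==> x : ga a ==> y : ga b ==>
   EX v':ga v. B mi (pp B x y) = Some v'" using amor_fun2[OF A B ga] by metis
 let ?s = "Cn ms $ Vr 0"
 let ?n = "Cn mn $ PairT B (SndT B (Vr 0)) (Cn rh $ ?s)"
 obtain l where l: "!!x v. ev B (x ## l ## und) (If B (Cn de $ (Cn mf $ Vr 0)) ?s (Vr 1 $ PairT B (FstT B (Vr 0)) ?n)) = Some v ==>
  B l x = Some v" by(rule pca_fix[OF B]) blast
 have loop: "EX v:ga c. B l (pp B x z) = Some v"
  if "beh A f (%vs. A a (tup A (t @ vs))) us c" "x : ga a" "z : ga (tup A t)" for a t us c x z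
  using that
 proof(induction us arbitrary: t z)
  case Nil
  let ?e = "pp B x z ## l ## und"
  have 1: "ev A (tup A t ## a ## und) (Vr 1 $ Vr 0) = Some (pp A (tru A) c)" using Nil.prems(1) by simp
  obtain v' where v': "v' : ga (tru A)" "B mf (pp B x z) = Some v'" using mf[OF ev_PFS(2)[OF A 1] Nil.prems(2,3)] by blast
  obtain v where v: "v : ga c" "B ms (pp B x z) = Some v" using ms[OF ev_PFS(3)[OF A 1] Nil.prems(2,3)] by blast
  have "B l (pp B x z) = Some v" by(rule l, rule ev_If(1)[OF B]) (simp_all add: v' v d)
  thus ?case using v(1) by blast
 next
  case (Cons u us)
  let ?e = "pp B x z ## l ## und"
  obtain q where q: "A a (tup A t) = Some (pp A (fls A) q)" "f q = Some u" using Cons.prems(1) by auto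
  hence 1: "ev A (tup A t ## a ## und) (Vr 1 $ Vr 0) = Some (pp A (fls A) q)" by simp
  obtain v' where v': "v' : ga (fls A)" "B mf (pp B x z) = Some v'" using mf[OF ev_PFS(2)[OF A 1] Cons.prems(2,3)] by blast
  obtain v where v: "v : ga q" "B ms (pp B x z) = Some v" using ms[OF ev_PFS(3)[OF A 1] Cons.prems(2,3)] by blast
  obtain w where w: "w : ga u" "B rh v = Some w" using rh[OF q(2) v(1)] by blast
  have "ev A (u ## tup A t ## und) (Cn (snoc A) $ PairT A (Vr 1) (Vr 0)) = Some (tup A (t @ [u]))"
   by(simp add: ev_PFS[OF A] snoc[OF A])
  from mn[OF this Cons.prems(3) w(1)] obtain z' where z': "z' : ga (tup A (t @ [u]))" "B mn (pp B z w) = Some z'" by blast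
  have "beh A f (%vs. A a (tup A ((t @ [u]) @ vs))) us c" using Cons.prems(1) by simp
  from Cons.IH[OF this Cons.prems(2) z'(1)] obtain y where y: "y : ga c" "B l (pp B x z') = Some y" by blast
  have n: "ev B ?e ?n = Some z'" by(simp add: ev_PFS[OF B] v(2) w(2) z'(2))
  have "B l (pp B x z) = Some y"
   by(rule l, rule ev_If(2)[OF B]) (simp_all add: v' d ev_PFS[OF B] n[simplified] y(2) v(2) w(2) z'(2))
  thus ?case using y(1) by blast
 qed
 obtain R g where R: "!!x. B R x = Some (g x)"
  "!!x y v. ev B (y ## x ## und) (Cn l $ PairT B (Vr 1) (Cn mi $ PairT B (Vr 1) (Vr 0))) = Some v ==> B (g x) y = Some v"
  by(rule lam2[OF B]) blast
 have "EX y. B (g x) b' = Some y & y : ga c" if 1: "adjoin A f a a' = Some c" "x : ga a" "b' : ga a'" for a a' c x b'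
 proof -
  obtain us where us: "beh A f (%vs. A a (tup A ([a'] @ vs))) us c" using 1(1) unfolding adjoin_Some[OF A n] by auto
  have "ev A (a' ## a ## und) (ConsT A (Vr 0) (NilT A)) = Some (tup A [a'])" by(simp add: ev_list[OF A])
  from mi[OF this 1(2,3)] obtain z where z: "z : ga (tup A [a'])" "B mi (pp B x b') = Some z" by blast
  obtain y where y: "y : ga c" "B l (pp B x z) = Some y" using loop[OF us 1(2) z(1)] by blast
  have "B (g x) b' = Some y" by(rule R(2)) (simp add: ev_PFS[OF B] z(2) y(2))
  thus ?thesis using y(1) by blast
 qed
 hence "ALL a a' c b b'. adjoin A f a a' = Some c --> b : ga a --> b' : ga a' --> (EX x y. B R b = Some x & B x b' = Some y & y : ga c)"
  using R(1) by blast
 thus ?thesis using ga unfolding amor_def by blast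
qed

text \<open>The oracle for the case of an inclusion of toposes: it computes the application of \<open>B\<close> on the
 codes \<open>h b\<close>, and decodes \<open>h b\<close> to the \<open>a\<close> with \<open>b : ga a\<close>.\<close>

definition orc :: "'a pas => 'b pas => ('a => 'b set) => ('b => 'a) => 'a => 'a => bool" where
 "orc A B ga h d u <->
  (EX b b' c. d = pp A (tru A) (pp A (h b) (h b')) & B b b' = Some c & u = h c) |
  (EX b. d = pp A (fls A) (h b) & b : ga u)"

definition orcf :: "'a pas => 'b pas => ('a => 'b set) => ('b => 'a) => 'a => 'a option" where
 "orcf A B ga h d = (if EX u. orc A B ga h d u then Some (SOME u. orc A B ga h d u) else None)"

lemma adjoin_oracle:
 fixes A :: "'a pas" and B :: "'b pas"
 assumes A: "pca A" and B: "pca B" and nB: "EX x y :: 'b. x ~= y" and dA: "decidable_pca A"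
  and ga: "amor A B ga" and e: "!!b. EX c. B e b = Some c & c : ga (h b)" and t: "!!b c. c : ga (h b) ==> B t c = Some b"
 shows "EX f :: 'a => 'a option. pca (adjoin A f) & tru A ~= fls A & amor (adjoin A f) B ga & amor B (adjoin A f) (%b. {h b}) &
  (EX t'. ALL a. ALL b:ga a. adjoin A f t' (h b) = Some a)"
proof -
 have TFB: "tru B ~= fls B" using true_neq_false[OF B] nB by blast
 have hinj: "b = b'" if "h b = h b'" for b b'
 proof -
  obtain c where c: "c : ga (h b)" using e by blast
  hence "c : ga (h b')" unfolding that .
  from t[OF this] t[OF c] show ?thesis by simp
 qed
 have n: "tru A ~= fls A"
 proof
  assume "tru A = fls A"
  hence "h (tru B) = h (fls B)" using true_neq_false[OF A, of "h (tru B)" "h (fls B)"] by argo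
  from hinj[OF this] show False using TFB by simp
 qed
 obtain r where r: "!!a a' c b b'. A a a' = Some c ==> b : ga a ==> b' : ga a' ==> EX x y. B r b = Some x & B x b' = Some y & y : ga c"
  using ga unfolding amor_def by blast
 have ne: "EX b. b : ga a" for a using ga unfolding amor_def by blast
 \<comment> \<open>Sending the truth values of \<open>A\<close> to the codes of those of
   \<open>B\<close> and decoding with \<open>t\<close> shows that \<open>ga\<close> is
   decidable.\<close>
 obtain w where w: "!!x v. ev A (x ## und) (If A (Vr 0) (Cn (h (tru B))) (Cn (h (fls B)))) = Some v ==> A w x = Some v"
  by(rule lam1[OF A]) blast
 have wT: "A w (tru A) = Some (h (tru B))" by(rule w, rule ev_If(1)[OF A]) simp_all
 have wF: "A w (fls A) = Some (h (fls B))" by(rule w, rule ev_If(2)[OF A]) simp_all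
 obtain w' where w': "w' : ga w" using ne by blast
 obtain de where de: "!!x v. ev B (x ## und) (Cn t $ (Cn r $ Cn w' $ Vr 0)) = Some v ==> B de x = Some v" by(rule lam1[OF B]) blast
 have dT: "B de b = Some (tru B)" if b: "b : ga (tru A)" for b
 proof -
  obtain x y where "B r w' = Some x" "B x b = Some y" "y : ga (h (tru B))" using r[OF wT w' b] by blast
  thus ?thesis by(intro de) (simp add: t)
 qed
 have dF: "B de b = Some (fls B)" if b: "b : ga (fls A)" for b
 proof -
  obtain x y where "B r w' = Some x" "B x b = Some y" "y : ga (h (fls B))" using r[OF wF w' b] by blast
  thus ?thesis by(intro de) (simp add: t)
 qed
 obtain d0 where "ALL a b. Some d0 \<cdot>\<^bsub>A\<^esub> Some a \<cdot>\<^bsub>A\<^esub> Some b = Some (if a = b then tru A else fls A)"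
  using dA unfolding decidable_pca_def by blast
 hence d0: "EX x. A d0 a = Some x & A x b = Some (if a = b then tru A else fls A)" for a b
  by(simp only: app_Some) (simp add: app_eq_Some)
 \<comment> \<open>Decidability of \<open>A\<close> enters here: an element realizing both
   \<open>a\<close> and \<open>a'\<close> would, through the test \<open>d0 a\<close>, give one
   realizing both truth values, which \<open>de\<close> tells apart.\<close>
 have disj: "a = a'" if b: "b : ga a" "b : ga a'" for a a' b
 proof(rule ccontr)
  assume na: "a ~= a'"
  obtain x x' where x: "A d0 a = Some x" "A x a = Some (tru A)" "A x a' = Some (fls A)"
   using d0[of a a] d0[of a a'] na by auto
  obtain d' where d': "d' : ga d0" using ne by blast
  obtain p q where p: "B r d' = Some p" "B p b = Some q" "q : ga x" using r[OF x(1) d' b(1)] by blast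
  obtain y z where y: "B r q = Some y" "B y b = Some z" "z : ga (tru A)" using r[OF x(2) p(3) b(1)] by blast
  obtain y' z' where y': "B r q = Some y'" "B y' b = Some z'" "z' : ga (fls A)" using r[OF x(3) p(3) b(2)] by blast
  have "z = z'" using y y' by simp
  thus False using dT[OF y(3)] dF[OF y'(3)] TFB by simp
 qed
 note pi = pca_pair_inject[OF A]
 define f where "f = orcf A B ga h"
 \<comment> \<open>The tags separate the two kinds of queries. Answers are unique since codes are
   injective in the first kind and the sets \<open>ga u\<close> are disjoint in the second.\<close>
 have orc_u: "u = u'" if "orc A B ga h d u" "orc A B ga h d u'" for d u u'
  using that n unfolding orc_def by(auto simp: pi dest!: hinj dest: disj)
 have f_orc: "f d = Some u <-> orc A B ga h d u" for d u
 proof(cases "EX u. orc A B ga h d u")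
  case True
  hence "orc A B ga h d (SOME u. orc A B ga h d u)" by(rule someI_ex)
  thus ?thesis unfolding f_def orcf_def using True orc_u by auto
 qed (auto simp: f_def orcf_def)
 have fT: "f (pp A (tru A) (pp A (h b) (h b'))) = Some (h c)" if "B b b' = Some c" for b b' c
  unfolding f_orc orc_def using that by blast
 have fF: "f (pp A (fls A) (h b)) = Some a" if "b : ga a" for a b
  unfolding f_orc orc_def using that by blast
 have A': "pca (adjoin A f)" by(rule adjoin_pca[OF A n])
 obtain m0 where m0: "!!a b v x y. ev A (b ## a ## und) (FstT A (Vr 0)) = Some v ==> x : ga a ==> y : ga b ==>
   EX v':ga v. B m0 (pp B x y) = Some v'" using amor_fun2[OF A B ga] by metis
 obtain m1 where m1: "!!a b v x y. ev A (b ## a ## und) (SndT A (Vr 0)) = Some v ==> x : ga a ==> y : ga b ==>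
   EX v':ga v. B m1 (pp B x y) = Some v'" using amor_fun2[OF A B ga] by metis
 obtain p0 where p0: "!!x v. ev B (x ## und) (Cn m0 $ PairT B (Vr 0) (Vr 0)) = Some v ==> B p0 x = Some v" by(rule lam1[OF B]) blast
 obtain p1 where p1: "!!x v. ev B (x ## und) (Cn m1 $ PairT B (Vr 0) (Vr 0)) = Some v ==> B p1 x = Some v" by(rule lam1[OF B]) blast
 have P0: "EX v:ga a. B p0 x = Some v" if x: "x : ga (pp A a b)" for a b x
 proof -
  have "ev A (pp A a b ## pp A a b ## und) (FstT A (Vr 0)) = Some a" by(simp add: ev_PFS[OF A])
  from m0[OF this x x] show ?thesis by(auto intro!: p0 simp: ev_PFS[OF B])
 qed
 have P1: "EX v:ga b. B p1 x = Some v" if x: "x : ga (pp A a b)" for a b x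
 proof -
  have "ev A (pp A a b ## pp A a b ## und) (SndT A (Vr 0)) = Some b" by(simp add: ev_PFS[OF A])
  from m1[OF this x x] show ?thesis by(auto intro!: p1 simp: ev_PFS[OF B])
 qed
 let ?s = "Cn p1 $ Vr 0"
 \<comment> \<open>Over \<open>B\<close> the oracle is computable: either decode both codes, apply,
   and encode with \<open>e\<close>, or decode to \<open>b\<close>, which already is an image of the
   answer.\<close>
 obtain rh where rh: "!!x v. ev B (x ## und) (If B (Cn de $ (Cn p0 $ Vr 0))
   (Cn e $ (Cn t $ (Cn p0 $ ?s) $ (Cn t $ (Cn p1 $ ?s)))) (Cn t $ ?s)) = Some v ==> B rh x = Some v" by(rule lam1[OF B]) blast
 have rep: "EX v:ga u. B rh c = Some v" if fd: "f d = Some u" and c: "c : ga d" for d u c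
 proof -
  consider b b' x where "d = pp A (tru A) (pp A (h b) (h b'))" "B b b' = Some x" "u = h x"
   | b where "d = pp A (fls A) (h b)" "b : ga u" using fd unfolding f_orc orc_def by blast
  thus ?thesis
  proof cases
   case 1
   obtain v0 where v0: "v0 : ga (tru A)" "B p0 c = Some v0" using P0 c unfolding 1(1) by blast
   obtain v1 where v1: "v1 : ga (pp A (h b) (h b'))" "B p1 c = Some v1" using P1 c unfolding 1(1) by blast
   obtain v2 where v2: "v2 : ga (h b)" "B p0 v1 = Some v2" using P0 v1(1) by blast
   obtain v3 where v3: "v3 : ga (h b')" "B p1 v1 = Some v3" using P1 v1(1) by blast
   obtain v where v: "B e x = Some v" "v : ga u" using e[of x] 1(3) by blast
   have "B rh c = Some v" by(rule rh, rule ev_If(1)[OF B]) (simp_all add: v0(2) v1(2) v2(2) v3(2) dT[OF v0(1)] t[OF v2(1)] t[OF v3(1)] 1(2) v(1))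
   thus ?thesis using v(2) by blast
  next
   case 2
   obtain v0 where v0: "v0 : ga (fls A)" "B p0 c = Some v0" using P0 c unfolding 2(1) by blast
   obtain v1 where v1: "v1 : ga (h b)" "B p1 c = Some v1" using P1 c unfolding 2(1) by blast
   have "B rh c = Some b" by(rule rh, rule ev_If(2)[OF B]) (simp_all add: v0(2) v1(2) dF[OF v0(1)] t[OF v1(1)])
   thus ?thesis using 2(2) by blast
  qed
 qed
 have am: "amor (adjoin A f) B ga" by(rule adjoin_amor[OF A B n ga dT dF rep])
 obtain al where "ALL a. EX x. adjoin A f al a = Some x & (ALL b c. A a b = Some c --> adjoin A f x b = Some c)"
  using adj_app[OF A n] by blast
 from choice[OF this] obtain g where g: "!!a. adjoin A f al a = Some (g a)" "!!a b c. A a b = Some c ==> adjoin A f (g a) b = Some c" by blast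
 obtain q where q: "!!d u. f d = Some u ==> adjoin A f q d = Some u" using adj_oracle[OF A n] by blast
 obtain prT gT where prT: "!!x. A prT x = Some (gT x)" "!!x y v. ev A (y ## x ## und) (PairT A (Cn (tru A)) (PairT A (Vr 1) (Vr 0))) = Some v ==> A (gT x) y = Some v"
  by(rule lam2[OF A]) blast
 obtain prF where prF: "!!x v. ev A (x ## und) (PairT A (Cn (fls A)) (Vr 0)) = Some v ==> A prF x = Some v"
  by(rule lam1[OF A]) blast
 \<comment> \<open>In \<open>A[f]\<close> a query of the first kind is application of
   \<open>B\<close> on codes, so the coding \<open>h\<close> becomes an applicative
   morphism.\<close>
 obtain R k where R: "!!x. adjoin A f R x = Some (k x)" "!!x y v. ev (adjoin A f) (y ## x ## und)
   (Cn q $ (Cn al $ (Cn al $ Cn prT $ Vr 1) $ Vr 0)) = Some v ==> adjoin A f (k x) y = Some v" by(rule lam2[OF A']) blast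
 have "adjoin A f (k (h b)) (h b') = Some (h c)" if c: "B b b' = Some c" for b b' c
 proof(rule R(2))
  have "A (gT (h b)) (h b') = Some (pp A (tru A) (pp A (h b) (h b')))" by(rule prT(2)) (simp add: ev_PFS[OF A])
  thus "ev (adjoin A f) (h b' ## h b ## und) (Cn q $ (Cn al $ (Cn al $ Cn prT $ Vr 1) $ Vr 0)) = Some (h c)"
   using q[OF fT[OF c]] g(2)[OF prT(1)] g by simp
 qed
 hence "amor B (adjoin A f) (%b. {h b})" unfolding amor_def using R(1) by blast
 moreover
 \<comment> \<open>A query of the second kind retrieves \<open>a\<close> from the code of any image
   of \<open>a\<close>.\<close>
 obtain t' where t': "!!x v. ev (adjoin A f) (x ## und) (Cn q $ (Cn al $ Cn prF $ Vr 0)) = Some v ==> adjoin A f t' x = Some v"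
  by(rule lam1[OF A']) blast
 have "adjoin A f t' (h b) = Some a" if b: "b : ga a" for a b
 proof(rule t')
  have "A prF (h b) = Some (pp A (fls A) (h b))" by(rule prF) (simp add: ev_PFS[OF A])
  thus "ev (adjoin A f) (h b ## und) (Cn q $ (Cn al $ Cn prF $ Vr 0)) = Some a"
   using q[OF fF[OF b]] g by simp
 qed
 ultimately show ?thesis using A' n am by blast
qed

section \<open>Retracts and equivalences from the oracle\<close>

section \<open>Subtoposes of realizability toposes\<close>

lemma subtopos_oracle:
 fixes A :: "'a pas" and B :: "'b pas"
 assumes U: "set_universe TYPE('u)" and A: "pca A" and sA: "small TYPE('u) (UNIV :: 'a set)" and dA: "decidable_pca A"
  and B: "pca B" and sB: "small TYPE('u) (UNIV :: 'b set)" and nB: "EX x y :: 'b. x ~= y"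
  and sub: "subtopos (RT TYPE('u) B) (RT TYPE('u) A)"
 shows "EX (f :: 'a => 'a option) ga h t'. pca (adjoin A f) & tru A ~= fls A & amor (adjoin A f) B ga &
  amor B (adjoin A f) (%b. {h b}) & (ALL a. ALL b:ga a. adjoin A f t' (h b) = Some a) &
  ent B (%b. {b}) (%b. im ga {h b}) & ent B (%b. im ga {h b}) (%b. {b}) & cdense B ga"
proof -
 obtain L :: "(('u, 'a) tob, ('u, 'a) tarr, ('u, 'b) tob, ('u, 'b) tarr) func" where L: "lexincl (TT A) (TT B) L"
  using subtopos_transport[OF RT_cat[OF A U] RT_cat[OF B U] TT_cat[OF A] TT_cat[OF B] RT_sqf[OF A U] RT_sqf[OF B U] sub] by blast
 have "topos_incl A B L" by(rule topos_incl.intro[OF A B U sA sB L])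
 from topos_incl.inclusion_analysis[OF this]
 obtain ga h e t where ga: "amor A B ga" and e: "ALL b. EX c. B e b = Some c & c : ga (h b)" and t: "ALL b. ALL c:ga (h b). B t c = Some b" by blast
 have "EX f :: 'a => 'a option. pca (adjoin A f) & tru A ~= fls A & amor (adjoin A f) B ga & amor B (adjoin A f) (%b. {h b}) &
  (EX t'. ALL a. ALL b:ga a. adjoin A f t' (h b) = Some a)"
  by(rule adjoin_oracle[OF A B nB dA ga e[rule_format] t[rule_format]])
 moreover have "ent B (%b. {b}) (%b. im ga {h b})" unfolding ent_def im_def using e by(intro exI[of _ e]) simp
 moreover have "ent B (%b. im ga {h b}) (%b. {b})" unfolding ent_def im_def using t by(intro exI[of _ t]) simp
 moreover have "cdense B ga" unfolding cdense_def using t by blast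
 ultimately show ?thesis by blast
qed

text \<open>Both \<open>ga\<close> and the coding are computationally dense, so each gives an
  inverse image, and the composite at \<open>B\<close> is the identity by encoding and decoding. At
  \<open>A[f]\<close> only one of the two entailments is available, which is why a retract
  results.\<close>

lemma realizability_retract:
 fixes A :: "'a pas" and B :: "'b pas"
 assumes U: "set_universe TYPE('u)" and A: "pca A" and sA: "small TYPE('u) (UNIV :: 'a set)" and dA: "decidable_pca A"
  and B: "pca B" and sB: "small TYPE('u) (UNIV :: 'b set)" and nB: "EX x y :: 'b. x ~= y"
  and sub: "subtopos (RT TYPE('u) B) (RT TYPE('u) A)"
 shows "EX f :: 'a => 'a option. retract_of_topos (RT TYPE('u) B) (RT TYPE('u) (adjoin A f))"
proof -
 obtain f :: "'a => 'a option" and ga h t' where f: "pca (adjoin A f)" "amor (adjoin A f) B ga" "amor B (adjoin A f) (%b. {h b})"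
  "ALL a. ALL b:ga a. adjoin A f t' (h b) = Some a" "ent B (%b. {b}) (%b. im ga {h b})" "ent B (%b. im ga {h b}) (%b. {b})" "cdense B ga"
  using subtopos_oracle[OF U A sA dA B sB nB sub] by blast
 have "ALL a. EX b. b : ga a" using f(2) unfolding amor_def by blast
 from choice[OF this] obtain g where "ALL a. g a : ga a" by blast
 \<comment> \<open>Density of the coding: \<open>t'\<close> recovers \<open>a\<close> from the code
   of its chosen image \<open>g a\<close>.\<close>
 hence cd: "cdense (adjoin A f) (%b. {h b})" unfolding cdense_def using f(4) by blast
 have G: "lexadj (TT (adjoin A f) :: ('u, 'a) tcat) (TT B) (gfun B ga)"
  by(rule gfun_lexadj[OF f(1) B f(2) f(7) U sB])
 have H: "lexadj (TT B :: ('u, 'b) tcat) (TT (adjoin A f)) (gfun (adjoin A f) (%b. {h b}))"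
  by(rule gfun_lexadj[OF B f(1) f(3) cd U sA])
 have "isof (TT B :: ('u, 'b) tcat) (TT B) ((gfun B ga) oo (gfun (adjoin A f) (%b. {h b}))) id_func"
  by(rule gfun_comp_iso[OF f(1) B f(2) f(3) f(5,6)])
 from retract_transport[OF RT_cat[OF B U] RT_cat[OF f(1) U] TT_cat[OF B] TT_cat[OF f(1)] RT_sqf[OF B U] RT_sqf[OF f(1) U] G H this]
 show ?thesis by blast
qed

text \<open>The entailment missing for an equivalence: to find from \<open>n\<close> a code of some
  image of \<open>n\<close>. Start with a code of an image of 0 and apply an image of the successor
  \<open>n\<close> times, by recursion on the numeral.\<close>

lemma numerals_comp:
 fixes A :: "nat pas" and B :: "'b pas"
 assumes A: "pca A" and B: "pca B" and ga: "amor A B ga" and de: "amor B A de"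
  and sc: "!!n. A sc n = Some (Suc n)" and pd: "!!n. A pd (Suc n) = Some n"
  and zt: "!!n. A zt n = Some (if n = 0 then tru A else fls A)"
 shows "ent A (%n. {n}) (%n. im de (ga n))"
proof -
 obtain r where r: "!!a a' c b b'. A a a' = Some c ==> b : ga a ==> b' : ga a' ==> EX x y. B r b = Some x & B x b' = Some y & y : ga c"
  using ga unfolding amor_def by blast
 obtain r' where r': "!!a a' c b b'. B a a' = Some c ==> b : de a ==> b' : de a' ==> EX x y. A r' b = Some x & A x b' = Some y & y : de c"
  using de unfolding amor_def by blast
 have ne: "EX b. b : ga a" "EX b. b : de c" for a c using ga de unfolding amor_def by blast+
 obtain b0 where b0: "b0 : ga 0" using ne by blast
 obtain d0 where d0: "d0 : de b0" using ne by blast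
 obtain s where s: "s : ga sc" using ne by blast
 \<comment> \<open>\<open>x\<close> acts as successor on images, so its fixed code \<open>dx\<close>
   serves in each step of the recursion.\<close>
 obtain x where x: "B r s = Some x" using r[OF sc[of 0] s b0] by blast
 obtain dx where dx: "dx : de x" using ne by blast
 obtain N where N: "!!x v. ev A (x ## N ## und) (If A (Cn zt $ Vr 0) (Cn d0) (Cn r' $ Cn dx $ (Vr 1 $ (Cn pd $ Vr 0)))) = Some v ==> A N x = Some v"
  by(rule pca_fix[OF A]) blast
 have "EX v. A N n = Some v & v : im de (ga n)" for n
 proof(induction n)
  case 0
  have "A N 0 = Some d0" by(rule N, rule ev_If(1)[OF A]) (simp_all add: zt)
  thus ?case unfolding im_def using b0 d0 by blast
 next
  case (Suc n)
  then obtain v b where v: "A N n = Some v" "v : de b" "b : ga n" unfolding im_def by blast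
  obtain b' where b': "B x b = Some b'" "b' : ga (Suc n)" using r[OF sc[of n] s v(3)] x by auto
  obtain p q where q: "A r' dx = Some p" "A p v = Some q" "q : de b'" using r'[OF b'(1) dx v(2)] by blast
  have "A N (Suc n) = Some q" by(rule N, rule ev_If(2)[OF A]) (simp_all add: zt pd v(1) q(1,2))
  thus ?case unfolding im_def using q(3) b'(2) by blast
 qed
 thus ?thesis unfolding ent_def by(intro exI[of _ N]) simp
qed

lemma numerals_equivalence:
 fixes A :: "nat pas" and B :: "'b pas"
 assumes U: "set_universe TYPE('u)" and A: "pca A" and dA: "decidable_pca A" and sc: "!!n. A sc n = Some (Suc n)"
  and B: "pca B" and sB: "small TYPE('u) (UNIV :: 'b set)" and nB: "EX x y :: 'b. x ~= y"
  and sub: "subtopos (RT TYPE('u) B) (RT TYPE('u) A)"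
 shows "EX f. equivalent_categories (RT TYPE('u) B) (RT TYPE('u) (adjoin A f))"
proof -
 have sA: "small TYPE('u) (UNIV :: nat set)" using U unfolding set_universe_def small_def by simp
 obtain f :: "nat => nat option" and ga h t' where f: "pca (adjoin A f)" "amor (adjoin A f) B ga" "amor B (adjoin A f) (%b. {h b})"
  "ALL a. ALL b:ga a. adjoin A f t' (h b) = Some a" "ent B (%b. {b}) (%b. im ga {h b})" "ent B (%b. im ga {h b}) (%b. {b})"
  and n: "tru A ~= fls A"
  using subtopos_oracle[OF U A sA dA B sB nB sub] by blast
 let ?A = "adjoin A f"
 obtain d where "ALL a b. Some d \<cdot>\<^bsub>A\<^esub> Some a \<cdot>\<^bsub>A\<^esub> Some b = Some (if a = b then tru A else fls A)"
  using dA unfolding decidable_pca_def by blast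
 hence d: "EX x. A d a = Some x & A x b = Some (if a = b then tru A else fls A)" for a b
  by(simp only: app_Some) (simp add: app_eq_Some)
 obtain z where "A d 0 = Some z" using d by blast
 hence z: "A z n = Some (if 0 = n then tru A else fls A)" for n using d[of 0 n] by simp
 \<comment> \<open>The predecessor is found by search: \<open>g\<close> raises its second component
   until the successor of that component is the first.\<close>
 obtain g where g: "!!x v. ev A (x ## g ## und) (If A (Cn d $ FstT A (Vr 0) $ (Cn sc $ SndT A (Vr 0))) (SndT A (Vr 0))
   (Vr 1 $ PairT A (FstT A (Vr 0)) (Cn sc $ SndT A (Vr 0)))) = Some v ==> A g x = Some v" by(rule pca_fix[OF A]) blast
 have gs: "A g (pp A (Suc (m + k)) m) = Some (m + k)" for k m
 proof(induction k arbitrary: m)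
  case 0
  obtain x where "A d (Suc m) = Some x" "A x (Suc m) = Some (tru A)" using d[of "Suc m" "Suc m"] by auto
  thus ?case by(intro g ev_If(1)[OF A]) (simp_all add: ev_PFS[OF A] sc)
 next
  case (Suc k)
  obtain x where "A d (Suc (m + Suc k)) = Some x" "A x (Suc m) = Some (fls A)" using d[of "Suc (m + Suc k)" "Suc m"] by auto
  thus ?case using Suc.IH[of "Suc m"] by(intro g ev_If(2)[OF A]) (simp_all add: ev_PFS[OF A] sc)
 qed
 let ?T = "%t. PairT A (Cn (tru A)) t"
 obtain sc' where sc': "!!x v. ev A (x ## und) (?T (Cn sc $ HdT A (Vr 0))) = Some v ==> A sc' x = Some v" by(rule lam1[OF A]) blast
 obtain pd where pd: "!!x v. ev A (x ## und) (?T (Cn g $ PairT A (HdT A (Vr 0)) (Cn 0))) = Some v ==> A pd x = Some v" by(rule lam1[OF A]) blast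
 \<comment> \<open>The answers are the Booleans of \<open>adjoin A f\<close>, whose choice is
   independent of those of \<open>A\<close>.\<close>
 obtain zt where zt: "!!x v. ev A (x ## und) (?T (If A (Cn z $ HdT A (Vr 0)) (Cn (tru ?A)) (Cn (fls ?A)))) = Some v ==> A zt x = Some v"
  by(rule lam1[OF A]) blast
 have hd: "ev A (tup A [x] ## und) (HdT A (Vr 0)) = Some x" for x by(rule ev_list(1)[OF A]) simp
 have "?A sc' n = Some (Suc n)" for n
  by(rule adj_pure[OF A n], rule sc') (simp add: ev_PFS[OF A] hd sc)
 moreover have "?A pd (Suc n) = Some n" for n
  using gs[of 0 n] by(intro adj_pure[OF A n] pd) (simp add: ev_PFS[OF A] hd)
 moreover have "?A zt n = Some (if n = 0 then tru ?A else fls ?A)" for n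
 proof(rule adj_pure[OF A n], rule zt, rule ev_PFS(1)[OF A], simp)
  show "ev A (tup A [n] ## und) (If A (Cn z $ HdT A (Vr 0)) (Cn (tru ?A)) (Cn (fls ?A))) =
    Some (if n = 0 then tru ?A else fls ?A)"
   by(cases "n = 0") (simp_all add: ev_If[OF A] hd z)
 qed
 ultimately have 1: "ent ?A (%a. {a}) (%a. im (%b. {h b}) (ga a))" by(rule numerals_comp[OF f(1) B f(2,3)])
 have 2: "ent ?A (%a. im (%b. {h b}) (ga a)) (%a. {a})" unfolding ent_def im_def using f(4) by(intro exI[of _ t']) simp
 have i1: "isof (TT B :: ('u, 'b) tcat) (TT B) ((gfun B ga) oo (gfun ?A (%b. {h b}))) id_func"
  by(rule gfun_comp_iso[OF f(1) B f(2) f(3) f(5,6)])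
 have i2: "isof (TT ?A :: (('u, nat) tob, ('u, nat) tarr) category) (TT ?A) ((gfun ?A (%b. {h b})) oo (gfun B ga)) id_func"
  by(rule gfun_comp_iso[OF B f(1) f(3) f(2) 1 2])
 from equivalence_transport[OF RT_cat[OF B U] RT_cat[OF f(1) U] TT_cat[OF B] TT_cat[OF f(1)] RT_sqf[OF B U] RT_sqf[OF f(1) U]
   gfun_functor[OF f(1) B f(2)] gfun_functor[OF B f(1) f(3)] i1 i2]
 show ?thesis by blast
qed

section \<open>Compilation of register programs to Turing machines\<close>

section \<open>Turing machine fragments\<close>

type_synonym instr = "nat \<times> nat \<times> nat"
type_synonym tab = "(instr \<times> instr) list"

definition ins :: "instr => nat" where "ins = (%(w, m, q). prod_encode (w, prod_encode (m, q)))"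

definition flat :: "tab => nat list" where
 "flat T = concat (map (%(a, b). [ins a, ins b]) T)"

lemma flat_simps [simp]: "flat [] = []" "flat (p # T) = ins (fst p) # ins (snd p) # flat T" "flat (T @ T') = flat T @ flat T'"
 by(auto simp: flat_def case_prod_unfold)

lemma length_flat [simp]: "length (flat T) = 2 * length T"
 by(induction T) auto

lemma flat_nth: "q < length T ==> flat T ! (2 * q + of_bool c) = ins (if c then snd (T ! q) else fst (T ! q))"
proof(induction T arbitrary: q)
 case (Cons p T) thus ?case by(cases q) auto
qed simp

definition dir :: "nat => int" where "dir m = (if even m then -1 else 1)"

lemma dir_simps [simp]: "dir 0 = -1" "dir 1 = 1" "dir (Suc 0) = 1" by(simp_all add: dir_def)

definition run :: "tab => tm_config => tm_config => bool" where
 "run T = (%c c'. tm_step (list_encode (flat T)) c = Some c')\<^sup>*\<^sup>*"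

lemma run_refl [simp]: "run T c c" by(simp add: run_def)
lemma run_trans [trans]: "run T c c' ==> run T c' c'' ==> run T c c''" unfolding run_def by(rule rtranclp_trans)

lemma run_step: "q < length T ==> (if t h then snd (T ! q) else fst (T ! q)) = (w, m, q') ==>
  run T (q, h, t) (q', h + dir m, t(h := odd w))"
 unfolding run_def by(rule r_into_rtranclp) (simp add: tm_step_def flat_nth Let_def ins_def dir_def)

lemma run_halt: "length T \<le> q ==> tm_step (list_encode (flat T)) (q, h, t) = None"
 by(simp add: tm_step_def Let_def)

text \<open>Runs of a fragment are described relative to such an occurrence in a larger table, so
  that fragments are verified before they are assembled.\<close>

definition has :: "tab => nat => tab => bool" where
 "has T o' L <-> (EX ys. drop o' T = L @ ys)"

lemma has_append: "has T o' (L @ L') <-> has T o' L & has T (o' + length L) L'"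
proof
 assume "has T o' (L @ L')"
 then obtain ys where ys: "drop o' T = L @ L' @ ys" by(auto simp: has_def)
 hence "drop (o' + length L) T = drop (length L) (L @ L' @ ys)" by(metis drop_drop add.commute)
 thus "has T o' L & has T (o' + length L) L'" using ys by(auto simp: has_def)
next
 assume "has T o' L & has T (o' + length L) L'"
 then obtain ys zs where ys: "drop o' T = L @ ys" "drop (o' + length L) T = L' @ zs" by(auto simp: has_def)
 have "drop (o' + length L) T = drop (length L) (drop o' T)" by(simp add: add.commute)
 hence "ys = L' @ zs" using ys by simp
 thus "has T o' (L @ L')" using ys by(auto simp: has_def)
qed

lemma has_Cons: "has T o' (p # L) ==> o' < length T & T ! o' = p & has T (Suc o') L"
proof -
 assume a: "has T o' (p # L)"
 then obtain ys where ys: "drop o' T = p # L @ ys" by(auto simp: has_def)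
 have "o' < length T" by(rule ccontr) (use ys in simp)
 moreover have "T ! o' = p" by(rule nth_via_drop[OF ys])
 moreover have "has T (Suc o') L" using has_append[of T o' "[p]" L] a by simp
 ultimately show ?thesis by simp
qed

lemma has_step:
 assumes "has T q ((a, b) # L)" "(if t h then b else a) = (w, m, q')"
 shows "run T (q, h, t) (q', h + dir m, t(h := odd w))"
 using has_Cons[OF assms(1)] assms(2) by(intro run_step) auto

definition keep :: "nat => nat => instr \<times> instr" where "keep m q = ((0, m, q), (1, m, q))"

fun chain :: "nat => nat => nat => nat => tab" where
 "chain m o' 0 e = []"
| "chain m o' (Suc k) e = keep m (if k = 0 then e else Suc o') # chain m (Suc o') k e"

lemma length_chain [simp]: "length (chain m o' k e) = k"
 by(induction k arbitrary: o') auto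

lemma has_keep: "has T q (keep m q' # L) ==> run T (q, h, t) (q', h + dir m, t)"
 using has_step[of T q "(0, m, q')" "(1, m, q')" L t h "of_bool (t h)" m q'] by(simp add: keep_def)

lemma chain_run: "has T q (chain m q k e) ==> k = 0 --> e = q ==> run T (q, h, t) (e, h + dir m * int k, t)"
proof(induction k arbitrary: q h)
 case (Suc k)
 note h = Suc.prems(1)[unfolded chain.simps]
 have "run T (q, h, t) (if k = 0 then e else Suc q, h + dir m, t)" by(rule has_keep[OF h])
 also have "run T (if k = 0 then e else Suc q, h + dir m, t) (e, h + dir m + dir m * int k, t)"
  using Suc.IH[of "Suc q" "h + dir m"] has_Cons[OF h] by auto
 finally show ?case by(simp add: algebra_simps)
qed simp

text \<open>Move in steps of length \<open>N\<close> until a blank is found; it is treated by the instruction \<open>a\<close>.\<close>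

definition scan :: "nat => nat => nat => instr => tab" where
 "scan N m o' a = (a, (1, 1 - m, Suc o')) # chain m (Suc o') (Suc N) o'"

lemma length_scan [simp]: "length (scan N m o' a) = N + 2" by(simp add: scan_def)

text \<open>Every machine step moves the head. On a stroke the test steps one cell back, and the
  chain of \<open>N + 1\<close> moves leaves a net shift of \<open>N\<close>.\<close>

lemma scan_run:
 assumes T: "has T q (scan N m q a)" and m: "m \<le> 1"
 shows "(ALL j<k. t (h + dir m * int (N * j))) ==> run T (q, h, t) (q, h + dir m * int (N * k), t)"
proof(induction k arbitrary: h)
 case (Suc k)
 have m': "dir (Suc 0 - m) = - dir m" using m by(cases m) auto
 have th: "t h" using Suc.prems by(auto dest: spec[of _ 0])
 have c: "has T (Suc q) (chain m (Suc q) (Suc N) q)" using has_Cons[OF T[unfolded scan_def]] by simp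
 have "run T (q, h, t) (Suc q, h + dir (1 - m), t(h := odd (1::nat)))"
  by(rule has_step[OF T[unfolded scan_def]]) (simp add: th)
 also have "t(h := odd (1::nat)) = t" using th by(auto simp: fun_upd_idem_iff)
 also have "run T (Suc q, h + dir (1 - m), t) (q, h + dir (1 - m) + dir m * int (Suc N), t)" by(rule chain_run[OF c]) simp
 also have "h + dir (1 - m) + dir m * int (Suc N) = h + dir m * int N" by(simp add: m' algebra_simps)
 also have "run T (q, h + dir m * int N, t) (q, (h + dir m * int N) + dir m * int (N * k), t)"
 proof(rule Suc.IH, intro allI impI)
  fix j assume "j < k"
  thus "t (h + dir m * int N + dir m * int (N * j))" using Suc.prems[rule_format, of "Suc j"] by(simp add: algebra_simps)
 qed
 finally show ?case by(simp add: algebra_simps)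
qed simp

section \<open>Registers\<close>

text \<open>Register \<open>r < N\<close> is kept in unary on the cells congruent to \<open>r\<close> modulo \<open>N\<close>.\<close>

definition tp :: "nat => (nat => nat) => int => bool" where
 "tp N s x <-> 0 \<le> x & nat x div N < s (nat x mod N)"

lemma tp_cell: "i < N ==> tp N s (int i + int (N * j)) <-> j < s i"
proof -
 assume i: "i < N"
 have e: "nat (int i + int (N * j)) = i + N * j" by(metis nat_int of_nat_add)
 have "(i + N * j) div N = j" "(i + N * j) mod N = i" using i by(simp_all add: mult.commute)
 thus ?thesis unfolding tp_def e by simp
qed

lemma tp_neg: "x < 0 ==> \<not> tp N s x" by(simp add: tp_def)

text \<open>A register changes at its outer end only, so one cell accounts for a difference of
  one.\<close>

lemma tp_upd: 
 assumes i: "i < N" and s: "s' = s(i := k)" and b: "k = Suc (s i) & p = s i & v | Suc k = s i & p = k & \<not> v"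
 shows "(tp N s)(int i + int (N * p) := v) = tp N s'"
proof
 fix x
 show "((tp N s)(int i + int (N * p) := v)) x = tp N s' x"
 proof(cases "x = int i + int (N * p)")
  case True thus ?thesis using tp_cell[OF i, of s' p] s b by auto
 next
  case False
  show ?thesis
  proof(cases "0 \<le> x & nat x mod N = i")
   case True
   have x: "x = int i + int (N * (nat x div N))"
    using True mod_mult_div_eq[of "nat x" N] by(metis int_nat_eq of_nat_add)
   have "nat x div N ~= p" using False x by auto
   thus ?thesis using False s b tp_cell[OF i, of s "nat x div N"] tp_cell[OF i, of s' "nat x div N"] x by auto
  next
   case False': False
   thus ?thesis using False s by(auto simp: tp_def)
  qed
 qed
qed

lemma tp_Sigma: "0 < N ==> {x. tp N s x} = (%(r, j). int r + int (N * j)) ` (SIGMA r:{..<N}. {..<s r})"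
proof(intro equalityI subsetI)
 fix x assume N: "0 < N" and "x : {x. tp N s x}"
 hence x: "0 \<le> x" "nat x div N < s (nat x mod N)" by(auto simp: tp_def)
 hence "x = int (nat x mod N) + int (N * (nat x div N))" using mod_mult_div_eq[of "nat x" N] by(metis int_nat_eq of_nat_add)
 thus "x : (%(r, j). int r + int (N * j)) ` (SIGMA r:{..<N}. {..<s r})"
  using x N by(intro image_eqI[of _ _ "(nat x mod N, nat x div N)"]) auto
qed (auto simp: tp_cell[simplified])

text \<open>The output is the number of all strokes, that is, the sum of the registers; hence final
  states must have a single nonzero register.\<close>

lemma card_tp: "0 < N ==> card {x. tp N s x} = (\<Sum>r<N. s r)"
proof -
 assume N: "0 < N"
 have inj: "inj_on (%(r, j). int r + int (N * j)) (SIGMA r:{..<N}. {..<s r})"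
 proof(rule inj_onI, clarsimp)
  fix r j r' j' assume 1: "r < N" "r' < N" "int r + int N * int j = int r' + int N * int j'"
  hence "r + N * j = r' + N * j'" by(metis of_nat_add of_nat_eq_iff of_nat_mult)
  hence "(r + N * j) mod N = (r' + N * j') mod N" "(r + N * j) div N = (r' + N * j') div N" by simp_all
  thus "r = r' & j = j'" using 1 by(simp add: mult.commute)
 qed
 show ?thesis unfolding tp_Sigma[OF N] card_image[OF inj] by simp
qed

text \<open>The first blank of register \<open>i\<close> is filled; then the head goes left in
  strides of \<open>N\<close> to the blank cell \<open>i - N\<close> before the origin. As the scan
  leaves that cell to the left, \<open>N - i + 1\<close> moves to the right return to cell
  0.\<close>

definition IncM :: "nat => nat => nat => nat => tab" where
 "IncM N i o' e = (let A = o' + i; C = A + N + 2; D = C + (N - 1); E = D + N + 2 in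
  chain 1 o' i A @ scan N 1 A (1, 0, C) @ chain 0 C (N - 1) D @ scan N 0 D (0, 0, E) @ chain 1 E (N - i + 1) e)"

text \<open>An empty register is noticed at its first cell and exits through \<open>Z\<close>.
  Otherwise the search for the blank starts one stride further, entering the scan at
  \<open>Suc B\<close>, behind its test; one stride back from the blank is the stroke to
  erase.\<close>

definition DecM :: "nat => nat => nat => nat => nat => tab" where
 "DecM N i o' e e0 = (let A = o' + i; B = A + 1; B' = B + N + 2; C = B' + (N + 1); D = C + 1 + (N - 1); E = D + N + 2; Z = E + (N - i + 1) in
  chain 1 o' i A @ [((0, 1, Z), (1, 0, Suc B))] @ scan N 1 B (0, 1, B') @ chain 0 B' (N + 1) C @ [((0, 0, C + 1), (0, 0, C + 1))] @
  chain 0 (C + 1) (N - 1) D @ scan N 0 D (0, 0, E) @ chain 1 E (N - i + 1) e @ chain 0 Z (i + 1) e0)"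

lemma length_IncM: "i < N ==> length (IncM N i o' e) = 4 * N + 4" by(simp add: IncM_def Let_def)
lemma length_DecM: "i < N ==> length (DecM N i o' e e0) = 5 * N + 8 + i" by(simp add: DecM_def Let_def)

lemma return_run:
 assumes i: "i < N" and h: "has T C (chain 0 C (N - 1) D)" "has T D (scan N 0 D (0, 0, E))" "has T E (chain 1 E (N - i + 1) e)"
  and D: "D = C + (N - 1)" and t: "!!j. j < k ==> t (int i + int (N * j))" and tn: "!!x. x < 0 ==> \<not> t x"
 shows "run T (C, int i + int (N * k) - 1, t) (e, 0, t)"
proof -
 have p: "int i + int (N * k) - 1 - int (N - 1) = int i + int (N * k) - int N" using i by simp
 have "run T (C, int i + int (N * k) - 1, t) (D, int i + int (N * k) - 1 + dir 0 * int (N - 1), t)"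
  by(rule chain_run[OF h(1)]) (use D in simp)
 also have "int i + int (N * k) - 1 + dir 0 * int (N - 1) = int i + int (N * k) - int N" using p by simp
 also have "run T (D, int i + int (N * k) - int N, t) (D, int i + int (N * k) - int N + dir 0 * int (N * k), t)"
 proof(rule scan_run[OF h(2)], simp, intro allI impI)
  fix j assume j: "j < k"
  obtain l where l: "k = Suc (j + l)" using less_imp_Suc_add[OF j] by blast
  have "int (N * k) - int N - int (N * j) = int (N * (k - 1 - j))" by(simp add: l algebra_simps)
  hence eq: "int i + int (N * k) - int N + dir 0 * int (N * j) = int i + int (N * (k - 1 - j))" by simp
  show "t (int i + int (N * k) - int N + dir 0 * int (N * j))" unfolding eq by(rule t) (use j in simp)
 qed
 also have "int i + int (N * k) - int N + dir 0 * int (N * k) = int i - int N" by simp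
 also have "run T (D, int i - int N, t) (E, int i - int N + dir 0, t(int i - int N := odd (0::nat)))"
  by(rule has_step[OF h(2)[unfolded scan_def]]) (use tn i in simp)
 also have "t(int i - int N := odd (0::nat)) = t" using tn[of "int i - int N"] i by(auto simp: fun_upd_idem_iff)
 also have "run T (E, int i - int N + dir 0, t) (e, int i - int N + dir 0 + dir 1 * int (N - i + 1), t)"
  by(rule chain_run[OF h(3)]) simp
 also have "int i - int N + dir 0 + dir 1 * int (N - i + 1) = 0" using i by simp
 finally show ?thesis .
qed

lemma IncM_run:
 assumes i: "i < N" and h: "has T q (IncM N i q e)"
 shows "run T (q, 0, tp N s) (e, 0, tp N (s(i := Suc (s i))))"
proof -
 define A C D E where "A = q + i" and "C = A + N + 2" and "D = C + (N - 1)" and "E = D + N + 2"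
 have h: "has T q (chain 1 q i A)" "has T A (scan N 1 A (1, 0, C))" "has T C (chain 0 C (N - 1) D)" "has T D (scan N 0 D (0, 0, E))"
  "has T E (chain 1 E (N - i + 1) e)"
  using h unfolding IncM_def Let_def A_def[symmetric] C_def[symmetric] D_def[symmetric] E_def[symmetric] has_append
  by(simp_all add: A_def C_def D_def E_def add.assoc)
 let ?t = "tp N (s(i := Suc (s i)))"
 have "run T (q, 0, tp N s) (A, 0 + dir 1 * int i, tp N s)" by(rule chain_run[OF h(1)]) (simp add: A_def)
 also have "0 + dir 1 * int i = int i" by simp
 also have "run T (A, int i, tp N s) (A, int i + dir 1 * int (N * s i), tp N s)"
  by(rule scan_run[OF h(2)]) (use tp_cell[OF i] in simp_all)
 also have "int i + dir 1 * int (N * s i) = int i + int (N * s i)" by simp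
 also have "run T (A, int i + int (N * s i), tp N s) (C, int i + int (N * s i) + dir 0, (tp N s)(int i + int (N * s i) := odd (1::nat)))"
  by(rule has_step[OF h(2)[unfolded scan_def]]) (use tp_cell[OF i, of s "s i"] in simp)
 also have "(tp N s)(int i + int (N * s i) := odd (1::nat)) = ?t" by(rule tp_upd[OF i refl]) simp
 also have "int i + int (N * s i) + dir 0 = int i + int (N * s i) - 1" by simp
 also have "run T (C, int i + int (N * s i) - 1, ?t) (e, 0, ?t)"
  by(rule return_run[OF i h(3,4,5) D_def]) (use tp_cell[OF i] tp_neg in simp_all)
 finally show ?thesis .
qed

lemma DecM_run:
 assumes i: "i < N" and h: "has T q (DecM N i q e e0)"
 shows "s i = 0 ==> run T (q, 0, tp N s) (e0, 0, tp N s)" "s i = Suc k ==> run T (q, 0, tp N s) (e, 0, tp N (s(i := k)))"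
proof -
 define A B B' C D E Z where "A = q + i" and "B = A + 1" and "B' = B + N + 2" and "C = B' + (N + 1)" and "D = C + 1 + (N - 1)"
  and "E = D + N + 2" and "Z = E + (N - i + 1)"
 have h: "has T q (chain 1 q i A)" "has T A [((0, 1, Z), (1, 0, Suc B))]" "has T B (scan N 1 B (0, 1, B'))" "has T B' (chain 0 B' (N + 1) C)"
  "has T C [((0, 0, C + 1), (0, 0, C + 1))]" "has T (C + 1) (chain 0 (C + 1) (N - 1) D)" "has T D (scan N 0 D (0, 0, E))"
  "has T E (chain 1 E (N - i + 1) e)" "has T Z (chain 0 Z (i + 1) e0)"
  using h unfolding DecM_def Let_def A_def[symmetric] B_def[symmetric] B'_def[symmetric] C_def[symmetric] D_def[symmetric] E_def[symmetric] Z_def[symmetric] has_append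
  by(simp_all add: A_def B_def B'_def C_def D_def E_def Z_def add.assoc)
 have "run T (q, 0, tp N s) (A, 0 + dir 1 * int i, tp N s)" by(rule chain_run[OF h(1)]) (simp add: A_def)
 also have "0 + dir 1 * int i = int i" by simp
 finally have 1: "run T (q, 0, tp N s) (A, int i, tp N s)" .
 have c: "tp N s (int i + int (N * j)) <-> j < s i" for j by(rule tp_cell[OF i])
 show "run T (q, 0, tp N s) (e0, 0, tp N s)" if z: "s i = 0"
 proof -
  note 1
  also have "run T (A, int i, tp N s) (Z, int i + dir 1, (tp N s)(int i := odd (0::nat)))"
   by(rule has_step[OF h(2)]) (use c[of 0] z in simp)
  also have "(tp N s)(int i := odd (0::nat)) = tp N s" using c[of 0] z by(auto simp: fun_upd_idem_iff)
  also have "run T (Z, int i + dir 1, tp N s) (e0, int i + dir 1 + dir 0 * int (i + 1), tp N s)" by(rule chain_run[OF h(9)]) simp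
  finally show ?thesis by simp
 qed
 show "run T (q, 0, tp N s) (e, 0, tp N (s(i := k)))" if z: "s i = Suc k"
 proof -
  let ?t = "tp N (s(i := k))"
  have cB: "has T (Suc B) (chain 1 (Suc B) (Suc N) B)" using has_Cons[OF h(3)[unfolded scan_def]] by simp
  note 1
  also have "run T (A, int i, tp N s) (Suc B, int i + dir 0, (tp N s)(int i := odd (1::nat)))"
   by(rule has_step[OF h(2)]) (use c[of 0] z in simp)
  also have "(tp N s)(int i := odd (1::nat)) = tp N s" using c[of 0] z by(auto simp: fun_upd_idem_iff)
  also have "run T (Suc B, int i + dir 0, tp N s) (B, int i + dir 0 + dir 1 * int (Suc N), tp N s)" by(rule chain_run[OF cB]) simp
  also have "int i + dir 0 + dir 1 * int (Suc N) = int i + int N" by simp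
  also have "run T (B, int i + int N, tp N s) (B, int i + int N + dir 1 * int (N * k), tp N s)"
  proof(rule scan_run[OF h(3)], simp, intro allI impI)
   fix j assume "j < k"
   thus "tp N s (int i + int N + dir 1 * int (N * j))" using c[of "Suc j"] z by(simp add: algebra_simps)
  qed
  also have "int i + int N + dir 1 * int (N * k) = int i + int (N * Suc k)" by(simp add: algebra_simps)
  also have "run T (B, int i + int (N * Suc k), tp N s) (B', int i + int (N * Suc k) + dir 1, (tp N s)(int i + int (N * Suc k) := odd (0::nat)))"
   by(rule has_step[OF h(3)[unfolded scan_def]]) (use c[of "Suc k"] z in simp)
  also have "(tp N s)(int i + int (N * Suc k) := odd (0::nat)) = tp N s" using c[of "Suc k"] z by(auto simp: fun_upd_idem_iff)
  also have "run T (B', int i + int (N * Suc k) + dir 1, tp N s) (C, int i + int (N * Suc k) + dir 1 + dir 0 * int (N + 1), tp N s)"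
   by(rule chain_run[OF h(4)]) simp
  also have "int i + int (N * Suc k) + dir 1 + dir 0 * int (N + 1) = int i + int (N * k)" by(simp add: algebra_simps)
  also have "run T (C, int i + int (N * k), tp N s) (C + 1, int i + int (N * k) + dir 0, (tp N s)(int i + int (N * k) := odd (0::nat)))"
   by(rule has_step[OF h(5)]) simp
  also have "(tp N s)(int i + int (N * k) := odd (0::nat)) = ?t" by(rule tp_upd[OF i refl]) (simp add: z)
  also have "int i + int (N * k) + dir 0 = int i + int (N * k) - 1" by simp
  also have "run T (C + 1, int i + int (N * k) - 1, ?t) (e, 0, ?t)"
   by(rule return_run[OF i h(6,7,8) D_def]) (use tp_cell[OF i] tp_neg in simp_all)
  finally show ?thesis .
 qed
qed


section \<open>Register programs\<close>

datatype prog = Inc nat | Dec nat | Sq prog prog (infixr ";;" 60) | Loop nat prog | Br nat prog prog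

text \<open>\<open>Loop\<close> decrements before each round and \<open>Br\<close> on its first
  branch, because \<open>DecM\<close> tests and decrements in one go.\<close>

inductive ex :: "prog => (nat => nat) => (nat => nat) => bool" where
 ex_Inc: "ex (Inc i) s (s(i := Suc (s i)))"
| ex_Dec: "ex (Dec i) s (s(i := s i - 1))"
| ex_Sq: "ex P s s' ==> ex Q s' s'' ==> ex (P ;; Q) s s''"
| ex_Loop0: "s i = 0 ==> ex (Loop i P) s s"
| ex_LoopS: "s i = Suc k ==> ex P (s(i := k)) s' ==> ex (Loop i P) s' s'' ==> ex (Loop i P) s s''"
| ex_Br0: "s i = 0 ==> ex Q s s' ==> ex (Br i P Q) s s'"
| ex_BrS: "s i = Suc k ==> ex P (s(i := k)) s' ==> ex (Br i P Q) s s'"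

fun mreg :: "prog => nat" where
 "mreg (Inc i) = i" | "mreg (Dec i) = i" | "mreg (P ;; Q) = max (mreg P) (mreg Q)"
| "mreg (Loop i P) = max i (mreg P)" | "mreg (Br i P Q) = max i (max (mreg P) (mreg Q))"

fun plen :: "nat => prog => nat" where
 "plen N (Inc i) = 4 * N + 4" | "plen N (Dec i) = 5 * N + 8 + i" | "plen N (P ;; Q) = plen N P + plen N Q"
| "plen N (Loop i P) = 5 * N + 8 + i + plen N P" | "plen N (Br i P Q) = 5 * N + 8 + i + plen N P + plen N Q"

fun comp :: "nat => prog => nat => nat => tab" where
 "comp N (Inc i) o' e = IncM N i o' e"
| "comp N (Dec i) o' e = DecM N i o' e e"
| "comp N (P ;; Q) o' e = comp N P o' (o' + plen N P) @ comp N Q (o' + plen N P) e"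
| "comp N (Loop i P) o' e = DecM N i o' (o' + (5 * N + 8 + i)) e @ comp N P (o' + (5 * N + 8 + i)) o'"
| "comp N (Br i P Q) o' e = DecM N i o' (o' + (5 * N + 8 + i)) (o' + (5 * N + 8 + i) + plen N P) @
  comp N P (o' + (5 * N + 8 + i)) e @ comp N Q (o' + (5 * N + 8 + i) + plen N P) e"

lemma length_comp: "mreg P < N ==> length (comp N P o' e) = plen N P"
 by(induction P arbitrary: o' e) (auto simp: length_IncM length_DecM)

lemma comp_run: "ex P s s' ==> mreg P < N ==> has T q (comp N P q e) ==> run T (q, 0, tp N s) (e, 0, tp N s')"
proof(induction arbitrary: q e rule: ex.induct)
 case (ex_Inc i s)
 hence "i < N" "has T q (IncM N i q e)" by simp_all
 thus ?case by(rule IncM_run)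
next
 case (ex_Dec i s)
 hence h: "i < N" "has T q (DecM N i q e e)" by simp_all
 have "run T (q, 0, tp N s) (e, 0, tp N (s(i := s i - 1)))"
  using DecM_run[OF h, of s] by(cases "s i") (simp_all add: fun_upd_idem)
 thus ?case .
next
 case (ex_Sq P s s' Q s'')
 let ?m = "q + plen N P"
 have "run T (q, 0, tp N s) (?m, 0, tp N s')" "run T (?m, 0, tp N s') (e, 0, tp N s'')"
  using ex_Sq by(auto simp: has_append length_comp)
 thus ?case by(rule run_trans)
next
 case (ex_Loop0 s i P)
 thus ?case using DecM_run(1)[of i N T q _ e s] by(auto simp: has_append)
next
 case (ex_LoopS s i k P s' s'')
 let ?m = "q + (5 * N + 8 + i)"
 have h: "has T q (DecM N i q ?m e)" "has T ?m (comp N P ?m q)" and i: "i < N" "mreg P < N"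
  using ex_LoopS.prems by(auto simp: has_append length_DecM)
 have "run T (q, 0, tp N s) (?m, 0, tp N (s(i := k)))" by(rule DecM_run(2)[where s = s and i = i, OF i(1) h(1) ex_LoopS.hyps(1)])
 also have "run T (?m, 0, tp N (s(i := k))) (q, 0, tp N s')" by(rule ex_LoopS.IH(1)[OF i(2) h(2)])
 also have "run T (q, 0, tp N s') (e, 0, tp N s'')" by(rule ex_LoopS.IH(2)[OF ex_LoopS.prems])
 finally show ?case .
next
 case (ex_Br0 s i Q s' P)
 let ?m = "q + (5 * N + 8 + i)"
 have h: "has T q (DecM N i q ?m (?m + plen N P))" "has T (?m + plen N P) (comp N Q (?m + plen N P) e)" and i: "i < N" "mreg P < N" "mreg Q < N"
  using ex_Br0.prems by(auto simp: has_append length_DecM length_comp add.assoc)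
 have "run T (q, 0, tp N s) (?m + plen N P, 0, tp N s)" by(rule DecM_run(1)[where s = s and i = i, OF i(1) h(1) ex_Br0.hyps(1)])
 also have "run T (?m + plen N P, 0, tp N s) (e, 0, tp N s')" by(rule ex_Br0.IH[OF i(3) h(2)])
 finally show ?case .
next
 case (ex_BrS s i k P s' Q)
 let ?m = "q + (5 * N + 8 + i)"
 have h: "has T q (DecM N i q ?m (?m + plen N P))" "has T ?m (comp N P ?m e)" and i: "i < N" "mreg P < N"
  using ex_BrS.prems by(auto simp: has_append length_DecM length_comp)
 have "run T (q, 0, tp N s) (?m, 0, tp N (s(i := k)))" by(rule DecM_run(2)[where s = s and i = i, OF i(1) h(1) ex_BrS.hyps(1)])
 also have "run T (?m, 0, tp N (s(i := k))) (e, 0, tp N s')" by(rule ex_BrS.IH[OF i(2) h(2)])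
 finally show ?case .
qed

definition rel :: "nat => instr \<times> instr => instr \<times> instr" where
 "rel d = (%((w, m, q), (w', m', q')). ((w, m, q + d), (w', m', q' + d)))"

lemma rel_simps [simp]: "rel d ((w, m, q), (w', m', q')) = ((w, m, q + d), (w', m', q' + d))" by(simp add: rel_def)

lemma chain_rel: "chain m (o' + d) k (e + d) = map (rel d) (chain m o' k e)"
proof(induction k arbitrary: o')
 case (Suc k) show ?case using Suc[of "Suc o'"] by(simp add: keep_def)
qed simp

lemma scan_rel: "scan N m (o' + d) (w, m', q + d) = map (rel d) (scan N m o' (w, m', q))"
 unfolding scan_def using chain_rel[of m "Suc o'" d "Suc N" o'] by simp

lemma IncM_rel: "IncM N i (o' + d) (e + d) = map (rel d) (IncM N i o' e)"
proof -
 define A C D E where "A = o' + i" and "C = A + N + 2" and "D = C + (N - 1)" and "E = D + N + 2"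
 have e: "o' + d + i = A + d" "A + d + N + 2 = C + d" "C + d + (N - 1) = D + d" "D + d + N + 2 = E + d"
  by(simp_all add: A_def C_def D_def E_def)
 show ?thesis unfolding IncM_def Let_def e chain_rel scan_rel map_append
  by(simp only: A_def[symmetric] C_def[symmetric] D_def[symmetric] E_def[symmetric])
qed

lemma DecM_rel: "DecM N i (o' + d) (e + d) (e0 + d) = map (rel d) (DecM N i o' e e0)"
proof -
 define A B B' C D E Z where "A = o' + i" and "B = A + 1" and "B' = B + N + 2" and "C = B' + (N + 1)" and "D = C + 1 + (N - 1)"
  and "E = D + N + 2" and "Z = E + (N - i + 1)"
 have e: "o' + d + i = A + d" "A + d + 1 = B + d" "B + d + N + 2 = B' + d" "B' + d + (N + 1) = C + d" "C + d + 1 = C + 1 + d" "C + 1 + d + (N - 1) = D + d"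
  "D + d + N + 2 = E + d" "E + d + (N - i + 1) = Z + d"
  by(simp_all add: A_def B_def B'_def C_def D_def E_def Z_def)
 show ?thesis unfolding DecM_def Let_def e chain_rel scan_rel map_append
  by(simp only: A_def[symmetric] B_def[symmetric] B'_def[symmetric] C_def[symmetric] D_def[symmetric] E_def[symmetric] Z_def[symmetric]) simp
qed

text \<open>Jumps are absolute, so moving a fragment adds one constant to all targets. This turns
  the dependence of code on its position into arithmetic, as \<open>smn\<close> requires.\<close>

lemma comp_rel: "comp N P (o' + d) (e + d) = map (rel d) (comp N P o' e)"
proof(induction P arbitrary: o' e)
 case (Sq P Q)
 show ?case using Sq.IH(1)[of o' "o' + plen N P"] Sq.IH(2)[of "o' + plen N P" e] by(simp add: ac_simps)
next
 case (Loop i P)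
 show ?case using Loop.IH[of "o' + (5 * N + 8 + i)" o'] DecM_rel[of N i o' d "o' + (5 * N + 8 + i)" e] by(simp add: ac_simps)
next
 case (Br i P Q)
 show ?case using Br.IH(1)[of "o' + (5 * N + 8 + i)" e] Br.IH(2)[of "o' + (5 * N + 8 + i) + plen N P" e]
  DecM_rel[of N i o' d "o' + (5 * N + 8 + i)" "o' + (5 * N + 8 + i) + plen N P"] by(simp add: ac_simps)
qed (simp_all add: IncM_rel DecM_rel)

lemma tm_det:
 assumes "(%c c'. tm_step M c = Some c')\<^sup>*\<^sup>* c d" "tm_step M d = None" "(%c c'. tm_step M c = Some c')\<^sup>*\<^sup>* c d'" "tm_step M d' = None"
 shows "d = d'"
 using assms
proof(induction arbitrary: d' rule: converse_rtranclp_induct)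
 case base
 from base.prems(2) show ?case by(cases rule: converse_rtranclpE) (use base.prems(1) in auto)
next
 case (step y z)
 from step.prems(2) show ?case
 proof(cases rule: converse_rtranclpE)
  case base thus ?thesis using step.hyps(1) step.prems(3) by simp
 next
  case (step z')
  thus ?thesis using \<open>tm_step M y = Some z\<close> step.IH[OF \<open>tm_step M d = None\<close> _ \<open>tm_step M d' = None\<close>] by simp
 qed
qed

lemma tm_outcome_det: "tm_outcome M b v ==> tm_outcome M b v' ==> v = v'"
 unfolding tm_outcome_def by(metis prod.inject tm_det)

lemma K1_iff: "K1 a b = Some v <-> tm_outcome a b v"
proof -
 have "(THE v. tm_outcome a b v) = v" if "tm_outcome a b v" for v by(rule the_equality, rule that, rule tm_outcome_det[OF _ that])
 thus ?thesis unfolding K1_def using tm_outcome_det by auto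
qed

text \<open>The \<open>b + 1\<close> strokes of the input are spread over all registers. Collecting
  them in register 0 and removing one leaves \<open>b\<close>.\<close>

fun norm_prog :: "nat => prog" where
 "norm_prog 0 = Dec 0"
| "norm_prog (Suc n) = Loop (Suc n) (Inc 0) ;; norm_prog n"

lemma ex_move: "i ~= j ==> ex (Loop i (Inc j)) s (s(i := 0, j := s j + s i))"
proof(induction "s i" arbitrary: s)
 case 0 thus ?case using ex_Loop0[of s i "Inc j"] by(simp add: fun_upd_idem)
next
 case (Suc k)
 have "ex (Loop i (Inc j)) s ((s(i := k, j := Suc (s j)))(i := 0, j := Suc (s j) + k))"
 proof(rule ex_LoopS[of s i k, OF Suc.hyps(2)[symmetric]])
  show "ex (Inc j) (s(i := k)) (s(i := k, j := Suc (s j)))" using ex_Inc[of j "s(i := k)"] Suc.prems by simp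
  show "ex (Loop i (Inc j)) (s(i := k, j := Suc (s j))) ((s(i := k, j := Suc (s j)))(i := 0, j := Suc (s j) + k))"
   using Suc.hyps(1)[of "s(i := k, j := Suc (s j))"] Suc.prems by simp
 qed
 moreover have "(s(i := k, j := Suc (s j)))(i := 0, j := Suc (s j) + k) = s(i := 0, j := s j + s i)"
  using Suc.prems Suc.hyps(2) by(auto simp: fun_eq_iff)
 ultimately show ?case by simp
qed

lemma ex_norm: "(!!r. n < r ==> s r = 0) ==> ex (norm_prog n) s ((%_. 0)(0 := (\<Sum>r\<le>n. s r) - 1))"
proof(induction n arbitrary: s)
 case 0
 have e: "(%_. 0)(0 := (\<Sum>r\<le>0. s r) - 1) = s(0 := s 0 - 1)" using 0 by(auto simp: fun_eq_iff)
 show ?case unfolding norm_prog.simps e by(rule ex_Dec)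
next
 case (Suc n)
 let ?s = "s(Suc n := 0, 0 := s 0 + s (Suc n))"
 have 1: "ex (norm_prog n) ?s ((%_. 0)(0 := (\<Sum>r\<le>n. ?s r) - 1))" using Suc.prems by(intro Suc.IH) (auto simp: Suc_lessI)
 have "(\<Sum>r\<le>n. ?s r) = (\<Sum>r\<le>Suc n. s r)"
 proof -
  have "(\<Sum>r\<le>n. ?s r) = ?s 0 + (\<Sum>r\<in>{1..n}. s r)" by(subst sum.remove[of _ 0]) (auto intro!: sum.cong)
  also have "\<dots> = (\<Sum>r\<le>n. s r) + s (Suc n)" by(subst (2) sum.remove[of _ 0]) (auto intro!: sum.cong)
  finally show ?thesis by simp
 qed
 hence "ex (Loop (Suc n) (Inc 0) ;; norm_prog n) s ((%_. 0)(0 := (\<Sum>r\<le>Suc n. s r) - 1))"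
  using ex_Sq[OF ex_move[of "Suc n" 0 s] 1] by simp
 thus ?case unfolding norm_prog.simps .
qed

lemma mreg_norm [simp]: "mreg (norm_prog n) = n" by(induction n) auto

text \<open>Between normalization and \<open>E\<close>, \<open>a\<close> copies of the increment of
  register 1 build the parameter \<open>a\<close> into the table.\<close>

definition pmach :: "nat => prog => nat => tab" where
 "pmach N E a = (let n = plen N (norm_prog (N - 1)); l = plen N (Inc 1) in
  comp N (norm_prog (N - 1)) 0 n @ concat (map (%i. comp N (Inc 1) (n + i * l) (n + Suc i * l)) [0..<a]) @
  comp N E (n + a * l) (n + a * l + plen N E))"

lemma pmach_K1:
 assumes N: "1 < N" "mreg E < N" and E: "ex E ((%_. 0)(0 := b, 1 := a)) ((%_. 0)(0 := y))"
 shows "K1 (list_encode (flat (pmach N E a))) b = Some y"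
proof -
 define n l T where "n = plen N (norm_prog (N - 1))" and "l = plen N (Inc 1)" and "T = pmach N E a"
 let ?b = "%i. comp N (Inc 1) (n + i * l) (n + Suc i * l)"
 have T: "T = comp N (norm_prog (N - 1)) 0 n @ concat (map ?b [0..<a]) @ comp N E (n + a * l) (n + a * l + plen N E)"
  by(simp only: T_def pmach_def Let_def n_def l_def)
 have ln: "length (comp N (norm_prog (N - 1)) 0 n) = n" unfolding n_def by(rule length_comp) (use N in simp)
 have li: "length (comp N (Inc 1) x z) = l" for x z unfolding l_def by(rule length_comp) (use N in simp)
 have lb: "length (concat (map ?b [0..<k])) = k * l" for k by(induction k) (simp_all add: li[unfolded One_nat_def] del: comp.simps)
 have h0: "has T 0 T" unfolding has_def by simp
 have h: "has T 0 (comp N (norm_prog (N - 1)) 0 n)" "has T n (concat (map ?b [0..<a]))" "has T (n + a * l) (comp N E (n + a * l) (n + a * l + plen N E))"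
  using h0[unfolded T has_append ln lb, folded T] by simp_all
 \<comment> \<open>Register \<open>r\<close> gets the strokes of the input block on the cells
   \<open>r\<close>, \<open>r + N\<close>, and so on up to \<open>b\<close>.\<close>
 define s0 where "s0 r = (if r < N & r \<le> b then Suc ((b - r) div N) else 0)" for r
 have t0: "(%i. 0 \<le> i & i \<le> int b) = tp N s0"
 proof
  fix x :: int
  show "(0 \<le> x & x \<le> int b) = tp N s0 x"
  proof(cases "0 \<le> x")
   case True
   define y where "y = nat x"
   have y: "x = int y" using True by(simp add: y_def)
   have "y div N < s0 (y mod N) <-> y \<le> b"
   proof
    assume "y \<le> b"
    moreover have m: "y mod N \<le> y" by simp
    ultimately have "(y - y mod N) div N \<le> (b - y mod N) div N" by(intro div_le_mono) simp
    moreover have "(y - y mod N) div N = y div N" using N by(simp add: minus_mod_eq_mult_div)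
    ultimately show "y div N < s0 (y mod N)" using \<open>y \<le> b\<close> N m by(simp add: s0_def less_Suc_eq_le order.trans[OF m])
   next
    assume a: "y div N < s0 (y mod N)"
    hence m: "y mod N \<le> b" and "y div N \<le> (b - y mod N) div N" by(auto simp: s0_def split: if_splits)
    hence "N * (y div N) \<le> b - y mod N" by(metis div_times_less_eq_dividend mult.commute mult_le_mono2 order.trans)
    thus "y \<le> b" using m mod_mult_div_eq[of y N] by linarith
   qed
   thus ?thesis using y by(simp add: tp_def)
  qed (simp add: tp_def)
 qed
 have "(\<Sum>r\<le>N - 1. s0 r) = (\<Sum>r<N. s0 r)" using N by(intro sum.cong) auto
 also have "\<dots> = card {i. 0 \<le> i & i \<le> int b}" using card_tp[of N s0] N unfolding t0[symmetric] by simp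
 also have "\<dots> = Suc b"
 proof -
  have "{i. 0 \<le> i & i \<le> int b} = {0..int b}" by auto
  thus ?thesis by simp
 qed
 finally have sum: "(\<Sum>r\<le>N - 1. s0 r) - 1 = b" by simp
 have "ex (norm_prog (N - 1)) s0 ((%_. 0)(0 := (\<Sum>r\<le>N - 1. s0 r) - 1))" by(rule ex_norm) (auto simp: s0_def)
 hence "ex (norm_prog (N - 1)) s0 ((%_. 0)(0 := b))" unfolding sum .
 hence r1: "run T (0, 0, tp N s0) (n, 0, tp N ((%_. 0)(0 := b)))" by(rule comp_run) (use N h(1) in simp_all)
 define st where "st k = (%_::nat. 0::nat)(0 := b, 1 := k)" for k
 have st0: "(%_. 0)(0 := b) = st 0" and stS: "(st k)(1 := Suc (st k 1)) = st (Suc k)" for k by(auto simp: fun_eq_iff st_def)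
 have r2: "k \<le> a ==> run T (n, 0, tp N (st 0)) (n + k * l, 0, tp N (st k))" for k
 proof(induction k)
  case (Suc k)
  have "[0..<a] = [0..<k] @ k # [Suc k..<a]" using Suc.prems by(metis Suc_le_eq upt_add_eq_append upt_conv_Cons le_add1 le_Suc_ex less_imp_le_nat add_0)
  hence "has T n (concat (map ?b [0..<k]) @ ?b k @ concat (map ?b [Suc k..<a]))" using h(2) by simp
  hence hk: "has T (n + k * l) (?b k)" unfolding has_append lb by blast
  have "run T (n + k * l, 0, tp N (st k)) (n + Suc k * l, 0, tp N (st (Suc k)))"
   by(rule comp_run[OF ex_Inc[of 1 "st k", unfolded stS] _ hk]) (use N in simp)
  thus ?case using run_trans Suc by simp
 qed simp
 have r3: "run T (n + a * l, 0, tp N ((%_. 0)(0 := b, 1 := a))) (n + a * l + plen N E, 0, tp N ((%_. 0)(0 := y)))"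
  by(rule comp_run[OF E N(2) h(3)])
 have "run T (tm_init b) (n + a * l + plen N E, 0, tp N ((%_. 0)(0 := y)))"
  unfolding tm_init_def t0 by(rule run_trans[OF r1[unfolded st0] run_trans[OF r2[OF order.refl] r3[folded st_def]]])
 moreover have "length T = n + a * l + plen N E" unfolding T length_append ln lb using length_comp[OF N(2)] by simp
 moreover have "card {x. tp N ((%_. 0)(0 := y)) x} = y" using N by(subst card_tp) (auto simp: sum.remove[of _ 0] if_distrib cong: if_cong)
 ultimately show ?thesis unfolding K1_iff tm_outcome_def T_def[symmetric] run_def using run_halt[of T "n + a * l + plen N E"] by force
qed

section \<open>Computable relations and functions on the natural numbers\<close>

section \<open>Computable relations\<close>

text \<open>One-sided computability: where \<open>R x y\<close> holds, some run turns
  \<open>x\<close> into \<open>y\<close>. A program must exist for every base register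
  \<open>n\<close>; it starts with empty registers above \<open>n\<close> and leaves them empty, so
  programs compose without renaming.\<close>

definition rl :: "(nat => nat => bool) => bool" where
 "rl R <-> (ALL n. EX P. ALL s y. (ALL r>n. s r = 0) --> R (s n) y --> ex P s (s(n := y)))"

abbreviation tf :: "(nat => nat) => bool" where "tf f \<equiv> rl (%x y. y = f x)"

definition pr :: "nat => nat => nat" where "pr x y = prod_encode (x, y)"
definition p1 :: "nat => nat" where "p1 x = fst (prod_decode x)"
definition p2 :: "nat => nat" where "p2 x = snd (prod_decode x)"

lemma pr_simps [simp]: "p1 (pr x y) = x" "p2 (pr x y) = y" "pr (p1 x) (p2 x) = x"
 by(simp_all add: pr_def p1_def p2_def)

lemma rl_mono: "rl R ==> (!!x y. S x y ==> R x y) ==> rl S"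
 unfolding rl_def by meson

lemma rlE:
 assumes "rl R"
 obtains P where "!!s y. (!!r. n < r ==> s r = 0) ==> R (s n) y ==> ex P s (s(n := y))"
 using assms unfolding rl_def by meson

lemma rlI: "(!!n. EX P. ALL s y. (ALL r>n. s r = 0) --> R (s n) y --> ex P s (s(n := y))) ==> rl R"
 unfolding rl_def by blast

lemma ex_eq: "ex P s s' ==> s' = s'' ==> ex P s s''" by simp

lemma rl_comp: assumes R: "rl R" and S: "rl S" shows "rl (R OO S)"
proof(rule rlI)
 fix n
 obtain P where P: "!!s y. (!!r. n < r ==> s r = 0) ==> R (s n) y ==> ex P s (s(n := y))" using R by(rule rlE[where n = n]) blast
 obtain Q where Q: "!!s y. (!!r. n < r ==> s r = 0) ==> S (s n) y ==> ex Q s (s(n := y))" using S by(rule rlE[where n = n]) blast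
 have "ex (P ;; Q) s (s(n := y))" if z: "ALL r>n. s r = 0" and y: "(R OO S) (s n) y" for s y
 proof -
  obtain x where x: "R (s n) x" "S x y" using y by blast
  have 1: "ex P s (s(n := x))" by(rule P) (use z x in simp_all)
  have 2: "ex Q (s(n := x)) ((s(n := x))(n := y))" by(rule Q) (use z x in simp_all)
  show ?thesis using ex_Sq[OF 1 2] by simp
 qed
 thus "EX P. ALL s y. (ALL r>n. s r = 0) --> (R OO S) (s n) y --> ex P s (s(n := y))" by blast
qed

lemma tf_comp: "tf f ==> tf g ==> tf (%x. g (f x))"
 by(rule rl_mono[OF rl_comp[of "%x y. y = f x" "%x y. y = g x"]]) auto

lemma ex_move2:
 assumes "distinct [i, j, k]"
 shows "ex (Loop i (Inc j ;; Inc k)) s (s(i := 0, j := s j + s i, k := s k + s i))"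
proof(induction "s i" arbitrary: s)
 case 0
 hence "s(i := 0, j := s j + s i, k := s k + s i) = s" by(auto simp: fun_eq_iff)
 thus ?case using ex_Loop0[of s i "Inc j ;; Inc k"] 0 by metis
next
 case (Suc n)
 let ?s = "s(i := n, j := Suc (s j), k := Suc (s k))"
 have 1: "ex (Inc j ;; Inc k) (s(i := n)) ?s"
  by(rule ex_eq[OF ex_Sq[OF ex_Inc ex_Inc]]) (use assms in auto)
 have "n = ?s i" using assms by auto
 from Suc.hyps(1)[of ?s, OF this] have 2: "ex (Loop i (Inc j ;; Inc k)) ?s (?s(i := 0, j := ?s j + ?s i, k := ?s k + ?s i))" .
 have "?s(i := 0, j := ?s j + ?s i, k := ?s k + ?s i) = s(i := 0, j := s j + s i, k := s k + s i)"
  using assms Suc.hyps(2) by(auto simp: fun_eq_iff)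
 thus ?case using ex_LoopS[of s i n, OF Suc.hyps(2)[symmetric] 1 2] by(simp only:)
qed

text \<open>Decrementing the empty register \<open>z\<close> does nothing and serves as empty loop
  body.\<close>

lemma ex_clear:
 assumes "i ~= z" shows "s z = 0 ==> ex (Loop i (Dec z)) s (s(i := 0))"
proof(induction "s i" arbitrary: s)
 case 0
 hence "s(i := 0) = s" by(simp add: fun_upd_idem)
 thus ?case using ex_Loop0[of s i "Dec z"] 0 by metis
next
 case (Suc n)
 have 1: "ex (Dec z) (s(i := n)) (s(i := n))" by(rule ex_eq[OF ex_Dec]) (use assms Suc.prems in "auto simp: fun_eq_iff")
 have "n = (s(i := n)) i" "(s(i := n)) z = 0" using assms Suc.prems by simp_all
 from Suc.hyps(1)[of "s(i := n)", OF this] have 2: "ex (Loop i (Dec z)) (s(i := n)) ((s(i := n))(i := 0))" .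
 have "(s(i := n))(i := 0) = s(i := 0)" by simp
 thus ?case using ex_LoopS[of s i n, OF Suc.hyps(2)[symmetric] 1 2] by(simp only:)
qed

text \<open>\<open>prod_encode (u, v) = u + triangle (u + v)\<close>, with \<open>v\<close> in register \<open>n\<close> and \<open>u\<close> in register \<open>n + 1\<close>.\<close>

definition enc :: "nat => prog" where
 "enc n = Loop (n + 1) (Inc (n + 2) ;; Inc n) ;;
  Loop n (Inc (n + 2) ;; Loop n (Inc (n + 2) ;; Inc (n + 3)) ;; Loop (n + 3) (Inc n)) ;; Loop (n + 2) (Inc n)"

text \<open>A round that starts with \<open>k + 1\<close> in register \<open>n\<close> adds
  \<open>k + 1\<close> to the sum; register \<open>n + 3\<close> saves the counter while it is
  copied.\<close>

lemma ex_triangle: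
 "s (n + 3) = 0 ==> ex (Loop n (Inc (n + 2) ;; Loop n (Inc (n + 2) ;; Inc (n + 3)) ;; Loop (n + 3) (Inc n))) s
  (s(n := 0, n + 2 := s (n + 2) + triangle (s n)))"
proof(induction "s n" arbitrary: s)
 case 0
 hence "s(n := 0, n + 2 := s (n + 2) + triangle (s n)) = s" by(auto simp: fun_eq_iff)
 thus ?case using ex_Loop0[of s n "Inc (n + 2) ;; Loop n (Inc (n + 2) ;; Inc (n + 3)) ;; Loop (n + 3) (Inc n)"] 0 by metis
next
 case (Suc k)
 let ?B = "Inc (n + 2) ;; Loop n (Inc (n + 2) ;; Inc (n + 3)) ;; Loop (n + 3) (Inc n)"
 let ?s = "s(n := k, n + 2 := s (n + 2) + Suc k)"
 have 1: "ex ?B (s(n := k)) ?s"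
  by(rule ex_eq[OF ex_Sq[OF ex_Inc ex_Sq[OF ex_move2 ex_move]]]) (use Suc.prems in "auto simp: fun_eq_iff")
 have "k = ?s n" "?s (n + 3) = 0" using Suc.prems by simp_all
 from Suc.hyps(1)[of ?s, OF this] have 2: "ex (Loop n ?B) ?s (?s(n := 0, n + 2 := ?s (n + 2) + triangle (?s n)))" .
 have "?s(n := 0, n + 2 := ?s (n + 2) + triangle (?s n)) = s(n := 0, n + 2 := s (n + 2) + triangle (s n))"
  by(simp add: Suc.hyps(2)[symmetric] fun_eq_iff)
 thus ?case using ex_LoopS[of s n k, OF Suc.hyps(2)[symmetric] 1 2] by(simp only:)
qed

lemma ex_enc: "s (n + 2) = 0 ==> s (n + 3) = 0 ==> ex (enc n) s (s(n := pr (s (n + 1)) (s n), n + 1 := 0))"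
 unfolding enc_def
 by(rule ex_eq[OF ex_Sq[OF ex_move2 ex_Sq[OF ex_triangle ex_move]]])
  (auto simp: fun_eq_iff pr_def prod_encode_def add.commute)

lemma rl_pair: assumes R: "rl R" and S: "rl S" shows "rl (%x z. EX u v. R x u & S x v & z = pr u v)"
proof(rule rlI)
 fix n
 obtain P where P: "!!s y. (!!r. n + 1 < r ==> s r = 0) ==> R (s (n + 1)) y ==> ex P s (s(n + 1 := y))" using R by(rule rlE[where n = "n + 1"]) blast
 obtain Q where Q: "!!s y. (!!r. n + 2 < r ==> s r = 0) ==> S (s (n + 2)) y ==> ex Q s (s(n + 2 := y))" using S by(rule rlE[where n = "n + 2"]) blast
 \<comment> \<open>\<open>S\<close> runs first, in the topmost register in use. Its result is parked
   in register \<open>n\<close> before \<open>R\<close> runs in \<open>n + 1\<close> with empty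
   registers above.\<close>
 let ?P = "Loop n (Inc (n + 1) ;; Inc (n + 2)) ;; Q ;; Loop (n + 2) (Inc n) ;; P ;; enc n"
 have "ex ?P s (s(n := pr u v))" if z: "ALL r>n. s r = 0" and uv: "R (s n) u" "S (s n) v" for s u v
 proof -
  have 1: "ex (Loop n (Inc (n + 1) ;; Inc (n + 2))) s (s(n := 0, n + 1 := s n, n + 2 := s n))"
   by(rule ex_eq[OF ex_move2]) (use z in "auto simp: fun_eq_iff")
  have 2: "ex Q (s(n := 0, n + 1 := s n, n + 2 := s n)) (s(n := 0, n + 1 := s n, n + 2 := v))"
   by(rule ex_eq[OF Q]) (use z uv in "auto simp: fun_eq_iff")
  have 3: "ex (Loop (n + 2) (Inc n)) (s(n := 0, n + 1 := s n, n + 2 := v)) (s(n := v, n + 1 := s n))"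
   by(rule ex_eq[OF ex_move]) (use z in "auto simp: fun_eq_iff")
  have 4: "ex P (s(n := v, n + 1 := s n)) (s(n := v, n + 1 := u))"
   by(rule ex_eq[OF P]) (use z uv in "auto simp: fun_eq_iff")
  have 5: "ex (enc n) (s(n := v, n + 1 := u)) (s(n := pr u v))"
   by(rule ex_eq[OF ex_enc]) (use z in "auto simp: fun_eq_iff")
  show ?thesis by(rule ex_Sq[OF 1 ex_Sq[OF 2 ex_Sq[OF 3 ex_Sq[OF 4 5]]]])
 qed
 thus "EX P. ALL s y. (ALL r>n. s r = 0) --> (EX u v. R (s n) u & S (s n) v & y = pr u v) --> ex P s (s(n := y))" by blast
qed

lemma tf_pr: "tf f ==> tf g ==> tf (%x. pr (f x) (g x))"
 by(rule rl_mono[OF rl_pair[of "%x y. y = f x" "%x y. y = g x"]]) auto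

lemma prod_decode_Suc: "prod_decode (Suc k) = (case prod_decode k of (m, 0) => (0, Suc m) | (m, Suc n) => (Suc m, n))"
proof -
 obtain m n where mn: "prod_decode k = (m, n)" by(cases "prod_decode k")
 hence k: "k = prod_encode (m, n)" by(metis prod_decode_inverse)
 have "prod_encode (case n of 0 => (0, Suc m) | Suc n => (Suc m, n)) = Suc k"
  unfolding k by(cases n) (simp_all add: prod_encode_def)
 thus ?thesis unfolding mn by(metis prod.case prod_encode_inverse)
qed

text \<open>Counts register \<open>n\<close> down while walking along the Cantor enumeration;
  \<open>prod_decode_Suc\<close> is a step on a diagonal or to the next one.\<close>

definition dec :: "nat => prog" where
 "dec n = Loop n (Br (n + 2) (Inc (n + 1)) (Loop (n + 1) (Inc (n + 2)) ;; Inc (n + 2)))"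

lemma ex_dec: "s (n + 1) = p1 k ==> s (n + 2) = p2 k ==> ex (dec n) s (s(n := 0, n + 1 := p1 (k + s n), n + 2 := p2 (k + s n)))"
proof(induction "s n" arbitrary: s k)
 case 0
 hence "s(n := 0, n + 1 := p1 (k + s n), n + 2 := p2 (k + s n)) = s" by(auto simp: fun_eq_iff)
 thus ?case using ex_Loop0[of s n] 0 unfolding dec_def by metis
next
 case (Suc x)
 let ?B = "Br (n + 2) (Inc (n + 1)) (Loop (n + 1) (Inc (n + 2)) ;; Inc (n + 2))"
 let ?s = "s(n := x, n + 1 := p1 (Suc k), n + 2 := p2 (Suc k))"
 have 1: "ex ?B (s(n := x)) ?s"
 proof(cases "p2 k")
  case 0
  hence d: "p1 (Suc k) = 0" "p2 (Suc k) = Suc (p1 k)" unfolding p1_def p2_def prod_decode_Suc by(auto split: prod.split)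
  show ?thesis
   by(rule ex_eq[OF ex_Br0[OF _ ex_Sq[OF ex_move ex_Inc]]]) (use Suc.prems 0 d in "auto simp: fun_eq_iff")
 next
  case (Suc y)
  hence d: "p1 (Suc k) = Suc (p1 k)" "p2 (Suc k) = y" unfolding p1_def p2_def prod_decode_Suc by(auto split: prod.split)
  have "(s(n := x)) (n + 2) = Suc y" using Suc.prems Suc by simp
  from ex_BrS[of "s(n := x)" "n + 2", OF this ex_Inc] show ?thesis
   by(rule ex_eq) (use Suc.prems d in "auto simp: fun_eq_iff")
 qed
 have "x = ?s n" "?s (n + 1) = p1 (Suc k)" "?s (n + 2) = p2 (Suc k)" by simp_all
 from Suc.hyps(1)[of ?s "Suc k", OF this] have 2: "ex (Loop n ?B) ?s (?s(n := 0, n + 1 := p1 (Suc k + ?s n), n + 2 := p2 (Suc k + ?s n)))" unfolding dec_def .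
 have "?s(n := 0, n + 1 := p1 (Suc k + ?s n), n + 2 := p2 (Suc k + ?s n)) = s(n := 0, n + 1 := p1 (k + s n), n + 2 := p2 (k + s n))"
  by(simp add: Suc.hyps(2)[symmetric] fun_eq_iff)
 thus ?case using ex_LoopS[of s n x, OF Suc.hyps(2)[symmetric] 1 2] unfolding dec_def by(simp only:)
qed

lemma p_0 [simp]: "p1 0 = 0" "p2 0 = 0"
 by(simp_all add: p1_def p2_def prod_decode_def prod_decode_aux.simps)

lemma tf_p1: "tf f ==> tf (%x. p1 (f x))" and tf_p2: "tf f ==> tf (%x. p2 (f x))"
proof -
 have d: "ex (dec n) s (s(n := 0, n + 1 := p1 (s n), n + 2 := p2 (s n)))" if z: "ALL r>n. s r = 0" for n s
  by(rule ex_eq[OF ex_dec[of s n 0]]) (use z in simp_all)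
 have "tf p1"
 proof(rule rlI)
  fix n
  have "ex (dec n ;; Loop (n + 1) (Inc n) ;; Loop (n + 2) (Dec (n + 3))) s (s(n := p1 (s n)))" if z: "ALL r>n. s r = 0" for s
   by(rule ex_eq[OF ex_Sq[OF d[OF z] ex_Sq[OF ex_move ex_clear]]]) (use z in "auto simp: fun_eq_iff")
  thus "EX P. ALL s y. (ALL r>n. s r = 0) --> y = p1 (s n) --> ex P s (s(n := y))" by blast
 qed
 thus "tf f ==> tf (%x. p1 (f x))" by(rule tf_comp[rotated])
 have "tf p2"
 proof(rule rlI)
  fix n
  have "ex (dec n ;; Loop (n + 2) (Inc n) ;; Loop (n + 1) (Dec (n + 3))) s (s(n := p2 (s n)))" if z: "ALL r>n. s r = 0" for s
   by(rule ex_eq[OF ex_Sq[OF d[OF z] ex_Sq[OF ex_move ex_clear]]]) (use z in "auto simp: fun_eq_iff")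
  thus "EX P. ALL s y. (ALL r>n. s r = 0) --> y = p2 (s n) --> ex P s (s(n := y))" by blast
 qed
 thus "tf f ==> tf (%x. p2 (f x))" by(rule tf_comp[rotated])
qed

lemma tf_Suc: "tf f ==> tf (%x. Suc (f x))" and tf_pred: "tf f ==> tf (%x. f x - 1)"
proof -
 have "tf Suc" by(rule rlI) (use ex_Inc in blast)
 thus "tf f ==> tf (%x. Suc (f x))" by(rule tf_comp[rotated])
 have "tf (%x. x - 1)" by(rule rlI) (use ex_Dec in blast)
 thus "tf f ==> tf (%x. f x - 1)" by(rule tf_comp[rotated])
qed

lemma tf_const: "tf (%_. c)"
proof(induction c)
 case 0
 show ?case
 proof(rule rlI)
  fix n
  have "ex (Loop n (Dec (n + 1))) s (s(n := 0))" if "ALL r>n. s r = 0" for s by(rule ex_clear) (use that in auto)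
  thus "EX P. ALL s y. (ALL r>n. s r = 0) --> y = 0 --> ex P s (s(n := y))" by blast
 qed
next
 case (Suc c) thus ?case by(rule tf_Suc)
qed

text \<open>The argument is copied first, so it survives the computation of the test value in the
  next register.\<close>

lemma test_prog:
 assumes "rl G"
 obtains P where "!!s g. (!!r. n < r ==> s r = 0) ==> G (s n) g ==> ex P s (s(n + 1 := g))"
proof -
 obtain P where P: "!!s y. (!!r. n + 1 < r ==> s r = 0) ==> G (s (n + 1)) y ==> ex P s (s(n + 1 := y))"
  using assms by(rule rlE[where n = "n + 1"]) blast
 have "ex (Loop n (Inc (n + 1) ;; Inc (n + 2)) ;; Loop (n + 2) (Inc n) ;; P) s (s(n + 1 := g))"
  if z: "!!r. n < r ==> s r = 0" and g: "G (s n) g" for s g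
 proof -
  have 1: "ex (Loop n (Inc (n + 1) ;; Inc (n + 2))) s (s(n := 0, n + 1 := s n, n + 2 := s n))"
   by(rule ex_eq[OF ex_move2]) (use z in "auto simp: fun_eq_iff")
  have 2: "ex (Loop (n + 2) (Inc n)) (s(n := 0, n + 1 := s n, n + 2 := s n)) (s(n + 1 := s n))"
   by(rule ex_eq[OF ex_move]) (use z in "auto simp: fun_eq_iff")
  have 3: "ex P (s(n + 1 := s n)) (s(n + 1 := g))" by(rule ex_eq[OF P]) (use z g in auto)
  show ?thesis by(rule ex_Sq[OF 1 ex_Sq[OF 2 3]])
 qed
 thus ?thesis using that by blast
qed

inductive whl :: "(nat => nat => bool) => (nat => nat => bool) => nat => nat => bool" for G F where
 whl_0: "G x 0 ==> whl G F x x"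
| whl_Suc: "G x (Suc k) ==> F x y ==> whl G F y z ==> whl G F x z"

text \<open>The test value lies in register \<open>n + 1\<close>. A round clears what the decrement
  of \<open>Loop\<close> left of it, runs the body, and computes the test anew.\<close>

lemma rl_whl: assumes G: "rl G" and F: "rl F" shows "rl (whl G F)"
proof(rule rlI)
 fix n
 obtain C where C: "!!s g. (!!r. n < r ==> s r = 0) ==> G (s n) g ==> ex C s (s(n + 1 := g))" using test_prog[OF G] by metis
 obtain P where P: "!!s y. (!!r. n < r ==> s r = 0) ==> F (s n) y ==> ex P s (s(n := y))" using F by(rule rlE[where n = n]) blast
 let ?L = "Loop (n + 1) (Loop (n + 1) (Dec (n + 2)) ;; P ;; C)"
 have loop: "EX g. G x g & ex ?L (s(n := x, n + 1 := g)) (s(n := z))" if "whl G F x z" and z: "ALL r>n. s r = 0" for s x z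
  using that(1)
 proof induction
  case (whl_0 x)
  have "ex ?L (s(n := x, n + 1 := 0)) (s(n := x, n + 1 := 0))" by(rule ex_Loop0) simp
  moreover have "s(n := x, n + 1 := 0) = s(n := x)" using z by(auto simp: fun_eq_iff)
  ultimately show ?case using whl_0 by metis
 next
  case (whl_Suc x k y z')
  obtain g where g: "G y g" "ex ?L (s(n := y, n + 1 := g)) (s(n := z'))" using whl_Suc.IH by blast
  have 1: "ex (Loop (n + 1) (Dec (n + 2))) (s(n := x, n + 1 := k)) (s(n := x))"
   by(rule ex_eq[OF ex_clear]) (use z in "auto simp: fun_eq_iff")
  have 2: "ex P (s(n := x)) (s(n := y))" by(rule ex_eq[OF P]) (use z whl_Suc.hyps in auto)
  have 3: "ex C (s(n := y)) (s(n := y, n + 1 := g))" by(rule C) (use z g in auto)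
  have s: "(s(n := x, n + 1 := Suc k)) (n + 1) = Suc k" by simp
  have "ex ?L (s(n := x, n + 1 := Suc k)) (s(n := z'))"
   by(rule ex_LoopS[of "s(n := x, n + 1 := Suc k)" "n + 1", OF s _ g(2)]) (use ex_Sq[OF 1 ex_Sq[OF 2 3]] in simp)
  thus ?case using whl_Suc.hyps(1) by blast
 qed
 have "ex (C ;; ?L) s (s(n := y))" if z: "ALL r>n. s r = 0" and w: "whl G F (s n) y" for s y
 proof -
  obtain g where g: "G (s n) g" "ex ?L (s(n := s n, n + 1 := g)) (s(n := y))" using loop[OF w z] by blast
  have "ex C s (s(n + 1 := g))" by(rule C) (use z g in auto)
  thus ?thesis by(rule ex_Sq) (use g(2) in simp)
 qed
 thus "EX P. ALL s y. (ALL r>n. s r = 0) --> whl G F (s n) y --> ex P s (s(n := y))" by blast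
qed

lemma tf_if: assumes b: "tf b" and f: "tf f" and g: "tf g" shows "tf (%x. if b x = 0 then f x else g x)"
proof(rule rlI)
 fix n
 obtain C where C: "!!s y. (!!r. n < r ==> s r = 0) ==> y = b (s n) ==> ex C s (s(n + 1 := y))" using test_prog[OF b] by metis
 obtain P where P: "!!s y. (!!r. n < r ==> s r = 0) ==> y = f (s n) ==> ex P s (s(n := y))" using f by(rule rlE[where n = n]) blast
 obtain Q where Q: "!!s y. (!!r. n < r ==> s r = 0) ==> y = g (s n) ==> ex Q s (s(n := y))" using g by(rule rlE[where n = n]) blast
 have "ex (C ;; Br (n + 1) (Loop (n + 1) (Dec (n + 2)) ;; Q) P) s (s(n := if b (s n) = 0 then f (s n) else g (s n)))"
  if z: "ALL r>n. s r = 0" for s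
 proof(rule ex_Sq[OF C[of s "b (s n)"]])
  show "ex (Br (n + 1) (Loop (n + 1) (Dec (n + 2)) ;; Q) P) (s(n + 1 := b (s n))) (s(n := if b (s n) = 0 then f (s n) else g (s n)))"
  proof(cases "b (s n)")
   case 0
   hence e: "s(n + 1 := b (s n)) = s" using z by(simp add: fun_upd_idem)
   show ?thesis unfolding e by(rule ex_Br0) (use z 0 P[of s] in auto)
  next
   case (Suc k)
   have 1: "ex (Loop (n + 1) (Dec (n + 2))) (s(n + 1 := k)) s"
    by(rule ex_eq[OF ex_clear]) (use z in "auto simp: fun_eq_iff")
   have 2: "ex Q s (s(n := g (s n)))" by(rule Q) (use z in auto)
   have s: "(s(n + 1 := b (s n))) (n + 1) = Suc k" using Suc by simp
   show ?thesis by(rule ex_BrS[of "s(n + 1 := b (s n))" "n + 1", OF s]) (use ex_Sq[OF 1 2] Suc in simp)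
  qed
 qed (use z in auto)
 thus "EX P. ALL s y. (ALL r>n. s r = 0) --> y = (if b (s n) = 0 then f (s n) else g (s n)) --> ex P s (s(n := y))" by blast
qed

lemma tf_id: "tf (%x. x)"
proof(rule rlI)
 fix n
 have "ex (Dec (n + 1)) s (s(n := s n))" if "ALL r>n. s r = 0" for s
  by(rule ex_eq[OF ex_Dec]) (use that in "auto simp: fun_eq_iff")
 thus "EX P. ALL s y. (ALL r>n. s r = 0) --> y = s n --> ex P s (s(n := y))" by blast
qed

section \<open>The s-m-n property, the universal program and the combinators of
  \<open>K1\<close>\<close>

section \<open>Kleene's first model is a decidable pca\<close>

lemma tf_rl: "tf f ==> rl R ==> rl (%x y. R (f x) y)"
 by(rule rl_mono[OF rl_comp[of "%x y. y = f x" R]]) auto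

lemma rl_tf: "rl R ==> tf f ==> rl (%x y. EX z. R x z & y = f z)"
 by(rule rl_mono[OF rl_comp[of R "%x y. y = f x"]]) auto

text \<open>A while loop on pairs of a counter and the current value.\<close>

lemma tf_iter:
 assumes h: "tf h" and g: "tf g" and f: "tf f"
 shows "tf (%x. (h ^^ g x) (f x))"
proof -
 let ?G = "%x y. y = p1 x" and ?F = "%x y. y = pr (p1 x - 1) (h (p2 x))"
 have w: "whl ?G ?F (pr k a) (pr 0 ((h ^^ k) a))" for k a
 proof(induction k arbitrary: a)
  case 0 thus ?case by(simp add: whl_0)
 next
  case (Suc k)
  show ?case by(rule whl_Suc[of ?G "pr (Suc k) a" k ?F "pr k (h a)"]) (use Suc in "simp_all add: funpow_swap1")
 qed
 have "tf p1" by(rule tf_p1[OF tf_id])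
 moreover have "tf (%x. pr (p1 x - 1) (h (p2 x)))" by(intro tf_pr tf_pred tf_p1 tf_comp[OF tf_p2[OF tf_id] h] tf_id)
 ultimately have "rl (whl ?G ?F)" by(rule rl_whl)
 from rl_tf[OF tf_rl[OF tf_pr[OF g f] this] tf_p2[OF tf_id]]
 show ?thesis by(rule rl_mono) (use w in force)
qed

lemma tf_add: assumes "tf f" "tf g" shows "tf (%x. f x + g x)"
proof -
 have "tf (%x. (Suc ^^ g x) (f x))" by(rule tf_iter[OF tf_Suc[OF tf_id] assms(2,1)])
 moreover have "(Suc ^^ n) m = m + n" for m n by(induction n) simp_all
 ultimately show ?thesis by(simp only:)
qed

lemma tf_diff: assumes "tf f" "tf g" shows "tf (%x. f x - g x)"
proof -
 have "tf (%x. ((%y. y - 1) ^^ g x) (f x))" by(rule tf_iter[OF tf_pred[OF tf_id] assms(2,1)])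
 moreover have "((%y. y - 1) ^^ n) m = m - n" for m n :: nat by(induction n) simp_all
 ultimately show ?thesis by simp
qed

text \<open>Prepends the block \<open>L\<close>, relocated by \<open>d\<close>, to an encoded table.
  For fixed \<open>L\<close> this is made from successor, addition and pairing alone.\<close>

definition blk :: "tab => nat => nat => nat" where
 "blk L d acc = foldr (%p acc. Suc (pr (ins (fst (rel d p))) (Suc (pr (ins (snd (rel d p))) acc)))) L acc"

lemma blk_encode: "list_encode (flat (map (rel d) L @ T)) = blk L d (list_encode (flat T))"
 by(induction L) (simp_all add: blk_def pr_def)

lemma tf_blk: "tf f ==> tf g ==> tf (%x. blk L (f x) (g x))"
proof(induction L)
 case (Cons p L)
 obtain w m q w' m' q' where p: "p = ((w, m, q), (w', m', q'))" by(metis prod.collapse)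
 have e: "blk (p # L) d acc = Suc (pr (pr w (pr m (q + d))) (Suc (pr (pr w' (pr m' (q' + d))) (blk L d acc))))" for d acc
  by(simp add: blk_def p ins_def pr_def)
 show ?case unfolding e by(intro tf_Suc tf_pr tf_add tf_const Cons)
qed (simp add: blk_def)

text \<open>The table of \<open>pmach\<close> depends on \<open>a\<close> only through the number of
  increments and the offsets that this causes, so its code is obtained by iteration.\<close>

lemma smn:
 assumes R: "rl R"
 shows "EX S. tf S & (ALL a x y. R (pr a x) y --> K1 (S a) x = Some y)"
proof -
 obtain P where P: "!!s y. (!!r. 0 < r ==> s r = 0) ==> R (s 0) y ==> ex P s (s(0 := y))" using R by(rule rlE[where n = 0]) blast
 define E where "E = enc 0 ;; P"
 define N where "N = mreg E + 2"
 have E: "ex E ((%_. 0)(0 := x, 1 := a)) ((%_. 0)(0 := y))" if "R (pr a x) y" for a x y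
 proof -
  have 1: "ex (enc 0) ((%_. 0)(0 := x, 1 := a)) ((%_. 0)(0 := pr a x))" by(rule ex_eq[OF ex_enc]) (auto simp: fun_eq_iff)
  have 2: "ex P ((%_. 0)(0 := pr a x)) ((%_. 0)(0 := y))" by(rule ex_eq[OF P]) (use that in auto)
  show ?thesis unfolding E_def by(rule ex_Sq[OF 1 2])
 qed
 define S where "S a = list_encode (flat (pmach N E a))" for a
 have "K1 (S a) x = Some y" if "R (pr a x) y" for a x y
  unfolding S_def by(rule pmach_K1[OF _ _ E[OF that]]) (simp_all add: N_def)
 moreover have "tf S"
 proof -
  define n l LN LI LE where "n = plen N (norm_prog (N - 1))" and "l = plen N (Inc 1)" and "LN = comp N (norm_prog (N - 1)) 0 n"
   and "LI = comp N (Inc 1) 0 l" and "LE = comp N E 0 (plen N E)"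
  let ?b = "%i. comp N (Inc 1) (n + i * l) (n + Suc i * l)"
  have b: "?b i = map (rel (n + i * l)) LI" for i using comp_rel[of N "Inc 1" 0 "n + i * l" l] by(simp add: LI_def ac_simps del: comp.simps)
  have e: "comp N E (n + a * l) (n + a * l + plen N E) = map (rel (n + a * l)) LE" for a
   using comp_rel[of N E 0 "n + a * l" "plen N E"] by(simp add: LE_def ac_simps)
  have r0: "map (rel 0) L = L" for L by(rule map_idI) (auto simp: rel_def)
  \<comment> \<open>The table is built from its end: a round lowers the offset by \<open>l\<close>
    and puts one more relocated increment in front.\<close>
  define body where "body s = pr (p1 s - l) (blk LI (p1 s - l) (p2 s))" for s
  have it: "k \<le> a ==> (body ^^ k) (pr (n + a * l) (list_encode (flat T))) = pr (n + (a - k) * l) (list_encode (flat (concat (map ?b [a - k..<a]) @ T)))" for a k T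
  proof(induction k)
   case (Suc k)
   define j where "j = a - Suc k"
   have j: "a - k = Suc j" "[j..<a] = j # [Suc j..<a]" using Suc.prems by(simp_all add: j_def upt_conv_Cons)
   have "(body ^^ Suc k) (pr (n + a * l) (list_encode (flat T))) = body (pr (n + Suc j * l) (list_encode (flat (concat (map ?b [Suc j..<a]) @ T))))"
    using Suc j by simp
   also have "\<dots> = pr (n + j * l) (blk LI (n + j * l) (list_encode (flat (concat (map ?b [Suc j..<a]) @ T))))"
    by(simp add: body_def)
   also have "\<dots> = pr (n + j * l) (list_encode (flat (concat (map ?b [j..<a]) @ T)))"
    unfolding blk_encode[symmetric] b[symmetric] j(2) by simp
   finally show ?case unfolding j_def .
  qed simp
  have "S a = blk LN 0 (p2 ((body ^^ a) (pr (((%s. s + l) ^^ a) n) (blk LE (((%s. s + l) ^^ a) n) 0))))" for a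
  proof -
   have nl: "((%s. s + l) ^^ a) n = n + a * l" by(induction a) simp_all
   have 1: "blk LE (n + a * l) 0 = list_encode (flat (map (rel (n + a * l)) LE))" using blk_encode[of "n + a * l" LE "[]"] by simp
   have "S a = list_encode (flat (map (rel 0) LN @ concat (map ?b [0..<a]) @ map (rel (n + a * l)) LE))"
    unfolding S_def pmach_def Let_def n_def[symmetric] l_def[symmetric] e r0 LN_def ..
   also have "\<dots> = blk LN 0 (p2 ((body ^^ a) (pr (n + a * l) (blk LE (n + a * l) 0))))"
    unfolding blk_encode 1 it[OF order.refl] by simp
   finally show ?thesis unfolding nl .
  qed
  hence "S = (%a. blk LN 0 (p2 ((body ^^ a) (pr (((%s. s + l) ^^ a) n) (blk LE (((%s. s + l) ^^ a) n) 0)))))" by(rule ext)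
  moreover have "tf body" unfolding body_def by(intro tf_pr tf_blk tf_diff tf_p1 tf_p2 tf_id tf_const)
  moreover have "tf (%a. ((%s. s + l) ^^ a) n)" by(intro tf_iter tf_add tf_id tf_const)
  ultimately show ?thesis by(simp only:) (intro tf_blk tf_p2 tf_iter tf_pr tf_add tf_id tf_const)
 qed
 ultimately show ?thesis by blast
qed

lemma K1_tf: assumes "tf f" obtains m where "!!x. K1 m x = Some (f x)"
proof -
 obtain S where "ALL a x y. y = f (p2 (pr a x)) --> K1 (S a) x = Some y" using smn[OF tf_comp[OF tf_p2[OF tf_id] assms]] by blast
 thus ?thesis using that[of "S 0"] by simp
qed

text \<open>A tape is represented by the numbers \<open>l\<close> and \<open>r\<close> coding the sequences of its cells to the left
 of the head, and from the head to the right; \<open>0 = prod_encode (0, 0)\<close> codes the blank sequence.\<close>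

definition stk :: "nat => (nat => bool) => bool" where
 "stk z f <-> (ALL k. p1 ((p2 ^^ k) z) = of_bool (f k))"

lemma stk_pop: "stk z f ==> p1 z = of_bool (f 0)" "stk z f ==> stk (p2 z) (%k. f (Suc k))"
 unfolding stk_def by(metis funpow_0, metis comp_apply funpow_Suc_right)

lemma stk_push: "stk z f ==> g 0 = b ==> (!!k. g (Suc k) = f k) ==> stk (pr (of_bool b) z) g"
 unfolding stk_def
proof
 fix k assume "ALL k. p1 ((p2 ^^ k) z) = of_bool (f k)" "g 0 = b" "!!k. g (Suc k) = f k"
 thus "p1 ((p2 ^^ k) (pr (of_bool b) z)) = of_bool (g k)" by(cases k) (simp_all add: funpow_swap1)
qed

lemma stk_cong: "stk z f ==> (!!k. f k = g k) ==> stk z g" by(simp add: stk_def)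

text \<open>A simulated configuration consists of table, state, number of strokes and the two half
  tapes. The number of strokes is carried along because it is the output.\<close>

definition cq where "cq c = p1 (p2 c)"
definition cn where "cn c = p1 (p2 (p2 c))"
definition cl where "cl c = p1 (p2 (p2 (p2 c)))"
definition cr where "cr c = p2 (p2 (p2 (p2 c)))"
definition mkc where "mkc M q n l r = pr M (pr q (pr n (pr l r)))"

lemma mkc_simps [simp]: "p1 (mkc M q n l r) = M" "cq (mkc M q n l r) = q" "cn (mkc M q n l r) = n" "cl (mkc M q n l r) = l" "cr (mkc M q n l r) = r"
 by(simp_all add: mkc_def cq_def cn_def cl_def cr_def)

definition par :: "nat => nat" where "par x = ((%b. 1 - b) ^^ x) 0"

lemma par: "par x = of_bool (odd x)"
 by(induction x) (simp_all add: par_def)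

text \<open>The table from the applicable instruction on, as a list code. It is 0 if there is no
  such instruction, so it is also the test for halting.\<close>

definition rest :: "nat => nat" where "rest c = ((%m. p2 (m - 1)) ^^ (cq c + cq c + p1 (cr c))) (p1 c)"
definition nxt :: "nat => nat" where
 "nxt c = (let x = p1 (rest c - 1); w = par (p1 x) in
  if par (p1 (p2 x)) = 0
  then mkc (p1 c) (p2 (p2 x)) (cn c + w - p1 (cr c)) (p2 (cl c)) (pr (p1 (cl c)) (pr w (p2 (cr c))))
  else mkc (p1 c) (p2 (p2 x)) (cn c + w - p1 (cr c)) (pr w (cl c)) (p2 (cr c)))"

lemmas tf_intros = tf_Suc tf_pr tf_add tf_diff tf_p1 tf_p2 tf_if tf_iter tf_id tf_const

lemma tf_rest: "tf rest" unfolding rest_def cq_def cr_def by(intro tf_intros)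

lemma tf_nxt: "tf nxt"
proof -
 have r: "tf (%c. p1 (rest c - 1))" by(intro tf_intros tf_rest)
 have p: "tf (%x. par (p1 (p1 (rest x - 1))))" unfolding par_def by(intro tf_intros r)
 have q: "tf (%x. par (p1 (p2 (p1 (rest x - 1)))))" unfolding par_def by(intro tf_intros r)
 show ?thesis unfolding nxt_def Let_def mkc_def cn_def cl_def cr_def by(intro tf_intros r p q)
qed

lemma drop_encode: "((%m. p2 (m - 1)) ^^ i) (list_encode xs) = list_encode (drop i xs)"
proof(induction i arbitrary: xs)
 case (Suc i)
 show ?case
 proof(cases xs)
  case Nil thus ?thesis using Suc[of "[]"] by(simp add: funpow_Suc_right del: funpow.simps)
 next
  case (Cons x ys) thus ?thesis using Suc[of ys] by(simp add: funpow_Suc_right pr_def[symmetric] del: funpow.simps)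
 qed
qed simp

definition inv :: "nat => nat => tm_config => bool" where
 "inv M c = (%(q, h, t). finite {i. t i} & p1 c = M & cq c = q & cn c = card {i. t i} &
  stk (cl c) (%k. t (h - 1 - int k)) & stk (cr c) (%k. t (h + int k)))"

lemma rest_inv: "inv M c (q, h, t) ==> rest c = list_encode (drop (2 * q + of_bool (t h)) (list_decode M))"
 using stk_pop(1)[of "cr c" "%k. t (h + int k)"] drop_encode[of "2 * q + of_bool (t h)" "list_decode M"]
 by(simp add: inv_def rest_def mult_2)

lemma tm_step_None: "tm_step M (q, h, t) = None <-> length (list_decode M) \<le> 2 * q + of_bool (t h)"
 by(cases "t h") (simp_all add: tm_step_def Let_def case_prod_unfold not_less)

lemma inv_halt: "inv M c (q, h, t) ==> tm_step M (q, h, t) = None ==> rest c = 0"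
 unfolding tm_step_None rest_inv by(simp only: drop_all list_encode.simps)

text \<open>Truncated subtraction does no harm: if \<open>t h\<close> holds, the cell
  \<open>h\<close> is among those counted.\<close>

lemma card_upd: "finite {i. t i} ==> card {i. (t(h := b)) i} = card {i. t i} + of_bool b - of_bool (t h)"
proof -
 assume f: "finite {i. t i}"
 have "{i. (t(h := b)) i} = (if b then insert h {i. t i} else {i. t i} - {h})" by auto
 thus ?thesis using f by(auto simp: card_insert_if)
qed

lemma inv_step:
 assumes i: "inv M c (q, h, t)" and s: "tm_step M (q, h, t) = Some d"
 shows "rest c ~= 0 & inv M (nxt c) d"
proof -
 define j where "j = 2 * q + of_bool (t h)"
 have j: "j < length (list_decode M)" using s tm_step_None[of M q h t] by(simp only: j_def option.distinct not_le[symmetric] simp_thms)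
 define x where "x = list_decode M ! j"
 have dr: "drop j (list_decode M) = x # drop (Suc j) (list_decode M)" unfolding x_def by(rule Cons_nth_drop_Suc[OF j, symmetric])
 have r: "rest c = Suc (pr x (list_encode (drop (Suc j) (list_decode M))))"
  unfolding rest_inv[OF i] j_def[symmetric] dr by(simp add: pr_def)
 have x: "p1 (rest c - 1) = x" by(simp add: r)
 define w m q' where "w = odd (p1 x)" and "m = even (p1 (p2 x))" and "q' = p2 (p2 x)"
 have d: "d = (q', if m then h - 1 else h + 1, t(h := w))"
  using s j by(simp add: tm_step_def Let_def case_prod_unfold j_def[symmetric] x_def[symmetric] w_def m_def q'_def p1_def p2_def) auto
 note iv = i[unfolded inv_def prod.case]
 have l: "stk (cl c) (%k. t (h - 1 - int k))" and rr: "stk (cr c) (%k. t (h + int k))" using iv by simp_all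
 have fin: "finite {i. (t(h := w)) i}"
  by(rule finite_subset[of _ "insert h {i. t i}"]) (use iv in auto)
 have pp: "par (p1 x) = of_bool w" "(par (p1 (p2 x)) = 0) = m" by(simp_all add: par w_def m_def)
 have cn: "cn c + of_bool w - p1 (cr c) = card {i. (t(h := w)) i}"
  unfolding card_upd[OF conjunct1[OF iv]] using iv stk_pop(1)[OF rr] by simp
 have pl: "p1 (cl c) = of_bool (t (h - 1))" using stk_pop(1)[OF l] by simp
 have sl: "stk (p2 (cl c)) (%k. (t(h := w)) (h - 1 - 1 - int k))"
  by(rule stk_cong[OF stk_pop(2)[OF l]]) (simp add: algebra_simps)
 have sr: "stk (p2 (cr c)) (%k. (t(h := w)) (h + 1 + int k))"
  by(rule stk_cong[OF stk_pop(2)[OF rr]]) (simp add: algebra_simps)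
 have sr0: "stk (pr (of_bool w) (p2 (cr c))) (%k. (t(h := w)) (h + int k))"
  by(rule stk_push[OF sr]) (simp_all add: algebra_simps)
 have sr': "stk (pr (of_bool (t (h - 1))) (pr (of_bool w) (p2 (cr c)))) (%k. (t(h := w)) (h - 1 + int k))"
  by(rule stk_push[OF sr0]) (simp_all add: algebra_simps)
 have sl': "stk (pr (of_bool w) (cl c)) (%k. (t(h := w)) (h + 1 - 1 - int k))"
  by(rule stk_push[OF l]) (simp_all add: diff_diff_eq)
 show ?thesis
  using r fin cn sl sr sl' sr' pl iv unfolding nxt_def Let_def x pp inv_def d by(simp add: q'_def del: fun_upd_apply)
qed

definition start :: "nat => nat" where
 "start x = mkc (p1 x) 0 (Suc (p2 x)) 0 (((%r. pr 1 r) ^^ Suc (p2 x)) 0)"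

lemma inv_start: "inv (p1 x) (start x) (tm_init (p2 x))"
proof -
 have z: "(p2 ^^ k) 0 = 0" for k by(induction k) simp_all
 have "stk (((%r. pr 1 r) ^^ n) 0) (%k. k < n)" for n
 proof(induction n)
  case 0 show ?case by(simp add: stk_def z)
 next
  case (Suc n)
  from stk_push[OF this, of "%k. k < Suc n" True] show ?case by simp
 qed
 from this[of "Suc (p2 x)"] have "stk (((%r. pr 1 r) ^^ Suc (p2 x)) 0) (%k. 0 \<le> 0 + int k & 0 + int k \<le> int (p2 x))"
  by(rule stk_cong) auto
 moreover have "stk 0 (%k. 0 \<le> 0 - 1 - int k & 0 - 1 - int k \<le> int (p2 x))" by(simp add: stk_def z)
 moreover have "{i. 0 \<le> i & i \<le> int (p2 x)} = {0..int (p2 x)}" by auto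
 ultimately show ?thesis unfolding inv_def start_def tm_init_def by simp
qed

text \<open>A universal program: iterate \<open>nxt\<close> from the initial configuration until
  \<open>rest\<close> is 0, then output the number of strokes. \<open>whl\<close> follows a halting
  run step by step.\<close>

lemma rl_K1: "rl (%x y. K1 (p1 x) (p2 x) = Some y)"
proof -
 let ?G = "%x y. y = rest x" and ?F = "%x y. y = nxt x"
 have run: "EX c'. whl ?G ?F c c' & cn c' = card {i. snd (snd d') i}"
  if "(%c c'. tm_step M c = Some c')\<^sup>*\<^sup>* d d'" "tm_step M d' = None" "inv M c d" for M c d d'
  using that
 proof(induction arbitrary: c rule: converse_rtranclp_induct)
  case base
  obtain q h t where d: "d' = (q, h, t)" by(cases d') auto
  have "rest c = 0" using inv_halt base unfolding d by blast
  thus ?case using base whl_0[of ?G c ?F] unfolding d inv_def by auto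
 next
  case (step d d'')
  obtain q h t where d: "d = (q, h, t)" by(cases d) auto
  have i: "rest c ~= 0 & inv M (nxt c) d''" using inv_step step.prems(2) step.hyps(1) unfolding d by blast
  then obtain c' where c': "whl ?G ?F (nxt c) c'" "cn c' = card {i. snd (snd d') i}" using step.IH[OF step.prems(1)] by blast
  obtain k where "rest c = Suc k" using i by(cases "rest c") auto
  thus ?case using whl_Suc[of ?G c k ?F "nxt c" c'] c' by auto
 qed
 have st: "tf start" unfolding start_def mkc_def by(intro tf_intros)
 have c: "tf cn" unfolding cn_def by(intro tf_intros)
 have "rl (%x y. EX z. whl ?G ?F (start x) z & y = cn z)"
  by(rule rl_tf[OF tf_rl[OF st rl_whl[OF tf_rest tf_nxt]] c])
 thus ?thesis
 proof(rule rl_mono)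
  fix x y assume "K1 (p1 x) (p2 x) = Some y"
  then obtain q h t where 1: "(%c c'. tm_step (p1 x) c = Some c')\<^sup>*\<^sup>* (tm_init (p2 x)) (q, h, t)" "tm_step (p1 x) (q, h, t) = None" "y = card {i. t i}"
   unfolding K1_iff tm_outcome_def by blast
  show "EX z. whl ?G ?F (start x) z & y = cn z" using run[OF 1(1,2) inv_start] 1(3) by auto
 qed
qed

lemma K1_pca: "pca K1"
proof -
 obtain Sk where Sk: "tf Sk" "!!a x. K1 (Sk a) x = Some a" using smn[OF tf_p1[OF tf_id]] by auto
 obtain k where k: "!!a. K1 k a = Some (Sk a)" using K1_tf[OF Sk(1)] by blast
 let ?U = "%x y. K1 (p1 x) (p2 x) = Some y"
 have t: "tf (%x. pr (p1 (p1 x)) (p2 x))" "tf (%x. pr (p2 (p1 x)) (p2 x))" by(intro tf_intros)+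
 \<comment> \<open>Applying \<open>smn\<close> twice turns this relation between a coded pair, an
   argument and a result into the combinator \<open>s\<close>.\<close>
 have "rl (%x y. EX p q. K1 (p1 (p1 x)) (p2 x) = Some p & K1 (p2 (p1 x)) (p2 x) = Some q & K1 p q = Some y)"
  by(rule rl_mono[OF rl_comp[OF rl_pair[OF tf_rl[OF t(1) rl_K1] tf_rl[OF t(2) rl_K1]] rl_K1]]) force
 from smn[OF this] obtain S1 where S1: "tf S1"
  "!!ab c p q y. K1 (p1 ab) c = Some p ==> K1 (p2 ab) c = Some q ==> K1 p q = Some y ==> K1 (S1 ab) c = Some y" by auto
 obtain S2 where S2: "tf S2" "!!a b. K1 (S2 a) b = Some (S1 (pr a b))" using smn[OF S1(1)] by auto
 obtain s where s: "!!a. K1 s a = Some (S2 a)" using K1_tf[OF S2(1)] by blast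
 have "is_ks K1 k s"
  unfolding is_ks_def
 proof(intro allI conjI impI)
  fix a b c v
  show "Some k \<cdot>\<^bsub>K1\<^esub> Some a \<cdot>\<^bsub>K1\<^esub> Some b = Some a" by(simp add: k Sk(2))
  show "Some s \<cdot>\<^bsub>K1\<^esub> Some a \<cdot>\<^bsub>K1\<^esub> Some b ~= None" by(simp add: s S2(2))
  assume "(Some a \<cdot>\<^bsub>K1\<^esub> Some c) \<cdot>\<^bsub>K1\<^esub> (Some b \<cdot>\<^bsub>K1\<^esub> Some c) = Some v"
  thus "Some s \<cdot>\<^bsub>K1\<^esub> Some a \<cdot>\<^bsub>K1\<^esub> Some b \<cdot>\<^bsub>K1\<^esub> Some c = Some v"
   by(auto simp: s S2(2) app_eq_Some intro!: S1(2))
 qed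
 thus ?thesis unfolding pca_def by blast
qed

lemma K1_decidable: "decidable_pca K1"
proof -
 \<comment> \<open>The sum of both truncated differences is 0 exactly when the numbers are
   equal.\<close>
 have "tf (%x. if (p1 x - p2 x) + (p2 x - p1 x) = 0 then pca_true K1 else pca_false K1)" by(intro tf_intros)
 from smn[OF this] obtain S where S: "tf S" "!!a x. K1 (S a) x = Some (if (a - x) + (x - a) = 0 then pca_true K1 else pca_false K1)"
  by auto
 obtain d where d: "!!a. K1 d a = Some (S a)" using K1_tf[OF S(1)] by blast
 show ?thesis unfolding decidable_pca_def by(intro exI[of _ d]) (auto simp: d S(2))
qed

theorem corollary2p11:
  assumes "set_universe TYPE('u)"
  shows
    "(\<forall>(A :: 'a pas) (B :: 'b pas).
        pca A \<and> small TYPE('u) (UNIV :: 'a set) \<and> decidable_pca A \<and>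
        pca B \<and> small TYPE('u) (UNIV :: 'b set) \<and> (\<exists>x y :: 'b. x \<noteq> y) \<and>
        subtopos (RT TYPE('u) B) (RT TYPE('u) A) \<longrightarrow>
        (\<exists>f :: 'a \<Rightarrow> 'a option. retract_of_topos (RT TYPE('u) B) (RT TYPE('u) (adjoin A f))))
     \<and>
     (\<forall>B :: 'b pas.
        pca B \<and> small TYPE('u) (UNIV :: 'b set) \<and> (\<exists>x y :: 'b. x \<noteq> y) \<and>
        subtopos (RT TYPE('u) B) (RT TYPE('u) K1) \<longrightarrow>
        (\<exists>f :: nat \<Rightarrow> nat option. equivalent_categories (RT TYPE('u) B) (RT TYPE('u) (adjoin K1 f))))"
proof(intro conjI allI impI; elim conjE)
 fix A :: "'a pas" and B :: "'b pas"
 assume "pca A" "small TYPE('u) (UNIV :: 'a set)" "decidable_pca A" "pca B" "small TYPE('u) (UNIV :: 'b set)" "EX x y :: 'b. x ~= y"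
  "subtopos (RT TYPE('u) B) (RT TYPE('u) A)"
 thus "EX f :: 'a => 'a option. retract_of_topos (RT TYPE('u) B) (RT TYPE('u) (adjoin A f))"
  by(rule realizability_retract[OF assms])
next
 fix B :: "'b pas"
 assume B: "pca B" "small TYPE('u) (UNIV :: 'b set)" "EX x y :: 'b. x ~= y" "subtopos (RT TYPE('u) B) (RT TYPE('u) K1)"
 obtain sc where "!!n. K1 sc n = Some (Suc n)" using K1_tf[OF tf_Suc[OF tf_id]] by blast
 from numerals_equivalence[OF assms K1_pca K1_decidable this B]
 show "EX f :: nat => nat option. equivalent_categories (RT TYPE('u) B) (RT TYPE('u) (adjoin K1 f))" .
qed

end
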